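(* Let $G$ be a finite abelian group and $k\ge 0$ an integer. If $G$ is $k$-close, then there is an algorithm solving the Group-Constrained Matroid Base problem over $G$ in time $\tilde{O}\big(\binom{k+|G|-1}{k}^2\, n\, r^{5/6}\big)$. If $G$ is strongly $k$-close, then there is an algorithm solving the Group-Constrained Optimum Matroid Base problem over $G$ in time $\tilde{O}\big(\binom{k+|G|-1}{k}^2\, n\, r^{5/6}\big)$. Here $n=|E|$ and $r$ is the rank of the input matroid.
   Context: Matroids are finite and loopless; $M=(E,\mathcal{I})$ is accessed via an independence oracle taking constant time per query, and each group operation in $G$ takes $O(1)$ time. A $G$-labeling is a map $\ell:E\to G$; for $F\subseteq E$, $\ell(F)=\sum_{e\in F}\ell(e)$. For $g\in G$, a $g$-base is a base $B$ with $\ell(B)=g$. Given a weight $w:E\to\mathbb{R}$, an optimum base is a base of minimum weight $w(B)=\sum_{e\in B}w(e)$, and an optimum $g$-base is a $g$-base of minimum weight among all $g$-bases. A $G$-labeling $\ell$ of $M$ is $k$-close if for every $g\in G$ for which a $g$-base exists, every base $A$ has a $g$-base $B$ with $|A\setminus B|\le k$; it is strongly $k$-close if for every weight $w:E\to\mathbb{R}$ and every $g\in G$ for which a $g$-base exists, every optimum base $A$ has an optimum $g$-base $B$ with $|A\setminus B|\le k$. The group $G$ is (strongly) $k$-close if every $G$-labeling of every matroid is (strongly) $k$-close. Group-Constrained Matroid Base problem: given $g\in G$, a matroid $M$ and $\ell:E\to G$, find a $g$-base if one exists. Group-Constrained Optimum Matroid Base problem: additionally given $w:E\to\mathbb{R}$,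 find an optimum $g$-base if one exists. *)

theory Defs
  imports Complex_Main "HOL-Algebra.FiniteProduct"
begin

section \<open>Matroids, labelings and closeness\<close>

definition matroid :: "'a set \<Rightarrow> 'a set set \<Rightarrow> bool" where
  "matroid E \<I> \<longleftrightarrow>
     finite E \<and> \<I> \<subseteq> Pow E \<and> {} \<in> \<I> \<and>
     (\<forall>S T. T \<in> \<I> \<longrightarrow> S \<subseteq> T \<longrightarrow> S \<in> \<I>) \<and>
     (\<forall>S T. S \<in> \<I> \<longrightarrow> T \<in> \<I> \<longrightarrow> card S < card T \<longrightarrow> (\<exists>e\<in>T - S. insert e S \<in> \<I>))"

definition loopless_matroid :: "'a set \<Rightarrow> 'a set set \<Rightarrow> bool" where
  "loopless_matroid E \<I> \<longleftrightarrow> matroid E \<I> \<and> (\<forall>e\<in>E. {e} \<in> \<I>)"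

definition is_base :: "'a set set \<Rightarrow> 'a set \<Rightarrow> bool" where
  "is_base \<I> B \<longleftrightarrow> B \<in> \<I> \<and> (\<forall>S\<in>\<I>. B \<subseteq> S \<longrightarrow> S = B)"

definition matroid_rank :: "'a set set \<Rightarrow> nat" where
  "matroid_rank \<I> = Max (card ` \<I>)"

text \<open>Groups are written multiplicatively, as in the library: the label of a set \<open>F\<close> is
  the product of the labels of its elements.\<close>

definition is_g_base ::
    "('g, 'b) monoid_scheme \<Rightarrow> 'a set set \<Rightarrow> ('a \<Rightarrow> 'g) \<Rightarrow> 'g \<Rightarrow> 'a set \<Rightarrow> bool" where
  "is_g_base G \<I> l g B \<longleftrightarrow> is_base \<I> B \<and> finprod G l B = g"

definition is_opt_base :: "'a set set \<Rightarrow> ('a \<Rightarrow> real) \<Rightarrow> 'a set \<Rightarrow> bool" where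
  "is_opt_base \<I> w B \<longleftrightarrow> is_base \<I> B \<and> (\<forall>B'. is_base \<I> B' \<longrightarrow> sum w B \<le> sum w B')"

definition is_opt_g_base ::
    "('g, 'b) monoid_scheme \<Rightarrow> 'a set set \<Rightarrow> ('a \<Rightarrow> 'g) \<Rightarrow> ('a \<Rightarrow> real) \<Rightarrow> 'g \<Rightarrow> 'a set \<Rightarrow> bool" where
  "is_opt_g_base G \<I> l w g B \<longleftrightarrow>
     is_g_base G \<I> l g B \<and> (\<forall>B'. is_g_base G \<I> l g B' \<longrightarrow> sum w B \<le> sum w B')"

definition k_close_labeling ::
    "('g, 'b) monoid_scheme \<Rightarrow> 'a set set \<Rightarrow> ('a \<Rightarrow> 'g) \<Rightarrow> nat \<Rightarrow> bool" where
  "k_close_labeling G \<I> l k \<longleftrightarrow>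
     (\<forall>g\<in>carrier G. (\<exists>B. is_g_base G \<I> l g B) \<longrightarrow>
        (\<forall>A. is_base \<I> A \<longrightarrow> (\<exists>B. is_g_base G \<I> l g B \<and> card (A - B) \<le> k)))"

definition strongly_k_close_labeling ::
    "('g, 'b) monoid_scheme \<Rightarrow> 'a set set \<Rightarrow> ('a \<Rightarrow> 'g) \<Rightarrow> nat \<Rightarrow> bool" where
  "strongly_k_close_labeling G \<I> l k \<longleftrightarrow>
     (\<forall>w. \<forall>g\<in>carrier G. (\<exists>B. is_g_base G \<I> l g B) \<longrightarrow>
        (\<forall>A. is_opt_base \<I> w A \<longrightarrow> (\<exists>B. is_opt_g_base G \<I> l w g B \<and> card (A - B) \<le> k)))"

text \<open>Every finite matroid is isomorphic to one whose ground set consists of natural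
  numbers, so quantifying over these covers all matroids.\<close>

definition k_close_group :: "('g, 'b) monoid_scheme \<Rightarrow> nat \<Rightarrow> bool" where
  "k_close_group G k \<longleftrightarrow>
     (\<forall>(E::nat set) \<I> l. loopless_matroid E \<I> \<longrightarrow> l \<in> E \<rightarrow> carrier G \<longrightarrow>
        k_close_labeling G \<I> l k)"

definition strongly_k_close_group :: "('g, 'b) monoid_scheme \<Rightarrow> nat \<Rightarrow> bool" where
  "strongly_k_close_group G k \<longleftrightarrow>
     (\<forall>(E::nat set) \<I> l. loopless_matroid E \<I> \<longrightarrow> l \<in> E \<rightarrow> carrier G \<longrightarrow>
        strongly_k_close_labeling G \<I> l k)"


section \<open>Oracle random access machines\<close>

text \<open>
  Algorithms are programs for a uniform-cost random access machine, presented as a while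
  language over unbounded arrays. There are three sorts of memory: natural numbers (with addition,
  truncated subtraction and comparison), elements of the group \<open>G\<close> (with the group operation,
  inversion and equality test) and reals (with addition, subtraction and comparison, for the
  weights). A cell is given by a fixed array name and a computed index.

  The matroid has ground set \<open>{..<n}\<close> and can only be accessed through \<open>Indep a\<close>, which asks
  whether the set whose membership vector is stored in array \<open>a\<close> is independent. A query costs one
  step, but writing the membership vector is paid for cell by cell.
\<close>

datatype iexp =
    INum nat
  | ICell nat iexp
  | IAdd iexp iexp
  | ISub iexp iexp

datatype 'g gexp =
    GConst 'g
  | GCell nat iexp
  | GMult "'g gexp" "'g gexp"
  | GInv "'g gexp"

datatype rexp =
    RCell nat iexp
  | RAdd rexp rexp
  | RSub rexp rexp

datatype 'g test =
    ILe iexp iexp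
  | GEq "'g gexp" "'g gexp"
  | RLe rexp rexp
  | Indep nat
  | TNot "'g test"
  | TAnd "'g test" "'g test"

datatype 'g com =
    Skip
  | IStore nat iexp iexp
  | GStore nat iexp "'g gexp"
  | RStore nat iexp rexp
  | Seq "'g com" "'g com"
  | Cond "'g test" "'g com" "'g com"
  | While "'g test" "'g com"

record 'g state =
  imem :: "nat \<Rightarrow> nat \<Rightarrow> nat"
  gmem :: "nat \<Rightarrow> nat \<Rightarrow> 'g"
  rmem :: "nat \<Rightarrow> nat \<Rightarrow> real"

definition stored_set :: "nat \<Rightarrow> 'g state \<Rightarrow> nat \<Rightarrow> nat set" where
  "stored_set n s a = {e. e < n \<and> imem s a e \<noteq> 0}"

definition store :: "(nat \<Rightarrow> nat \<Rightarrow> 'v) \<Rightarrow> nat \<Rightarrow> nat \<Rightarrow> 'v \<Rightarrow> nat \<Rightarrow> nat \<Rightarrow> 'v" where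
  "store m a i v = m(a := (m a)(i := v))"

primrec ival :: "'g state \<Rightarrow> iexp \<Rightarrow> nat" where
  "ival s (INum c) = c"
| "ival s (ICell a i) = imem s a (ival s i)"
| "ival s (IAdd x y) = ival s x + ival s y"
| "ival s (ISub x y) = ival s x - ival s y"

primrec gval :: "'g monoid \<Rightarrow> 'g state \<Rightarrow> 'g gexp \<Rightarrow> 'g" where
  "gval G s (GConst c) = c"
| "gval G s (GCell a i) = gmem s a (ival s i)"
| "gval G s (GMult x y) = gval G s x \<otimes>\<^bsub>G\<^esub> gval G s y"
| "gval G s (GInv x) = inv\<^bsub>G\<^esub> gval G s x"

primrec rval :: "'g state \<Rightarrow> rexp \<Rightarrow> real" where
  "rval s (RCell a i) = rmem s a (ival s i)"
| "rval s (RAdd x y) = rval s x + rval s y"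
| "rval s (RSub x y) = rval s x - rval s y"

primrec tval :: "'g monoid \<Rightarrow> nat \<Rightarrow> nat set set \<Rightarrow> 'g state \<Rightarrow> 'g test \<Rightarrow> bool" where
  "tval G n \<I> s (ILe x y) \<longleftrightarrow> ival s x \<le> ival s y"
| "tval G n \<I> s (GEq x y) \<longleftrightarrow> gval G s x = gval G s y"
| "tval G n \<I> s (RLe x y) \<longleftrightarrow> rval s x \<le> rval s y"
| "tval G n \<I> s (Indep a) \<longleftrightarrow> stored_set n s a \<in> \<I>"
| "tval G n \<I> s (TNot b) \<longleftrightarrow> \<not> tval G n \<I> s b"
| "tval G n \<I> s (TAnd b c) \<longleftrightarrow> tval G n \<I> s b \<and> tval G n \<I> s c"

primrec icost :: "iexp \<Rightarrow> nat" where
  "icost (INum c) = 1"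
| "icost (ICell a i) = 1 + icost i"
| "icost (IAdd x y) = 1 + icost x + icost y"
| "icost (ISub x y) = 1 + icost x + icost y"

primrec gcost :: "'g gexp \<Rightarrow> nat" where
  "gcost (GConst c) = 1"
| "gcost (GCell a i) = 1 + icost i"
| "gcost (GMult x y) = 1 + gcost x + gcost y"
| "gcost (GInv x) = 1 + gcost x"

primrec rcost :: "rexp \<Rightarrow> nat" where
  "rcost (RCell a i) = 1 + icost i"
| "rcost (RAdd x y) = 1 + rcost x + rcost y"
| "rcost (RSub x y) = 1 + rcost x + rcost y"

primrec tcost :: "'g test \<Rightarrow> nat" where
  "tcost (ILe x y) = 1 + icost x + icost y"
| "tcost (GEq x y) = 1 + gcost x + gcost y"
| "tcost (RLe x y) = 1 + rcost x + rcost y"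
| "tcost (Indep a) = 1"
| "tcost (TNot b) = 1 + tcost b"
| "tcost (TAnd b c) = 1 + tcost b + tcost c"

text \<open>\<open>exec G n \<I> c s t s'\<close>: started in state \<open>s\<close>, the program \<open>c\<close> halts in state \<open>s'\<close> after
  exactly \<open>t\<close> steps.\<close>

inductive exec ::
    "'g monoid \<Rightarrow> nat \<Rightarrow> nat set set \<Rightarrow> 'g com \<Rightarrow> 'g state \<Rightarrow> nat \<Rightarrow> 'g state \<Rightarrow> bool"
  for G n \<I> where
  Skip: "exec G n \<I> Skip s 1 s"
| IStore: "exec G n \<I> (IStore a i x) s (1 + icost i + icost x)
     (s\<lparr>imem := store (imem s) a (ival s i) (ival s x)\<rparr>)"
| GStore: "exec G n \<I> (GStore a i y) s (1 + icost i + gcost y)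
     (s\<lparr>gmem := store (gmem s) a (ival s i) (gval G s y)\<rparr>)"
| RStore: "exec G n \<I> (RStore a i z) s (1 + icost i + rcost z)
     (s\<lparr>rmem := store (rmem s) a (ival s i) (rval s z)\<rparr>)"
| Seq: "\<lbrakk>exec G n \<I> c s t s'; exec G n \<I> d s' u s''\<rbrakk> \<Longrightarrow> exec G n \<I> (Seq c d) s (t + u) s''"
| CondTrue: "\<lbrakk>tval G n \<I> s b; exec G n \<I> c s t s'\<rbrakk> \<Longrightarrow>
     exec G n \<I> (Cond b c d) s (1 + tcost b + t) s'"
| CondFalse: "\<lbrakk>\<not> tval G n \<I> s b; exec G n \<I> d s t s'\<rbrakk> \<Longrightarrow>
     exec G n \<I> (Cond b c d) s (1 + tcost b + t) s'"
| WhileFalse: "\<not> tval G n \<I> s b \<Longrightarrow> exec G n \<I> (While b c) s (1 + tcost b) s"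
| WhileTrue: "\<lbrakk>tval G n \<I> s b; exec G n \<I> c s t s'; exec G n \<I> (While b c) s' u s''\<rbrakk> \<Longrightarrow>
     exec G n \<I> (While b c) s (1 + tcost b + t + u) s''"

lemma exec_deterministic:
  assumes "exec G n \<I> c s t s'" and "exec G n \<I> c s u s''"
  shows "t = u \<and> s' = s''"
  using assms
proof (induction arbitrary: u s'' rule: exec.induct)
  case Skip
  from Skip.prems show ?case by cases simp
next
  case IStore
  from IStore.prems show ?case by cases simp
next
  case GStore
  from GStore.prems show ?case by cases simp
next
  case RStore
  from RStore.prems show ?case by cases simp
next
  case (Seq c s t s1 d v s2)
  from Seq.prems show ?case
  proof cases
    case (Seq t' r v')
    with Seq.IH(1)[of t' r] Seq.IH(2)[of v' s''] show ?thesis by simp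
  qed
next
  case CondTrue
  from CondTrue.prems show ?case
    by cases (use CondTrue.hyps(1) CondTrue.IH in simp_all)
next
  case CondFalse
  from CondFalse.prems show ?case
    by cases (use CondFalse.hyps(1) CondFalse.IH in simp_all)
next
  case WhileFalse
  from WhileFalse.prems show ?case by cases (use WhileFalse.hyps(1) in simp_all)
next
  case (WhileTrue s b c t s1 v s2)
  from WhileTrue.prems show ?case
  proof cases
    case WhileFalse
    with WhileTrue.hyps(1) show ?thesis by simp
  next
    case (WhileTrue t' r v')
    with WhileTrue.IH(1)[of t' r] WhileTrue.IH(2)[of v' s''] show ?thesis by simp
  qed
qed


section \<open>The problems and their solution in bounded time\<close>

text \<open>Input: \<open>n\<close> in integer cell (0, 0), the labels in group array 0, the target \<open>g\<close> in group
  cell (1, 0), the weights in real array 0; all other cells are zero (or the neutral element).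
  Output: integer cell (1, 0) is nonzero iff a set is returned, and that set is then
  given by its membership vector in integer array 2.\<close>

definition init_state ::
    "'g monoid \<Rightarrow> nat \<Rightarrow> (nat \<Rightarrow> 'g) \<Rightarrow> (nat \<Rightarrow> real) \<Rightarrow> 'g \<Rightarrow> 'g state" where
  "init_state G n l w g =
     \<lparr>imem = (\<lambda>a i. if a = 0 \<and> i = 0 then n else 0),
      gmem = (\<lambda>a i. if a = 0 \<and> i < n then l i else if a = 1 \<and> i = 0 then g else \<one>\<^bsub>G\<^esub>),
      rmem = (\<lambda>a i. if a = 0 \<and> i < n then w i else 0)\<rparr>"

definition answer :: "nat \<Rightarrow> 'g state \<Rightarrow> nat set option" where
  "answer n s = (if imem s 1 0 \<noteq> 0 then Some (stored_set n s 2) else None)"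

definition correct_answer :: "('a set \<Rightarrow> bool) \<Rightarrow> 'a set option \<Rightarrow> bool" where
  "correct_answer P ans \<longleftrightarrow> (case ans of None \<Rightarrow> \<not> (\<exists>B. P B) | Some B \<Rightarrow> P B)"

text \<open>A program may depend on \<open>G\<close>, but not on the instance; the group
  constants it mentions (\<open>set_com c\<close>) must be elements of \<open>G\<close>.
  The time bound \<open>T\<close> is a function of \<open>n\<close> and the rank. The problem without weights is run with
  the weight array zero.\<close>

definition solves_matroid_base :: "'g monoid \<Rightarrow> 'g com \<Rightarrow> (nat \<Rightarrow> nat \<Rightarrow> real) \<Rightarrow> bool" where
  "solves_matroid_base G c T \<longleftrightarrow>
     set_com c \<subseteq> carrier G \<and>
     (\<forall>n \<I> l g. loopless_matroid {..<n} \<I> \<longrightarrow> l \<in> {..<n} \<rightarrow> carrier G \<longrightarrow> g \<in> carrier G \<longrightarrow>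
        (\<exists>t s. exec G n \<I> c (init_state G n l (\<lambda>_. 0) g) t s \<and>
               real t \<le> T n (matroid_rank \<I>) \<and>
               correct_answer (is_g_base G \<I> l g) (answer n s)))"

definition solves_opt_matroid_base :: "'g monoid \<Rightarrow> 'g com \<Rightarrow> (nat \<Rightarrow> nat \<Rightarrow> real) \<Rightarrow> bool" where
  "solves_opt_matroid_base G c T \<longleftrightarrow>
     set_com c \<subseteq> carrier G \<and>
     (\<forall>n \<I> l w g. loopless_matroid {..<n} \<I> \<longrightarrow> l \<in> {..<n} \<rightarrow> carrier G \<longrightarrow> g \<in> carrier G \<longrightarrow>
        (\<exists>t s. exec G n \<I> c (init_state G n l w g) t s \<and>
               real t \<le> T n (matroid_rank \<I>) \<and>
               correct_answer (is_opt_g_base G \<I> l w g) (answer n s)))"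

text \<open>Soft-O of \<open>f\<close> means \<open>O(f log\<^sup>d f)\<close> for some constant \<open>d\<close>. The maximum with 1 only matters
  for the empty matroid, where \<open>f = 0\<close>.\<close>

definition soft_O_bound :: "real \<Rightarrow> nat \<Rightarrow> real \<Rightarrow> real" where
  "soft_O_bound C d f = C * max 1 f * (1 + ln (max 1 f)) ^ d"

definition run_time :: "nat \<Rightarrow> nat \<Rightarrow> nat \<Rightarrow> nat \<Rightarrow> real" where
  "run_time q k n r = (real ((k + q - 1) choose k))\<^sup>2 * real n * real r powr (5/6)"

end

theory Submission
  imports Defs
begin

text \<open>
  Start from a greedy optimum base \<open>A\<close> and let \<open>K = min k n\<close>. By closeness some optimum \<open>g\<close>-base
  arises from \<open>A\<close> by exchanging at most \<open>K\<close> elements, and its label depends only on the number of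
  elements taken from each label class. So it suffices to enumerate the pairs \<open>(R, S)\<close> of
  compositions of \<open>K\<close> over the classes (\<open>R\<close> removed, \<open>S\<close> added) whose target counts have label \<open>g\<close>, and
  to compute a minimum-weight base with the given class counts for each.

  The latter starts at \<open>A\<close> and repairs one deficient class at a time along a shortest exchange path
  between classes. Class potentials \<open>u\<close> keep the current base optimum for \<open>w + u\<close>, so that
  Dijkstra's algorithm applies and an optimum base is minimum among all bases with its class counts;
  if no surplus class is reachable, then the exchange-closed set of reached classes shows that no base
  has the target counts. One such repair takes time \<open>O(q n)\<close> for \<open>q\<close> label classes.

  Let \<open>b = (K + q - 1 choose K)\<close> and \<open>m = min K (q - 1)\<close>. Given \<open>R\<close>, the label condition determines \<open>S\<close> from
  any \<open>K - 1\<close> of its elements, and \<open>R\<close> and \<open>S\<close> may be taken disjoint away from the padding class 0;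
  these two filters leave at most \<open>4 b\<^sup>2 m\<^sup>2 / (K q)\<close> pairs. Each needs \<open>O(K)\<close> repairs, so the total time is
  \<open>O(b\<^sup>2 m\<^sup>2 n)\<close> up to the overhead of sorting, and \<open>2\<^sup>m \<le> b\<close> makes \<open>m\<close> logarithmic.
\<close>

section \<open>Matroid exchange\<close>

text \<open>Running \<open>K\<close> repairs of cost \<open>O(q n)\<close> on all
  \<open>b\<^sup>2\<close> pairs would lose a factor \<open>K q\<close>, which can be as large as
  \<open>b\<close> (take \<open>K = 1\<close>). Neither filter suffices alone: the label condition
  leaves at most a fraction \<open>K / (K + q - 1)\<close> of the pairs and helps for small
  \<open>K\<close>, disjointness leaves at most \<open>2 (q - 1) / (K + q - 1)\<close> and helps for
  small \<open>q\<close>.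

  Exchanging along a path need not give a base, because arcs that shortcut the path can interfere.
  Instead of minimising the number of arcs among shortest paths, ties are resolved by visiting time:
  a predecessor is replaced only on strict improvement. Classes visited before the recorded
  predecessor are then strictly worse, shortcuts from them are not tight for the updated potentials,
  and the swaps can be made one at a time, starting at the surplus end.

  The factor \<open>r powr (5/6)\<close> enters through \<open>r \<ge> 1\<close>, which looplessness
  guarantees for a nonempty ground set. The enumeration requires \<open>K \<ge> 1\<close>; for
  \<open>k = 0\<close> it is run with 1, because only the trivial group is 0-close.\<close>

locale finite_matroid =
  fixes E :: "'a set" and \<I> :: "'a set set"
  assumes matroid: "matroid E \<I>"
begin

lemma finite_ground: "finite E"
  using matroid by (simp add: matroid_def)

lemma indep_subset_ground: "X \<in> \<I> \<Longrightarrow> X \<subseteq> E"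
  using matroid by (auto simp: matroid_def)

lemma indep_finite: "X \<in> \<I> \<Longrightarrow> finite X"
  using indep_subset_ground finite_ground finite_subset by blast

lemma indep_empty: "{} \<in> \<I>"
  using matroid by (simp add: matroid_def)

lemma indep_mono: "X \<in> \<I> \<Longrightarrow> Y \<subseteq> X \<Longrightarrow> Y \<in> \<I>"
  using matroid unfolding matroid_def by blast

lemma augment: "X \<in> \<I> \<Longrightarrow> Y \<in> \<I> \<Longrightarrow> card X < card Y \<Longrightarrow> \<exists>e\<in>Y - X. insert e X \<in> \<I>"
  using matroid unfolding matroid_def by blast

lemma extend:
  assumes "X \<in> \<I>" "Y \<in> \<I>" "card X \<le> card Y"
  shows "\<exists>Z\<in>\<I>. X \<subseteq> Z \<and> Z \<subseteq> X \<union> Y \<and> card Z = card Y"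
  using assms
proof (induction "card Y - card X" arbitrary: X)
  case 0
  then show ?case by (intro bexI[of _ X]) auto
next
  case (Suc d)
  have "card X < card Y" using Suc.hyps(2) by simp
  then obtain e where e: "e \<in> Y - X" "insert e X \<in> \<I>"
    using augment[OF Suc.prems(1,2)] by blast
  have "card (insert e X) = Suc (card X)"
    using e indep_finite Suc.prems(1) by simp
  then have "d = card Y - card (insert e X)" "card (insert e X) \<le> card Y"
    using Suc.hyps(2) \<open>card X < card Y\<close> by linarith+
  then obtain Z where "Z \<in> \<I>" "insert e X \<subseteq> Z" "Z \<subseteq> insert e X \<union> Y" "card Z = card Y"
    using Suc.hyps(1)[OF _ e(2) Suc.prems(2)] by blast
  then show ?case using e by blast
qed

lemma base_indep: "is_base \<I> B \<Longrightarrow> B \<in> \<I>"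
  by (simp add: is_base_def)

lemma base_finite: "is_base \<I> B \<Longrightarrow> finite B"
  using base_indep indep_finite by blast

lemma base_subset: "is_base \<I> B \<Longrightarrow> B \<subseteq> E"
  using base_indep indep_subset_ground by blast

lemma card_le_base: assumes "is_base \<I> B" "X \<in> \<I>" shows "card X \<le> card B"
proof (rule ccontr)
  assume "\<not> card X \<le> card B"
  then obtain e where "e \<in> X - B" "insert e B \<in> \<I>"
    using augment[of B X] assms base_indep by force
  then show False using assms(1) unfolding is_base_def by blast
qed

lemma base_card: "is_base \<I> B \<Longrightarrow> is_base \<I> B' \<Longrightarrow> card B = card B'"
  by (meson base_indep card_le_base order_antisym)

lemma baseI: assumes "is_base \<I> B" "X \<in> \<I>" "card X = card B" shows "is_base \<I> X"
  unfolding is_base_def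
  by (metis assms base_finite card_le_base card_seteq card_subset_eq indep_finite)

lemma extend_base:
  assumes "is_base \<I> B" "X \<in> \<I>"
  shows "\<exists>Z. is_base \<I> Z \<and> X \<subseteq> Z \<and> Z \<subseteq> X \<union> B"
  using extend[of X B] assms baseI card_le_base base_indep by metis

lemma swap_card: "finite B \<Longrightarrow> f \<in> B \<Longrightarrow> e \<notin> B \<Longrightarrow> card (insert e (B - {f})) = card B"
  by (metis DiffD1 card_insert_disjoint card_Suc_Diff1 finite_Diff)

lemma swap_baseI:
  "is_base \<I> B \<Longrightarrow> f \<in> B \<Longrightarrow> e \<notin> B \<Longrightarrow> insert e (B - {f}) \<in> \<I> \<Longrightarrow>
    is_base \<I> (insert e (B - {f}))"
  using baseI swap_card base_finite by metis

text \<open>Extending \<open>insert e X\<close> to a base inside \<open>insert e B\<close> leaves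
  out exactly one element of \<open>B\<close>, and that element is \<open>f\<close>.\<close>

lemma indep_swap:
  assumes B: "is_base \<I> B" and X: "X \<subseteq> B" and e: "e \<notin> B" and "insert e X \<in> \<I>"
  shows "\<exists>f\<in>B - X. is_base \<I> (insert e (B - {f}))"
proof -
  obtain Z where Z: "is_base \<I> Z" "insert e X \<subseteq> Z" "Z \<subseteq> insert e X \<union> B"
    using extend_base assms by metis
  have "card Z = card B" using Z B base_card by blast
  moreover have "\<not> B \<subseteq> Z"
    using e Z calculation by (metis B card_subset_eq base_finite insert_subset)
  ultimately obtain f where f: "f \<in> B" "f \<notin> Z" by blast
  have "Z \<subseteq> insert e (B - {f})" using Z f X by auto
  then have "Z = insert e (B - {f})"
    using f e B \<open>card Z = card B\<close> by (metis base_finite card_subset_eq finite_Diff finite.insertI swap_card)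
  then show ?thesis using f Z by blast
qed

text \<open>Here \<open>F\<close> is the fundamental circuit of \<open>e\<close> in \<open>B\<close>
  without \<open>e\<close>. If no element of \<open>F\<close> could replace \<open>e\<close> in
  \<open>B'\<close>, then \<open>F\<close> would lie in the span of \<open>B' - {e}\<close>; since
  \<open>insert e F\<close> is dependent, \<open>e\<close> would lie there too.\<close>

lemma symmetric_exchange:
  assumes B: "is_base \<I> B" and B': "is_base \<I> B'" and e: "e \<in> B'" "e \<notin> B"
  shows "\<exists>f\<in>B - B'. is_base \<I> (insert e (B - {f})) \<and> is_base \<I> (insert f (B' - {e}))"
proof (rule ccontr)
  assume neg: "\<not> ?thesis"
  define F where "F = {f \<in> B. is_base \<I> (insert e (B - {f}))}"
  have FB: "F \<subseteq> B" by (auto simp: F_def)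
  \<comment> \<open>\<open>indep_swap\<close> would turn independence of \<open>insert e F\<close>
    into an exchange with an element outside \<open>F\<close>.\<close>
  have dep: "insert e F \<notin> \<I>"
    using indep_swap[OF B FB e(2)] by (auto simp: F_def)
  have FI: "F \<in> \<I>" using FB B base_indep indep_mono by blast
  have BeI: "B' - {e} \<in> \<I>" using B' base_indep indep_mono by blast
  have nadd: "insert f (B' - {e}) \<notin> \<I>" if "f \<in> F" "f \<notin> B' - {e}" for f
  proof
    assume *: "insert f (B' - {e}) \<in> \<I>"
    have "f \<noteq> e" using that FB e by auto
    then have "f \<notin> B'" using that by auto
    then have "is_base \<I> (insert f (B' - {e}))" using swap_baseI[OF B' e(1)] * by auto
    then show False using neg that FB \<open>f \<notin> B'\<close> by (auto simp: F_def)
  qed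
  \<comment> \<open>\<open>B' - {e}\<close> cannot be enlarged within
    \<open>F \<union> (B' - {e})\<close>, so it is a largest independent subset there.\<close>
  have small: "card X \<le> card (B' - {e})" if "X \<in> \<I>" "X \<subseteq> F \<union> (B' - {e})" for X
  proof (rule ccontr)
    assume "\<not> ?thesis"
    then have "\<exists>f\<in>X - (B' - {e}). insert f (B' - {e}) \<in> \<I>"
      using augment[OF BeI that(1)] by linarith
    then show False using nadd that by blast
  qed
  obtain Y where Y: "Y \<in> \<I>" "F \<subseteq> Y" "Y \<subseteq> F \<union> (B' - {e})" "card Y = card (B' - {e})"
    using extend[OF FI BeI] small[OF FI] by auto
  have "card Y < card B'" using Y e B' base_finite
    by (metis card_Diff1_less)
  then obtain y where y: "y \<in> B' - Y" "insert y Y \<in> \<I>"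
    using augment[OF Y(1) base_indep[OF B']] by blast
  have "card (insert y Y) > card (B' - {e})" using y Y indep_finite by auto
  then have "\<not> insert y Y \<subseteq> F \<union> (B' - {e})" using small y by fastforce
  then have "y = e" using y Y by auto
  then show False using dep y Y indep_mono by (metis insert_mono)
qed

section \<open>Weighted bases: local optimality and exchanges of equal weight\<close>

lemma sum_swap:
  fixes u :: "'a \<Rightarrow> real"
  shows "finite B \<Longrightarrow> f \<in> B \<Longrightarrow> e \<notin> B \<Longrightarrow> sum u (insert e (B - {f})) = sum u B - u f + u e"
  by (simp add: sum.insert_if sum_diff1)

lemma opt_base_swap_le:
  assumes "is_opt_base \<I> u B" "f \<in> B" "e \<notin> B" "is_base \<I> (insert e (B - {f}))"
  shows "u f \<le> u e"
  using assms sum_swap[of B f e u] base_finite[of B] unfolding is_opt_base_def by fastforce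

text \<open>Any competitor is moved towards \<open>B\<close> by symmetric exchanges; each replaces
  some \<open>e\<close> by an \<open>f\<close> with \<open>u f \<le> u e\<close>, so the weight does
  not grow while \<open>B' - B\<close> shrinks.\<close>

lemma local_opt_base:
  fixes u :: "'a \<Rightarrow> real"
  assumes B: "is_base \<I> B"
    and loc: "\<And>e f. e \<notin> B \<Longrightarrow> f \<in> B \<Longrightarrow> is_base \<I> (insert e (B - {f})) \<Longrightarrow> u f \<le> u e"
  shows "is_opt_base \<I> u B"
  unfolding is_opt_base_def
proof (intro conjI allI impI B)
  fix B' assume "is_base \<I> B'"
  then show "sum u B \<le> sum u B'"
  proof (induction "card (B' - B)" arbitrary: B' rule: less_induct)
    case less
    show ?case
    proof (cases "B' \<subseteq> B")
      case True
      then show ?thesis using less.prems B by (metis order_refl base_indep is_base_def)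
    next
      case False
      then obtain e where e: "e \<in> B'" "e \<notin> B" by blast
      obtain f where f: "f \<in> B - B'" "is_base \<I> (insert e (B - {f}))" "is_base \<I> (insert f (B' - {e}))"
        using symmetric_exchange[OF B less.prems e] by blast
      have fin: "finite B'" using less.prems base_finite by blast
      have "insert f (B' - {e}) - B = (B' - B) - {e}" using f by auto
      then have "card (insert f (B' - {e}) - B) < card (B' - B)"
        using e fin by (metis DiffI card_Diff1_less finite_Diff)
      then have "sum u B \<le> sum u (insert f (B' - {e}))"
        using less.hyps f by blast
      also have "\<dots> = sum u B' - u e + u f" using sum_swap fin e f by blast
      also have "\<dots> \<le> sum u B'" using loc[OF e(2), of f] f by auto
      finally show ?thesis .
    qed
  qed
qed

text \<open>\<open>insert a (B - {f, g})\<close> can be augmented from the base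
  \<open>insert e (B - {f})\<close> only by \<open>e\<close> or \<open>g\<close>; the choice
  \<open>g\<close> would make \<open>a\<close> exchangeable with \<open>f\<close>, which is
  excluded.\<close>

lemma double_swap:
  assumes B: "is_base \<I> B" and "e \<notin> B" "a \<notin> B" "a \<noteq> e" "f \<in> B" "g \<in> B" "f \<noteq> g"
    and Be: "is_base \<I> (insert e (B - {f}))" and Ba: "is_base \<I> (insert a (B - {g}))"
    and n: "\<not> is_base \<I> (insert a (B - {f}))"
  shows "is_base \<I> (insert a (insert e (B - {f}) - {g}))"
proof -
  have X: "insert a (B - {f, g}) \<in> \<I>"
    by (rule indep_mono[OF base_indep[OF Ba]]) auto
  have fin: "finite B" using B base_finite by blast
  have "card (insert a (B - {f, g})) = card (insert a (B - {g}) - {f})"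
    using assms by (intro arg_cong[where f = card]) auto
  also have "\<dots> < card (insert a (B - {g}))"
    using assms fin by (intro card_Diff1_less) auto
  also have "\<dots> = card (insert e (B - {f}))" using base_card Ba Be by blast
  finally obtain y where y: "y \<in> insert e (B - {f}) - insert a (B - {f, g})"
    "insert y (insert a (B - {f, g})) \<in> \<I>"
    using augment[OF X base_indep[OF Be]] by blast
  have "y = e \<or> y = g" using y by auto
  moreover have "y \<noteq> g"
  proof
    assume "y = g"
    then have "insert y (insert a (B - {f, g})) = insert a (B - {f})" using assms by auto
    then show False using n y swap_baseI[of B f a] assms by simp
  qed
  ultimately have "insert y (insert a (B - {f, g})) = insert a (insert e (B - {f}) - {g})"
    using assms by auto
  moreover have "card (insert a (insert e (B - {f}) - {g})) = card (insert e (B - {f}))"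
    using assms fin by (intro swap_card) auto
  ultimately show ?thesis using y baseI Be by metis
qed

text \<open>Exchanges that keep an optimum base optimum: arcs of reduced cost zero in the exchange
  graph.\<close>

definition tight :: "('a \<Rightarrow> real) \<Rightarrow> 'a set \<Rightarrow> 'a \<Rightarrow> 'a \<Rightarrow> bool" where
  "tight u B e f \<longleftrightarrow> is_base \<I> (insert e (B - {f})) \<and> u e = u f"

lemma opt_base_tight_swap:
  assumes "is_opt_base \<I> u B" "e \<notin> B" "f \<in> B" "tight u B e f"
  shows "is_opt_base \<I> u (insert e (B - {f}))"
  using assms sum_swap[of B f e u] base_finite[of B] unfolding is_opt_base_def tight_def by auto

text \<open>If \<open>a\<close> cannot replace \<open>f\<close> at all, \<open>double_swap\<close>
  applies directly. Otherwise optimality gives \<open>u f < u a\<close>, hence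
  \<open>u e < u g\<close>; so \<open>e\<close> cannot replace \<open>g\<close>, and
  \<open>double_swap\<close> applies with the two exchanges in the other order.\<close>

lemma tight_swap1:
  assumes opt: "is_opt_base \<I> u B" and mem: "e \<notin> B" "a \<notin> B" "a \<noteq> e" "f \<in> B" "g \<in> B" "f \<noteq> g"
    and ef: "tight u B e f" and af: "\<not> tight u B a f" and ag: "tight u B a g"
  shows "tight u (insert e (B - {f})) a g"
proof -
  have B: "is_base \<I> B" using opt by (simp add: is_opt_base_def)
  have bef: "is_base \<I> (insert e (B - {f}))" "u e = u f" and bag: "is_base \<I> (insert a (B - {g}))" "u a = u g"
    using ef ag by (auto simp: tight_def)
  show ?thesis
  proof (cases "is_base \<I> (insert a (B - {f}))")
    case False
    then show ?thesis using double_swap[OF B mem bef(1) bag(1)] bag(2) by (simp add: tight_def)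
  next
    case True
    then have "u f < u a"
      using opt_base_swap_le[OF opt mem(4,2)] af by (force simp: tight_def)
    then have "\<not> is_base \<I> (insert e (B - {g}))"
      using opt_base_swap_le[OF opt mem(5,1)] bef bag by force
    then have "is_base \<I> (insert e (insert a (B - {g}) - {f}))"
      using double_swap[OF B, of a e g f] mem bef bag by blast
    moreover have "insert e (insert a (B - {g}) - {f}) = insert a (insert e (B - {f}) - {g})"
      using mem by auto
    ultimately show ?thesis using bag by (simp add: tight_def)
  qed
qed

text \<open>The converse direction is \<open>tight_swap1\<close> applied to the swapped base, where
  exchanging \<open>f\<close> for \<open>e\<close> undoes the swap.\<close>

lemma tight_swap:
  assumes opt: "is_opt_base \<I> u B" and mem: "e \<notin> B" "a \<notin> B" "a \<noteq> e" "f \<in> B" "g \<in> B" "f \<noteq> g"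
    and ef: "tight u B e f" and af: "\<not> tight u B a f"
  shows "tight u (insert e (B - {f})) a g \<longleftrightarrow> tight u B a g"
proof
  let ?C = "insert e (B - {f})"
  assume *: "tight u ?C a g"
  have undo: "insert f (?C - {e}) = B" using mem by auto
  have 1: "is_opt_base \<I> u ?C" using opt_base_tight_swap opt mem ef by blast
  have 2: "tight u ?C f e"
    using ef opt unfolding tight_def undo by (simp add: is_opt_base_def)
  have "insert a (?C - {e}) = insert a (B - {f})" using mem by auto
  then have 3: "\<not> tight u ?C a e" using af ef by (simp add: tight_def)
  have "tight u (insert f (?C - {e})) a g"
    by (rule tight_swap1[OF 1 _ _ _ _ _ _ 2 3 *]) (use mem in auto)
  then show "tight u B a g" unfolding undo .
qed (use tight_swap1 assms in blast)

text \<open>Elements of classes in \<open>X\<close> that can only be exchanged among themselves: the part of \<open>B\<close> in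
  these classes spans them.\<close>

lemma closed_classes_card:
  assumes B: "is_base \<I> B" and B': "is_base \<I> B'"
    and closed: "\<And>e f. e \<in> E - B \<Longrightarrow> f \<in> B \<Longrightarrow> is_base \<I> (insert e (B - {f})) \<Longrightarrow> e \<in> X \<Longrightarrow> f \<in> X"
  shows "card (B' \<inter> X) \<le> card (B \<inter> X)"
proof (rule ccontr)
  assume "\<not> ?thesis"
  moreover have "B' \<inter> X \<in> \<I>" "B \<inter> X \<in> \<I>" using B B' base_indep indep_mono by blast+
  ultimately obtain e where e: "e \<in> B' \<inter> X - B \<inter> X" "insert e (B \<inter> X) \<in> \<I>"
    using augment[of "B \<inter> X" "B' \<inter> X"] by force
  then obtain f where "f \<in> B - B \<inter> X" "is_base \<I> (insert e (B - {f}))"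
    using indep_swap[OF B, of "B \<inter> X" e] by auto
  then show False using closed[of e f] e B' base_subset by blast
qed

text \<open>The potential contributes \<open>count c * p c\<close> per class \<open>c\<close>, the
  same for all bases with equal class counts. Optimality for \<open>w\<close> plus potential thus
  becomes optimality for \<open>w\<close> within one count vector.\<close>

lemma opt_base_potential:
  fixes p :: "'c \<Rightarrow> real"
  assumes opt: "is_opt_base \<I> (\<lambda>e. w e + p (cls e)) B"
    and fin: "finite Q" and cls: "\<And>e. e \<in> E \<Longrightarrow> cls e \<in> Q"
    and B': "is_base \<I> B'" and cnt: "\<And>c. c \<in> Q \<Longrightarrow> card {e\<in>B. cls e = c} = card {e\<in>B'. cls e = c}"
  shows "sum w B \<le> sum w B'"
proof -
  have B: "is_base \<I> B" using opt by (simp add: is_opt_base_def)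
  have *: "(\<Sum>e\<in>D. p (cls e)) = (\<Sum>c\<in>Q. real (card {e\<in>D. cls e = c}) * p c)"
    if "is_base \<I> D" for D
  proof -
    have "finite D" "cls ` D \<subseteq> Q" using that base_finite base_subset cls by blast+
    then have "(\<Sum>e\<in>D. p (cls e)) = (\<Sum>c\<in>Q. \<Sum>e\<in>{e\<in>D. cls e = c}. p (cls e))"
      using fin by (intro sum.group[symmetric])
    also have "\<dots> = (\<Sum>c\<in>Q. real (card {e\<in>D. cls e = c}) * p c)"
      by (intro sum.cong refl) simp
    finally show ?thesis .
  qed
  have "(\<Sum>e\<in>B. w e + p (cls e)) \<le> (\<Sum>e\<in>B'. w e + p (cls e))"
    using opt B' by (simp add: is_opt_base_def)
  then show ?thesis using *[OF B] *[OF B'] cnt by (simp add: sum.distrib)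
qed

end

section \<open>Reasoning about programs\<close>

notation Seq (infixr ";;" 60)

abbreviation val :: "nat \<Rightarrow> iexp" where "val a \<equiv> ICell a (INum 0)"
abbreviation set_val :: "nat \<Rightarrow> iexp \<Rightarrow> 'g com" (infix ":==" 65) where "a :== x \<equiv> IStore a (INum 0) x"
abbreviation less_test :: "iexp \<Rightarrow> iexp \<Rightarrow> 'g test" where "less_test x y \<equiv> TNot (ILe y x)"
abbreviation eq_test :: "iexp \<Rightarrow> iexp \<Rightarrow> 'g test" where "eq_test x y \<equiv> TAnd (ILe x y) (ILe y x)"
abbreviation incr :: "nat \<Rightarrow> 'g com" where "incr a \<equiv> a :== IAdd (val a) (INum 1)"

definition for_loop :: "nat \<Rightarrow> nat \<Rightarrow> 'g com \<Rightarrow> 'g com" where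
  "for_loop a b c = (a :== INum 0 ;; While (less_test (val a) (val b)) (c ;; incr a))"

lemma store_row: "store m a i v b = (if b = a then (m a)(i := v) else m b)"
  by (simp add: store_def)

text \<open>\<open>X\<close>, \<open>Y\<close> and \<open>Z\<close> bound the integer, group and
  real arrays that may have been written. A whole array counts as written even if a single cell was,
  so frames are constant sets of array names.\<close>

definition frame :: "nat set \<Rightarrow> nat set \<Rightarrow> nat set \<Rightarrow> 'g state \<Rightarrow> 'g state \<Rightarrow> bool" where
  "frame X Y Z s s' \<longleftrightarrow> (\<forall>a. a \<notin> X \<longrightarrow> imem s' a = imem s a) \<and>
     (\<forall>a. a \<notin> Y \<longrightarrow> gmem s' a = gmem s a) \<and> (\<forall>a. a \<notin> Z \<longrightarrow> rmem s' a = rmem s a)"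

lemma frame_refl [simp]: "frame X Y Z s s"
  by (simp add: frame_def)

lemma frame_trans: "frame X Y Z s s' \<Longrightarrow> frame X Y Z s' s'' \<Longrightarrow> frame X Y Z s s''"
  by (simp add: frame_def)

lemma frame_mono: "frame X Y Z s s' \<Longrightarrow> X \<subseteq> X' \<Longrightarrow> Y \<subseteq> Y' \<Longrightarrow> Z \<subseteq> Z' \<Longrightarrow> frame X' Y' Z' s s'"
  by (auto simp: frame_def)

lemma frame_imem: "frame X Y Z s s' \<Longrightarrow> a \<notin> X \<Longrightarrow> imem s' a = imem s a"
  and frame_gmem: "frame X Y Z s s' \<Longrightarrow> a \<notin> Y \<Longrightarrow> gmem s' a = gmem s a"
  and frame_rmem: "frame X Y Z s s' \<Longrightarrow> a \<notin> Z \<Longrightarrow> rmem s' a = rmem s a"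
  by (simp_all add: frame_def)

lemmas frameD = frame_imem frame_gmem frame_rmem

lemma frame_store [simp]:
  "a \<in> X \<Longrightarrow> frame X Y Z s (s'\<lparr>imem := store m a i v\<rparr>) \<longleftrightarrow> frame X Y Z s (s'\<lparr>imem := m\<rparr>)"
  "a \<in> Y \<Longrightarrow> frame X Y Z s (s'\<lparr>gmem := store h a i x\<rparr>) \<longleftrightarrow> frame X Y Z s (s'\<lparr>gmem := h\<rparr>)"
  "a \<in> Z \<Longrightarrow> frame X Y Z s (s'\<lparr>rmem := store r a i z\<rparr>) \<longleftrightarrow> frame X Y Z s (s'\<lparr>rmem := r\<rparr>)"
  "frame X Y Z s (s'\<lparr>imem := imem s'\<rparr>) \<longleftrightarrow> frame X Y Z s s'"
  "frame X Y Z s (s'\<lparr>gmem := gmem s'\<rparr>) \<longleftrightarrow> frame X Y Z s s'"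
  "frame X Y Z s (s'\<lparr>rmem := rmem s'\<rparr>) \<longleftrightarrow> frame X Y Z s s'"
  by (auto simp: frame_def store_row)

locale ram =
  fixes G :: "'g monoid" and n :: nat and \<I> :: "nat set set"
begin

declare numeral_2_eq_2 [symmetric, simp]

section \<open>Cost calculus for straight-line code and loops\<close>

definition runs :: "'g com \<Rightarrow> 'g state \<Rightarrow> nat \<Rightarrow> ('g state \<Rightarrow> bool) \<Rightarrow> bool" where
  "runs c s T Q \<longleftrightarrow> (\<exists>t s'. exec G n \<I> c s t s' \<and> t \<le> T \<and> Q s')"

lemma runs_mono: "runs c s T Q \<Longrightarrow> T \<le> T' \<Longrightarrow> (\<And>s'. Q s' \<Longrightarrow> Q' s') \<Longrightarrow> runs c s T' Q'"
  unfolding runs_def by (meson order_trans)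

lemma exec_Skip: "exec G n \<I> Skip s t s' \<longleftrightarrow> t = 1 \<and> s' = s"
  by (auto elim: exec.cases intro: exec.Skip[simplified])

lemma exec_IStore: "exec G n \<I> (IStore a i x) s t s' \<longleftrightarrow>
    t = 1 + icost i + icost x \<and> s' = s\<lparr>imem := store (imem s) a (ival s i) (ival s x)\<rparr>"
  by (auto elim: exec.cases intro: exec.IStore[simplified])

lemma exec_GStore: "exec G n \<I> (GStore a i y) s t s' \<longleftrightarrow>
    t = 1 + icost i + gcost y \<and> s' = s\<lparr>gmem := store (gmem s) a (ival s i) (gval G s y)\<rparr>"
  by (auto elim: exec.cases intro: exec.GStore[simplified])

lemma exec_RStore: "exec G n \<I> (RStore a i z) s t s' \<longleftrightarrow>
    t = 1 + icost i + rcost z \<and> s' = s\<lparr>rmem := store (rmem s) a (ival s i) (rval s z)\<rparr>"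
  by (auto elim: exec.cases intro: exec.RStore[simplified])

lemma exec_Seq: "exec G n \<I> (c ;; d) s t s'' \<longleftrightarrow>
    (\<exists>u v s'. exec G n \<I> c s u s' \<and> exec G n \<I> d s' v s'' \<and> t = u + v)"
  by (rule iffI, erule exec.cases) (auto intro: exec.Seq)

lemma exec_Cond: "exec G n \<I> (Cond b c d) s t s' \<longleftrightarrow>
    (\<exists>u. exec G n \<I> (if tval G n \<I> s b then c else d) s u s' \<and> t = 1 + tcost b + u)"
  by (auto elim: exec.cases intro: exec.CondTrue[simplified] exec.CondFalse[simplified])

lemma runs_basic [simp]:
  "runs Skip s T Q \<longleftrightarrow> 1 \<le> T \<and> Q s"
  "runs (IStore a i x) s T Q \<longleftrightarrow> 1 + icost i + icost x \<le> T \<and>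
     Q (s\<lparr>imem := store (imem s) a (ival s i) (ival s x)\<rparr>)"
  "runs (GStore a i y) s T Q \<longleftrightarrow> 1 + icost i + gcost y \<le> T \<and>
     Q (s\<lparr>gmem := store (gmem s) a (ival s i) (gval G s y)\<rparr>)"
  "runs (RStore a i z) s T Q \<longleftrightarrow> 1 + icost i + rcost z \<le> T \<and>
     Q (s\<lparr>rmem := store (rmem s) a (ival s i) (rval s z)\<rparr>)"
  by (auto simp: runs_def exec_Skip exec_IStore exec_GStore exec_RStore)

text \<open>Expresses the remaining budget as a truncated difference, so that simp can execute a
  program from the front while subtracting costs from \<open>T\<close>.\<close>

lemma add_le_split: "m + u \<le> T \<longleftrightarrow> m \<le> T \<and> u \<le> T - (m::nat)"
  by auto

lemma runs_Cond [simp]: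
  "runs (Cond b c d) s T Q \<longleftrightarrow> 1 + tcost b \<le> T \<and>
     (if tval G n \<I> s b then runs c s (T - (1 + tcost b)) Q else runs d s (T - (1 + tcost b)) Q)"
proof -
  let ?e = "if tval G n \<I> s b then c else d"
  have "runs (Cond b c d) s T Q \<longleftrightarrow> (\<exists>u s'. exec G n \<I> ?e s u s' \<and> (1 + tcost b) + u \<le> T \<and> Q s')"
    unfolding runs_def exec_Cond by blast
  also have "\<dots> \<longleftrightarrow> 1 + tcost b \<le> T \<and> (\<exists>u s'. exec G n \<I> ?e s u s' \<and> u \<le> T - (1 + tcost b) \<and> Q s')"
    unfolding add_le_split by blast
  also have "(\<exists>u s'. exec G n \<I> ?e s u s' \<and> u \<le> T - (1 + tcost b) \<and> Q s') \<longleftrightarrow>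
      (if tval G n \<I> s b then runs c s (T - (1 + tcost b)) Q else runs d s (T - (1 + tcost b)) Q)"
    by (simp add: runs_def)
  finally show ?thesis .
qed

lemma runs_Seq_eq: "runs (c ;; d) s T Q \<longleftrightarrow>
    (\<exists>u s'. exec G n \<I> c s u s' \<and> u \<le> T \<and> runs d s' (T - u) Q)"
proof -
  have "runs (c ;; d) s T Q \<longleftrightarrow>
     (\<exists>u v s' s''. exec G n \<I> c s u s' \<and> exec G n \<I> d s' v s'' \<and> u + v \<le> T \<and> Q s'')"
    unfolding runs_def exec_Seq by blast
  then show ?thesis unfolding add_le_split runs_def by blast
qed

lemma runs_Seq_basic [simp]:
  "runs (Skip ;; d) s T Q \<longleftrightarrow> 1 \<le> T \<and> runs d s (T - 1) Q"
  "runs (IStore a i x ;; d) s T Q \<longleftrightarrow> 1 + icost i + icost x \<le> T \<and>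
     runs d (s\<lparr>imem := store (imem s) a (ival s i) (ival s x)\<rparr>) (T - (1 + icost i + icost x)) Q"
  "runs (GStore a i y ;; d) s T Q \<longleftrightarrow> 1 + icost i + gcost y \<le> T \<and>
     runs d (s\<lparr>gmem := store (gmem s) a (ival s i) (gval G s y)\<rparr>) (T - (1 + icost i + gcost y)) Q"
  "runs (RStore a i z ;; d) s T Q \<longleftrightarrow> 1 + icost i + rcost z \<le> T \<and>
     runs d (s\<lparr>rmem := store (rmem s) a (ival s i) (rval s z)\<rparr>) (T - (1 + icost i + rcost z)) Q"
  by (auto simp: runs_Seq_eq exec_Skip exec_IStore exec_GStore exec_RStore)

lemma runs_Seq_assoc [simp]: "runs ((c ;; d) ;; e) s T Q \<longleftrightarrow> runs (c ;; d ;; e) s T Q"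
proof -
  have "exec G n \<I> ((c ;; d) ;; e) s t s' \<longleftrightarrow> (\<exists>u v w s1 s2. exec G n \<I> c s u s1 \<and>
      exec G n \<I> d s1 v s2 \<and> exec G n \<I> e s2 w s' \<and> t = u + v + w)" for t s'
    unfolding exec_Seq by blast
  moreover have "exec G n \<I> (c ;; d ;; e) s t s' \<longleftrightarrow> (\<exists>u v w s1 s2. exec G n \<I> c s u s1 \<and>
      exec G n \<I> d s1 v s2 \<and> exec G n \<I> e s2 w s' \<and> t = u + v + w)" for t s'
    unfolding exec_Seq add.assoc by blast
  ultimately show ?thesis by (simp add: runs_def)
qed

lemma runs_Seq_Cond [simp]:
  "runs (Cond b c d ;; e) s T Q \<longleftrightarrow> 1 + tcost b \<le> T \<and>
     (if tval G n \<I> s b then runs (c ;; e) s (T - (1 + tcost b)) Q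
      else runs (d ;; e) s (T - (1 + tcost b)) Q)"
proof -
  let ?e = "if tval G n \<I> s b then c else d" and ?m = "1 + tcost b"
  have "runs (Cond b c d ;; e) s T Q \<longleftrightarrow>
      (\<exists>u s'. exec G n \<I> ?e s u s' \<and> ?m + u \<le> T \<and> runs e s' (T - (?m + u)) Q)"
    unfolding runs_Seq_eq exec_Cond by blast
  also have "\<dots> \<longleftrightarrow> ?m \<le> T \<and> runs (?e ;; e) s (T - ?m) Q"
    unfolding runs_Seq_eq add_le_split diff_diff_left[symmetric] by blast
  finally show ?thesis by simp
qed

lemma runs_Seq:
  assumes "runs c s Tc R" "\<And>s'. R s' \<Longrightarrow> runs d s' Td Q" "Tc + Td \<le> T"
  shows "runs (c ;; d) s T Q"
proof -
  obtain u s' where u: "exec G n \<I> c s u s'" "u \<le> Tc" "R s'" using assms(1) by (auto simp: runs_def)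
  have "runs d s' (T - u) Q" by (rule runs_mono[OF assms(2)[OF u(3)]]) (use assms(3) u in auto)
  moreover have "u \<le> T" using u assms(3) by simp
  ultimately show ?thesis unfolding runs_Seq_eq using u by blast
qed

text \<open>Amortised loop rule: \<open>\<phi>\<close> bounds the time still to be spent, and every
  round pays for its body and its test by a drop of \<open>\<phi>\<close>. The test alone costs at
  least one step, so \<open>\<phi>\<close> also proves termination.\<close>

lemma runs_While:
  assumes "P s" and T: "\<phi> s + 1 + tcost b \<le> T"
    and step: "\<And>s. P s \<Longrightarrow> tval G n \<I> s b \<Longrightarrow>
      \<exists>t. runs c s t (\<lambda>s'. P s' \<and> \<phi> s' + t + 1 + tcost b \<le> \<phi> s)"
    and post: "\<And>s. P s \<Longrightarrow> \<not> tval G n \<I> s b \<Longrightarrow> Q s"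
  shows "runs (While b c) s T Q"
  using assms(1,2)
proof (induction "\<phi> s" arbitrary: s T rule: less_induct)
  case less
  show ?case
  proof (cases "tval G n \<I> s b")
    case False
    then have "exec G n \<I> (While b c) s (1 + tcost b) s" by (rule exec.WhileFalse)
    then show ?thesis using less.prems post[OF less.prems(1) False] unfolding runs_def by fastforce
  next
    case True
    obtain t u s' where s': "exec G n \<I> c s u s'" "u \<le> t" "P s'" "\<phi> s' + t + 1 + tcost b \<le> \<phi> s"
      using step[OF less.prems(1) True] by (auto simp: runs_def)
    have "runs (While b c) s' (\<phi> s' + 1 + tcost b) Q"
      using less.hyps[of s'] s' by simp
    then obtain v s'' where "exec G n \<I> (While b c) s' v s''" "v \<le> \<phi> s' + 1 + tcost b" "Q s''"
      by (auto simp: runs_def)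
    moreover have "exec G n \<I> (While b c) s (1 + tcost b + u + v) s''"
      by (rule exec.WhileTrue) fact+
    moreover have "1 + tcost b + u + v \<le> T" using calculation s' less.prems by simp
    ultimately show ?thesis unfolding runs_def by blast
  qed
qed

text \<open>\<open>P\<close> must tolerate writes to the counter cell because the loop itself stores
  there. The 13 steps per round are 7 for the test and 6 for the increment; the extra round in the
  bound pays for the initial store and the failing test.\<close>

lemma runs_for_sum:
  assumes bound: "\<And>i s. P i s \<Longrightarrow> imem s b 0 = m"
    and stable: "\<And>i j s. P i s \<Longrightarrow> P i (s\<lparr>imem := store (imem s) a 0 j\<rparr>)"
    and ab: "a \<noteq> b" and init: "P 0 s"
    and step: "\<And>i s. i < m \<Longrightarrow> P i s \<Longrightarrow> imem s a 0 = i \<Longrightarrow>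
      runs c s (t i) (\<lambda>s'. P (Suc i) s' \<and> imem s' a 0 = i)"
    and T: "(\<Sum>i<m. t i) + (m + 1) * 13 \<le> T"
    and Q: "\<And>s. P m s \<Longrightarrow> Q s"
  shows "runs (for_loop a b c) s T Q"
proof -
  define P' where "P' s \<longleftrightarrow> P (imem s a 0) s \<and> imem s a 0 \<le> m" for s
  define \<phi> where "\<phi> s = (\<Sum>i\<in>{imem s a 0..<m}. t i) + 13 * (m - imem s a 0)" for s :: "'g state"
  let ?s = "s\<lparr>imem := store (imem s) a 0 0\<rparr>"
  have "runs (While (less_test (val a) (val b)) (c ;; incr a)) ?s (T - 3) Q"
  proof (rule runs_While[where P = P' and \<phi> = \<phi>])
    show "P' ?s" unfolding P'_def using stable[OF init] by (simp add: store_row)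
    show "\<phi> ?s + 1 + tcost (less_test (val a) (val b)) \<le> T - 3"
      using T by (simp add: \<phi>_def store_row atLeast0LessThan)
  next
    fix s assume s: "P' s" "tval G n \<I> s (less_test (val a) (val b))"
    define i where "i = imem s a 0"
    have Pi: "P i s" and i: "i < m" using s bound by (auto simp: P'_def i_def)
    have "runs (c ;; incr a) s (t i + 6) (\<lambda>s'. P' s' \<and> imem s' a 0 = Suc i)"
    proof (rule runs_Seq[OF step[OF i Pi i_def[symmetric]]])
      fix s' assume "P (Suc i) s' \<and> imem s' a 0 = i"
      then show "runs (incr a) s' 6 (\<lambda>s'. P' s' \<and> imem s' a 0 = Suc i)"
        using stable[of "Suc i" s'] i by (simp add: P'_def store_row)
    qed simp
    moreover have "(\<Sum>j\<in>{i..<m}. t j) = t i + (\<Sum>j\<in>{Suc i..<m}. t j)"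
      using i by (simp add: sum.atLeast_Suc_lessThan)
    ultimately have "runs (c ;; incr a) s (t i + 6) (\<lambda>s'. P' s' \<and>
        \<phi> s' + (t i + 6) + 1 + tcost (less_test (val a) (val b)) \<le> \<phi> s)"
      using i unfolding \<phi>_def i_def[symmetric] by (elim runs_mono) auto
    then show "\<exists>t. runs (c ;; incr a) s t (\<lambda>s'. P' s' \<and>
        \<phi> s' + t + 1 + tcost (less_test (val a) (val b)) \<le> \<phi> s)" by blast
  next
    fix s assume "P' s" "\<not> tval G n \<I> s (less_test (val a) (val b))"
    then show "Q s" using Q bound[of "imem s a 0" s] by (auto simp: P'_def)
  qed
  then show ?thesis unfolding for_loop_def using T by simp
qed

lemma runs_for:
  assumes "\<And>i s. P i s \<Longrightarrow> imem s b 0 = m"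
    and "\<And>i j s. P i s \<Longrightarrow> P i (s\<lparr>imem := store (imem s) a 0 j\<rparr>)"
    and "a \<noteq> b" and "P 0 s"
    and "\<And>i s. i < m \<Longrightarrow> P i s \<Longrightarrow> imem s a 0 = i \<Longrightarrow>
      runs c s t (\<lambda>s'. P (Suc i) s' \<and> imem s' a 0 = i)"
    and T: "(m + 1) * (t + 13) \<le> T"
    and "\<And>s. P m s \<Longrightarrow> Q s"
  shows "runs (for_loop a b c) s T Q"
proof (rule runs_for_sum[where P = P and m = m and t = "\<lambda>_. t"])
  show "(\<Sum>i<m. t) + (m + 1) * 13 \<le> T" using T by (simp add: algebra_simps)
qed (fact assms)+

end

section \<open>Label classes\<close>

text \<open>
  Memory layout. Integer arrays: 3 and 30 hold the membership vector and the class counts of \<open>A\<close>, 10 and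
  11 the classes and their number, 20 the elements by weight, 31 and 32 the class blocks and their
  offsets, 35 the number \<open>K\<close>, 40 and 41 the compositions \<open>R\<close> and \<open>S\<close>, 42 the target counts, 50 and 51 the current
  base and its class counts, 52 a copy of the base modified during a scan, 53 the time at which a class
  was visited (0 if not), 54 to 57 the reached flag, the predecessor and the two exchanged elements on
  the edge into a class. Real arrays: 1 holds potentials, 2 distances, 5 the best weight so far.
  Group arrays: 2 holds the class labels. The group and real arrays 4 are
  never written and supply neutral elements. The remaining
  arrays are loop counters and scratch cells.
\<close>

definition classify :: "'g com" where
  "classify = for_loop 12 0
    (13 :== INum 0 ;;
     While (TAnd (less_test (val 13) (val 11)) (TNot (GEq (GCell 2 (val 13)) (GCell 0 (val 12)))))
       (incr 13) ;;
     IStore 10 (val 12) (val 13) ;;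
     Cond (less_test (val 13) (val 11)) Skip (GStore 2 (val 11) (GCell 0 (val 12)) ;; incr 11))"

definition label_classes :: "(nat \<Rightarrow> 'g) \<Rightarrow> nat \<Rightarrow> nat \<Rightarrow> (nat \<Rightarrow> nat) \<Rightarrow> (nat \<Rightarrow> 'g) \<Rightarrow> bool" where
  "label_classes l n q cls rep \<longleftrightarrow> q = card (l ` {..<n}) \<and> inj_on rep {..<q} \<and> rep ` {..<q} = l ` {..<n} \<and>
     (\<forall>e<n. cls e < q \<and> rep (cls e) = l e)"

text \<open>The linear search ends at \<open>c = q\<close> exactly when the label \<open>l i\<close>
  is new; the class number \<open>q\<close> is then opened for it.\<close>

lemma label_classes_Suc:
  assumes C: "label_classes l i q cls rep"
    and c: "c \<le> q" "\<forall>c'<c. rep c' \<noteq> l i" "c < q \<Longrightarrow> rep c = l i"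
  shows "label_classes l (Suc i) (if c < q then q else Suc q) (cls(i := c)) (if c < q then rep else rep(q := l i))"
proof (cases "c < q")
  case True
  then have "l i \<in> l ` {..<i}" using C c(3) by (metis label_classes_def image_eqI lessThan_iff)
  then have "l ` {..<Suc i} = l ` {..<i}" by (auto simp: lessThan_Suc)
  then show ?thesis using C True c by (auto simp: label_classes_def less_Suc_eq)
next
  case False
  then have "l i \<notin> rep ` {..<q}" using c by auto
  then have "l i \<notin> l ` {..<i}" using C unfolding label_classes_def by metis
  then show ?thesis using False C c
    by (auto simp: label_classes_def lessThan_Suc less_Suc_eq card_insert_if inj_on_def)
qed

lemma label_classes_mono: "label_classes l i q cls rep \<Longrightarrow> i \<le> n \<Longrightarrow> q \<le> card (l ` {..<n})"
  unfolding label_classes_def by (auto intro!: card_mono image_mono)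

context ram
begin

lemma runs_classify:
  assumes "imem s 0 0 = n" "imem s 11 0 = 0" "gmem s 0 = l" "l ` {..<n} = L"
    and "(n + 1) * (22 * card L + 100) \<le> T"
  shows "runs classify s T (\<lambda>s'. frame {10, 11, 12, 13} {2} {} s s' \<and>
    label_classes l n (imem s' 11 0) (imem s' 10) (gmem s' 2))"
  unfolding classify_def
proof (rule runs_for[where m = n and P = "\<lambda>i s'. i \<le> n \<and> frame {10, 11, 12, 13} {2} {} s s' \<and>
    label_classes l i (imem s' 11 0) (imem s' 10) (gmem s' 2)" and t = "22 * card L + 80"])
  fix i s1 assume i: "i < n" and P: "i \<le> n \<and> frame {10, 11, 12, 13} {2} {} s s1 \<and>
    label_classes l i (imem s1 11 0) (imem s1 10) (gmem s1 2)" and i1: "imem s1 12 0 = i"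
  let ?q = "imem s1 11 0"
  have q: "?q \<le> card L" using label_classes_mono[of l i _ _ _ n] P i assms(4) by simp blast
  let ?b = "TAnd (less_test (val 13) (val 11)) (TNot (GEq (GCell 2 (val 13)) (GCell 0 (val 12))))"
  have W: "runs (While ?b (incr 13)) (s1\<lparr>imem := store (imem s1) 13 0 0\<rparr>) (22 * card L + 20)
     (\<lambda>s'. frame {13} {} {} s1 s' \<and> imem s' 13 0 \<le> ?q \<and> (\<forall>c'<imem s' 13 0. gmem s1 2 c' \<noteq> l i) \<and>
       (imem s' 13 0 < ?q \<longrightarrow> gmem s1 2 (imem s' 13 0) = l i))"
    by (rule runs_While[where \<phi> = "\<lambda>s'. 22 * (?q - imem s' 13 0)" and
        P = "\<lambda>s'. frame {13} {} {} s1 s' \<and> imem s' 13 0 \<le> ?q \<and> (\<forall>c'<imem s' 13 0. gmem s1 2 c' \<noteq> l i)"])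
      (use q i1 P assms(3) in \<open>auto simp: store_row frame_def less_Suc_eq intro!: exI[of _ 6]\<close>)
  show "runs (13 :== INum 0 ;; While ?b (incr 13) ;; IStore 10 (val 12) (val 13) ;;
     Cond (less_test (val 13) (val 11)) Skip (GStore 2 (val 11) (GCell 0 (val 12)) ;; incr 11)) s1 (22 * card L + 80)
     (\<lambda>s'. (Suc i \<le> n \<and> frame {10, 11, 12, 13} {2} {} s s' \<and>
       label_classes l (Suc i) (imem s' 11 0) (imem s' 10) (gmem s' 2)) \<and> imem s' 12 0 = i)"
proof -
    have F: "runs (IStore 10 (val 12) (val 13) ;;
       Cond (less_test (val 13) (val 11)) Skip (GStore 2 (val 11) (GCell 0 (val 12)) ;; incr 11)) s2 40
     (\<lambda>s'. (Suc i \<le> n \<and> frame {10, 11, 12, 13} {2} {} s s' \<and>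
       label_classes l (Suc i) (imem s' 11 0) (imem s' 10) (gmem s' 2)) \<and> imem s' 12 0 = i)"
      if R: "frame {13} {} {} s1 s2 \<and> imem s2 13 0 \<le> ?q \<and> (\<forall>c'<imem s2 13 0. gmem s1 2 c' \<noteq> l i) \<and>
       (imem s2 13 0 < ?q \<longrightarrow> gmem s1 2 (imem s2 13 0) = l i)" for s2
    proof -
      have "frame {10, 11, 12, 13} {2} {} s1 s2" by (rule frame_mono[OF R[THEN conjunct1]]) simp_all
      then have fr: "frame {10, 11, 12, 13} {2} {} s s2" using P by (blast intro: frame_trans)
      have l: "gmem s2 0 = l" using assms(3) by (simp add: frameD[OF fr])
      have rows: "imem s2 12 0 = i" "imem s2 11 = imem s1 11" "imem s2 10 = imem s1 10" "gmem s2 2 = gmem s1 2"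
        using i1 by (simp_all add: frameD[OF R[THEN conjunct1]])
      have "label_classes l (Suc i) (if imem s2 13 0 < ?q then ?q else Suc ?q)
          ((imem s1 10)(i := imem s2 13 0)) (if imem s2 13 0 < ?q then gmem s1 2 else (gmem s1 2)(?q := l i))"
        by (rule label_classes_Suc) (use P R in auto)
      then show ?thesis using i fr by (auto simp: store_row rows l not_le split: if_splits)
    qed
    show ?thesis using runs_Seq[OF W F] by simp
  qed
qed (use assms in \<open>auto simp: store_row frame_def label_classes_def algebra_simps\<close>)

end

section \<open>Sorting\<close>

definition min_exp :: "iexp \<Rightarrow> iexp \<Rightarrow> iexp" where "min_exp x y = ISub x (ISub x y)"

lemma ival_min_exp [simp]: "ival s (min_exp x y) = min (ival s x) (ival s y)"
  by (simp add: min_exp_def)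

lemma icost_min_exp [simp]: "icost (min_exp x y) = 2 + 2 * icost x + icost y"
  by (simp add: min_exp_def)

definition weight_at :: "nat \<Rightarrow> rexp" where "weight_at i = RCell 0 (ICell 20 (val i))"

definition merge_step :: "'g com" where
  "merge_step = Cond (TAnd (less_test (val 25) (val 27))
      (TNot (TAnd (less_test (val 26) (val 28)) (TNot (RLe (weight_at 25) (weight_at 26))))))
    (IStore 21 (val 24) (ICell 20 (val 25)) ;; incr 25 ;; incr 24)
    (IStore 21 (val 24) (ICell 20 (val 26)) ;; incr 26 ;; incr 24)"

definition merge_block :: "'g com" where
  "merge_block = (25 :== val 23 ;; 24 :== val 23 ;;
     27 :== min_exp (IAdd (val 23) (val 22)) (val 0) ;;
     28 :== min_exp (IAdd (val 27) (val 22)) (val 0) ;; 26 :== val 27 ;;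
     While (less_test (val 24) (val 28)) merge_step ;; 23 :== val 28)"

definition merge_round :: "'g com" where
  "merge_round = (23 :== INum 0 ;; While (less_test (val 23) (val 0)) merge_block ;;
     for_loop 29 0 (IStore 20 (val 29) (ICell 21 (val 29))) ;; 22 :== IAdd (val 22) (val 22))"

definition merge_sort :: "'g com" where
  "merge_sort = (for_loop 29 0 (IStore 20 (val 29) (val 29)) ;; 22 :== INum 1 ;;
     While (less_test (val 22) (val 0)) merge_round)"

definition sorted_on :: "(nat \<Rightarrow> real) \<Rightarrow> (nat \<Rightarrow> nat) \<Rightarrow> nat \<Rightarrow> nat \<Rightarrow> bool" where
  "sorted_on w f a b \<longleftrightarrow> (\<forall>x y. a \<le> x \<longrightarrow> x \<le> y \<longrightarrow> y < b \<longrightarrow> w (f x) \<le> w (f y))"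

text \<open>\<open>i\<close> and \<open>j\<close> point into the runs \<open>{lo..<mi}\<close> and
  \<open>{mi..<hi}\<close>, and \<open>k\<close> is the next output position. The image clause
  starts at index 0 instead of \<open>lo\<close>: it carries the finished blocks along, so that the
  output enumerates the whole ground set at the end.\<close>

definition merging :: "(nat \<Rightarrow> real) \<Rightarrow> (nat \<Rightarrow> nat) \<Rightarrow> (nat \<Rightarrow> nat) \<Rightarrow> nat \<Rightarrow> nat \<Rightarrow> nat \<Rightarrow> nat \<Rightarrow> nat \<Rightarrow> nat \<Rightarrow> bool" where
  "merging w f h lo mi hi i j k \<longleftrightarrow> lo \<le> i \<and> i \<le> mi \<and> mi \<le> j \<and> j \<le> hi \<and> k = i + (j - mi) \<and>
     h ` {..<k} = f ` ({..<i} \<union> {mi..<j}) \<and> sorted_on w h lo k \<and>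
     (\<forall>x\<in>{lo..<k}. \<forall>y\<in>{i..<mi} \<union> {j..<hi}. w (h x) \<le> w (f y))"

text \<open>Both runs are sorted, so the smaller of the two heads bounds everything not yet merged
  from below; this restores the last clause of the invariant.\<close>

lemma merging_step:
  assumes M: "merging w f h lo mi hi i j k" and f: "sorted_on w f lo mi" "sorted_on w f mi hi"
    and c: "(c = i \<and> i < mi \<and> (j < hi \<longrightarrow> w (f i) \<le> w (f j)) \<and> i' = Suc i \<and> j' = j) \<or>
      (c = j \<and> j < hi \<and> (i < mi \<longrightarrow> w (f j) \<le> w (f i)) \<and> i' = i \<and> j' = Suc j)"
  shows "merging w f (h(k := f c)) lo mi hi i' j' (Suc k)"
proof -
  have A: "lo \<le> i" "i \<le> mi" "mi \<le> j" "j \<le> hi" "k = i + (j - mi)"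
    and I: "h ` {..<k} = f ` ({..<i} \<union> {mi..<j})" and S: "sorted_on w h lo k"
    and D: "\<And>x y. lo \<le> x \<Longrightarrow> x < k \<Longrightarrow> i \<le> y \<and> y < mi \<or> j \<le> y \<and> y < hi \<Longrightarrow> w (h x) \<le> w (f y)"
    using M unfolding merging_def by auto
  have fi: "w (f i) \<le> w (f y)" if "i \<le> y" "y < mi" for y
    using f(1) A(1) that unfolding sorted_on_def by blast
  have fj: "w (f j) \<le> w (f y)" if "j \<le> y" "y < hi" for y
    using f(2) A(3) that unfolding sorted_on_def by blast
  have A': "lo \<le> i'" "i' \<le> mi" "mi \<le> j'" "j' \<le> hi" "Suc k = i' + (j' - mi)"
    and c': "i \<le> c \<and> c < mi \<or> j \<le> c \<and> c < hi" and set: "insert c ({..<i} \<union> {mi..<j}) = {..<i'} \<union> {mi..<j'}"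
    using c A by auto
  have "(h(k := f c)) ` {..<Suc k} = insert (f c) (h ` {..<k})" by (auto simp: lessThan_Suc)
  also have "\<dots> = f ` insert c ({..<i} \<union> {mi..<j})" unfolding I by simp
  finally have 1: "(h(k := f c)) ` {..<Suc k} = f ` ({..<i'} \<union> {mi..<j'})" unfolding set .
  have 2: "sorted_on w (h(k := f c)) lo (Suc k)"
    using S D[OF _ _ c'] by (auto simp: sorted_on_def less_Suc_eq)
  have 3: "w (f c) \<le> w (f y)" if "y \<in> {i'..<mi} \<union> {j'..<hi}" for y
    using c
  proof (elim disjE conjE)
    assume "c = i" "i < mi" "j < hi \<longrightarrow> w (f i) \<le> w (f j)" "i' = Suc i" "j' = j"
    then show ?thesis using that fi[of y] fj[of y] by force
  next
    assume "c = j" "j < hi" "i < mi \<longrightarrow> w (f j) \<le> w (f i)" "i' = i" "j' = Suc j"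
    then show ?thesis using that fi[of y] fj[of y] by force
  qed
  have "i \<le> i'" "j \<le> j'" using c by auto
  then have 4: "w ((h(k := f c)) x) \<le> w (f y)" if "x \<in> {lo..<Suc k}" "y \<in> {i'..<mi} \<union> {j'..<hi}" for x y
    using 3[OF that(2)] D[of x y] that by (auto simp: less_Suc_eq)
  show ?thesis unfolding merging_def using A' 1 2 4 by blast
qed

definition block_sorted :: "(nat \<Rightarrow> real) \<Rightarrow> (nat \<Rightarrow> nat) \<Rightarrow> nat \<Rightarrow> nat \<Rightarrow> bool" where
  "block_sorted w f W b \<longleftrightarrow> (\<forall>m. sorted_on w f (m * W) (min (m * W + W) b))"

lemma block_sorted_1: "block_sorted w f (Suc 0) b"
  unfolding block_sorted_def sorted_on_def
proof (intro allI impI)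
  fix m x y assume "m * Suc 0 \<le> x" "x \<le> y" "y < min (m * Suc 0 + Suc 0) b"
  then have "x = y" by simp
  then show "w (f x) \<le> w (f y)" by simp
qed

lemma block_sorted_extend:
  assumes "block_sorted w f W lo" "lo = m * W" "hi \<le> lo + W" "sorted_on w f lo hi"
  shows "block_sorted w f W hi"
  unfolding block_sorted_def sorted_on_def
proof (intro allI impI)
  fix m' x y assume x: "m' * W \<le> x" "x \<le> y" "y < min (m' * W + W) hi"
  show "w (f x) \<le> w (f y)"
  proof (cases "y < lo")
    case True
    then show ?thesis using assms(1) x by (auto simp: block_sorted_def sorted_on_def)
  next
    case False
    then have "m * W < Suc m' * W" "m' * W < Suc m * W" using x assms by auto
    then have "m' = m" by (metis less_Suc_eq_le mult_less_cancel2 order_antisym)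
    then show ?thesis using assms x by (auto simp: sorted_on_def)
  qed
qed

context ram
begin

lemma runs_merge_block:
  assumes n: "imem s 0 0 = n" and w: "rmem s 0 = w" and W: "imem s 22 0 = W" "W > 0"
    and lo: "imem s 23 0 = lo" "lo < n" "lo = m * (W + W)"
    and f: "imem s 20 = f" "block_sorted w f W n"
    and h: "imem s 21 ` {..<lo} = f ` {..<lo}" "block_sorted w (imem s 21) (W + W) lo"
  shows "runs merge_block s (70 * (min (lo + W + W) n - lo) + 70)
    (\<lambda>s'. frame {21, 23, 24, 25, 26, 27, 28} {} {} s s' \<and> imem s' 23 0 = min (lo + W + W) n \<and>
      imem s' 21 ` {..<imem s' 23 0} = f ` {..<imem s' 23 0} \<and>
      block_sorted w (imem s' 21) (W + W) (imem s' 23 0))"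
proof -
  define mi hi where "mi = min (lo + W) n" and "hi = min (lo + W + W) n"
  have hi: "min (mi + W) n = hi" by (auto simp: mi_def hi_def)
  have le: "lo < hi" "lo \<le> mi" "mi \<le> hi" using lo W by (auto simp: mi_def hi_def)
  \<comment> \<open>The two runs inside the double block with number \<open>m\<close> are the single
    blocks with numbers \<open>2 m\<close> and \<open>2 m + 1\<close>.\<close>
  have "m * 2 * W = lo" "Suc (m * 2) * W = lo + W" using lo by (auto simp: algebra_simps)
  then have sorted: "sorted_on w f lo mi" "sorted_on w f mi hi"
    using f(2)[unfolded block_sorted_def, rule_format, of "m * 2"]
      f(2)[unfolded block_sorted_def, rule_format, of "Suc (m * 2)"]
    by (auto simp: mi_def hi_def sorted_on_def add.commute)
  define P where "P s' \<longleftrightarrow> frame {21, 23, 24, 25, 26, 27, 28} {} {} s s' \<and> imem s' 27 0 = mi \<and> imem s' 28 0 = hi \<and>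
     block_sorted w (imem s' 21) (W + W) lo \<and>
     merging w f (imem s' 21) lo mi hi (imem s' 25 0) (imem s' 26 0) (imem s' 24 0)" for s'
  let ?s = "s\<lparr>imem := store (store (store (store (store (imem s) 25 0 lo) 24 0 lo) 27 0 mi) 28 0 hi) 26 0 mi\<rparr>"
  have W: "runs (While (less_test (val 24) (val 28)) merge_step) ?s (70 * (hi - lo) + 10)
     (\<lambda>s'. P s' \<and> imem s' 24 0 = hi)"
  proof (rule runs_While[where P = P and \<phi> = "\<lambda>s'. 70 * (hi - imem s' 24 0)"])
    show "P ?s" unfolding P_def using h le by (auto simp: store_row merging_def sorted_on_def)
  next
    fix s1 assume P: "P s1" and b: "tval G n \<I> s1 (less_test (val 24) (val 28))"
    have fr: "frame {21, 23, 24, 25, 26, 27, 28} {} {} s s1" using P by (simp add: P_def)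
    have rows: "imem s1 20 = f" "rmem s1 0 = w" "imem s1 27 0 = mi" "imem s1 28 0 = hi"
      using P f w by (simp_all add: P_def frameD[OF fr])
    define i j k where "i = imem s1 25 0" and "j = imem s1 26 0" and "k = imem s1 24 0"
    have M: "merging w f (imem s1 21) lo mi hi i j k" and bs: "block_sorted w (imem s1 21) (W + W) lo"
      using P by (simp_all add: P_def i_def j_def k_def)
    have k: "k < hi" "lo \<le> k" using b rows M by (auto simp: k_def merging_def)
    have bs': "block_sorted w ((imem s1 21)(k := v)) (W + W) lo" for v
      using bs k by (auto simp: block_sorted_def sorted_on_def)
    have ij: "i \<le> mi" "j \<le> hi" "k = i + (j - mi)" "mi \<le> j" using M by (auto simp: merging_def)
    have "runs merge_step s1 50 (\<lambda>s'. P s' \<and> imem s' 24 0 = Suc k)"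
    proof (cases "i < mi \<and> (j < hi \<longrightarrow> w (f i) \<le> w (f j))")
      case True
      then have "merging w f ((imem s1 21)(k := f i)) lo mi hi (Suc i) j (Suc k)"
        by (intro merging_step[OF M sorted]) auto
      then show ?thesis using True fr bs'
        by (auto simp: merge_step_def weight_at_def rows store_row P_def i_def[symmetric] j_def[symmetric] k_def[symmetric])
    next
      case False
      then have "j < hi" using k ij by auto
      then have "merging w f ((imem s1 21)(k := f j)) lo mi hi i (Suc j) (Suc k)"
        using False by (intro merging_step[OF M sorted]) auto
      then show ?thesis using False \<open>j < hi\<close> fr bs'
        by (auto simp: merge_step_def weight_at_def rows store_row P_def i_def[symmetric] j_def[symmetric] k_def[symmetric])
    qed
    then have "runs merge_step s1 50 (\<lambda>s'. P s' \<and>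
        70 * (hi - imem s' 24 0) + 50 + 1 + tcost (less_test (val 24) (val 28)) \<le> 70 * (hi - imem s1 24 0))"
      by (rule runs_mono) (use k in \<open>auto simp: k_def[symmetric]\<close>)
    then show "\<exists>t. runs merge_step s1 t (\<lambda>s'. P s' \<and>
        70 * (hi - imem s' 24 0) + t + 1 + tcost (less_test (val 24) (val 28)) \<le> 70 * (hi - imem s1 24 0))" ..
  qed (auto simp: store_row P_def merging_def)
  have F: "runs (23 :== val 28) s2 10 (\<lambda>s'. frame {21, 23, 24, 25, 26, 27, 28} {} {} s s' \<and> imem s' 23 0 = hi \<and>
      imem s' 21 ` {..<imem s' 23 0} = f ` {..<imem s' 23 0} \<and>
      block_sorted w (imem s' 21) (W + W) (imem s' 23 0))"
    if P: "P s2 \<and> imem s2 24 0 = hi" for s2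
  proof -
    have M: "merging w f (imem s2 21) lo mi hi (imem s2 25 0) (imem s2 26 0) hi"
      and bs: "block_sorted w (imem s2 21) (W + W) lo"
      using P by (auto simp: P_def)
    have "{..<imem s2 25 0} \<union> {mi..<imem s2 26 0} = {..<hi}" using M by (auto simp: merging_def)
    moreover have "imem s2 21 ` {..<hi} = f ` ({..<imem s2 25 0} \<union> {mi..<imem s2 26 0})"
      "sorted_on w (imem s2 21) lo hi"
      using M unfolding merging_def by blast+
    ultimately have "imem s2 21 ` {..<hi} = f ` {..<hi}" "sorted_on w (imem s2 21) lo hi" by simp_all
    moreover have "block_sorted w (imem s2 21) (W + W) hi"
      by (rule block_sorted_extend[OF bs lo(3)]) (use calculation in \<open>simp_all add: hi_def\<close>)
    ultimately show ?thesis using P by (simp add: P_def store_row)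
  qed
  show ?thesis unfolding merge_block_def hi_def[symmetric]
    using runs_Seq[OF W F, of "26 + 70 * (hi - lo)"] n lo(1) \<open>imem s 22 0 = W\<close> hi
    by (simp add: store_row mi_def[symmetric] min_def[symmetric])
qed

lemma runs_merge_round:
  assumes n: "imem s 0 0 = n" and w: "rmem s 0 = w" and W: "imem s 22 0 = W" "W > 0"
    and f: "imem s 20 ` {..<n} = {..<n}" "block_sorted w (imem s 20) W n"
  shows "runs merge_round s (200 * (n + 1))
    (\<lambda>s'. frame {20..29} {} {} s s' \<and> imem s' 22 0 = W + W \<and>
      imem s' 20 ` {..<n} = {..<n} \<and> block_sorted w (imem s' 20) (W + W) n)"
proof -
  define P where "P s' \<longleftrightarrow> frame {21, 23, 24, 25, 26, 27, 28} {} {} s s' \<and> imem s' 23 0 \<le> n \<and>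
     (imem s' 23 0 < n \<longrightarrow> (\<exists>m. imem s' 23 0 = m * (W + W))) \<and>
     imem s' 21 ` {..<imem s' 23 0} = imem s 20 ` {..<imem s' 23 0} \<and>
     block_sorted w (imem s' 21) (W + W) (imem s' 23 0)" for s'
  let ?s = "s\<lparr>imem := store (imem s) 23 0 0\<rparr>"
  have A: "runs (While (less_test (val 23) (val 0)) merge_block) ?s (150 * n + 10)
      (\<lambda>s'. P s' \<and> imem s' 23 0 = n)"
  proof (rule runs_While[where P = P and \<phi> = "\<lambda>s'. 150 * (n - imem s' 23 0)"])
    show "P ?s" by (auto simp: P_def store_row block_sorted_def sorted_on_def)
  next
    fix s1 assume P: "P s1" and b: "tval G n \<I> s1 (less_test (val 23) (val 0))"
    define lo where "lo = imem s1 23 0"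
    have fr: "frame {21, 23, 24, 25, 26, 27, 28} {} {} s s1" using P by (simp add: P_def)
    have rows: "imem s1 0 0 = n" "rmem s1 0 = w" "imem s1 22 0 = W" "imem s1 20 = imem s 20"
      by (simp_all add: frameD[OF fr] n w W)
    obtain m where m: "lo = m * (W + W)" and lo: "lo < n"
      using P b rows by (auto simp: P_def lo_def)
    have h: "imem s1 21 ` {..<lo} = imem s 20 ` {..<lo}" "block_sorted w (imem s1 21) (W + W) lo"
      using P by (simp_all add: P_def lo_def)
    define hi where "hi = min (lo + W + W) n"
    have hi: "lo < hi" "hi \<le> n" using lo W by (auto simp: hi_def)
    have him: "\<exists>m'. hi = m' * (W + W)" if "hi < n"
      using that m by (intro exI[of _ "Suc m"]) (auto simp: hi_def)
    have "runs merge_block s1 (70 * (hi - lo) + 70)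
      (\<lambda>s'. P s' \<and> 150 * (n - imem s' 23 0) + (70 * (hi - lo) + 70) + 1 +
        tcost (less_test (val 23) (val 0)) \<le> 150 * (n - lo))"
      using runs_merge_block[OF rows(1-3) W(2) lo_def[symmetric] lo m rows(4) f(2) h] unfolding hi_def[symmetric]
    proof (rule runs_mono)
      fix s2
      assume s2: "frame {21, 23, 24, 25, 26, 27, 28} {} {} s1 s2 \<and> imem s2 23 0 = hi \<and>
        imem s2 21 ` {..<imem s2 23 0} = imem s 20 ` {..<imem s2 23 0} \<and>
        block_sorted w (imem s2 21) (W + W) (imem s2 23 0)"
      then have "P s2" using hi him frame_trans[OF fr] unfolding P_def by metis
      then show "P s2 \<and> 150 * (n - imem s2 23 0) + (70 * (hi - lo) + 70) + 1 +
          tcost (less_test (val 23) (val 0)) \<le> 150 * (n - lo)"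
        using s2 hi by auto
    qed simp
    then show "\<exists>t. runs merge_block s1 t (\<lambda>s'. P s' \<and> 150 * (n - imem s' 23 0) + t + 1 +
        tcost (less_test (val 23) (val 0)) \<le> 150 * (n - imem s1 23 0))"
      unfolding lo_def by blast
  next
    fix s1 assume P: "P s1" and "\<not> tval G n \<I> s1 (less_test (val 23) (val 0))"
    moreover have "imem s1 0 0 = n" using P n by (simp add: P_def frame_def)
    ultimately have "imem s1 23 0 = n" by (simp add: P_def)
    then show "P s1 \<and> imem s1 23 0 = n" using P by simp
  qed (simp add: store_row)
  define Q where "Q s' \<longleftrightarrow> frame {20..29} {} {} s s' \<and> imem s' 22 0 = W + W \<and>
      imem s' 20 ` {..<n} = {..<n} \<and> block_sorted w (imem s' 20) (W + W) n" for s'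
  have F: "runs (for_loop 29 0 (IStore 20 (val 29) (ICell 21 (val 29))) ;; 22 :== IAdd (val 22) (val 22)) s2
      ((n + 1) * 19 + 10) Q" if s2: "P s2 \<and> imem s2 23 0 = n" for s2
  proof (rule runs_Seq[where Td = 10 and R = "\<lambda>s'. frame {20..29} {} {} s s' \<and> imem s' 22 0 = W \<and>
      imem s' 20 ` {..<n} = {..<n} \<and> block_sorted w (imem s' 20) (W + W) n"])
    have fr2: "frame {21, 23, 24, 25, 26, 27, 28} {} {} s s2" using s2 by (simp add: P_def)
    then have fr: "frame {20..29} {} {} s s2" by (rule frame_mono) auto
    show "runs (for_loop 29 0 (IStore 20 (val 29) (ICell 21 (val 29)))) s2 ((n + 1) * 19)
      (\<lambda>s'. frame {20..29} {} {} s s' \<and> imem s' 22 0 = W \<and>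
      imem s' 20 ` {..<n} = {..<n} \<and> block_sorted w (imem s' 20) (W + W) n)"
    proof (rule runs_for[where m = n and t = 6 and
        P = "\<lambda>i s'. frame {20, 29} {} {} s2 s' \<and> (\<forall>e<i. imem s' 20 e = imem s2 21 e)"])
      show "imem s' 0 0 = n" if "frame {20, 29} {} {} s2 s' \<and> (\<forall>e<i. imem s' 20 e = imem s2 21 e)" for i s'
        using that n fr2 by (simp add: frame_def)
    next
      fix s3 assume s3: "frame {20, 29} {} {} s2 s3 \<and> (\<forall>e<n. imem s3 20 e = imem s2 21 e)"
      then have "frame {20..29} {} {} s2 s3" by (intro frame_mono[OF s3[THEN conjunct1]]) auto
      moreover have "imem s3 20 ` {..<n} = imem s2 21 ` {..<n}" using s3 by simp
      moreover have e2: "imem s2 21 ` {..<n} = imem s 20 ` {..<n}" "block_sorted w (imem s2 21) (W + W) n"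
        using s2[THEN conjunct1] unfolding P_def s2[THEN conjunct2] by blast+
      moreover have "block_sorted w (imem s3 20) (W + W) n"
        using e2(2) s3 by (simp add: block_sorted_def sorted_on_def)
      moreover have "imem s3 22 0 = W" using s3 W(1) fr2 by (simp add: frame_def)
      ultimately show "frame {20..29} {} {} s s3 \<and> imem s3 22 0 = W \<and>
          imem s3 20 ` {..<n} = {..<n} \<and> block_sorted w (imem s3 20) (W + W) n"
        using f(1) frame_trans[OF fr] by auto
    qed (auto simp: store_row less_Suc_eq frame_def)
  qed (simp_all add: Q_def store_row)
  show ?thesis unfolding merge_round_def Q_def[symmetric]
    using runs_Seq[OF A F, of "200 * (n + 1) - 3"] by simp
qed

end

context ram begin
lemma runs_merge_sort:
  assumes n: "imem s 0 0 = n" and w: "rmem s 0 = w" and L: "n \<le> 2 ^ L"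
    and T: "300 * (n + 1) * (L + 1) \<le> T"
  shows "runs merge_sort s T (\<lambda>s'. frame {20..29} {} {} s s' \<and>
      imem s' 20 ` {..<n} = {..<n} \<and> sorted_on w (imem s' 20) 0 n)"
proof -
  have I: "runs (for_loop 29 0 (IStore 20 (val 29) (val 29))) s ((n + 1) * 19)
      (\<lambda>s'. frame {20..29} {} {} s s' \<and> (\<forall>e<n. imem s' 20 e = e))"
    by (rule runs_for[where m = n and t = 6 and P = "\<lambda>i s'. frame {20..29} {} {} s s' \<and> (\<forall>e<i. imem s' 20 e = e)"])
      (use n in \<open>auto simp: store_row less_Suc_eq frame_def\<close>)
  define Q where "Q s' \<longleftrightarrow> frame {20..29} {} {} s s' \<and>
      imem s' 20 ` {..<n} = {..<n} \<and> sorted_on w (imem s' 20) 0 n" for s'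
  \<comment> \<open>The run width is always a power of two. Reading its exponent back from the state
    makes the number of remaining rounds a function of the state, as the loop rule requires.\<close>
  define lg :: "nat \<Rightarrow> nat" where "lg W = (THE r. 2 ^ r = W)" for W
  have lg: "lg (2 ^ r) = r" for r by (simp add: lg_def)
  have F: "runs (22 :== INum 1 ;; While (less_test (val 22) (val 0)) merge_round) s1
      (250 * (n + 1) * L + 20) Q" if s1: "frame {20..29} {} {} s s1 \<and> (\<forall>e<n. imem s1 20 e = e)" for s1
  proof -
    let ?s = "s1\<lparr>imem := store (imem s1) 22 0 1\<rparr>"
    define P where "P s' \<longleftrightarrow> frame {20..29} {} {} s s' \<and> (\<exists>r. imem s' 22 0 = 2 ^ r) \<and>
      imem s' 20 ` {..<n} = {..<n} \<and> block_sorted w (imem s' 20) (imem s' 22 0) n" for s'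
    have "runs (While (less_test (val 22) (val 0)) merge_round) ?s (250 * (n + 1) * L + 10) Q"
    proof (rule runs_While[where P = P and \<phi> = "\<lambda>s'. 250 * (n + 1) * (L - lg (imem s' 22 0))"])
      have "imem s1 20 ` {..<n} = {..<n}" using s1 by (auto simp: image_def)
      then show "P ?s" using s1 unfolding P_def
        by (auto simp: store_row block_sorted_1 intro: exI[of _ 0])
      show "250 * (n + 1) * (L - lg (imem ?s 22 0)) + 1 + tcost (less_test (val 22) (val 0)) \<le> 250 * (n + 1) * L + 10"
        using lg[of 0] by (simp add: store_row)
    next
      fix s2 assume P: "P s2" and b: "tval G n \<I> s2 (less_test (val 22) (val 0))"
      then obtain r where r: "imem s2 22 0 = 2 ^ r" by (auto simp: P_def)
      have fr: "frame {20..29} {} {} s s2" using P by (simp add: P_def)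
      have rows: "imem s2 0 0 = n" "rmem s2 0 = w" by (simp_all add: frameD[OF fr] n w)
      have "2 ^ r < n" using b r rows by simp
      then have "(2::nat) ^ r < 2 ^ L" using L by linarith
      then have "r < L" by simp
      then have Lr: "L - r = Suc (L - Suc r)" by (simp add: Suc_diff_Suc)
      have c: "250 * (n + 1) * (L - Suc r) + 250 * (n + 1) = 250 * (n + 1) * (L - r)"
        unfolding Lr by simp
      have "runs merge_round s2 (200 * (n + 1)) (\<lambda>s'. P s' \<and> 250 * (n + 1) * (L - lg (imem s' 22 0)) +
          200 * (n + 1) + 1 + tcost (less_test (val 22) (val 0)) \<le> 250 * (n + 1) * (L - lg (imem s2 22 0)))"
      proof (rule runs_mono[OF runs_merge_round[OF rows r] order_refl])
        fix s3 assume s3: "frame {20..29} {} {} s2 s3 \<and> imem s3 22 0 = 2 ^ r + 2 ^ r \<and>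
          imem s3 20 ` {..<n} = {..<n} \<and> block_sorted w (imem s3 20) (2 ^ r + 2 ^ r) n"
        have two: "(2::nat) ^ r + 2 ^ r = 2 ^ Suc r" by simp
        have r3: "imem s3 22 0 = 2 ^ Suc r" using s3 unfolding two by blast
        have "block_sorted w (imem s3 20) (2 ^ Suc r) n"
          using s3[unfolded two] by blast
        moreover have "frame {20..29} {} {} s s3" using frame_trans[OF fr] s3 by blast
        ultimately have "P s3" unfolding P_def r3 using s3 by blast
        then show "P s3 \<and> 250 * (n + 1) * (L - lg (imem s3 22 0)) + 200 * (n + 1) + 1 +
            tcost (less_test (val 22) (val 0)) \<le> 250 * (n + 1) * (L - lg (imem s2 22 0))"
          unfolding r r3 lg c[symmetric] by simp
      qed (use P in \<open>simp_all add: P_def r\<close>)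
      then show "\<exists>t. runs merge_round s2 t (\<lambda>s'. P s' \<and> 250 * (n + 1) * (L - lg (imem s' 22 0)) + t + 1 +
        tcost (less_test (val 22) (val 0)) \<le> 250 * (n + 1) * (L - lg (imem s2 22 0)))" by (intro exI[of _ "200 * (n + 1)"])
    next
      fix s2 assume P: "P s2" and b: "\<not> tval G n \<I> s2 (less_test (val 22) (val 0))"
      have "imem s2 0 0 = n" using P n by (simp add: P_def frame_def)
      then have "n \<le> imem s2 22 0" using b by simp
      moreover have "sorted_on w (imem s2 20) (0 * imem s2 22 0) (min (0 * imem s2 22 0 + imem s2 22 0) n)"
        using P unfolding P_def block_sorted_def by blast
      ultimately have "sorted_on w (imem s2 20) 0 n" by (simp add: min.absorb2)
      then show "Q s2" using P by (simp add: P_def Q_def)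
    qed
    then have "runs (While (less_test (val 22) (val 0)) merge_round) ?s (250 * (n + 1) * L + 20 - 3) Q"
      by (rule runs_mono) simp_all
    then show ?thesis by simp
  qed
  have "(n + 1) * 19 + (250 * (n + 1) * L + 20) \<le> 300 * (n + 1) * (L + 1)"
    by (simp add: algebra_simps)
  then show ?thesis unfolding merge_sort_def Q_def[symmetric]
    using runs_Seq[OF I F] T by (meson order_trans)
qed

end

section \<open>The greedy base and the class blocks\<close>

definition mem_vec :: "nat set \<Rightarrow> nat \<Rightarrow> nat" where
  "mem_vec X = (\<lambda>e. if e \<in> X then 1 else 0)"

lemma mem_vec_upd: "(mem_vec X)(e := Suc 0) = mem_vec (insert e X)" "(mem_vec X)(e := 0) = mem_vec (X - {e})"
  by (auto simp: mem_vec_def)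

lemma mem_vec_eq_0 [simp]: "mem_vec X e = 0 \<longleftrightarrow> e \<notin> X"
  by (simp add: mem_vec_def)

lemma stored_set_mem_vec: "imem s a = mem_vec X \<Longrightarrow> X \<subseteq> {..<n} \<Longrightarrow> stored_set n s a = X"
  by (auto simp: stored_set_def)

primrec greedy :: "'a set set \<Rightarrow> (nat \<Rightarrow> 'a) \<Rightarrow> nat \<Rightarrow> 'a set" where
  "greedy \<I> f 0 = {}"
| "greedy \<I> f (Suc i) = (if insert (f i) (greedy \<I> f i) \<in> \<I> then insert (f i) (greedy \<I> f i) else greedy \<I> f i)"

lemma greedy_mono: "i \<le> j \<Longrightarrow> greedy \<I> f i \<subseteq> greedy \<I> f j"
proof (induction j)
  case (Suc j)
  then show ?case by (cases "i = Suc j") auto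
qed simp

lemma greedy_subset: "greedy \<I> f i \<subseteq> f ` {..<i}"
proof (induction i)
  case (Suc i)
  then show ?case unfolding lessThan_Suc by auto
qed simp

lemma (in finite_matroid) greedy_indep: "greedy \<I> f i \<in> \<I>"
  by (induction i) (simp_all add: indep_empty)

text \<open>An element rejected at position \<open>i\<close> cannot be added to
  \<open>greedy \<I> f i\<close>. Whatever it can be exchanged with was therefore chosen before
  position \<open>i\<close> and is no heavier, so \<open>local_opt_base\<close> applies.\<close>

lemma (in finite_matroid) greedy_opt_base:
  fixes u :: "'a \<Rightarrow> real"
  assumes f: "f ` {..<m} = E" and sorted: "\<And>i j. i \<le> j \<Longrightarrow> j < m \<Longrightarrow> u (f i) \<le> u (f j)"
  shows "is_opt_base \<I> u (greedy \<I> f m)"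
proof -
  let ?A = "greedy \<I> f m"
  have rej: "insert (f i) (greedy \<I> f i) \<notin> \<I>" if "i < m" "f i \<notin> ?A" for i
  proof
    assume "insert (f i) (greedy \<I> f i) \<in> \<I>"
    then have "f i \<in> greedy \<I> f (Suc i)" by simp
    then show False using greedy_mono[of "Suc i" m \<I> f] that by (meson Suc_leI subsetD)
  qed
  have Ef: "\<exists>i<m. e = f i" if "e \<in> E" for e using that unfolding f[symmetric] by blast
  have base: "is_base \<I> ?A" unfolding is_base_def
  proof (intro conjI ballI impI)
    fix S assume S: "S \<in> \<I>" "?A \<subseteq> S"
    show "S = ?A"
    proof (rule ccontr)
      assume "S \<noteq> ?A"
      then obtain e where e: "e \<in> S" "e \<notin> ?A" using S by blast
      then obtain i where i: "i < m" "e = f i" using Ef indep_subset_ground[OF S(1)] by blast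
      have "insert (f i) (greedy \<I> f i) \<subseteq> S" using e i S greedy_mono[of i m \<I> f] by auto
      then show False using rej[OF i(1)] i e indep_mono[OF S(1)] by metis
    qed
  qed (rule greedy_indep)
  show ?thesis
  proof (rule local_opt_base[OF base])
    fix e g assume e: "e \<notin> ?A" and g: "g \<in> ?A" and b: "is_base \<I> (insert e (?A - {g}))"
    have "e \<in> E" using base_subset[OF b] by blast
    then obtain i where i: "i < m" "e = f i" using Ef by blast
    have "\<not> greedy \<I> f i \<subseteq> ?A - {g}"
    proof
      assume "greedy \<I> f i \<subseteq> ?A - {g}"
      then have "insert (f i) (greedy \<I> f i) \<subseteq> insert e (?A - {g})" using i by auto
      then show False using rej[OF i(1)] i e indep_mono[OF base_indep[OF b]] by metis
    qed
    then have "g \<in> greedy \<I> f i" using greedy_mono[of i m \<I> f] i by auto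
    then obtain j where "j < i" "g = f j" using greedy_subset[of \<I> f i] by blast
    then show "u g \<le> u e" using sorted[of j i] i by simp
  qed
qed

definition greedy_base :: "'g com" where
  "greedy_base = for_loop 29 0 (IStore 3 (ICell 20 (val 29)) (INum 1) ;;
     Cond (Indep 3) (IStore 30 (ICell 10 (ICell 20 (val 29))) (IAdd (ICell 30 (ICell 10 (ICell 20 (val 29)))) (INum 1)))
       (IStore 3 (ICell 20 (val 29)) (INum 0)))"

definition class_count :: "(nat \<Rightarrow> nat) \<Rightarrow> nat set \<Rightarrow> nat \<Rightarrow> nat" where
  "class_count cls X c = card {e\<in>X. cls e = c}"

lemma class_count_insert:
  assumes "finite X" "e \<notin> X"
  shows "class_count cls (insert e X) = (class_count cls X)(cls e := Suc (class_count cls X (cls e)))"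
proof
  fix c
  have "{x \<in> insert e X. cls x = c} = (if cls e = c then insert e {x\<in>X. cls x = c} else {x\<in>X. cls x = c})"
    by auto
  then show "class_count cls (insert e X) c = ((class_count cls X)(cls e := Suc (class_count cls X (cls e)))) c"
    using assms by (simp add: class_count_def)
qed

text \<open>One pass over the weight order per class, so each block inherits the order. The cost
  \<open>O(q n)\<close> does not exceed that of a single repair.\<close>

definition class_blocks :: "'g com" where
  "class_blocks = for_loop 34 11
     (for_loop 29 0 (Cond (eq_test (ICell 10 (ICell 20 (val 29))) (val 34))
        (IStore 31 (val 33) (ICell 20 (val 29)) ;; incr 33) Skip) ;;
      IStore 32 (IAdd (val 34) (INum 1)) (val 33))"

definition sorted_block :: "(nat \<Rightarrow> real) \<Rightarrow> (nat \<Rightarrow> nat) \<Rightarrow> nat \<Rightarrow> nat \<Rightarrow> nat set \<Rightarrow> bool" where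
  "sorted_block w f a b X \<longleftrightarrow> a \<le> b \<and> inj_on f {a..<b} \<and> f ` {a..<b} = X \<and> sorted_on w f a b"

lemma sorted_block_card: "sorted_block w f a b X \<Longrightarrow> b - a = card X"
  unfolding sorted_block_def by (metis card_atLeastLessThan card_image)

lemma sorted_block_cong: "sorted_block w f a b X \<Longrightarrow> (\<And>x. a \<le> x \<Longrightarrow> x < b \<Longrightarrow> h x = f x) \<Longrightarrow> sorted_block w h a b X"
  unfolding sorted_block_def sorted_on_def inj_on_def image_def by auto

lemma sorted_block_snoc:
  assumes "sorted_block w f a b X" "e \<notin> X" "\<And>x. x \<in> X \<Longrightarrow> w x \<le> w e"
  shows "sorted_block w (f(b := e)) a (Suc b) (insert e X)"
proof -
  have "f x \<in> X" if "a \<le> x" "x < b" for x using assms(1) that by (auto simp: sorted_block_def)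
  moreover have "{a..<Suc b} = insert b {a..<b}" using assms(1) by (auto simp: sorted_block_def)
  moreover have "e \<notin> f ` {a..<b}" "e \<notin> f ` ({a..<b} - {b})" using assms(1,2) by (auto simp: sorted_block_def)
  ultimately show ?thesis using assms
    by (auto simp: sorted_block_def sorted_on_def less_Suc_eq inj_on_def)
qed

context ram
begin

lemma runs_greedy_base:
  assumes n: "imem s 0 0 = n" and f: "imem s 20 = f" "f ` {..<n} = {..<n}" and cls: "imem s 10 = cls"
    and init: "imem s 3 = (\<lambda>_. 0)" "imem s 30 = (\<lambda>_. 0)" and T: "50 * (n + 1) \<le> T"
  shows "runs greedy_base s T (\<lambda>s'. frame {3, 29, 30} {} {} s s' \<and>
    imem s' 3 = mem_vec (greedy \<I> f n) \<and> imem s' 30 = class_count cls (greedy \<I> f n))"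
  unfolding greedy_base_def
proof (rule runs_for[where m = n and t = 37 and P = "\<lambda>i s'. frame {3, 29, 30} {} {} s s' \<and>
    imem s' 3 = mem_vec (greedy \<I> f i) \<and> imem s' 30 = class_count cls (greedy \<I> f i)"])
  fix i s1 assume i: "i < n" "imem s1 29 0 = i"
    and P: "frame {3, 29, 30} {} {} s s1 \<and> imem s1 3 = mem_vec (greedy \<I> f i) \<and>
      imem s1 30 = class_count cls (greedy \<I> f i)"
  have rows: "imem s1 20 = f" "imem s1 10 = cls" using P f cls by (simp_all add: frame_def)
  have inj: "inj_on f {..<n}" using f(2) by (simp add: eq_card_imp_inj_on)
  have sub: "greedy \<I> f i \<subseteq> f ` {..<i}" by (rule greedy_subset)
  have fi: "f i < n" using f i by auto
  have new: "f i \<notin> greedy \<I> f i"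
  proof
    assume "f i \<in> greedy \<I> f i"
    then obtain j where "j < i" "f j = f i" using sub by auto
    then show False using inj i by (auto simp: inj_on_def)
  qed
  have le: "insert (f i) (greedy \<I> f i) \<subseteq> {..<n}" using sub f i fi by fastforce
  have fin: "finite (greedy \<I> f i)" using sub finite_surj by blast
  have st: "stored_set n (s1\<lparr>imem := store (imem s1) 3 (f i) (Suc 0)\<rparr>) 3 = insert (f i) (greedy \<I> f i)"
    by (rule stored_set_mem_vec[OF _ le]) (use P in \<open>simp add: store_row mem_vec_upd\<close>)
  show "runs (IStore 3 (ICell 20 (val 29)) (INum 1) ;;
     Cond (Indep 3) (IStore 30 (ICell 10 (ICell 20 (val 29))) (IAdd (ICell 30 (ICell 10 (ICell 20 (val 29)))) (INum 1)))
       (IStore 3 (ICell 20 (val 29)) (INum 0))) s1 37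
     (\<lambda>s'. (frame {3, 29, 30} {} {} s s' \<and> imem s' 3 = mem_vec (greedy \<I> f (Suc i)) \<and>
      imem s' 30 = class_count cls (greedy \<I> f (Suc i))) \<and> imem s' 29 0 = i)"
    using P i new by (simp add: rows st store_row mem_vec_upd class_count_insert[OF fin new])
qed (use n init T in \<open>auto simp: store_row frame_def mem_vec_def class_count_def\<close>)

lemma runs_class_blocks:
  assumes n: "imem s 0 0 = n" and f: "imem s 20 = f" "f ` {..<n} = {..<n}" "sorted_on w f 0 n"
    and cls: "imem s 10 = cls" and q: "imem s 11 0 = q"
    and init: "imem s 32 0 = 0" "imem s 33 0 = 0" and T: "70 * (q + 1) * (n + 1) \<le> T"
  shows "runs class_blocks s T (\<lambda>s'. frame {29, 31, 32, 33, 34} {} {} s s' \<and>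
    (\<forall>c<q. sorted_block w (imem s' 31) (imem s' 32 c) (imem s' 32 (Suc c)) {e. e < n \<and> cls e = c}))"
  unfolding class_blocks_def
proof (rule runs_for[where m = q and t = "53 * (n + 1)" and P = "\<lambda>c s'. frame {29, 31, 32, 33, 34} {} {} s s' \<and>
    imem s' 32 c = imem s' 33 0 \<and> (\<forall>d<c. imem s' 32 (Suc d) \<le> imem s' 33 0 \<and>
      sorted_block w (imem s' 31) (imem s' 32 d) (imem s' 32 (Suc d)) {e. e < n \<and> cls e = d})"])
  fix c s1 assume c: "c < q" "imem s1 34 0 = c"
    and P: "frame {29, 31, 32, 33, 34} {} {} s s1 \<and>
    imem s1 32 c = imem s1 33 0 \<and> (\<forall>d<c. imem s1 32 (Suc d) \<le> imem s1 33 0 \<and>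
      sorted_block w (imem s1 31) (imem s1 32 d) (imem s1 32 (Suc d)) {e. e < n \<and> cls e = d})"
  define a where "a = imem s1 33 0"
  have inj: "inj_on f {..<n}" using f(2) by (simp add: eq_card_imp_inj_on)
  let ?I = "\<lambda>i s'. frame {29, 31, 33} {} {} s1 s' \<and>
      sorted_block w (imem s' 31) a (imem s' 33 0) {e \<in> f ` {..<i}. cls e = c} \<and>
      (\<forall>x<a. imem s' 31 x = imem s1 31 x)"
  have A: "runs (for_loop 29 0 (Cond (eq_test (ICell 10 (ICell 20 (val 29))) (val 34))
        (IStore 31 (val 33) (ICell 20 (val 29)) ;; incr 33) Skip)) s1 ((n + 1) * 43) (?I n)"
  proof (rule runs_for[where m = n and t = 30 and P = ?I])
    fix i s2 assume i: "i < n" "imem s2 29 0 = i" and I: "?I i s2"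
    have rows: "imem s2 20 = f" "imem s2 10 = cls" "imem s2 34 0 = c"
      using I P f cls c by (simp_all add: frame_def)
    let ?X = "{e \<in> f ` {..<i}. cls e = c}"
    have new: "f i \<notin> ?X"
    proof
      assume "f i \<in> ?X"
      then obtain x where "x < i" "f i = f x" by auto
      then show False using inj_onD[OF inj, of i x] i by simp
    qed
    have w: "w x \<le> w (f i)" if "x \<in> ?X" for x
      using that f(3) i by (auto simp: sorted_on_def)
    have X: "{e \<in> f ` {..<Suc i}. cls e = c} = (if cls (f i) = c then insert (f i) ?X else ?X)"
      by (auto simp: lessThan_Suc)
    have "sorted_block w ((imem s2 31)(imem s2 33 0 := f i)) a (Suc (imem s2 33 0)) (insert (f i) ?X)"
      using I new w by (intro sorted_block_snoc) auto
    moreover have "a \<le> imem s2 33 0" using I by (simp add: sorted_block_def)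
    ultimately show "runs (Cond (eq_test (ICell 10 (ICell 20 (val 29))) (val 34))
        (IStore 31 (val 33) (ICell 20 (val 29)) ;; incr 33) Skip) s2 30 (\<lambda>s'. ?I (Suc i) s' \<and> imem s' 29 0 = i)"
      using I i unfolding X by (auto simp: rows store_row)
  qed (use n P in \<open>auto simp: store_row frame_def sorted_block_def sorted_on_def a_def\<close>)
  show "runs (for_loop 29 0 (Cond (eq_test (ICell 10 (ICell 20 (val 29))) (val 34))
        (IStore 31 (val 33) (ICell 20 (val 29)) ;; incr 33) Skip) ;;
      IStore 32 (IAdd (val 34) (INum 1)) (val 33)) s1 (53 * (n + 1))
      (\<lambda>s'. (frame {29, 31, 32, 33, 34} {} {} s s' \<and>
    imem s' 32 (Suc c) = imem s' 33 0 \<and> (\<forall>d<Suc c. imem s' 32 (Suc d) \<le> imem s' 33 0 \<and>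
      sorted_block w (imem s' 31) (imem s' 32 d) (imem s' 32 (Suc d)) {e. e < n \<and> cls e = d})) \<and> imem s' 34 0 = c)"
  proof (rule runs_Seq[OF A, where Td = 10])
    fix s2 assume I: "?I n s2"
    have fr: "frame {29, 31, 32, 33, 34} {} {} s s2"
      using I P by (auto simp: frame_def)
    have rows: "imem s2 34 0 = c" "imem s2 32 = imem s1 32"
      using I c by (simp_all add: frame_def)
    have "{e \<in> f ` {..<n}. cls e = c} = {e. e < n \<and> cls e = c}" unfolding f(2) by auto
    then have new: "sorted_block w (imem s2 31) a (imem s2 33 0) {e. e < n \<and> cls e = c}"
      using I by metis
    then have le: "a \<le> imem s2 33 0" by (simp add: sorted_block_def)
    have old: "imem s1 32 (Suc d) \<le> imem s2 33 0 \<and>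
        sorted_block w (imem s2 31) (imem s1 32 d) (imem s1 32 (Suc d)) {e. e < n \<and> cls e = d}" if "d < c" for d
    proof
      have d: "imem s1 32 (Suc d) \<le> a" using P that by (simp add: a_def)
      then show "imem s1 32 (Suc d) \<le> imem s2 33 0" using le by simp
      show "sorted_block w (imem s2 31) (imem s1 32 d) (imem s1 32 (Suc d)) {e. e < n \<and> cls e = d}"
        by (rule sorted_block_cong[where f = "imem s1 31"]) (use P that d I in auto)
    qed
    have "imem s1 32 c = a" using P by (simp add: a_def)
    then show "runs (IStore 32 (IAdd (val 34) (INum 1)) (val 33)) s2 10
      (\<lambda>s'. (frame {29, 31, 32, 33, 34} {} {} s s' \<and>
    imem s' 32 (Suc c) = imem s' 33 0 \<and> (\<forall>d<Suc c. imem s' 32 (Suc d) \<le> imem s' 33 0 \<and>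
      sorted_block w (imem s' 31) (imem s' 32 d) (imem s' 32 (Suc d)) {e. e < n \<and> cls e = d})) \<and> imem s' 34 0 = c)"
      using fr old new by (simp add: store_row rows less_Suc_eq)
  qed simp
qed (use n q init T in \<open>auto simp: store_row frame_def algebra_simps\<close>)

end

section \<open>Cheapest exchanges between two classes\<close>

text \<open>Weight-sorted blocks of the classes are held in array 31. Adding the elements of the target block
  back in increasing order finds the heaviest exchangeable element, and since later candidates of the
  source block are heavier, the pointer into the target block never has to move back.\<close>

definition relax :: "'g com" where
  "relax = (67 :== ICell 31 (ISub (val 64) (INum 1)) ;;
     RStore 3 (INum 0) (RSub (RAdd (RCell 2 (val 60)) (RCell 0 (val 66))) (RCell 0 (val 67))) ;;
     Cond (TAnd (ILe (INum 1) (ICell 54 (val 61))) (RLe (RCell 2 (val 61)) (RCell 3 (INum 0)))) Skip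
       (IStore 54 (val 61) (INum 1) ;; IStore 55 (val 61) (val 60) ;; IStore 56 (val 61) (val 66) ;;
        IStore 57 (val 61) (val 67) ;; RStore 2 (val 61) (RCell 3 (INum 0))))"

definition put_back :: "'g com" where
  "put_back = (IStore 52 (ICell 31 (val 64)) (ICell 50 (ICell 31 (val 64))) ;; incr 64)"

definition scan_elem :: "'g com" where
  "scan_elem = (66 :== ICell 31 (val 62) ;;
     Cond (ILe (ICell 50 (val 66)) (INum 0))
       (IStore 52 (val 66) (INum 1) ;;
        Cond (Indep 52) (While (Indep 52) put_back ;; relax) Skip ;;
        IStore 52 (val 66) (INum 0))
       Skip ;;
     incr 62)"

definition scan_pair :: "'g com" where
  "scan_pair = (64 :== ICell 32 (val 61) ;; 65 :== ICell 32 (IAdd (val 61) (INum 1)) ;;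
     While (less_test (val 64) (val 65)) (IStore 52 (ICell 31 (val 64)) (INum 0) ;; incr 64) ;;
     64 :== ICell 32 (val 61) ;;
     62 :== ICell 32 (val 60) ;; 63 :== ICell 32 (IAdd (val 60) (INum 1)) ;;
     While (less_test (val 62) (val 63)) scan_elem ;;
     While (less_test (val 64) (val 65)) put_back)"

locale class_matroid = ram G n \<I> + finite_matroid "{..<n}" \<I>
  for G :: "'g monoid" and n \<I> +
  fixes w :: "nat \<Rightarrow> real" and cls :: "nat \<Rightarrow> nat" and q :: nat and cl st :: "nat \<Rightarrow> nat"
  assumes cls: "e < n \<Longrightarrow> cls e < q"
    and blocks: "c < q \<Longrightarrow> sorted_block w cl (st c) (st (Suc c)) {e. e < n \<and> cls e = c}"
begin

section \<open>Arcs of the exchange graph and the data recorded for each class\<close>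

definition static :: "'g state \<Rightarrow> bool" where
  "static s \<longleftrightarrow> imem s 0 0 = n \<and> imem s 11 0 = q \<and> rmem s 0 = w \<and> imem s 10 = cls \<and> imem s 31 = cl \<and> imem s 32 = st"

lemma static_frame:
  "static s \<Longrightarrow> frame X Y Z s s' \<Longrightarrow> X \<inter> {0, 10, 11, 31, 32} = {} \<Longrightarrow> 0 \<notin> Z \<Longrightarrow> static s'"
  by (auto simp: static_def frame_def)

text \<open>An arc from class \<open>x\<close> to class \<open>z\<close>: an element of class
  \<open>x\<close> enters and one of class \<open>z\<close> leaves. A path from a deficient class to
  a surplus class therefore repairs one unit.\<close>

definition exch :: "nat set \<Rightarrow> nat \<Rightarrow> nat \<Rightarrow> nat \<Rightarrow> nat \<Rightarrow> bool" where
  "exch B e f x z \<longleftrightarrow> e < n \<and> e \<notin> B \<and> f \<in> B \<and> cls e = x \<and> cls f = z \<and> is_base \<I> (insert e (B - {f}))"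

definition node :: "'g state \<Rightarrow> nat \<Rightarrow> nat \<times> nat \<times> nat \<times> nat \<times> real" where
  "node s y = (imem s 54 y, imem s 55 y, imem s 56 y, imem s 57 y, rmem s 2 y)"

definition link :: "nat set \<Rightarrow> 'g state \<Rightarrow> nat \<Rightarrow> nat \<Rightarrow> bool" where
  "link B s x z \<longleftrightarrow> imem s 54 z \<noteq> 0 \<and> imem s 55 z = x \<and> exch B (imem s 56 z) (imem s 57 z) x z \<and>
     rmem s 2 z = rmem s 2 x + w (imem s 56 z) - w (imem s 57 z)"

text \<open>Strictness is the point of the last inequality: a candidate of equal length leaves the
  older predecessor in place, which later rules out tight shortcuts.\<close>

definition upd :: "nat set \<Rightarrow> 'g state \<Rightarrow> 'g state \<Rightarrow> nat \<Rightarrow> nat \<Rightarrow> bool" where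
  "upd B s s' x z \<longleftrightarrow> (\<forall>y. y \<noteq> z \<longrightarrow> node s' y = node s y) \<and>
     (node s' z = node s z \<or> link B s' x z \<and> (imem s 54 z \<noteq> 0 \<longrightarrow> rmem s' 2 z < rmem s 2 z))"

definition covered :: "'g state \<Rightarrow> nat \<Rightarrow> nat \<Rightarrow> nat \<Rightarrow> nat \<Rightarrow> bool" where
  "covered s x z e f \<longleftrightarrow> imem s 54 z \<noteq> 0 \<and> rmem s 2 z \<le> rmem s 2 x + w e - w f"

lemma state_imem_id [simp]: "s\<lparr>imem := imem s\<rparr> = s"
  by (cases s) simp

lemma store_other [simp]:
  assumes "a \<notin> {54, 55, 56, 57}"
  shows "node (s\<lparr>imem := store m a i v\<rparr>) = node (s\<lparr>imem := m\<rparr>)"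
    "link B (s\<lparr>imem := store m a i v\<rparr>) = link B (s\<lparr>imem := m\<rparr>)"
    "covered (s\<lparr>imem := store m a i v\<rparr>) = covered (s\<lparr>imem := m\<rparr>)"
    "upd B s' (s\<lparr>imem := store m a i v\<rparr>) = upd B s' (s\<lparr>imem := m\<rparr>)"
  using assms by (auto simp: fun_eq_iff node_def link_def covered_def upd_def store_row)

text \<open>The content of array 52 while the pointer into the block of \<open>z\<close> stands at
  \<open>J\<close>, apart from the entering element: \<open>B\<close> without the part of the block
  that has not been put back.\<close>

definition partial :: "nat set \<Rightarrow> nat \<Rightarrow> nat \<Rightarrow> nat set" where
  "partial B z J = B - cl ` {J..<st (Suc z)}"

lemma block_facts:
  assumes "c < q"
  shows "st c \<le> st (Suc c)" "\<And>x. st c \<le> x \<Longrightarrow> x < st (Suc c) \<Longrightarrow> cl x < n \<and> cls (cl x) = c"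
    "\<And>x y. st c \<le> x \<Longrightarrow> x \<le> y \<Longrightarrow> y < st (Suc c) \<Longrightarrow> w (cl x) \<le> w (cl y)"
    "\<And>x y. st c \<le> x \<Longrightarrow> x < st (Suc c) \<Longrightarrow> st c \<le> y \<Longrightarrow> y < st (Suc c) \<Longrightarrow> cl x = cl y \<Longrightarrow> x = y"
    "\<And>e. e < n \<Longrightarrow> cls e = c \<Longrightarrow> \<exists>x. st c \<le> x \<and> x < st (Suc c) \<and> cl x = e"
proof -
  note b = blocks[OF assms, unfolded sorted_block_def]
  have im: "cl ` {st c..<st (Suc c)} = {e. e < n \<and> cls e = c}" using b by blast
  show "st c \<le> st (Suc c)" using b by blast
  show "cl x < n \<and> cls (cl x) = c" if "st c \<le> x" "x < st (Suc c)" for x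
  proof -
    have "cl x \<in> cl ` {st c..<st (Suc c)}" using that by auto
    then show ?thesis unfolding im by blast
  qed
  show "w (cl x) \<le> w (cl y)" if "st c \<le> x" "x \<le> y" "y < st (Suc c)" for x y
    using b that unfolding sorted_on_def by blast
  show "x = y" if "st c \<le> x" "x < st (Suc c)" "st c \<le> y" "y < st (Suc c)" "cl x = cl y" for x y
    using b that inj_onD[of cl "{st c..<st (Suc c)}" x y] by simp
  show "\<exists>x. st c \<le> x \<and> x < st (Suc c) \<and> cl x = e" if "e < n" "cls e = c" for e
  proof -
    have "e \<in> cl ` {st c..<st (Suc c)}" unfolding im using that by blast
    then show ?thesis by auto
  qed
qed

text \<open>By \<open>indep_swap\<close> a completion of \<open>insert e (partial B z J)\<close>
  drops an element outside \<open>partial B z J\<close>, and all of those lie in the suffix of the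
  block. A single oracle query thus tests a whole suffix for an exchange partner of
  \<open>e\<close>.\<close>

lemma partial_indep_iff:
  assumes B: "is_base \<I> B" and e: "e < n" "e \<notin> B" and z: "z < q" and J: "st z \<le> J"
  shows "insert e (partial B z J) \<in> \<I> \<longleftrightarrow> (\<exists>y\<in>{J..<st (Suc z)}. exch B e (cl y) (cls e) z)"
proof
  assume "insert e (partial B z J) \<in> \<I>"
  then obtain f where f: "f \<in> B - partial B z J" "is_base \<I> (insert e (B - {f}))"
    using indep_swap[OF B _ e(2), of "partial B z J"] unfolding partial_def by blast
  then obtain y where y: "y \<in> {J..<st (Suc z)}" "f = cl y" unfolding partial_def by blast
  show "\<exists>y\<in>{J..<st (Suc z)}. exch B e (cl y) (cls e) z"
  proof
    have "cl y < n \<and> cls (cl y) = z" by (rule block_facts(2)[OF z]) (use y J in auto)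
    then show "exch B e (cl y) (cls e) z" using f e y(2) by (simp add: exch_def)
  qed (fact y(1))
next
  assume "\<exists>y\<in>{J..<st (Suc z)}. exch B e (cl y) (cls e) z"
  then obtain y where y: "y \<in> {J..<st (Suc z)}" "exch B e (cl y) (cls e) z" by blast
  then have "insert e (partial B z J) \<subseteq> insert e (B - {cl y})" by (auto simp: partial_def)
  moreover have "insert e (B - {cl y}) \<in> \<I>" using y(2) base_indep unfolding exch_def by blast
  ultimately show "insert e (partial B z J) \<in> \<I>" using indep_mono by metis
qed

lemma partial_Suc:
  assumes "z < q" "st z \<le> J" "J < st (Suc z)" "e \<noteq> cl J"
  shows "(mem_vec (insert e (partial B z J)))(cl J := mem_vec B (cl J)) = mem_vec (insert e (partial B z (Suc J)))"
    "(mem_vec (partial B z J))(cl J := mem_vec B (cl J)) = mem_vec (partial B z (Suc J))"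
proof -
  have i: "{J..<st (Suc z)} = insert J {Suc J..<st (Suc z)}" using assms by auto
  have ni: "cl J \<notin> cl ` {Suc J..<st (Suc z)}"
  proof
    assume "cl J \<in> cl ` {Suc J..<st (Suc z)}"
    then obtain y where y: "y \<in> {Suc J..<st (Suc z)}" "cl J = cl y" by blast
    have "J = y" by (rule block_facts(4)[OF assms(1)]) (use y assms in auto)
    then show False using y by simp
  qed
  have p1: "partial B z J = partial B z (Suc J) - {cl J}"
    unfolding partial_def i image_insert by blast
  have p2: "cl J \<in> partial B z (Suc J) \<longleftrightarrow> cl J \<in> B"
    unfolding partial_def using ni by blast
  show "(mem_vec (insert e (partial B z J)))(cl J := mem_vec B (cl J)) = mem_vec (insert e (partial B z (Suc J)))"
    "(mem_vec (partial B z J))(cl J := mem_vec B (cl J)) = mem_vec (partial B z (Suc J))"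
    unfolding p1 using p2 assms(4) unfolding mem_vec_def fun_eq_iff by simp_all
qed

lemma partial_end: "partial B z (st (Suc z)) = B"
  by (simp add: partial_def)

text \<open>Where the pointer stops for \<open>e\<close>. No partner of \<open>e\<close> remains at
  this position or later, so if the pointer has moved, the position just before holds the heaviest
  partner.\<close>

definition top :: "nat set \<Rightarrow> nat \<Rightarrow> nat \<Rightarrow> nat \<Rightarrow> nat" where
  "top B z e J = (LEAST j. J \<le> j \<and> insert e (partial B z j) \<notin> \<I>)"

lemma top_facts:
  assumes B: "is_base \<I> B" and e: "e < n" "e \<notin> B" and z: "z < q" and J: "J \<le> st (Suc z)"
  shows "J \<le> top B z e J" "top B z e J \<le> st (Suc z)" "insert e (partial B z (top B z e J)) \<notin> \<I>"
    "\<And>j. J \<le> j \<Longrightarrow> j < top B z e J \<Longrightarrow> insert e (partial B z j) \<in> \<I>"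
proof -
  \<comment> \<open>At the end of the block everything has been put back, and \<open>B\<close> with
    one more element exceeds the rank; this bounds the pointer.\<close>
  have "insert e B \<notin> \<I>" using card_le_base[OF B, of "insert e B"] e base_finite[OF B] by auto
  then have ex: "J \<le> st (Suc z) \<and> insert e (partial B z (st (Suc z))) \<notin> \<I>"
    using J by (simp add: partial_end)
  show "J \<le> top B z e J" "insert e (partial B z (top B z e J)) \<notin> \<I>"
    unfolding top_def using LeastI[of "\<lambda>j. J \<le> j \<and> insert e (partial B z j) \<notin> \<I>" "st (Suc z)"] ex by blast+
  show "top B z e J \<le> st (Suc z)" unfolding top_def by (rule Least_le) (fact ex)
  show "insert e (partial B z j) \<in> \<I>" if "J \<le> j" "j < top B z e J" for j
    using not_less_Least[of j "\<lambda>j. J \<le> j \<and> insert e (partial B z j) \<notin> \<I>"] that unfolding top_def by blast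
qed

lemma nodeD: "node s' y = node s y \<Longrightarrow> imem s' 54 y = imem s 54 y" "node s' y = node s y \<Longrightarrow> imem s' 55 y = imem s 55 y"
    "node s' y = node s y \<Longrightarrow> imem s' 56 y = imem s 56 y" "node s' y = node s y \<Longrightarrow> imem s' 57 y = imem s 57 y"
    "node s' y = node s y \<Longrightarrow> rmem s' 2 y = rmem s 2 y"
  by (simp_all add: node_def)

section \<open>The two-pointer scan of a pair of classes\<close>

lemma runs_advance:
  assumes B: "is_base \<I> B" and z: "z < q" and static: "static s" and row: "imem s 50 = mem_vec B"
    and e: "e < n" "e \<notin> B" "cls e \<noteq> z" and J: "imem s 64 0 = J" "st z \<le> J" "J \<le> st (Suc z)"
    and Q: "imem s 52 = mem_vec (insert e (partial B z J))" and T: "20 * (top B z e J - J) + 2 \<le> T"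
  shows "runs (While (Indep 52) put_back) s T (\<lambda>s'. frame {52, 64} {} {} s s' \<and>
     imem s' 64 0 = top B z e J \<and> imem s' 52 = mem_vec (insert e (partial B z (top B z e J))))"
proof -
  note top = top_facts[OF B e(1,2) z J(3)]
  define P where "P s' \<longleftrightarrow> frame {52, 64} {} {} s s' \<and> J \<le> imem s' 64 0 \<and> imem s' 64 0 \<le> top B z e J \<and>
      imem s' 52 = mem_vec (insert e (partial B z (imem s' 64 0)))" for s'
  have stored: "stored_set n s' 52 = insert e (partial B z (imem s' 64 0))" if "P s'" for s'
    by (rule stored_set_mem_vec) (use that e(1) base_subset[OF B] in \<open>auto simp: P_def partial_def\<close>)
  show ?thesis
  proof (rule runs_While[where P = P and \<phi> = "\<lambda>s'. 20 * (top B z e J - imem s' 64 0)"])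
    show "P s" using J Q top by (simp add: P_def)
    show "20 * (top B z e J - imem s 64 0) + 1 + tcost (Indep 52) \<le> T" using J T by simp
  next
    fix s1 assume P: "P s1" and b: "tval G n \<I> s1 (Indep 52)"
    define j where "j = imem s1 64 0"
    have "insert e (partial B z j) \<in> \<I>" using b stored[OF P] by (simp add: j_def)
    then have j: "j < top B z e J" using P top(3) by (metis P_def j_def le_neq_implies_less)
    have fr: "frame {52, 64} {} {} s s1" using P by (simp add: P_def)
    have rows: "imem s1 31 = cl" "imem s1 50 = mem_vec B"
      using static row by (simp_all add: frameD[OF fr] static_def)
    have j2: "st z \<le> j" "j < st (Suc z)" "J \<le> j" using P j top J by (auto simp: P_def j_def)
    have "e \<noteq> cl j" using block_facts(2)[OF z j2(1,2)] e by auto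
    note upd = partial_Suc(1)[OF z j2(1,2) this]
    have Q1: "imem s1 52 = mem_vec (insert e (partial B z j))" using P by (simp add: P_def j_def)
    have "runs put_back s1 15 (\<lambda>s'. P s' \<and> 20 * (top B z e J - imem s' 64 0) + 15 + 1 + tcost (Indep 52)
        \<le> 20 * (top B z e J - j))"
      using fr j j2 by (simp add: put_back_def rows store_row P_def j_def[symmetric] Q1 upd)
    then show "\<exists>t. runs put_back s1 t (\<lambda>s'. P s' \<and> 20 * (top B z e J - imem s' 64 0) + t + 1 + tcost (Indep 52)
        \<le> 20 * (top B z e J - imem s1 64 0))" unfolding j_def by blast
  next
    fix s1 assume P: "P s1" and b: "\<not> tval G n \<I> s1 (Indep 52)"
    then have "insert e (partial B z (imem s1 64 0)) \<notin> \<I>" using stored[OF P] by simp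
    then have "imem s1 64 0 = top B z e J" using P top(4)[of "imem s1 64 0"]
      by (metis P_def le_neq_implies_less)
    then show "frame {52, 64} {} {} s s1 \<and> imem s1 64 0 = top B z e J \<and>
        imem s1 52 = mem_vec (insert e (partial B z (top B z e J)))"
      using P by (simp add: P_def)
  qed
qed

lemma upd_trans:
  assumes "upd B s s1 x z" "upd B s1 s2 x z" "x \<noteq> z"
  shows "upd B s s2 x z"
proof -
  have x: "rmem s2 2 x = rmem s1 2 x" using assms nodeD(5)[of s2 x s1] by (simp add: upd_def)
  have "link B s2 x z" if "node s2 z = node s1 z" "link B s1 x z"
    using that(2) unfolding link_def nodeD[OF that(1)] x .
  moreover have "rmem s2 2 z = rmem s1 2 z" if "node s2 z = node s1 z" using that by (rule nodeD)
  moreover have "imem s1 54 z = imem s 54 z" "rmem s1 2 z = rmem s 2 z" if "node s1 z = node s z"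
    using that by (rule nodeD)+
  moreover have "imem s1 54 z \<noteq> 0" if "link B s1 x z" using that by (simp add: link_def)
  ultimately show ?thesis using assms unfolding upd_def by (smt (verit))
qed

lemma covered_mono:
  assumes "covered s x z e f" "upd B s s' x z" "x \<noteq> z"
  shows "covered s' x z e f"
proof -
  have x: "rmem s' 2 x = rmem s 2 x" using assms nodeD(5)[of s' x s] by (simp add: upd_def)
  show ?thesis
  proof (cases "node s' z = node s z")
    case True
    then show ?thesis using assms(1) x nodeD(1,5)[OF True] by (simp add: covered_def)
  next
    case False
    then have "link B s' x z" "rmem s' 2 z < rmem s 2 z"
      using assms by (auto simp: upd_def covered_def)
    then show ?thesis using assms(1) x by (auto simp: covered_def link_def)
  qed
qed

lemma runs_relax:
  assumes xz: "x \<noteq> z" and static: "static s" and v: "imem s 60 0 = x" "imem s 61 0 = z" "imem s 66 0 = e"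
    and f: "cl (imem s 64 0 - 1) = f" and exch: "exch B e f x z" and T: "70 \<le> T"
  shows "runs relax s T (\<lambda>s'. frame {54, 55, 56, 57, 67} {} {2, 3} s s' \<and> upd B s s' x z \<and> covered s' x z e f)"
proof -
  have rows: "imem s 31 = cl" "rmem s 0 = w" using static by (simp_all add: static_def)
  show ?thesis
  proof (cases "imem s 54 z \<noteq> 0 \<and> rmem s 2 z \<le> rmem s 2 x + w e - w f")
    case True
    then show ?thesis using T f
      by (auto simp: relax_def store_row rows v upd_def covered_def node_def)
  next
    case False
    have "Suc 0 \<le> imem s 54 z \<longleftrightarrow> imem s 54 z \<noteq> 0" by auto
    then show ?thesis using T f False exch xz
      by (auto simp: relax_def store_row rows v upd_def covered_def node_def link_def)
  qed
qed

text \<open>The last clause carries the amortisation. A lighter source element was already relaxed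
  with a partner at least as heavy as everything below \<open>J\<close>, so all later source
  elements are covered against those positions, whether or not they form exchanges.\<close>

definition scan_inv :: "nat set \<Rightarrow> nat \<Rightarrow> nat \<Rightarrow> 'g state \<Rightarrow> 'g state \<Rightarrow> nat \<Rightarrow> nat \<Rightarrow> bool" where
  "scan_inv B x z s s' i J \<longleftrightarrow> frame {52, 54, 55, 56, 57, 62, 63, 64, 65, 66, 67} {} {2, 3} s s' \<and> upd B s s' x z \<and>
     imem s' 52 = mem_vec (partial B z J) \<and> st z \<le> J \<and> J \<le> st (Suc z) \<and>
     imem s' 62 0 = i \<and> imem s' 64 0 = J \<and> imem s' 63 0 = st (Suc x) \<and> imem s' 65 0 = st (Suc z) \<and>
     (\<forall>i' f. st x \<le> i' \<longrightarrow> i' < i \<longrightarrow> exch B (cl i') f x z \<longrightarrow> covered s' x z (cl i') f) \<and>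
     (\<forall>i' y. i \<le> i' \<longrightarrow> i' < st (Suc x) \<longrightarrow> st z \<le> y \<longrightarrow> y < J \<longrightarrow> covered s' x z (cl i') (cl y))"

lemma runs_scan_elem:
  assumes B: "is_base \<I> B" and x: "x < q" and z: "z < q" and xz: "x \<noteq> z" and static: "static s"
    and row: "imem s 50 = mem_vec B" and v: "imem s 60 0 = x" "imem s 61 0 = z"
    and inv: "scan_inv B x z s s1 i J" and i: "st x \<le> i" "i < st (Suc x)"
  obtains J' where "J \<le> J'" "J' \<le> st (Suc z)"
    "runs scan_elem s1 (101 + 20 * (J' - J)) (\<lambda>s'. scan_inv B x z s s' (Suc i) J')"
proof -
  define e where "e = cl i"
  let ?F = "{52, 54, 55, 56, 57, 62, 63, 64, 65, 66, 67} :: nat set"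
  have fr: "frame ?F {} {2, 3} s s1" and up: "upd B s s1 x z" and Q: "imem s1 52 = mem_vec (partial B z J)"
    and J: "st z \<le> J" "J \<le> st (Suc z)" and v1: "imem s1 62 0 = i" "imem s1 64 0 = J"
      "imem s1 63 0 = st (Suc x)" "imem s1 65 0 = st (Suc z)"
    and past: "\<And>i' f. st x \<le> i' \<Longrightarrow> i' < i \<Longrightarrow> exch B (cl i') f x z \<Longrightarrow> covered s1 x z (cl i') f"
    and ahead: "\<And>i' y. i \<le> i' \<Longrightarrow> i' < st (Suc x) \<Longrightarrow> st z \<le> y \<Longrightarrow> y < J \<Longrightarrow> covered s1 x z (cl i') (cl y)"
    using inv unfolding scan_inv_def by blast+
  have static1: "static s1" by (rule static_frame[OF static fr]) auto
  have rows: "imem s1 31 = cl" "imem s1 50 = mem_vec B" "imem s1 60 0 = x" "imem s1 61 0 = z"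
    using static1 row v by (simp_all add: frameD[OF fr] static_def)
  have e: "e < n" "cls e = x" using block_facts(2)[OF x i] by (simp_all add: e_def)
  have ez: "cls e \<noteq> z" using e xz by simp
  show ?thesis
  proof (cases "e \<in> B")
    case True
    have "\<not> exch B e f x z" for f using True by (simp add: exch_def)
    then have "runs scan_elem s1 101 (\<lambda>s'. scan_inv B x z s s' (Suc i) J)"
      using True fr up Q J past ahead
      by (auto simp: scan_elem_def store_row rows v1 e_def[symmetric] scan_inv_def less_Suc_eq)
    then show ?thesis using that[of J] J by simp
  next
    case False
    note top = top_facts[OF B e(1) False z J(2)]
    define J' where "J' = top B z e J"
    let ?s2 = "s1\<lparr>imem := store (store (imem s1) 66 0 e) 52 e 1\<rparr>"
    have Q2: "imem ?s2 52 = mem_vec (insert e (partial B z J))" by (simp add: store_row Q mem_vec_upd)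
    have indep: "stored_set n ?s2 52 = insert e (partial B z J)"
      by (rule stored_set_mem_vec[OF Q2]) (use e base_subset[OF B] in \<open>auto simp: partial_def\<close>)
    have fr2: "frame ?F {} {2, 3} s ?s2" using fr by simp
    have static2: "static ?s2" by (rule static_frame[OF static fr2]) auto
    have pe: "partial B z j - {e} = partial B z j" for j using False by (auto simp: partial_def)
    let ?Q = "\<lambda>s'. scan_inv B x z s s' (Suc i) J'"
    show ?thesis
    proof (cases "J < J'")
      case False
      then have [simp]: "J' = J" using top(1) by (simp add: J'_def)
      have dep: "insert e (partial B z J) \<notin> \<I>" using top(3) J'_def by simp
      \<comment> \<open>The pointer does not move for this \<open>e\<close>, so all its partners sit
        below \<open>J\<close>, where earlier source elements have provided the bound.\<close>
      have "covered s1 x z e f" if ef: "exch B e f x z" for f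
      proof -
        obtain y where y: "st z \<le> y" "y < st (Suc z)" "cl y = f"
          using block_facts(5)[OF z, of f] ef base_subset[OF B] by (auto simp: exch_def)
        have "y < J"
        proof (rule ccontr)
          assume "\<not> y < J"
          then have "insert e (partial B z J) \<in> \<I>"
            using partial_indep_iff[OF B e(1) \<open>e \<notin> B\<close> z J(1)] y ef e by auto
          then show False using dep by simp
        qed
        then show ?thesis using ahead[of i y] i y by (simp add: e_def)
      qed
      then have "runs scan_elem s1 101 ?Q"
        using \<open>e \<notin> B\<close> fr up Q J past ahead dep indep
        by (auto simp: scan_elem_def store_row rows v1 e_def[symmetric] scan_inv_def less_Suc_eq mem_vec_upd pe)
      then show ?thesis using that[of J] J by simp
    next
      case True
      then have ind: "insert e (partial B z J) \<in> \<I>" using top(4)[of J] by (simp add: J'_def)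
      have J1: "J \<le> J' - 1" "J' - 1 < J'" "J' \<le> st (Suc z)" using True top(2) by (auto simp: J'_def)
      define f where "f = cl (J' - 1)"
      \<comment> \<open>The set is still independent with the pointer at \<open>J' - 1\<close> but
        no longer at \<open>J'\<close>, so position \<open>J' - 1\<close> itself holds a
        partner.\<close>
      have ef: "exch B e f x z"
      proof -
        have "insert e (partial B z (J' - 1)) \<in> \<I>" using top(4)[of "J' - 1"] J1 by (simp add: J'_def)
        moreover have "st z \<le> J' - 1" "st z \<le> J'" using J J1 by simp_all
        ultimately obtain y where y: "y \<in> {J' - 1..<st (Suc z)}" "exch B e (cl y) (cls e) z"
          using partial_indep_iff[OF B e(1) False z] by blast
        have "\<not> J' \<le> y"
          using partial_indep_iff[OF B e(1) False z \<open>st z \<le> J'\<close>] top(3) y unfolding J'_def by auto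
        then have "y = J' - 1" using y(1) J1(2) unfolding atLeastLessThan_iff by linarith
        then show ?thesis using y(2) e(2) by (simp add: f_def)
      qed
      have adv: "runs (While (Indep 52) put_back) ?s2 (20 * (J' - J) + 2) (\<lambda>s'. frame {52, 64} {} {} ?s2 s' \<and>
          imem s' 64 0 = J' \<and> imem s' 52 = mem_vec (insert e (partial B z J')))"
        unfolding J'_def by (rule runs_advance[OF B z static2 _ e(1) False ez _ J Q2 order_refl])
          (simp_all add: store_row rows v1)
      have rest: "runs (relax ;; IStore 52 (val 66) (INum 0) ;; incr 62) s3 82 ?Q"
        if s3: "frame {52, 64} {} {} ?s2 s3 \<and> imem s3 64 0 = J' \<and> imem s3 52 = mem_vec (insert e (partial B z J'))" for s3
      proof (rule runs_Seq[where Tc = 70 and Td = 12])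
        note fr3 = s3[THEN conjunct1]
        have static3: "static s3" by (rule static_frame[OF static2 fr3]) auto
        have rows3: "imem s3 60 0 = x" "imem s3 61 0 = z" "imem s3 66 0 = e" "imem s3 62 0 = i"
          "imem s3 63 0 = st (Suc x)" "imem s3 65 0 = st (Suc z)"
          by (simp_all add: frameD[OF fr3] store_row rows v1)
        show "runs relax s3 70 (\<lambda>s'. frame {54, 55, 56, 57, 67} {} {2, 3} s3 s' \<and> upd B s3 s' x z \<and> covered s' x z e f)"
          by (rule runs_relax[OF xz static3 rows3(1-3) _ ef order_refl]) (use s3 in \<open>simp add: f_def\<close>)
        fix s4 assume s4: "frame {54, 55, 56, 57, 67} {} {2, 3} s3 s4 \<and> upd B s3 s4 x z \<and> covered s4 x z e f"
        note fr4 = s4[THEN conjunct1]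
        have "frame ?F {} {2, 3} ?s2 s3" by (rule frame_mono[OF fr3]) auto
        moreover have "frame ?F {} {2, 3} s3 s4" by (rule frame_mono[OF fr4]) auto
        ultimately have fr': "frame ?F {} {2, 3} s s4" using fr2 by (blast intro: frame_trans)
        have node3: "node s3 y = node s1 y" for y
          by (simp add: node_def frameD[OF fr3] store_row)
        have up3: "upd B s s3 x z" using up unfolding upd_def node3 link_def nodeD[OF node3] .
        have up4: "upd B s s4 x z" using upd_trans[OF up3 _ xz] s4 by blast
        have up14: "upd B s1 s4 x z" using s4 unfolding upd_def node3 link_def nodeD[OF node3] by blast
        have rows4: "imem s4 64 0 = J'" "imem s4 52 = mem_vec (insert e (partial B z J'))" "imem s4 66 0 = e"
            "imem s4 62 0 = i" "imem s4 63 0 = st (Suc x)" "imem s4 65 0 = st (Suc z)"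
          using s3 by (simp_all add: frameD[OF fr4] rows3)
        have upto: "covered s4 x z (cl i') (cl y)"
          if "i \<le> i'" "i' < st (Suc x)" "st z \<le> y" "y < J'" for i' y
        proof -
          have "w (cl y) \<le> w f" unfolding f_def
            by (rule block_facts(3)[OF z]) (use that J1 in auto)
          moreover have "w e \<le> w (cl i')" unfolding e_def
            by (rule block_facts(3)[OF x]) (use that i in auto)
          ultimately show ?thesis using s4 by (auto simp: covered_def)
        qed
        have this_e: "covered s4 x z e f'" if ef': "exch B e f' x z" for f'
        proof -
          obtain y where y: "st z \<le> y" "y < st (Suc z)" "cl y = f'"
            using block_facts(5)[OF z, of f'] ef' base_subset[OF B] by (auto simp: exch_def)
          have "y < J'"
          proof (rule ccontr)
            assume "\<not> y < J'"
            moreover have "st z \<le> J'" using J J1 by simp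
            ultimately have "insert e (partial B z J') \<in> \<I>"
              using partial_indep_iff[OF B e(1) False z, of J'] y ef' e by auto
            then show False using top(3) by (simp add: J'_def)
          qed
          then show ?thesis using upto[of i y] i y by (simp add: e_def)
        qed
        have past4: "covered s4 x z (cl i') f'"
          if "st x \<le> i'" "i' < Suc i" "exch B (cl i') f' x z" for i' f'
        proof (cases "i' = i")
          case True
          then show ?thesis using this_e that by (simp add: e_def)
        next
          case False
          then show ?thesis using covered_mono[OF past up14 xz] that by simp
        qed
        show "runs (IStore 52 (val 66) (INum 0) ;; incr 62) s4 12 ?Q"
          using fr' up4 J J1 past4 upto
          by (simp add: store_row rows4 scan_inv_def mem_vec_upd pe)
      qed simp
      have "runs scan_elem s1 (101 + 20 * (J' - J)) ?Q"
        using runs_Seq[OF adv rest, of "84 + 20 * (J' - J)"] ind indep False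
        by (simp add: scan_elem_def store_row rows v1 e_def[symmetric] runs_mono)
      then show ?thesis using that[of J'] J1 True by simp
    qed
  qed
qed

text \<open>Both pointers only move forward, so the cost is linear in the two block lengths and not
  in their product. Summed over all pairs of classes this is what makes a repair cost
  \<open>O(q n)\<close>.\<close>

lemma runs_scan_pair:
  assumes B: "is_base \<I> B" and x: "x < q" and z: "z < q" and xz: "x \<noteq> z" and static: "static s"
    and row: "imem s 50 = mem_vec B" "imem s 52 = mem_vec B" and v: "imem s 60 0 = x" "imem s 61 0 = z"
    and T: "110 * (st (Suc x) - st x) + 80 * (st (Suc z) - st z) + 100 \<le> T"
  shows "runs scan_pair s T (\<lambda>s'. frame {52, 54, 55, 56, 57, 62, 63, 64, 65, 66, 67} {} {2, 3} s s' \<and>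
     imem s' 52 = mem_vec B \<and> upd B s s' x z \<and> (\<forall>e f. exch B e f x z \<longrightarrow> covered s' x z e f))"
proof -
  let ?F = "{52, 54, 55, 56, 57, 62, 63, 64, 65, 66, 67} :: nat set"
  let ?b = "st (Suc z)" and ?lx = "st (Suc x) - st x" and ?lz = "st (Suc z) - st z"
  let ?Q = "\<lambda>s'. frame ?F {} {2, 3} s s' \<and>
     imem s' 52 = mem_vec B \<and> upd B s s' x z \<and> (\<forall>e f. exch B e f x z \<longrightarrow> covered s' x z e f)"
  note bz = block_facts[OF z] and bx = block_facts[OF x]
  have rows: "imem s 31 = cl" "imem s 32 = st" using static by (simp_all add: static_def)
  let ?s = "s\<lparr>imem := store (store (imem s) 64 0 (st z)) 65 0 ?b\<rparr>"
  have clear: "runs (While (less_test (val 64) (val 65)) (IStore 52 (ICell 31 (val 64)) (INum 0) ;; incr 64))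
      ?s (20 * ?lz + 10) (\<lambda>s'. frame {52, 64, 65} {} {} s s' \<and> imem s' 65 0 = ?b \<and>
        imem s' 52 = mem_vec (partial B z (st z)))"
  proof (rule runs_While[where \<phi> = "\<lambda>s'. 20 * (?b - imem s' 64 0)" and
      P = "\<lambda>s'. frame {52, 64, 65} {} {} s s' \<and> imem s' 65 0 = ?b \<and> st z \<le> imem s' 64 0 \<and> imem s' 64 0 \<le> ?b \<and>
        imem s' 52 = mem_vec (B - cl ` {st z..<imem s' 64 0})"])
    fix s1 assume P: "frame {52, 64, 65} {} {} s s1 \<and> imem s1 65 0 = ?b \<and> st z \<le> imem s1 64 0 \<and> imem s1 64 0 \<le> ?b \<and>
        imem s1 52 = mem_vec (B - cl ` {st z..<imem s1 64 0})" and b: "tval G n \<I> s1 (less_test (val 64) (val 65))"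
    define j where "j = imem s1 64 0"
    have j: "st z \<le> j" "j < ?b" using P b by (simp_all add: j_def)
    have fr: "frame {52, 64, 65} {} {} s s1" using P by simp
    have r: "imem s1 31 = cl" using rows by (simp add: frameD[OF fr])
    have "B - cl ` {st z..<j} - {cl j} = B - cl ` {st z..<Suc j}"
      unfolding atLeastLessThanSuc using j by auto
    then have "runs (IStore 52 (ICell 31 (val 64)) (INum 0) ;; incr 64) s1 12 (\<lambda>s'. (frame {52, 64, 65} {} {} s s' \<and>
        imem s' 65 0 = ?b \<and> st z \<le> imem s' 64 0 \<and> imem s' 64 0 \<le> ?b \<and>
        imem s' 52 = mem_vec (B - cl ` {st z..<imem s' 64 0})) \<and>
        20 * (?b - imem s' 64 0) + 12 + 1 + tcost (less_test (val 64) (val 65)) \<le> 20 * (?b - j))"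
      using P j by (simp add: store_row r j_def[symmetric] mem_vec_upd)
    then show "\<exists>t. runs (IStore 52 (ICell 31 (val 64)) (INum 0) ;; incr 64) s1 t (\<lambda>s'. (frame {52, 64, 65} {} {} s s' \<and>
        imem s' 65 0 = ?b \<and> st z \<le> imem s' 64 0 \<and> imem s' 64 0 \<le> ?b \<and>
        imem s' 52 = mem_vec (B - cl ` {st z..<imem s' 64 0})) \<and>
        20 * (?b - imem s' 64 0) + t + 1 + tcost (less_test (val 64) (val 65)) \<le> 20 * (?b - imem s1 64 0))"
      unfolding j_def by blast
  qed (use bz(1) row in \<open>auto simp: store_row partial_def intro: le_antisym\<close>)
  have main: "runs (While (less_test (val 62) (val 63)) scan_elem) s2 (110 * ?lx + 20 * ?lz + 10)
      (\<lambda>s'. \<exists>J. scan_inv B x z s s' (st (Suc x)) J)"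
    if s2: "scan_inv B x z s s2 (st x) (st z)" for s2
  proof (rule runs_While[where \<phi> = "\<lambda>s'. 110 * (st (Suc x) - imem s' 62 0) + 20 * (?b - imem s' 64 0)" and
      P = "\<lambda>s'. scan_inv B x z s s' (imem s' 62 0) (imem s' 64 0) \<and> st x \<le> imem s' 62 0 \<and> imem s' 62 0 \<le> st (Suc x)"])
    have "imem s2 62 0 = st x" "imem s2 64 0 = st z" using s2 by (simp_all add: scan_inv_def)
    then show "scan_inv B x z s s2 (imem s2 62 0) (imem s2 64 0) \<and> st x \<le> imem s2 62 0 \<and> imem s2 62 0 \<le> st (Suc x)"
      "110 * (st (Suc x) - imem s2 62 0) + 20 * (?b - imem s2 64 0) + 1 + tcost (less_test (val 62) (val 63))
        \<le> 110 * ?lx + 20 * ?lz + 10"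
      using s2 bx(1) by simp_all
  next
    fix s1 assume P: "scan_inv B x z s s1 (imem s1 62 0) (imem s1 64 0) \<and> st x \<le> imem s1 62 0 \<and> imem s1 62 0 \<le> st (Suc x)"
      and b: "tval G n \<I> s1 (less_test (val 62) (val 63))"
    define i J where "i = imem s1 62 0" and "J = imem s1 64 0"
    have inv: "scan_inv B x z s s1 i J" using P by (simp add: i_def J_def)
    have "imem s1 63 0 = st (Suc x)" using inv by (simp add: scan_inv_def)
    then have i: "st x \<le> i" "i < st (Suc x)" using P b by (simp_all add: i_def)
    obtain J' where J': "J \<le> J'" "J' \<le> ?b"
      and r: "runs scan_elem s1 (101 + 20 * (J' - J)) (\<lambda>s'. scan_inv B x z s s' (Suc i) J')"
      by (rule runs_scan_elem[OF B x z xz static row(1) v inv i])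
    have "runs scan_elem s1 (101 + 20 * (J' - J)) (\<lambda>s'. (scan_inv B x z s s' (imem s' 62 0) (imem s' 64 0) \<and>
        st x \<le> imem s' 62 0 \<and> imem s' 62 0 \<le> st (Suc x)) \<and>
        110 * (st (Suc x) - imem s' 62 0) + 20 * (?b - imem s' 64 0) + (101 + 20 * (J' - J)) + 1 +
        tcost (less_test (val 62) (val 63)) \<le> 110 * (st (Suc x) - i) + 20 * (?b - J))"
    proof (rule runs_mono[OF r order_refl])
      fix s' assume s': "scan_inv B x z s s' (Suc i) J'"
      then have [simp]: "imem s' 62 0 = Suc i" "imem s' 64 0 = J'" by (simp_all add: scan_inv_def)
      have "110 * (st (Suc x) - Suc i) + 110 = 110 * (st (Suc x) - i)" using i by simp
      moreover have "20 * (?b - J') + 20 * (J' - J) = 20 * (?b - J)" using J' by simp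
      ultimately show "(scan_inv B x z s s' (imem s' 62 0) (imem s' 64 0) \<and>
        st x \<le> imem s' 62 0 \<and> imem s' 62 0 \<le> st (Suc x)) \<and>
        110 * (st (Suc x) - imem s' 62 0) + 20 * (?b - imem s' 64 0) + (101 + 20 * (J' - J)) + 1 +
        tcost (less_test (val 62) (val 63)) \<le> 110 * (st (Suc x) - i) + 20 * (?b - J)"
        using s' i by simp
    qed
    then show "\<exists>t. runs scan_elem s1 t (\<lambda>s'. (scan_inv B x z s s' (imem s' 62 0) (imem s' 64 0) \<and>
        st x \<le> imem s' 62 0 \<and> imem s' 62 0 \<le> st (Suc x)) \<and>
        110 * (st (Suc x) - imem s' 62 0) + 20 * (?b - imem s' 64 0) + t + 1 +
        tcost (less_test (val 62) (val 63)) \<le> 110 * (st (Suc x) - imem s1 62 0) + 20 * (?b - imem s1 64 0))"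
      unfolding i_def J_def by blast
  next
    fix s1 assume P: "scan_inv B x z s s1 (imem s1 62 0) (imem s1 64 0) \<and> st x \<le> imem s1 62 0 \<and> imem s1 62 0 \<le> st (Suc x)"
      and b: "\<not> tval G n \<I> s1 (less_test (val 62) (val 63))"
    have "imem s1 63 0 = st (Suc x)" using P by (simp add: scan_inv_def)
    then have "imem s1 62 0 = st (Suc x)" using P b by simp
    then show "\<exists>J. scan_inv B x z s s1 (st (Suc x)) J" using P by metis
  qed
  have restore: "runs (While (less_test (val 64) (val 65)) put_back) s3 (30 * ?lz + 10) ?Q"
    if s3: "\<exists>J. scan_inv B x z s s3 (st (Suc x)) J" for s3
  proof -
    obtain J where J: "scan_inv B x z s s3 (st (Suc x)) J" using s3 by blast
    have cov: "covered s3 x z e f" if ef: "exch B e f x z" for e f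
    proof -
      obtain i where "st x \<le> i" "i < st (Suc x)" "cl i = e"
        using bx(5)[of e] ef by (auto simp: exch_def)
      then show ?thesis using J ef unfolding scan_inv_def by metis
    qed
    let ?P = "\<lambda>s'. frame ?F {} {2, 3} s s' \<and> upd B s s' x z \<and> (\<forall>e f. exch B e f x z \<longrightarrow> covered s' x z e f) \<and>
        st z \<le> imem s' 64 0 \<and> imem s' 64 0 \<le> ?b \<and> imem s' 65 0 = ?b \<and> imem s' 52 = mem_vec (partial B z (imem s' 64 0))"
    show ?thesis
    proof (rule runs_While[where P = ?P and \<phi> = "\<lambda>s'. 30 * (?b - imem s' 64 0)"])
      show "?P s3" using J cov by (simp add: scan_inv_def)
      show "30 * (?b - imem s3 64 0) + 1 + tcost (less_test (val 64) (val 65)) \<le> 30 * ?lz + 10"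
        using J diff_le_mono2[of "st z" J ?b] by (auto simp: scan_inv_def)
    next
      fix s1 assume P: "?P s1" and b: "tval G n \<I> s1 (less_test (val 64) (val 65))"
      define j where "j = imem s1 64 0"
      have j: "st z \<le> j" "j < ?b" using P b by (simp_all add: j_def)
      have fr: "frame ?F {} {2, 3} s s1" using P by simp
      have r: "imem s1 31 = cl" "imem s1 50 = mem_vec B" using rows row by (simp_all add: frameD[OF fr])
      have Q1: "imem s1 52 = mem_vec (partial B z j)" using P by (simp add: j_def)
      have "runs put_back s1 15 (\<lambda>s'. ?P s' \<and>
          30 * (?b - imem s' 64 0) + 15 + 1 + tcost (less_test (val 64) (val 65)) \<le> 30 * (?b - j))"
        using P j partial_Suc(2)[OF z j, of "Suc (cl j)"] by (simp add: put_back_def store_row r Q1 j_def[symmetric])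
      then show "\<exists>t. runs put_back s1 t (\<lambda>s'. ?P s' \<and>
          30 * (?b - imem s' 64 0) + t + 1 + tcost (less_test (val 64) (val 65)) \<le> 30 * (?b - imem s1 64 0))"
        unfolding j_def by blast
    next
      fix s1 assume P: "?P s1" and b: "\<not> tval G n \<I> s1 (less_test (val 64) (val 65))"
      then have "imem s1 64 0 = ?b" by simp
      then show "?Q s1" using P by (simp add: partial_end)
    qed
  qed
  have mid: "runs (64 :== ICell 32 (val 61) ;; 62 :== ICell 32 (val 60) ;; 63 :== ICell 32 (IAdd (val 60) (INum 1)) ;;
     While (less_test (val 62) (val 63)) scan_elem ;; While (less_test (val 64) (val 65)) put_back) s1
     (110 * ?lx + 50 * ?lz + 50) ?Q"
    if s1: "frame {52, 64, 65} {} {} s s1 \<and> imem s1 65 0 = ?b \<and> imem s1 52 = mem_vec (partial B z (st z))" for s1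
  proof -
    note fr = s1[THEN conjunct1]
    have r: "imem s1 32 = st" "imem s1 60 0 = x" "imem s1 61 0 = z"
      using rows v by (simp_all add: frameD[OF fr])
    let ?s2 = "s1\<lparr>imem := store (store (store (imem s1) 64 0 (st z)) 62 0 (st x)) 63 0 (st (Suc x))\<rparr>"
    have "node s1 = node s" by (simp add: node_def fun_eq_iff frameD[OF fr])
    then have "upd B s s1 x z" by (simp add: upd_def)
    moreover have "frame ?F {} {2, 3} s s1" by (rule frame_mono[OF fr]) auto
    ultimately have "scan_inv B x z s ?s2 (st x) (st z)"
      using s1 bz(1) by (simp add: scan_inv_def store_row)
    from runs_Seq[OF main[OF this] restore, of "110 * ?lx + 50 * ?lz + 20"]
    have *: "runs (While (less_test (val 62) (val 63)) scan_elem ;; While (less_test (val 64) (val 65)) put_back) ?s2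
      (110 * ?lx + 50 * ?lz + 20) ?Q" by simp
    show ?thesis using * by (simp add: store_row r) (rule runs_mono, assumption, simp_all)
  qed
  have "runs (While (less_test (val 64) (val 65)) (IStore 52 (ICell 31 (val 64)) (INum 0) ;; incr 64) ;;
     64 :== ICell 32 (val 61) ;; 62 :== ICell 32 (val 60) ;; 63 :== ICell 32 (IAdd (val 60) (INum 1)) ;;
     While (less_test (val 62) (val 63)) scan_elem ;; While (less_test (val 64) (val 65)) put_back) ?s
     (110 * ?lx + 70 * ?lz + 60) ?Q"
    by (rule runs_Seq[OF clear mid]) simp_all
  then have "runs (While (less_test (val 64) (val 65)) (IStore 52 (ICell 31 (val 64)) (INum 0) ;; incr 64) ;;
     64 :== ICell 32 (val 61) ;; 62 :== ICell 32 (val 60) ;; 63 :== ICell 32 (IAdd (val 60) (INum 1)) ;;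
     While (less_test (val 62) (val 63)) scan_elem ;; While (less_test (val 64) (val 65)) put_back) ?s
     (T - 12) ?Q"
    by (rule runs_mono) (use T in simp_all)
  then show ?thesis using T unfolding scan_pair_def by (simp add: store_row rows v)
qed

end

section \<open>Shortest exchange paths\<close>

text \<open>The Dijkstra key of a class is its distance minus its potential. The distances are
  stored unreduced, which lets them serve directly as the new potentials of the visited
  classes.\<close>

definition select_class :: "'g com" where
  "select_class = (74 :== INum 0 ;; for_loop 71 11
     (Cond (TAnd (ILe (ICell 53 (val 71)) (INum 0)) (TAnd (ILe (INum 1) (ICell 54 (val 71)))
         (TNot (TAnd (ILe (INum 1) (val 74)) (RLe (RSub (RCell 2 (val 60)) (RCell 1 (val 60)))
            (RSub (RCell 2 (val 71)) (RCell 1 (val 71))))))))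
       (60 :== val 71 ;; 74 :== INum 1) Skip))"

text \<open>A class with surplus ends the search before its outgoing arcs are scanned; for this
  reason the final invariant exempts all arcs out of the end \<open>t\<close> of the path.\<close>

definition visit_class :: "'g com" where
  "visit_class = (incr 72 ;; IStore 53 (val 60) (val 72) ;;
     Cond (less_test (ICell 42 (val 60)) (ICell 51 (val 60))) (73 :== INum 1)
       (for_loop 61 11 (Cond (ILe (ICell 53 (val 61)) (INum 0)) scan_pair Skip)))"

text \<open>The deficient class starts at distance equal to its potential, that is, with Dijkstra
  key 0.\<close>

definition search_init :: "'g com" where
  "search_init = (for_loop 29 0 (IStore 52 (val 29) (ICell 50 (val 29))) ;;
     for_loop 71 11 (IStore 53 (val 71) (INum 0) ;; IStore 54 (val 71) (INum 0)) ;;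
     IStore 54 (val 70) (INum 1) ;; RStore 2 (val 70) (RCell 1 (val 70)) ;;
     72 :== INum 0 ;; 73 :== INum 0)"

definition search_path :: "'g com" where
  "search_path = (search_init ;; While (ILe (val 73) (INum 0))
     (select_class ;; Cond (ILe (val 74) (INum 0)) (73 :== INum 2) visit_class))"

lemma sum_class_count:
  assumes "finite X" "\<And>e. e \<in> X \<Longrightarrow> cls e \<in> Q" "finite Q"
  shows "(\<Sum>c\<in>Q. class_count cls X c) = card X"
proof -
  have "(\<Sum>c\<in>Q. class_count cls X c) = (\<Sum>c\<in>Q. \<Sum>e\<in>{e\<in>X. cls e = c}. 1)"
    by (simp add: class_count_def)
  also have "\<dots> = (\<Sum>e\<in>X. 1)" by (rule sum.group) (use assms in auto)
  finally show ?thesis by simp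
qed

context ram
begin

lemma runsE:
  assumes "runs c s T Q"
  obtains t s' where "exec G n \<I> c s t s'" "t \<le> T" "Q s'"
  using assms unfolding runs_def by blast

text \<open>The accounting of \<open>runs_While\<close>, with the body given by an explicit
  execution. This suits bodies whose later cost depends on an intermediate state, such as the class
  just selected, where the fixed budgets of \<open>runs_Seq\<close> are too coarse.\<close>

lemma runs_While_exec:
  assumes "P s" and T: "\<phi> s + 1 + tcost b \<le> T"
    and step: "\<And>s. P s \<Longrightarrow> tval G n \<I> s b \<Longrightarrow>
      \<exists>t s'. exec G n \<I> c s t s' \<and> P s' \<and> \<phi> s' + t + 1 + tcost b \<le> \<phi> s"
    and post: "\<And>s. P s \<Longrightarrow> \<not> tval G n \<I> s b \<Longrightarrow> Q s"
  shows "runs (While b c) s T Q"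
  using assms(1,2)
proof (induction "\<phi> s" arbitrary: s T rule: less_induct)
  case less
  show ?case
  proof (cases "tval G n \<I> s b")
    case False
    then have "exec G n \<I> (While b c) s (1 + tcost b) s" by (rule exec.WhileFalse)
    then show ?thesis using less.prems post[OF less.prems(1) False] unfolding runs_def by fastforce
  next
    case True
    obtain u s' where s': "exec G n \<I> c s u s'" "P s'" "\<phi> s' + u + 1 + tcost b \<le> \<phi> s"
      using step[OF less.prems(1) True] by blast
    have "runs (While b c) s' (\<phi> s' + 1 + tcost b) Q"
      using less.hyps[of s'] s' by simp
    then obtain v s'' where "exec G n \<I> (While b c) s' v s''" "v \<le> \<phi> s' + 1 + tcost b" "Q s''"
      by (auto simp: runs_def)
    moreover have "exec G n \<I> (While b c) s (1 + tcost b + u + v) s''"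
      by (rule exec.WhileTrue) fact+
    moreover have "1 + tcost b + u + v \<le> T" using calculation s' less.prems by simp
    ultimately show ?thesis unfolding runs_def by blast
  qed
qed

end

context class_matroid
begin

text \<open>Array 53 orders the classes by visiting time, and \<open>N\<close> lists arcs out of
  visited classes that are exempt from being covered. The last two clauses are the core: keys do not
  decrease with visiting time, and any class visited before the recorded predecessor of
  \<open>y\<close> reaches \<open>y\<close> only at strictly larger distance. The predecessor is
  thus the earliest optimal one.\<close>

definition path_inv ::
    "nat set \<Rightarrow> (nat \<Rightarrow> real) \<Rightarrow> nat \<Rightarrow> (nat \<times> nat) set \<Rightarrow> nat \<Rightarrow> 'g state \<Rightarrow> bool" where
  "path_inv B p S N tm s \<longleftrightarrow>
     (\<forall>c<q. imem s 53 c \<le> tm) \<and>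
     (\<forall>c<q. \<forall>d<q. imem s 53 c = imem s 53 d \<longrightarrow> imem s 53 c \<noteq> 0 \<longrightarrow> c = d) \<and>
     imem s 54 S \<noteq> 0 \<and> rmem s 2 S = p S \<and>
     (imem s 53 S \<noteq> 0 \<or> (\<forall>c<q. imem s 53 c = 0)) \<and>
     (\<forall>y<q. imem s 54 y \<noteq> 0 \<longrightarrow> y \<noteq> S \<longrightarrow> imem s 55 y < q \<and> imem s 53 (imem s 55 y) \<noteq> 0 \<and>
        (imem s 53 y \<noteq> 0 \<longrightarrow> imem s 53 (imem s 55 y) < imem s 53 y) \<and> link B s (imem s 55 y) y) \<and>
     (\<forall>x<q. imem s 53 x \<noteq> 0 \<longrightarrow> imem s 54 x \<noteq> 0) \<and>
     (\<forall>x<q. \<forall>y<q. imem s 53 x \<noteq> 0 \<longrightarrow> y \<noteq> x \<longrightarrow> (x, y) \<notin> N \<longrightarrow>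
        (\<forall>e f. exch B e f x y \<longrightarrow> covered s x y e f)) \<and>
     (\<forall>x<q. \<forall>y<q. imem s 53 x \<noteq> 0 \<longrightarrow> imem s 54 y \<noteq> 0 \<longrightarrow> (imem s 53 y = 0 \<or> imem s 53 x \<le> imem s 53 y) \<longrightarrow>
        rmem s 2 x - p x \<le> rmem s 2 y - p y) \<and>
     (\<forall>x<q. \<forall>y<q. imem s 53 x \<noteq> 0 \<longrightarrow> imem s 54 y \<noteq> 0 \<longrightarrow> y \<noteq> S \<longrightarrow> imem s 53 x < imem s 53 (imem s 55 y) \<longrightarrow>
        (\<forall>e f. exch B e f x y \<longrightarrow> rmem s 2 y < rmem s 2 x + w e - w f))"

lemma path_inv_parts:
  assumes "path_inv B p S N tm s"
  shows "(\<forall>c<q. imem s 53 c \<le> tm)"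
    "(\<forall>c<q. \<forall>d<q. imem s 53 c = imem s 53 d \<longrightarrow> imem s 53 c \<noteq> 0 \<longrightarrow> c = d)"
    "imem s 54 S \<noteq> 0"
    "rmem s 2 S = p S"
    "(imem s 53 S \<noteq> 0 \<or> (\<forall>c<q. imem s 53 c = 0))"
    "(\<forall>y<q. imem s 54 y \<noteq> 0 \<longrightarrow> y \<noteq> S \<longrightarrow> imem s 55 y < q \<and> imem s 53 (imem s 55 y) \<noteq> 0 \<and>
        (imem s 53 y \<noteq> 0 \<longrightarrow> imem s 53 (imem s 55 y) < imem s 53 y) \<and> link B s (imem s 55 y) y)"
    "(\<forall>x<q. imem s 53 x \<noteq> 0 \<longrightarrow> imem s 54 x \<noteq> 0)"
    "(\<forall>x<q. \<forall>y<q. imem s 53 x \<noteq> 0 \<longrightarrow> y \<noteq> x \<longrightarrow> (x, y) \<notin> N \<longrightarrow>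
        (\<forall>e f. exch B e f x y \<longrightarrow> covered s x y e f))"
    "(\<forall>x<q. \<forall>y<q. imem s 53 x \<noteq> 0 \<longrightarrow> imem s 54 y \<noteq> 0 \<longrightarrow> (imem s 53 y = 0 \<or> imem s 53 x \<le> imem s 53 y) \<longrightarrow>
        rmem s 2 x - p x \<le> rmem s 2 y - p y)"
    "(\<forall>x<q. \<forall>y<q. imem s 53 x \<noteq> 0 \<longrightarrow> imem s 54 y \<noteq> 0 \<longrightarrow> y \<noteq> S \<longrightarrow> imem s 53 x < imem s 53 (imem s 55 y) \<longrightarrow>
        (\<forall>e f. exch B e f x y \<longrightarrow> rmem s 2 y < rmem s 2 x + w e - w f))"
  using assms unfolding path_inv_def by - (elim conjE, assumption)+

lemmas path_invD = path_inv_parts[rule_format]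

lemma path_inv_mono:
  assumes "path_inv B p S N tm s" "\<And>x y. x < q \<Longrightarrow> y < q \<Longrightarrow> x \<noteq> y \<Longrightarrow> (x, y) \<in> N \<Longrightarrow> (x, y) \<in> N'"
  shows "path_inv B p S N' tm s"
proof -
  note D = path_inv_parts[OF assms(1)]
  have "\<forall>x<q. \<forall>y<q. imem s 53 x \<noteq> 0 \<longrightarrow> y \<noteq> x \<longrightarrow> (x, y) \<notin> N' \<longrightarrow> (\<forall>e f. exch B e f x y \<longrightarrow> covered s x y e f)"
    using D(8) assms(2) by metis
  then show ?thesis unfolding path_inv_def by (intro conjI D)
qed

lemma path_inv_store [simp]:
  "a \<notin> {53, 54, 55, 56, 57} \<Longrightarrow>
    path_inv B p S N tm (s\<lparr>imem := store m a i v\<rparr>) \<longleftrightarrow> path_inv B p S N tm (s\<lparr>imem := m\<rparr>)"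
  unfolding path_inv_def by (simp add: store_row)

text \<open>Nonnegativity of the reduced arc costs, the condition under which Dijkstra's algorithm
  is valid.\<close>

lemma exch_le:
  assumes opt: "is_opt_base \<I> (\<lambda>e. w e + p (cls e)) B" and ex: "exch B e f x y"
  shows "w f + p y \<le> w e + p x"
  using opt_base_swap_le[OF opt, of f e] ex by (auto simp: exch_def)

lemma covered_upd:
  assumes c: "covered s x y e f" and up: "upd B s s' v z" and xz: "x \<noteq> z"
  shows "covered s' x y e f"
proof -
  have x: "rmem s' 2 x = rmem s 2 x" using up xz nodeD(5)[of s' x s] by (simp add: upd_def)
  show ?thesis
  proof (cases "node s' y = node s y")
    case True
    then show ?thesis using c x nodeD(1,5)[OF True] by (simp add: covered_def)
  next
    case False
    then have yz: "y = z" using up by (auto simp: upd_def)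
    have "imem s 54 z \<noteq> 0" using c unfolding yz by (simp add: covered_def)
    then have "link B s' v z" "rmem s' 2 z < rmem s 2 z"
      using up False unfolding yz by (auto simp: upd_def)
    with yz show ?thesis using c x by (auto simp: covered_def link_def)
  qed
qed

text \<open>Arcs from \<open>y\<close> back to visited classes are covered without a scan: those
  classes have no larger key, and reduced costs are nonnegative. Only arcs into unvisited classes
  become pending.\<close>

lemma path_inv_visit:
  assumes inv: "path_inv B p S {} tm s" and opt: "is_opt_base \<I> (\<lambda>e. w e + p (cls e)) B"
    and y: "y < q" "imem s 53 y = 0" "imem s 54 y \<noteq> 0" and S: "S < q"
    and min: "\<And>c. c < q \<Longrightarrow> imem s 53 c = 0 \<Longrightarrow> imem s 54 c \<noteq> 0 \<Longrightarrow> rmem s 2 y - p y \<le> rmem s 2 c - p c"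
    and s': "imem s' 53 = (imem s 53)(y := Suc tm)" "node s' = node s"
  shows "path_inv B p S {(y, z) |z. imem s 53 z = 0} (Suc tm) s'"
proof -
  note D = path_invD[OF inv]
  have nd: "node s' c = node s c" for c using s'(2) by simp
  have a1: "imem s' 54 = imem s 54" by (rule ext) (rule nodeD(1)[OF nd])
  have a2: "imem s' 55 = imem s 55" by (rule ext) (rule nodeD(2)[OF nd])
  have a3: "rmem s' 2 = rmem s 2" by (rule ext) (rule nodeD(5)[OF nd])
  note a = a1 a2 a3
  have l: "link B s' = link B s" "covered s' = covered s"
    by (intro ext, simp add: link_def covered_def a nodeD(3,4)[OF nd])+
  have b: "imem s 53 c < Suc tm" if "c < q" for c using D(1)[OF that] by simp
  have yS: "imem s 53 S \<noteq> 0 \<or> y = S"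
    using D(5) D(6)[OF y(1,3)] by metis
  \<comment> \<open>Recorded predecessors are visited, so none of them is \<open>y\<close> yet and
    its new visiting time does not disturb the clauses about predecessors.\<close>
  have par: "imem s 55 c \<noteq> y" if "c < q" "imem s 54 c \<noteq> 0" "c \<noteq> S" for c
    using D(6)[OF that] y(2) by auto
  have cov: "covered s y c e f" if c: "c < q" "imem s 53 c \<noteq> 0" and ex: "exch B e f y c" for c e f
  proof -
    have "rmem s 2 c - p c \<le> rmem s 2 y - p y" by (rule D(9)) (use c y in auto)
    then show ?thesis using exch_le[OF opt ex] D(7)[OF c] by (simp add: covered_def)
  qed
  show ?thesis unfolding path_inv_def a l s'(1)
  proof (intro conjI allI impI)
    fix c assume "c < q"
    then show "((imem s 53)(y := Suc tm)) c \<le> Suc tm" using b[of c] by simp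
  next
    fix c d assume "c < q" "d < q" "((imem s 53)(y := Suc tm)) c = ((imem s 53)(y := Suc tm)) d"
      "((imem s 53)(y := Suc tm)) c \<noteq> 0"
    then show "c = d" using D(2)[of c d] b[of c] b[of d] by (auto split: if_splits)
  next
    show "((imem s 53)(y := Suc tm)) S \<noteq> 0 \<or> (\<forall>c<q. ((imem s 53)(y := Suc tm)) c = 0)"
      using yS by auto
  next
    fix c assume c: "c < q" "imem s 54 c \<noteq> 0" "c \<noteq> S"
    note D6 = D(6)[OF c] and P = par[OF c]
    show "imem s 55 c < q" "link B s (imem s 55 c) c" using D6 by auto
    show "((imem s 53)(y := Suc tm)) (imem s 55 c) \<noteq> 0" using D6 P by simp
    assume "((imem s 53)(y := Suc tm)) c \<noteq> 0"
    then show "((imem s 53)(y := Suc tm)) (imem s 55 c) < ((imem s 53)(y := Suc tm)) c"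
      using D6 P b[of "imem s 55 c"] by auto
  next
    fix x assume "x < q" "((imem s 53)(y := Suc tm)) x \<noteq> 0"
    then show "imem s 54 x \<noteq> 0" using D(7) y(3) by (auto split: if_splits)
  next
    fix x c e f assume x: "x < q" "c < q" "((imem s 53)(y := Suc tm)) x \<noteq> 0" "c \<noteq> x"
      "(x, c) \<notin> {(y, z) |z. imem s 53 z = 0}" "exch B e f x c"
    show "covered s x c e f"
    proof (cases "x = y")
      case True
      then show ?thesis using x cov[of c e f] by auto
    next
      case False
      then show ?thesis using x D(8)[of x c e f] by auto
    qed
  next
    fix x c assume x: "x < q" "c < q" "((imem s 53)(y := Suc tm)) x \<noteq> 0" "imem s 54 c \<noteq> 0"
      "((imem s 53)(y := Suc tm)) c = 0 \<or> ((imem s 53)(y := Suc tm)) x \<le> ((imem s 53)(y := Suc tm)) c"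
    show "rmem s 2 x - p x \<le> rmem s 2 c - p c"
    proof (cases "x = y")
      case True
      then have "c = y \<or> imem s 53 c = 0" using x b[of c] by (auto split: if_splits)
      then show ?thesis using min[of c] x True by auto
    next
      case False
      then show ?thesis using x D(9)[of x c] y by (auto split: if_splits)
    qed
  next
    fix x c e f assume x: "x < q" "c < q" "((imem s 53)(y := Suc tm)) x \<noteq> 0" "imem s 54 c \<noteq> 0" "c \<noteq> S"
      "((imem s 53)(y := Suc tm)) x < ((imem s 53)(y := Suc tm)) (imem s 55 c)" "exch B e f x c"
    have "imem s 55 c \<noteq> y" "imem s 55 c < q" using par D(6) x by auto
    then have "x \<noteq> y" using x b[of "imem s 55 c"] by auto
    then show "rmem s 2 c < rmem s 2 x + w e - w f"
      using x D(10)[of x c e f] \<open>imem s 55 c \<noteq> y\<close> by auto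
  qed (use D(3,4) in auto)
qed

text \<open>Only the record of \<open>z\<close> can change. Its new key is at least that of
  \<open>y\<close>, and \<open>y\<close> has the latest visiting time, so the order of keys
  survives. The strict clause holds because every earlier visited class had covered \<open>z\<close>
  already and the overwrite is a strict improvement.\<close>

lemma path_inv_scan:
  assumes inv: "path_inv B p S N tm s" and opt: "is_opt_base \<I> (\<lambda>e. w e + p (cls e)) B"
    and S: "S < q" and y: "y < q" "imem s 53 y = tm" "tm \<noteq> 0" and z: "z < q" "imem s 53 z = 0"
    and N: "\<And>x c. (x, c) \<in> N \<Longrightarrow> x = y"
    and up: "upd B s s' y z" and vis: "imem s' 53 = imem s 53"
    and cov: "\<And>e f. exch B e f y z \<Longrightarrow> covered s' y z e f"
  shows "path_inv B p S (N - {(y, z)}) tm s'"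
proof -
  note D = path_invD[OF inv]
  have yz: "y \<noteq> z" using y z by auto
  have zS: "z \<noteq> S" using D(5) y z by auto
  have nd: "node s' c = node s c" if "c \<noteq> z" for c using up that by (simp add: upd_def)
  have vp: "imem s 55 c \<noteq> z" if "c < q" "imem s 54 c \<noteq> 0" "c \<noteq> S" for c using D(6)[OF that] z(2) by auto
  have lk: "link B s' (imem s 55 c) c" if "node s' c = node s c" "c < q" "imem s 54 c \<noteq> 0" "c \<noteq> S" for c
    using D(6)[OF that(2-4)] nodeD(5)[OF nd[OF vp[OF that(2-4)]]] unfolding link_def nodeD[OF that(1)] by simp
  show ?thesis unfolding path_inv_def vis
  proof (intro conjI allI impI)
    fix c assume c: "c < q" "imem s' 54 c \<noteq> 0" "c \<noteq> S"
    have "imem s' 55 c < q \<and> imem s 53 (imem s' 55 c) \<noteq> 0 \<and>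
        (imem s 53 c \<noteq> 0 \<longrightarrow> imem s 53 (imem s' 55 c) < imem s 53 c) \<and> link B s' (imem s' 55 c) c"
    proof (cases "node s' c = node s c")
      case True
      have "imem s 54 c \<noteq> 0" using c(2) nodeD(1)[OF True] by simp
      then show ?thesis using D(6)[OF c(1) _ c(3)] lk[OF True c(1) _ c(3)] unfolding nodeD[OF True] by blast
    next
      case False
      then have "c = z" "link B s' y z" using up by (auto simp: upd_def)
      then show ?thesis using y z by (auto simp: link_def)
    qed
    then show "imem s' 55 c < q" "imem s 53 (imem s' 55 c) \<noteq> 0" "link B s' (imem s' 55 c) c"
      "imem s 53 c \<noteq> 0 \<Longrightarrow> imem s 53 (imem s' 55 c) < imem s 53 c" by blast+
  next
    fix x assume x: "x < q" "imem s 53 x \<noteq> 0"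
    then have "x \<noteq> z" using z by auto
    then show "imem s' 54 x \<noteq> 0" using D(7)[OF x] nodeD(1)[OF nd, of x] by simp
  next
    fix x c e f assume x: "x < q" "c < q" "imem s 53 x \<noteq> 0" "c \<noteq> x" "(x, c) \<notin> N - {(y, z)}" "exch B e f x c"
    show "covered s' x c e f"
    proof (cases "(x, c) = (y, z)")
      case True
      then show ?thesis using cov x by simp
    next
      case False
      then have "covered s x c e f" using x D(8)[of x c e f] by auto
      then show ?thesis by (rule covered_upd[OF _ up]) (use x z in auto)
    qed
  next
    fix x c assume x: "x < q" "c < q" "imem s 53 x \<noteq> 0" "imem s' 54 c \<noteq> 0"
      "imem s 53 c = 0 \<or> imem s 53 x \<le> imem s 53 c"
    have rx: "rmem s' 2 x = rmem s 2 x" by (rule nodeD(5)[OF nd]) (use x z in auto)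
    show "rmem s' 2 x - p x \<le> rmem s' 2 c - p c"
    proof (cases "node s' c = node s c")
      case True
      then show ?thesis using D(9)[OF x(1-3) _ x(5)] x(4) rx nodeD(1,5)[OF True] by simp
    next
      case False
      then have c: "c = z" "link B s' y z" using up by (auto simp: upd_def)
      have "rmem s 2 x - p x \<le> rmem s 2 y - p y"
        by (rule D(9)) (use x y D(1)[OF x(1)] D(7)[of y] in auto)
      moreover have "rmem s' 2 y = rmem s 2 y" using nodeD(5)[OF nd[OF yz]] .
      moreover have "w (imem s' 57 z) + p z \<le> w (imem s' 56 z) + p y"
        using exch_le[OF opt, of "imem s' 56 z" "imem s' 57 z" y z] c by (simp add: link_def)
      ultimately show ?thesis using c rx by (simp add: link_def)
    qed
  next
    fix x c e f assume x: "x < q" "c < q" "imem s 53 x \<noteq> 0" "imem s' 54 c \<noteq> 0" "c \<noteq> S"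
      "imem s 53 x < imem s 53 (imem s' 55 c)" "exch B e f x c"
    have rx: "rmem s' 2 x = rmem s 2 x" by (rule nodeD(5)[OF nd]) (use x z in auto)
    show "rmem s' 2 c < rmem s' 2 x + w e - w f"
    proof (cases "node s' c = node s c")
      case True
      then show ?thesis using D(10)[OF x(1-3) _ x(5) _ x(7)] x(4,6) rx nodeD(1,2,5)[OF True] by simp
    next
      case False
      then have c: "c = z" "link B s' y z" "imem s 54 z \<noteq> 0 \<longrightarrow> rmem s' 2 z < rmem s 2 z"
        using up by (auto simp: upd_def)
      then have "imem s 53 x < imem s 53 y" using x(6) by (simp add: link_def)
      then have "x \<noteq> y" by auto
      then have "(x, z) \<notin> N" using N by blast
      moreover have "z \<noteq> x" using x z by auto
      ultimately have "covered s x z e f" using D(8)[of x z e f] x c z by simp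
      then show ?thesis using c rx by (auto simp: covered_def)
    qed
  next
    show "imem s' 54 S \<noteq> 0" "rmem s' 2 S = p S" using D(3,4) nodeD(1,5)[OF nd, of S] zS by auto
  qed (use D(1,2,5) in auto)
qed

text \<open>All reached classes are visited and all their arcs are covered, so the visited classes
  are closed under exchange. By \<open>closed_classes_card\<close> no base has more elements in them
  than \<open>B\<close>, yet the target asks for at least as many in each of them and for more in
  \<open>S\<close>.\<close>

lemma no_target_base:
  assumes inv: "path_inv B p S {} tm s" and B: "is_base \<I> B" and S: "S < q" "class_count cls B S < tgt S"
    and all: "\<And>c. c < q \<Longrightarrow> imem s 54 c \<noteq> 0 \<Longrightarrow> imem s 53 c \<noteq> 0"
    and le: "\<And>c. c < q \<Longrightarrow> imem s 53 c \<noteq> 0 \<Longrightarrow> class_count cls B c \<le> tgt c"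
    and B': "is_base \<I> B'" "\<And>c. c < q \<Longrightarrow> class_count cls B' c = tgt c"
  shows False
proof -
  note D = path_invD[OF inv]
  define Q where "Q = {c. c < q \<and> imem s 53 c \<noteq> 0}"
  let ?X = "{e. e < n \<and> cls e \<in> Q}"
  have "card (B' \<inter> ?X) \<le> card (B \<inter> ?X)"
  proof (rule closed_classes_card[OF B B'(1)])
    fix e f assume e: "e \<in> {..<n} - B" "f \<in> B" "is_base \<I> (insert e (B - {f}))" "e \<in> ?X"
    have f: "f < n" using e base_subset[OF B] by auto
    show "f \<in> ?X"
    proof (cases "cls f = cls e")
      case True
      then show ?thesis using e f by auto
    next
      case False
      have "exch B e f (cls e) (cls f)" using e by (simp add: exch_def)
      then have "covered s (cls e) (cls f) e f" using D(8)[of "cls e" "cls f" e f] e f False cls by (auto simp: Q_def)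
      then show ?thesis using all[of "cls f"] f cls by (auto simp: Q_def covered_def)
    qed
  qed
  moreover have cnt: "card (D \<inter> ?X) = (\<Sum>c\<in>Q. class_count cls D c)" if D: "is_base \<I> D" for D
  proof -
    have "{e \<in> D \<inter> ?X. cls e = c} = {e \<in> D. cls e = c}" if "c \<in> Q" for c
      using base_subset[OF D] that by auto
    then have "(\<Sum>c\<in>Q. class_count cls D c) = (\<Sum>c\<in>Q. class_count cls (D \<inter> ?X) c)"
      by (simp add: class_count_def)
    also have "\<dots> = card (D \<inter> ?X)"
      by (rule sum_class_count) (use base_finite[OF D] in \<open>auto simp: Q_def\<close>)
    finally show ?thesis by simp
  qed
  moreover have "(\<Sum>c\<in>Q. class_count cls B c) < (\<Sum>c\<in>Q. class_count cls B' c)"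
  proof (rule sum_strict_mono_ex1)
    show "\<forall>c\<in>Q. class_count cls B c \<le> class_count cls B' c" using le B'(2) by (simp add: Q_def)
    have "S \<in> Q" using all[OF S(1)] D(3) S by (simp add: Q_def)
    then show "\<exists>c\<in>Q. class_count cls B c < class_count cls B' c"
      using S B'(2)[OF S(1)] by (intro bexI[of _ S]) simp_all
  qed (simp add: Q_def)
  ultimately show False using B B'(1) by simp
qed

lemma sum_block_lengths: "(\<Sum>c<q. st (Suc c) - st c) = n"
proof -
  have "(\<Sum>c<q. st (Suc c) - st c) = (\<Sum>c<q. class_count cls {..<n} c)"
    by (intro sum.cong refl) (use blocks sorted_block_card in \<open>force simp: class_count_def\<close>)
  also have "\<dots> = card {..<n}" by (rule sum_class_count) (use cls in auto)
  finally show ?thesis by simp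
qed

section \<open>The search as a program\<close>

lemma runs_select_class:
  assumes q: "imem s 11 0 = q" and p: "rmem s 1 = p" and T: "70 * (q + 1) \<le> T"
  shows "runs select_class s T (\<lambda>s'. frame {60, 71, 74} {} {} s s' \<and>
    (imem s' 74 0 = 0 \<longrightarrow> (\<forall>c<q. imem s 54 c \<noteq> 0 \<longrightarrow> imem s 53 c \<noteq> 0)) \<and>
    (imem s' 74 0 \<noteq> 0 \<longrightarrow> imem s' 60 0 < q \<and> imem s 53 (imem s' 60 0) = 0 \<and> imem s 54 (imem s' 60 0) \<noteq> 0 \<and>
      (\<forall>c<q. imem s 53 c = 0 \<longrightarrow> imem s 54 c \<noteq> 0 \<longrightarrow>
         rmem s 2 (imem s' 60 0) - p (imem s' 60 0) \<le> rmem s 2 c - p c)))"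
proof -
  let ?P = "\<lambda>i s'. frame {60, 71, 74} {} {} s s' \<and>
    (imem s' 74 0 = 0 \<longrightarrow> (\<forall>c<i. imem s 54 c \<noteq> 0 \<longrightarrow> imem s 53 c \<noteq> 0)) \<and>
    (imem s' 74 0 \<noteq> 0 \<longrightarrow> imem s' 60 0 < q \<and> imem s 53 (imem s' 60 0) = 0 \<and> imem s 54 (imem s' 60 0) \<noteq> 0 \<and>
      (\<forall>c<i. imem s 53 c = 0 \<longrightarrow> imem s 54 c \<noteq> 0 \<longrightarrow>
         rmem s 2 (imem s' 60 0) - p (imem s' 60 0) \<le> rmem s 2 c - p c))"
  let ?b = "Cond (TAnd (ILe (ICell 53 (val 71)) (INum 0)) (TAnd (ILe (INum 1) (ICell 54 (val 71)))
         (TNot (TAnd (ILe (INum 1) (val 74)) (RLe (RSub (RCell 2 (val 60)) (RCell 1 (val 60)))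
            (RSub (RCell 2 (val 71)) (RCell 1 (val 71))))))))
       (60 :== val 71 ;; 74 :== INum 1) Skip"
  have L: "runs (for_loop 71 11 ?b) (s\<lparr>imem := store (imem s) 74 0 0\<rparr>) (T - 3) (?P q)"
  proof (rule runs_for[where m = q and t = 45 and P = ?P])
    fix i s1 assume i: "i < q" "imem s1 71 0 = i" and P: "?P i s1"
    have fr: "frame {60, 71, 74} {} {} s s1" using P by blast
    have rows: "imem s1 53 = imem s 53" "imem s1 54 = imem s 54" "rmem s1 (Suc 0) = p" "rmem s1 2 = rmem s 2"
      using p by (simp_all add: frameD[OF fr])
    have e: "Suc 0 \<le> x \<longleftrightarrow> x \<noteq> 0" for x :: nat by auto
    show "runs ?b s1 45 (\<lambda>s'. ?P (Suc i) s' \<and> imem s' 71 0 = i)"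
    proof (cases "imem s 53 i = 0 \<and> imem s 54 i \<noteq> 0")
      case False
      then show ?thesis using P i by (auto simp: rows store_row less_Suc_eq)
    next
      case new: True
      show ?thesis
      proof (cases "imem s1 74 0 \<noteq> 0 \<and> rmem s 2 (imem s1 60 0) - p (imem s1 60 0) \<le> rmem s 2 i - p i")
        case True
        then show ?thesis using P i new by (auto simp: rows store_row less_Suc_eq)
      next
        case False
        have "rmem s 2 i - p i \<le> rmem s 2 c - p c" if c: "c < i" "imem s 53 c = 0" "imem s 54 c \<noteq> 0" for c
        proof (cases "imem s1 74 0 = 0")
          case True
          then show ?thesis using P c by auto
        next
          case t: False
          then have "rmem s 2 (imem s1 60 0) - p (imem s1 60 0) \<le> rmem s 2 c - p c" using P c by blast
          then show ?thesis using t False by linarith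
        qed
        then show ?thesis using P i new False by (auto simp: rows store_row less_Suc_eq e)
      qed
    qed
  qed (use q T in \<open>auto simp: store_row frame_def\<close>)
  then show ?thesis unfolding select_class_def using T by simp
qed

lemma runs_search_init:
  assumes static: "static s" and rows: "imem s 50 = mem_vec B" "imem s 70 0 = S" "rmem s 1 = p"
    and B: "B \<subseteq> {..<n}" and m: "\<forall>e\<ge>n. imem s 52 e = 0" and S: "S < q"
    and T: "30 * (n + 1) + 30 * (q + 1) + 30 \<le> T"
  shows "runs search_init s T (\<lambda>s'. frame {29, 52, 53, 54, 71, 72, 73} {} {2} s s' \<and> imem s' 52 = mem_vec B \<and>
    imem s' 72 0 = 0 \<and> imem s' 73 0 = 0 \<and> path_inv B p S {} 0 s')"
proof -
  have st: "imem s 0 0 = n" "imem s 11 0 = q" using static by (simp_all add: static_def)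
  have c1: "runs (for_loop 29 0 (IStore 52 (val 29) (ICell 50 (val 29)))) s (20 * (n + 1))
      (\<lambda>s'. frame {29, 52} {} {} s s' \<and> imem s' 52 = mem_vec B)"
  proof (rule runs_for[where m = n and t = 6 and
        P = "\<lambda>i s'. frame {29, 52} {} {} s s' \<and> (\<forall>e. e < i \<or> n \<le> e \<longrightarrow> imem s' 52 e = mem_vec B e)"])
    fix s' assume P: "frame {29, 52} {} {} s s' \<and> (\<forall>e. e < n \<or> n \<le> e \<longrightarrow> imem s' 52 e = mem_vec B e)"
    then have "imem s' 52 e = mem_vec B e" for e using linorder_not_le by blast
    then show "frame {29, 52} {} {} s s' \<and> imem s' 52 = mem_vec B" using P by auto
  next
    show "frame {29, 52} {} {} s s \<and> (\<forall>e. e < 0 \<or> n \<le> e \<longrightarrow> imem s 52 e = mem_vec B e)"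
      using m B by (auto simp: mem_vec_def)
  qed (use st rows in \<open>auto simp: store_row frame_def\<close>)
  have c2: "runs (for_loop 71 11 (IStore 53 (val 71) (INum 0) ;; IStore 54 (val 71) (INum 0)) ;;
     IStore 54 (val 70) (INum 1) ;; RStore 2 (val 70) (RCell 1 (val 70)) ;; 72 :== INum 0 ;; 73 :== INum 0) s1
     (25 * (q + 1) + 30) (\<lambda>s'. frame {29, 52, 53, 54, 71, 72, 73} {} {2} s s' \<and> imem s' 52 = mem_vec B \<and>
    imem s' 72 0 = 0 \<and> imem s' 73 0 = 0 \<and> path_inv B p S {} 0 s')"
    if s1: "frame {29, 52} {} {} s s1 \<and> imem s1 52 = mem_vec B" for s1
  proof (rule runs_Seq[where Td = 30 and R = "\<lambda>s'. frame {53, 54, 71} {} {} s1 s' \<and>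
      (\<forall>c<q. imem s' 53 c = 0 \<and> imem s' 54 c = 0)"])
    note fr1 = s1[THEN conjunct1]
    show "runs (for_loop 71 11 (IStore 53 (val 71) (INum 0) ;; IStore 54 (val 71) (INum 0))) s1 (25 * (q + 1))
      (\<lambda>s'. frame {53, 54, 71} {} {} s1 s' \<and> (\<forall>c<q. imem s' 53 c = 0 \<and> imem s' 54 c = 0))"
      by (rule runs_for[where m = q and t = 12 and P = "\<lambda>i s'. frame {53, 54, 71} {} {} s1 s' \<and>
        (\<forall>c<i. imem s' 53 c = 0 \<and> imem s' 54 c = 0)"])
        (use st s1 in \<open>auto simp: store_row frame_def less_Suc_eq\<close>)
    fix s2 assume s2: "frame {53, 54, 71} {} {} s1 s2 \<and> (\<forall>c<q. imem s2 53 c = 0 \<and> imem s2 54 c = 0)"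
    note fr2 = s2[THEN conjunct1]
    have r: "imem s2 70 0 = S" "rmem s2 (Suc 0) = p" "imem s2 52 = mem_vec B"
      using rows s1 by (simp_all add: frameD[OF fr2] frameD[OF fr1])
    have "frame {29, 52, 53, 54, 71, 72, 73} {} {2} s s1" by (rule frame_mono[OF fr1]) auto
    moreover have "frame {29, 52, 53, 54, 71, 72, 73} {} {2} s1 s2" by (rule frame_mono[OF fr2]) auto
    ultimately have fr: "frame {29, 52, 53, 54, 71, 72, 73} {} {2} s s2" by (rule frame_trans)
    show "runs (IStore 54 (val 70) (INum 1) ;; RStore 2 (val 70) (RCell 1 (val 70)) ;; 72 :== INum 0 ;; 73 :== INum 0)
       s2 30 (\<lambda>s'. frame {29, 52, 53, 54, 71, 72, 73} {} {2} s s' \<and> imem s' 52 = mem_vec B \<and>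
    imem s' 72 0 = 0 \<and> imem s' 73 0 = 0 \<and> path_inv B p S {} 0 s')"
      using fr s2 S by (auto simp: store_row r path_inv_def)
  qed simp
  show ?thesis unfolding search_init_def
    by (rule runs_Seq[OF c1 c2]) (use T in simp_all)
qed

definition search_frame :: "nat set" where
  "search_frame = {29, 52, 53, 54, 55, 56, 57, 60, 61, 62, 63, 64, 65, 66, 67, 71, 72, 73, 74}"

lemma runs_visit_class:
  assumes B: "is_base \<I> B" and opt: "is_opt_base \<I> (\<lambda>e. w e + p (cls e)) B" and S: "S < q"
    and static: "static s" and rows: "imem s 50 = mem_vec B" "imem s 52 = mem_vec B"
    and cnt: "imem s 42 = tgt" "imem s 51 = cB"
    and inv: "path_inv B p S {} tm s" and v: "imem s 72 0 = tm" "imem s 73 0 = 0" "imem s 60 0 = y"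
    and y: "y < q" "imem s 53 y = 0" "imem s 54 y \<noteq> 0"
      "\<And>c. c < q \<Longrightarrow> imem s 53 c = 0 \<Longrightarrow> imem s 54 c \<noteq> 0 \<Longrightarrow> rmem s 2 y - p y \<le> rmem s 2 c - p c"
    and T: "110 * (q * (st (Suc y) - st y)) + 80 * n + 150 * (q + 1) + 100 \<le> T"
  shows "runs visit_class s T (\<lambda>s'. frame search_frame {} {2, 3} s s' \<and> imem s' 52 = mem_vec B \<and>
    imem s' 72 0 = Suc tm \<and> imem s' 60 0 = y \<and> imem s' 53 = (imem s 53)(y := Suc tm) \<and>
    (if tgt y < cB y then imem s' 73 0 = 1 \<and> path_inv B p S {(y, z) |z. imem s 53 z = 0} (Suc tm) s'
     else imem s' 73 0 = 0 \<and> path_inv B p S {} (Suc tm) s'))"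
proof -
  let ?s = "s\<lparr>imem := store (store (imem s) 72 0 (Suc tm)) 53 y (Suc tm)\<rparr>"
  let ?vis = "(imem s 53)(y := Suc tm)"
  have inv1: "path_inv B p S {(y, z) |z. imem s 53 z = 0} (Suc tm) ?s"
    by (rule path_inv_visit[OF inv opt y(1-3) S y(4)]) (simp_all add: store_row)
  have fr1: "frame search_frame {} {2, 3} s ?s" by (simp add: search_frame_def)
  show ?thesis
  proof (cases "tgt y < cB y")
    case True
    have "path_inv B p S {(y, z) |z. imem s 53 z = 0} (Suc tm) (?s\<lparr>imem := store (imem ?s) 73 0 1\<rparr>)"
      using inv1 by simp
    then show ?thesis using True T fr1 rows
      by (simp add: visit_class_def store_row v cnt) (auto simp: search_frame_def)
  next
    case False
    let ?N = "\<lambda>i. {(y, z) |z. i \<le> z \<and> imem s 53 z = 0}"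
    let ?P = "\<lambda>i s'. frame search_frame {} {2, 3} s s' \<and> imem s' 52 = mem_vec B \<and>
      imem s' 72 0 = Suc tm \<and> imem s' 73 0 = 0 \<and> imem s' 60 0 = y \<and> imem s' 53 = ?vis \<and> path_inv B p S (?N i) (Suc tm) s'"
    let ?t = "\<lambda>z. 110 * (st (Suc y) - st y) + 80 * (st (Suc z) - st z) + 110"
    have "runs (for_loop 61 11 (Cond (ILe (ICell 53 (val 61)) (INum 0)) scan_pair Skip)) ?s (T - 20) (?P q)"
    proof (rule runs_for_sum[where m = q and t = ?t and P = ?P])
      show "imem s' 11 0 = q" if "?P i s'" for i s'
      proof -
        have fr: "frame search_frame {} {2, 3} s s'" using that by blast
        show ?thesis using static by (simp add: frameD[OF fr] static_def search_frame_def)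
      qed
      show "?P i (s'\<lparr>imem := store (imem s') 61 0 j\<rparr>)" if "?P i s'" for i j s'
        using that by (simp add: store_row search_frame_def)
      show "?P 0 ?s" using inv1 fr1 rows v by (simp add: store_row)
      have "(\<Sum>z<q. ?t z) = 110 * (q * (st (Suc y) - st y)) + 80 * n + 110 * q"
        by (simp add: sum.distrib sum_distrib_left[symmetric] sum_block_lengths del: sum_diff_nat)
      then show "(\<Sum>z<q. ?t z) + (q + 1) * 13 \<le> T - 20" using T by simp
    next
      fix z s1 assume z: "z < q" "imem s1 61 0 = z" and P: "?P z s1"
      have fr: "frame search_frame {} {2, 3} s s1" and v1: "imem s1 72 0 = Suc tm" "imem s1 73 0 = 0" "imem s1 60 0 = y"
        and Q1: "imem s1 52 = mem_vec B" and vis: "imem s1 53 = ?vis" and pinv: "path_inv B p S (?N z) (Suc tm) s1"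
        using P by blast+
      have static1: "static s1" by (rule static_frame[OF static fr]) (auto simp: search_frame_def)
      have B1: "imem s1 50 = mem_vec B" using rows by (simp add: frameD[OF fr] search_frame_def)
      show "runs (Cond (ILe (ICell 53 (val 61)) (INum 0)) scan_pair Skip) s1 (?t z)
          (\<lambda>s'. ?P (Suc z) s' \<and> imem s' 61 0 = z)"
      proof (cases "?vis z = 0")
        \<comment> \<open>\<open>?vis\<close> already counts \<open>y\<close> as visited, so this
          case also skips the pair of \<open>y\<close> with itself.\<close>
        case False
        have "path_inv B p S (?N (Suc z)) (Suc tm) s1"
        proof (cases "z = y")
          case True
          show ?thesis by (rule path_inv_mono[OF pinv]) (use True in \<open>auto simp: Suc_le_eq\<close>)
        next
          case neq: False
          then have "imem s 53 z \<noteq> 0" using False by simp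
          show ?thesis
          proof (rule path_inv_mono[OF pinv])
            fix x c assume "(x, c) \<in> ?N z"
            then have "x = y" "z \<le> c" "imem s 53 c = 0" by auto
            moreover have "z \<noteq> c" using \<open>imem s 53 z \<noteq> 0\<close> calculation(3) by auto
            ultimately show "(x, c) \<in> ?N (Suc z)" by auto
          qed
        qed
        then show ?thesis using False P z vis by simp
      next
        case True
        then have zy: "z \<noteq> y" and z0: "imem s 53 z = 0" by (auto split: if_splits)
        have N: "?N (Suc z) = ?N z - {(y, z)}" using z0 by (auto simp: Suc_le_eq)
        have "runs scan_pair s1 (?t z - 6) (\<lambda>s'. ?P (Suc z) s' \<and> imem s' 61 0 = z)"
        proof (rule runs_mono[OF runs_scan_pair[OF B y(1) z(1) zy[symmetric] static1 B1 Q1 v1(3) z(2) order_refl]])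
          fix s2 assume s2: "frame {52, 54, 55, 56, 57, 62, 63, 64, 65, 66, 67} {} {2, 3} s1 s2 \<and>
            imem s2 52 = mem_vec B \<and> upd B s1 s2 y z \<and> (\<forall>e f. exch B e f y z \<longrightarrow> covered s2 y z e f)"
          note fr2 = s2[THEN conjunct1]
          have "frame search_frame {} {2, 3} s1 s2" by (rule frame_mono[OF fr2]) (auto simp: search_frame_def)
          with fr have fr': "frame search_frame {} {2, 3} s s2" by (rule frame_trans)
          have "path_inv B p S (?N z - {(y, z)}) (Suc tm) s2"
            by (rule path_inv_scan[OF pinv opt S y(1) _ _ z(1)])
              (use s2 True in \<open>auto simp: vis frameD[OF fr2]\<close>)
          then show "?P (Suc z) s2 \<and> imem s2 61 0 = z"
            unfolding N using s2 fr' v1 z vis by (simp add: frameD[OF fr2])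
        qed simp
        then show ?thesis using True z vis by simp
      qed
    next
      fix s' assume "?P q s'"
      then show "?P q s'" .
    qed simp
    then have "runs (for_loop 61 11 (Cond (ILe (ICell 53 (val 61)) (INum 0)) scan_pair Skip)) ?s (T - 20)
      (\<lambda>s'. frame search_frame {} {2, 3} s s' \<and> imem s' 52 = mem_vec B \<and>
       imem s' 72 0 = Suc tm \<and> imem s' 60 0 = y \<and> imem s' 53 = ?vis \<and>
       (if tgt y < cB y then imem s' 73 0 = 1 \<and> path_inv B p S {(y, z) |z. imem s 53 z = 0} (Suc tm) s'
       else imem s' 73 0 = 0 \<and> path_inv B p S {} (Suc tm) s'))"
    proof (rule runs_mono)
      fix s' assume P: "?P q s'"
      have "path_inv B p S {} (Suc tm) s'"
        by (rule path_inv_mono[where N = "?N q"]) (use P in auto)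
      then show "frame search_frame {} {2, 3} s s' \<and> imem s' 52 = mem_vec B \<and>
       imem s' 72 0 = Suc tm \<and> imem s' 60 0 = y \<and> imem s' 53 = ?vis \<and>
       (if tgt y < cB y then imem s' 73 0 = 1 \<and> path_inv B p S {(y, z) |z. imem s 53 z = 0} (Suc tm) s'
       else imem s' 73 0 = 0 \<and> path_inv B p S {} (Suc tm) s')"
        using P False by simp
    qed simp
    moreover have "30 \<le> T" using T by simp
    ultimately show ?thesis using False by (auto simp: visit_class_def store_row v cnt)
  qed
qed

lemma runs_search_path:
  assumes B: "is_base \<I> B" and opt: "is_opt_base \<I> (\<lambda>e. w e + p (cls e)) B"
    and S: "S < q" "class_count cls B S < tgt S"
    and static: "static s" and rows: "imem s 50 = mem_vec B" "imem s 70 0 = S" "rmem s 1 = p"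
    and cnt: "imem s 42 = tgt" "imem s 51 = class_count cls B" and m: "\<forall>e\<ge>n. imem s 52 e = 0"
    and T: "190 * (q * n) + 500 * (q + 1) * (q + 1) + 60 * (n + 1) \<le> T"
  shows "runs search_path s T (\<lambda>s'. frame search_frame {} {2, 3} s s' \<and> imem s' 52 = mem_vec B \<and>
    (imem s' 73 0 = 1 \<and> imem s' 60 0 < q \<and> tgt (imem s' 60 0) < class_count cls B (imem s' 60 0) \<and>
       imem s' 72 0 \<noteq> 0 \<and> imem s' 53 (imem s' 60 0) = imem s' 72 0 \<and>
       path_inv B p S {(imem s' 60 0, z) |z. True} (imem s' 72 0) s' \<or>
     imem s' 73 0 = 2 \<and> (\<forall>B'. is_base \<I> B' \<longrightarrow> (\<exists>c<q. class_count cls B' c \<noteq> tgt c))))"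
proof -
  let ?cB = "class_count cls B"
  \<comment> \<open>The cost charged to a visit of \<open>x\<close>, selection included: the block
    of \<open>x\<close> is read again for each partner class, while the partner blocks together have
    length \<open>n\<close>. Summed over \<open>x\<close> the two contributions give the coefficient
    110 + 80 = 190 of \<open>q * n\<close>.\<close>
  define K where "K x = 110 * (q * (st (Suc x) - st x)) + 80 * n + 220 * (q + 1) + 150" for x
  \<comment> \<open>Unvisited classes prepay their visit; the extra summand pays for a final
    selection that finds no class.\<close>
  define \<phi> :: "'g state \<Rightarrow> nat" where "\<phi> s' = (if imem s' 73 0 = 0 then 70 * (q + 1) + 40 + (\<Sum>x<q. if imem s' 53 x = 0 then K x else 0) else 0)" for s'
  define R where "R s' \<longleftrightarrow>
    (imem s' 73 0 = 1 \<and> imem s' 60 0 < q \<and> tgt (imem s' 60 0) < ?cB (imem s' 60 0) \<and>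
       imem s' 72 0 \<noteq> 0 \<and> imem s' 53 (imem s' 60 0) = imem s' 72 0 \<and>
       path_inv B p S {(imem s' 60 0, z) |z. True} (imem s' 72 0) s' \<or>
     imem s' 73 0 = 2 \<and> (\<forall>B'. is_base \<I> B' \<longrightarrow> (\<exists>c<q. class_count cls B' c \<noteq> tgt c)))" for s'
  define P where "P s' \<longleftrightarrow> frame search_frame {} {2, 3} s s' \<and> imem s' 52 = mem_vec B \<and>
     (imem s' 73 0 = 0 \<and> path_inv B p S {} (imem s' 72 0) s' \<and> (\<forall>c<q. imem s' 53 c \<noteq> 0 \<longrightarrow> ?cB c \<le> tgt c) \<or> R s')" for s'
  have K: "(\<Sum>x<q. K x) = 190 * (q * n) + (220 * (q + 1) + 150) * q"
  proof -
    have "(\<Sum>x<q. K x) = 110 * (q * (\<Sum>x<q. st (Suc x) - st x)) + (80 * n + (220 * (q + 1) + 150)) * q"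
      unfolding K_def by (simp add: sum.distrib sum_distrib_left algebra_simps)
    then show ?thesis unfolding sum_block_lengths by (simp add: algebra_simps)
  qed
  have T2: "(\<Sum>x<q. K x) + 70 * (q + 1) + 60 + (30 * (n + 1) + 30 * (q + 1) + 30) \<le> T"
    using T unfolding K by (simp add: algebra_simps)
  let ?body = "select_class ;; Cond (ILe (val 74) (INum 0)) (73 :== INum 2) visit_class"
  have loop: "runs (While (ILe (val 73) (INum 0)) ?body) s1 ((\<Sum>x<q. K x) + 70 * (q + 1) + 60) (\<lambda>s'. P s' \<and> R s')"
    if s1: "frame {29, 52, 53, 54, 71, 72, 73} {} {2} s s1 \<and> imem s1 52 = mem_vec B \<and>
      imem s1 72 0 = 0 \<and> imem s1 73 0 = 0 \<and> path_inv B p S {} 0 s1" for s1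
  proof (rule runs_While_exec[where P = P and \<phi> = \<phi>])
    have "frame search_frame {} {2, 3} s s1" by (rule frame_mono[OF s1[THEN conjunct1]]) (auto simp: search_frame_def)
    moreover have "imem s1 53 c = 0" if "c < q" for c using path_invD(1)[of B p S "{}" 0 s1 c] s1 that by simp
    ultimately show "P s1" using s1 by (simp add: P_def)
    show "\<phi> s1 + 1 + tcost (ILe (val 73) (INum 0)) \<le> (\<Sum>x<q. K x) + 70 * (q + 1) + 60"
    proof -
      have "(\<Sum>x<q. if imem s1 53 x = 0 then K x else 0) \<le> (\<Sum>x<q. K x)" by (rule sum_mono) simp
      then show ?thesis by (simp add: \<phi>_def)
    qed
  next
    fix s2 assume P: "P s2" and b: "tval G n \<I> s2 (ILe (val 73) (INum 0))"
    define tm where "tm = imem s2 72 0"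
    have st0: "imem s2 73 0 = 0" using b by simp
    then have inv: "path_inv B p S {} tm s2" and vis: "\<And>c. c < q \<Longrightarrow> imem s2 53 c \<noteq> 0 \<Longrightarrow> ?cB c \<le> tgt c"
      and fr: "frame search_frame {} {2, 3} s s2" and Q: "imem s2 52 = mem_vec B"
      using P by (auto simp: P_def R_def tm_def)
    have static2: "static s2" by (rule static_frame[OF static fr]) (auto simp: search_frame_def)
    have q2: "imem s2 11 0 = q" using static2 by (simp add: static_def)
    have r2: "rmem s2 1 = p" "imem s2 50 = mem_vec B" "imem s2 42 = tgt" "imem s2 51 = ?cB"
      using rows cnt by (simp_all add: frameD[OF fr] search_frame_def)
    obtain t1 s3 where e1: "exec G n \<I> select_class s2 t1 s3" "t1 \<le> 70 * (q + 1)" and sel: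
      "frame {60, 71, 74} {} {} s2 s3 \<and>
    (imem s3 74 0 = 0 \<longrightarrow> (\<forall>c<q. imem s2 54 c \<noteq> 0 \<longrightarrow> imem s2 53 c \<noteq> 0)) \<and>
    (imem s3 74 0 \<noteq> 0 \<longrightarrow> imem s3 60 0 < q \<and> imem s2 53 (imem s3 60 0) = 0 \<and> imem s2 54 (imem s3 60 0) \<noteq> 0 \<and>
      (\<forall>c<q. imem s2 53 c = 0 \<longrightarrow> imem s2 54 c \<noteq> 0 \<longrightarrow>
         rmem s2 2 (imem s3 60 0) - p (imem s3 60 0) \<le> rmem s2 2 c - p c))"
      by (rule runsE[OF runs_select_class[OF q2 r2(1) order_refl]])
    note fr3 = sel[THEN conjunct1] and none = sel[THEN conjunct2, THEN conjunct1, THEN mp]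
      and some = sel[THEN conjunct2, THEN conjunct2, THEN mp]
    have "frame search_frame {} {2, 3} s2 s3" by (rule frame_mono[OF fr3]) (auto simp: search_frame_def)
    with fr have fr': "frame search_frame {} {2, 3} s s3" by (rule frame_trans)
    have static3: "static s3" by (rule static_frame[OF static fr']) (auto simp: search_frame_def)
    have r3: "imem s3 52 = mem_vec B" "imem s3 53 = imem s2 53" "imem s3 54 = imem s2 54" "rmem s3 = rmem s2"
        "imem s3 72 0 = tm" "imem s3 73 0 = 0" "imem s3 50 = mem_vec B" "imem s3 42 = tgt" "imem s3 51 = ?cB"
        "imem s3 55 = imem s2 55" "imem s3 56 = imem s2 56" "imem s3 57 = imem s2 57"
      using st0 Q r2 by (simp_all add: frameD[OF fr3] tm_def fun_eq_iff)
    have inv3: "path_inv B p S {} tm s3"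
      using inv unfolding path_inv_def link_def covered_def r3 .
    show "\<exists>t s'. exec G n \<I> ?body s2 t s' \<and> P s' \<and> \<phi> s' + t + 1 + tcost (ILe (val 73) (INum 0)) \<le> \<phi> s2"
    proof (cases "imem s3 74 0 = 0")
      case True
      let ?s4 = "s3\<lparr>imem := store (imem s3) 73 0 2\<rparr>"
      have e2: "exec G n \<I> (Cond (ILe (val 74) (INum 0)) (73 :== INum 2) visit_class) s3 8 ?s4"
        using True by (simp add: exec_Cond exec_IStore)
      have "\<exists>c<q. class_count cls B' c \<noteq> tgt c" if "is_base \<I> B'" for B'
        using no_target_base[OF inv B S _ vis that] none[OF True] by blast
      then have "R ?s4" by (simp add: R_def store_row)
      then have P4: "P ?s4" using fr' r3 by (simp add: P_def store_row) (simp add: search_frame_def)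
      have "exec G n \<I> ?body s2 (t1 + 8) ?s4" using e1(1) e2 by (rule exec.Seq)
      moreover have "\<phi> ?s4 + (t1 + 8) + 1 + tcost (ILe (val 73) (INum 0)) \<le> \<phi> s2"
        using e1(2) st0 by (simp add: \<phi>_def store_row)
      ultimately show ?thesis using P4 by blast
    next
      case False
      define y where "y = imem s3 60 0"
      have y: "y < q" "imem s3 53 y = 0" "imem s3 54 y \<noteq> 0"
        and min: "\<And>c. c < q \<Longrightarrow> imem s3 53 c = 0 \<Longrightarrow> imem s3 54 c \<noteq> 0 \<Longrightarrow> rmem s3 2 y - p y \<le> rmem s3 2 c - p c"
        using some[OF False] unfolding y_def r3 by blast+
      obtain t2 s4 where e2: "exec G n \<I> visit_class s3 t2 s4" "t2 \<le> 110 * (q * (st (Suc y) - st y)) + 80 * n + 150 * (q + 1) + 100"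
        and vc: "frame search_frame {} {2, 3} s3 s4 \<and> imem s4 52 = mem_vec B \<and> imem s4 72 0 = Suc tm \<and> imem s4 60 0 = y \<and>
          imem s4 53 = (imem s3 53)(y := Suc tm) \<and>
          (if tgt y < ?cB y then imem s4 73 0 = 1 \<and> path_inv B p S {(y, z) |z. imem s3 53 z = 0} (Suc tm) s4
          else imem s4 73 0 = 0 \<and> path_inv B p S {} (Suc tm) s4)"
        by (rule runsE[OF runs_visit_class[OF B opt S(1) static3 r3(7,1,8,9) inv3 r3(5,6) y_def[symmetric] y min order_refl]])
      have fr4: "frame search_frame {} {2, 3} s3 s4" and r4: "imem s4 52 = mem_vec B" "imem s4 72 0 = Suc tm" "imem s4 60 0 = y"
          "imem s4 53 = (imem s3 53)(y := Suc tm)"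
        and cases4: "if tgt y < ?cB y then imem s4 73 0 = 1 \<and> path_inv B p S {(y, z) |z. imem s3 53 z = 0} (Suc tm) s4
          else imem s4 73 0 = 0 \<and> path_inv B p S {} (Suc tm) s4"
        using vc by - (elim conjE, assumption)+
      have fr'': "frame search_frame {} {2, 3} s s4" using fr' fr4 by (rule frame_trans)
      have e3: "exec G n \<I> (Cond (ILe (val 74) (INum 0)) (73 :== INum 2) visit_class) s3 (5 + t2) s4"
        using False e2(1) by (simp add: exec_Cond)
      have P4: "P s4"
      proof (cases "tgt y < ?cB y")
        case True
        then have c: "imem s4 73 0 = 1" and pi: "path_inv B p S {(y, z) |z. imem s3 53 z = 0} (Suc tm) s4"
          using cases4 by auto
        have "path_inv B p S {(y, z) |z. True} (Suc tm) s4" by (rule path_inv_mono[OF pi]) auto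
        then have "R s4" using True c y r4 by (simp add: R_def)
        then show ?thesis using fr'' r4 by (simp add: P_def)
      next
        case False
        then have "imem s4 73 0 = 0 \<and> path_inv B p S {} (Suc tm) s4" using cases4 by auto
        moreover have "?cB c \<le> tgt c" if "c < q" "imem s4 53 c \<noteq> 0" for c
          using that vis[of c] False unfolding r4 r3 by (auto split: if_splits)
        ultimately show ?thesis using fr'' r4 by (simp add: P_def)
      qed
      have "(\<Sum>x<q. if imem s2 53 x = 0 then K x else 0) = K y + (\<Sum>x\<in>{..<q} - {y}. if imem s2 53 x = 0 then K x else 0)"
        using y r3 by (subst sum.remove[of _ y]) auto
      also have "(\<Sum>x\<in>{..<q} - {y}. if imem s2 53 x = 0 then K x else 0) = (\<Sum>x\<in>{..<q} - {y}. if imem s4 53 x = 0 then K x else 0)"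
        by (rule sum.cong) (auto simp: r4 r3)
      also have "\<dots> = (\<Sum>x<q. if imem s4 53 x = 0 then K x else 0)"
        using y r4 by (subst (2) sum.remove[of _ y]) auto
      finally have "\<phi> s4 + K y \<le> \<phi> s2" using st0 by (simp add: \<phi>_def)
      then have "\<phi> s4 + (t1 + (5 + t2)) + 1 + tcost (ILe (val 73) (INum 0)) \<le> \<phi> s2"
        using e1(2) e2(2) by (simp add: K_def)
      moreover have "exec G n \<I> ?body s2 (t1 + (5 + t2)) s4" using e1(1) e3 by (rule exec.Seq)
      ultimately show ?thesis using P4 by blast
    qed
  next
    fix s2 assume "P s2" "\<not> tval G n \<I> s2 (ILe (val 73) (INum 0))"
    then show "P s2 \<and> R s2" by (auto simp: P_def)
  qed
  have "runs search_path s T (\<lambda>s'. P s' \<and> R s')" unfolding search_path_def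
    by (rule runs_Seq[OF runs_search_init[OF static rows base_subset[OF B] m S(1) order_refl] loop])
      (use T2 in simp_all)
  then show ?thesis by (rule runs_mono) (auto simp: P_def R_def)
qed

end

section \<open>Augmentation\<close>

text \<open>The key of \<open>t\<close> is saved in real cell (3, 0) first, because the loop
  overwrites the potential of \<open>t\<close> itself.\<close>

definition augment_path :: "'g com" where
  "augment_path = (RStore 3 (INum 0) (RSub (RCell 2 (val 60)) (RCell 1 (val 60))) ;;
     for_loop 71 11 (Cond (ILe (INum 1) (ICell 53 (val 71))) (RStore 1 (val 71) (RCell 2 (val 71)))
       (RStore 1 (val 71) (RAdd (RCell 1 (val 71)) (RCell 3 (INum 0))))) ;;
     75 :== val 60 ;;
     While (TNot (eq_test (val 75) (val 70)))
       (IStore 50 (ICell 57 (val 75)) (INum 0) ;; IStore 50 (ICell 56 (val 75)) (INum 1) ;;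
        75 :== ICell 55 (val 75)) ;;
     IStore 51 (val 70) (IAdd (ICell 51 (val 70)) (INum 1)) ;;
     IStore 51 (val 60) (ISub (ICell 51 (val 60)) (INum 1)))"

definition find_deficit :: "'g com" where
  "find_deficit = (77 :== INum 0 ;; for_loop 71 11
     (Cond (less_test (ICell 51 (val 71)) (ICell 42 (val 71))) (70 :== val 71 ;; 77 :== INum 1) Skip))"

definition solve_step :: "'g com" where
  "solve_step = (find_deficit ;; Cond (ILe (val 77) (INum 0)) (76 :== INum 1)
     (search_path ;; Cond (ILe (INum 2) (val 73)) (76 :== INum 2) augment_path))"

definition solve_init :: "'g com" where
  "solve_init = (for_loop 29 0 (IStore 50 (val 29) (ICell 3 (val 29))) ;;
     for_loop 71 11 (IStore 51 (val 71) (ICell 30 (val 71)) ;; RStore 1 (val 71) (RCell 4 (INum 0))) ;;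
     76 :== INum 0)"

definition solve :: "'g com" where
  "solve = (solve_init ;; While (ILe (val 76) (INum 0)) solve_step)"

lemma class_count_swap:
  assumes "finite B" "f \<in> B" "e \<notin> B"
  shows "class_count cls (insert e (B - {f})) c + of_bool (c = cls f) = class_count cls B c + of_bool (c = cls e)"
proof -
  have "B = insert f (B - {f})" using assms by auto
  then have "class_count cls B = (class_count cls (B - {f}))(cls f := Suc (class_count cls (B - {f}) (cls f)))"
    using class_count_insert[of "B - {f}" f cls] assms by simp
  moreover have "class_count cls (insert e (B - {f})) =
      (class_count cls (B - {f}))(cls e := Suc (class_count cls (B - {f}) (cls e)))"
    by (rule class_count_insert) (use assms in auto)
  ultimately show ?thesis by auto
qed

context class_matroid
begin

text \<open>The usual dual update: every potential is raised by the smaller of the key of its class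
  and the key of \<open>t\<close>. Indices from \<open>q\<close> on keep their value since the
  program rewrites only the first \<open>q\<close> cells.\<close>

definition new_pot :: "(nat \<Rightarrow> real) \<Rightarrow> 'g state \<Rightarrow> nat \<Rightarrow> nat \<Rightarrow> real" where
  "new_pot p s t c = (if q \<le> c then p c else if imem s 53 c \<noteq> 0 then rmem s 2 c else p c + (rmem s 2 t - p t))"

text \<open>If the class of \<open>e\<close> is raised by the full amount, no class is raised more
  and the old optimality carries over. Otherwise that class was visited and is not \<open>t\<close>,
  its arcs to other classes have been dealt with, and \<open>covered\<close> is the required
  inequality; within one class the change cancels.\<close>

lemma new_pot_opt:
  assumes inv: "path_inv B p S {(t, z) |z. True} tm s" and opt: "is_opt_base \<I> (\<lambda>e. w e + p (cls e)) B"
    and t: "t < q" "imem s 53 t = tm" "tm \<noteq> 0"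
  shows "is_opt_base \<I> (\<lambda>e. w e + new_pot p s t (cls e)) B"
proof (rule local_opt_base)
  note D = path_invD[OF inv]
  show B: "is_base \<I> B" using opt by (simp add: is_opt_base_def)
  fix e f assume e: "e \<notin> B" "f \<in> B" "is_base \<I> (insert e (B - {f}))"
  define x y where "x = cls e" and "y = cls f"
  have ef: "e < n" "f < n" using e base_subset[OF e(3)] base_subset[OF B] by auto
  have xy: "x < q" "y < q" using cls ef by (simp_all add: x_def y_def)
  have ex: "exch B e f x y" using e ef by (simp add: exch_def x_def y_def)
  have le: "w f + p y \<le> w e + p x" by (rule exch_le[OF opt ex])
  let ?\<delta> = "rmem s 2 t - p t"
  have max: "rmem s 2 c - p c \<le> ?\<delta>" if "c < q" "imem s 53 c \<noteq> 0" for c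
    by (rule D(9)) (use that t D(1)[OF that(1)] D(7)[OF t(1)] in auto)
  then have upper: "new_pot p s t c \<le> p c + ?\<delta>" if "c < q" for c
    using that by (fastforce simp: new_pot_def)
  show "w f + new_pot p s t (cls f) \<le> w e + new_pot p s t (cls e)"
  proof (cases "imem s 53 x = 0 \<or> x = t")
    case True
    \<comment> \<open>At \<open>t\<close> the distance and the shifted potential coincide.\<close>
    then have "new_pot p s t x = p x + ?\<delta>" using xy t by (auto simp: new_pot_def)
    then show ?thesis using upper[OF xy(2)] le unfolding x_def[symmetric] y_def[symmetric] by linarith
  next
    case False
    show ?thesis
    proof (cases "x = y")
      case True
      then show ?thesis using le unfolding x_def[symmetric] y_def[symmetric] by simp
    next
      case neq: False
      then have c: "covered s x y e f" using D(8)[OF xy _ _ _ ex] False by auto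
      have "new_pot p s t y \<le> rmem s 2 y"
      proof (cases "imem s 53 y = 0")
        case True
        \<comment> \<open>\<open>y\<close> is reached but unvisited, so its key is at least that of
          \<open>t\<close>.\<close>
        have "?\<delta> \<le> rmem s 2 y - p y"
          by (rule D(9)) (use t xy True c in \<open>auto simp: covered_def\<close>)
        then show ?thesis using True xy by (simp add: new_pot_def)
      qed (use xy in \<open>simp add: new_pot_def\<close>)
      then show ?thesis using c False xy unfolding x_def[symmetric] y_def[symmetric]
        by (simp add: new_pot_def covered_def)
    qed
  qed
qed

text \<open>\<open>C\<close> is the base after the swaps from \<open>t\<close> back to
  \<open>y\<close>. Tightness is demanded for all classes visited no later than \<open>y\<close>,
  not just for those on the path, which avoids representing the path. The second quantified clause
  excludes shortcuts. Counts are compared additively so that \<open>y = t\<close> at the start needs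
  no special case.\<close>

definition chain_inv :: "(nat \<Rightarrow> real) \<Rightarrow> nat set \<Rightarrow> nat \<Rightarrow> nat \<Rightarrow> 'g state \<Rightarrow> nat set \<Rightarrow> nat \<Rightarrow> bool" where
  "chain_inv u B S t s C y \<longleftrightarrow> is_opt_base \<I> u C \<and> y < q \<and> imem s 53 y \<noteq> 0 \<and>
     (\<forall>z<q. imem s 53 z \<noteq> 0 \<longrightarrow> z \<noteq> S \<longrightarrow> imem s 53 z \<le> imem s 53 y \<longrightarrow>
        imem s 56 z \<notin> C \<and> imem s 57 z \<in> C \<and> tight u C (imem s 56 z) (imem s 57 z)) \<and>
     (\<forall>z<q. \<forall>z'<q. imem s 53 z \<noteq> 0 \<longrightarrow> z \<noteq> S \<longrightarrow> imem s 53 z \<le> imem s 53 y \<longrightarrow>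
        imem s 53 z' \<noteq> 0 \<longrightarrow> z' \<noteq> S \<longrightarrow> imem s 53 z' \<le> imem s 53 y \<longrightarrow>
        imem s 53 (imem s 55 z) < imem s 53 (imem s 55 z') \<longrightarrow> \<not> tight u C (imem s 56 z) (imem s 57 z')) \<and>
     (\<forall>c. class_count cls C c + of_bool (c = t) = class_count cls B c + of_bool (c = y))"

text \<open>On visited classes the new potential is the distance, so the recorded exchanges are
  tight by the equation in \<open>link\<close>, and the strict clause of \<open>path_inv\<close>
  says that exchanges from earlier predecessor classes are not.\<close>

lemma chain_inv_init:
  assumes inv: "path_inv B p S {(t, z) |z. True} tm s" and opt: "is_opt_base \<I> (\<lambda>e. w e + p (cls e)) B"
    and t: "t < q" "imem s 53 t = tm" "tm \<noteq> 0"
  shows "chain_inv (\<lambda>e. w e + new_pot p s t (cls e)) B S t s B t"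
proof -
  note D = path_invD[OF inv]
  let ?u = "\<lambda>e. w e + new_pot p s t (cls e)"
  have pot: "new_pot p s t c = rmem s 2 c" if "c < q" "imem s 53 c \<noteq> 0" for c
    using that by (simp add: new_pot_def)
  have L: "exch B (imem s 56 z) (imem s 57 z) (imem s 55 z) z \<and>
      rmem s 2 z = rmem s 2 (imem s 55 z) + w (imem s 56 z) - w (imem s 57 z) \<and>
      imem s 55 z < q \<and> imem s 53 (imem s 55 z) \<noteq> 0"
    if "z < q" "imem s 53 z \<noteq> 0" "z \<noteq> S" for z
    using D(6)[OF that(1) D(7)[OF that(1,2)] that(3)] by (simp add: link_def)
  have tight: "tight ?u B (imem s 56 z) (imem s 57 z)" if "z < q" "imem s 53 z \<noteq> 0" "z \<noteq> S" for z
    using L[OF that] pot[OF that(1,2)] pot[of "imem s 55 z"] by (simp add: tight_def exch_def)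
  have loose: "\<not> tight ?u B (imem s 56 z) (imem s 57 z')"
    if z: "z < q" "imem s 53 z \<noteq> 0" "z \<noteq> S" and z': "z' < q" "imem s 53 z' \<noteq> 0" "z' \<noteq> S"
      and lt: "imem s 53 (imem s 55 z) < imem s 53 (imem s 55 z')" for z z'
  proof
    assume t: "tight ?u B (imem s 56 z) (imem s 57 z')"
    have ex: "exch B (imem s 56 z) (imem s 57 z') (imem s 55 z) z'"
      using t L[OF z] L[OF z'] by (simp add: tight_def exch_def)
    have "rmem s 2 z' < rmem s 2 (imem s 55 z) + w (imem s 56 z) - w (imem s 57 z')"
      by (rule D(10)[OF _ z'(1) _ D(7)[OF z'(1,2)] z'(3) lt ex]) (use L[OF z] in auto)
    then show False
      using t L[OF z] L[OF z'] pot[OF z'(1,2)] pot[of "imem s 55 z"] by (simp add: tight_def exch_def)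
  qed
  show ?thesis unfolding chain_inv_def
    using new_pot_opt[OF inv opt t] t tight loose L by (auto simp: exch_def)
qed

text \<open>The exchanges still to come belong to classes visited no later than the predecessor of
  \<open>y\<close>, so their entering elements come from strictly earlier classes and are not tight
  with the leaving element of \<open>y\<close>. By \<open>tight_swap\<close> the swap at
  \<open>y\<close> then preserves their tightness and the absence of shortcuts.\<close>

lemma chain_inv_step:
  assumes C: "chain_inv u B S t s C y" and yS: "y \<noteq> S"
    and L: "\<And>z. z < q \<Longrightarrow> imem s 53 z \<noteq> 0 \<Longrightarrow> z \<noteq> S \<Longrightarrow> cls (imem s 56 z) = imem s 55 z \<and> cls (imem s 57 z) = z \<and>
      imem s 55 z < q \<and> imem s 53 (imem s 55 z) \<noteq> 0 \<and> imem s 53 (imem s 55 z) < imem s 53 z"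
  shows "chain_inv u B S t s (insert (imem s 56 y) (C - {imem s 57 y})) (imem s 55 y)"
proof -
  let ?e = "imem s 56 y" and ?f = "imem s 57 y" and ?y = "imem s 55 y"
  have opt: "is_opt_base \<I> u C" and y: "y < q" "imem s 53 y \<noteq> 0"
    and pairs: "\<And>z. z < q \<Longrightarrow> imem s 53 z \<noteq> 0 \<Longrightarrow> z \<noteq> S \<Longrightarrow> imem s 53 z \<le> imem s 53 y \<Longrightarrow>
        imem s 56 z \<notin> C \<and> imem s 57 z \<in> C \<and> tight u C (imem s 56 z) (imem s 57 z)"
    and loose: "\<And>z z'. z < q \<Longrightarrow> z' < q \<Longrightarrow> imem s 53 z \<noteq> 0 \<Longrightarrow> z \<noteq> S \<Longrightarrow> imem s 53 z \<le> imem s 53 y \<Longrightarrow>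
        imem s 53 z' \<noteq> 0 \<Longrightarrow> z' \<noteq> S \<Longrightarrow> imem s 53 z' \<le> imem s 53 y \<Longrightarrow>
        imem s 53 (imem s 55 z) < imem s 53 (imem s 55 z') \<Longrightarrow> \<not> tight u C (imem s 56 z) (imem s 57 z')"
    and cnt: "\<And>c. class_count cls C c + of_bool (c = t) = class_count cls B c + of_bool (c = y)"
    using C unfolding chain_inv_def by metis+
  note Ly = L[OF y yS] and py = pairs[OF y yS order_refl]
  have fin: "finite C" using opt base_finite by (auto simp: is_opt_base_def)
  have other: "imem s 56 z \<noteq> ?e \<and> imem s 57 z \<noteq> ?f \<and> imem s 56 z \<notin> C \<and> imem s 57 z \<in> C \<and> \<not> tight u C (imem s 56 z) ?f"
    if z: "z < q" "imem s 53 z \<noteq> 0" "z \<noteq> S" "imem s 53 z \<le> imem s 53 ?y" for z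
  proof -
    have lt: "imem s 53 (imem s 55 z) < imem s 53 ?y" "imem s 53 z < imem s 53 y"
      using L[OF z(1-3)] z(4) Ly by auto
    have "imem s 56 z \<noteq> ?e"
    proof
      assume "imem s 56 z = ?e"
      then have "imem s 55 z = ?y" using L[OF z(1-3)] Ly by metis
      then show False using lt by simp
    qed
    moreover have "imem s 57 z \<noteq> ?f"
    proof
      assume "imem s 57 z = ?f"
      then have "z = y" using L[OF z(1-3)] Ly by metis
      then show False using lt by simp
    qed
    moreover have "\<not> tight u C (imem s 56 z) ?f"
      by (rule loose[OF z(1) y(1) z(2,3) _ y(2) yS]) (use lt in auto)
    ultimately show ?thesis using pairs[OF z(1-3)] lt by simp
  qed
  have ts: "tight u (insert ?e (C - {?f})) (imem s 56 z) (imem s 57 z') \<longleftrightarrow> tight u C (imem s 56 z) (imem s 57 z')"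
    if "z < q" "imem s 53 z \<noteq> 0" "z \<noteq> S" "imem s 53 z \<le> imem s 53 ?y"
      "z' < q" "imem s 53 z' \<noteq> 0" "z' \<noteq> S" "imem s 53 z' \<le> imem s 53 ?y" for z z'
    by (rule tight_swap[OF opt]) (use other[OF that(1-4)] other[OF that(5-8)] py in auto)
  have le: "imem s 53 z \<le> imem s 53 y" if "imem s 53 z \<le> imem s 53 ?y" for z using that Ly by simp
  have "is_opt_base \<I> u (insert ?e (C - {?f}))" by (rule opt_base_tight_swap[OF opt]) (use py in auto)
  moreover have "imem s 56 z \<notin> insert ?e (C - {?f}) \<and> imem s 57 z \<in> insert ?e (C - {?f}) \<and>
      tight u (insert ?e (C - {?f})) (imem s 56 z) (imem s 57 z)"
    if "z < q" "imem s 53 z \<noteq> 0" "z \<noteq> S" "imem s 53 z \<le> imem s 53 ?y" for z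
    using ts[OF that that] other[OF that] pairs[OF that(1-3) le[OF that(4)]] by simp
  moreover have "\<not> tight u (insert ?e (C - {?f})) (imem s 56 z) (imem s 57 z')"
    if "z < q" "z' < q" "imem s 53 z \<noteq> 0" "z \<noteq> S" "imem s 53 z \<le> imem s 53 ?y"
      "imem s 53 z' \<noteq> 0" "z' \<noteq> S" "imem s 53 z' \<le> imem s 53 ?y"
      "imem s 53 (imem s 55 z) < imem s 53 (imem s 55 z')" for z z'
    using ts[of z z'] loose[of z z'] that le by simp
  moreover have "class_count cls (insert ?e (C - {?f})) c + of_bool (c = t) = class_count cls B c + of_bool (c = ?y)" for c
    using class_count_swap[OF fin, of ?f ?e cls c] cnt[of c] py Ly by simp
  ultimately show ?thesis unfolding chain_inv_def using Ly by blast
qed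

lemma runs_augment_path:
  assumes inv: "path_inv B p S {(t, z) |z. True} tm s" and opt: "is_opt_base \<I> (\<lambda>e. w e + p (cls e)) B"
    and t: "t < q" "imem s 53 t = tm" "tm \<noteq> 0" and S: "S < q" "S \<noteq> t" and static: "static s"
    and rows: "imem s 50 = mem_vec B" "imem s 51 = class_count cls B" "imem s 70 0 = S" "imem s 60 0 = t" "rmem s 1 = p"
    and T: "100 * (q + 1) + 50 \<le> T"
  shows "runs augment_path s T (\<lambda>s'. frame {50, 51, 71, 75} {} {1, 3} s s' \<and>
    (\<exists>C. imem s' 50 = mem_vec C \<and> imem s' 51 = class_count cls C \<and>
      is_opt_base \<I> (\<lambda>e. w e + rmem s' 1 (cls e)) C \<and>
      (\<forall>c. class_count cls C c + of_bool (c = t) = class_count cls B c + of_bool (c = S))))"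
proof -
  note D = path_invD[OF inv]
  define p' where "p' = new_pot p s t"
  let ?u = "\<lambda>e. w e + p' (cls e)"
  have st: "imem s 11 0 = q" using static by (simp add: static_def)
  have L: "cls (imem s 56 z) = imem s 55 z \<and> cls (imem s 57 z) = z \<and>
      imem s 55 z < q \<and> imem s 53 (imem s 55 z) \<noteq> 0 \<and> imem s 53 (imem s 55 z) < imem s 53 z"
    if "z < q" "imem s 53 z \<noteq> 0" "z \<noteq> S" for z
    using D(6)[OF that(1) D(7)[OF that(1,2)] that(3)] that(2) by (simp add: link_def exch_def)
  let ?s = "s\<lparr>rmem := store (rmem s) 3 0 (rmem s 2 t - p t)\<rparr>"
  let ?P = "\<lambda>i s'. frame {71} {} {1, 3} s s' \<and> rmem s' 3 0 = rmem s 2 t - p t \<and>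
      rmem s' 1 = (\<lambda>c. if c < i then p' c else p c)"
  have pots: "runs (for_loop 71 11 (Cond (ILe (INum 1) (ICell 53 (val 71))) (RStore 1 (val 71) (RCell 2 (val 71)))
       (RStore 1 (val 71) (RAdd (RCell 1 (val 71)) (RCell 3 (INum 0)))))) ?s (40 * (q + 1))
       (\<lambda>s'. frame {71} {} {1, 3} s s' \<and> rmem s' 1 = p')"
  proof (rule runs_for[where m = q and t = 20 and P = ?P])
    fix i s1 assume i: "i < q" "imem s1 71 0 = i" and P: "?P i s1"
    have fr: "frame {71} {} {1, 3} s s1" and r1: "rmem s1 1 = (\<lambda>c. if c < i then p' c else p c)"
      and r3: "rmem s1 3 0 = rmem s 2 t - p t" using P by blast+
    have r: "imem s1 53 = imem s 53" "rmem s1 2 = rmem s 2" by (simp_all add: frameD[OF fr])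
    have e: "Suc 0 \<le> x \<longleftrightarrow> x \<noteq> 0" for x :: nat by auto
    have "(\<lambda>c. if c < Suc i then p' c else p c) = (\<lambda>c. if c < i then p' c else p c)(i := p' i)"
      by (auto simp: fun_eq_iff less_Suc_eq)
    then show "runs (Cond (ILe (INum 1) (ICell 53 (val 71))) (RStore 1 (val 71) (RCell 2 (val 71)))
       (RStore 1 (val 71) (RAdd (RCell 1 (val 71)) (RCell 3 (INum 0))))) s1 20 (\<lambda>s'. ?P (Suc i) s' \<and> imem s' 71 0 = i)"
      using fr r1[unfolded One_nat_def] r3 i by (simp add: r store_row e) (simp add: p'_def new_pot_def)
  next
    fix s1 assume P: "?P q s1"
    have "(\<lambda>c. if c < q then p' c else p c) = p'" by (auto simp: fun_eq_iff p'_def new_pot_def)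
    then show "frame {71} {} {1, 3} s s1 \<and> rmem s1 1 = p'" using P by simp
  qed (use st rows in \<open>auto simp: store_row frame_def\<close>)
  \<comment> \<open>Visiting times decrease from a class to its predecessor, so the classes visited
    no later than the current one bound the rest of the walk.\<close>
  define \<phi> where "\<phi> s' = 40 * card {z. z < q \<and> imem s 53 z \<noteq> 0 \<and> imem s 53 z \<le> imem s 53 (imem s' 75 0)}" for s' :: "'g state"
  have walk: "runs (While (TNot (eq_test (val 75) (val 70)))
       (IStore 50 (ICell 57 (val 75)) (INum 0) ;; IStore 50 (ICell 56 (val 75)) (INum 1) ;; 75 :== ICell 55 (val 75))) s2
       (40 * q + 20) (\<lambda>s'. frame {50, 75} {} {} s2 s' \<and> (\<exists>C. imem s' 50 = mem_vec C \<and> chain_inv ?u B S t s C S))"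
    if s2: "frame {71, 75} {} {1, 3} s s2 \<and> imem s2 75 0 = t" for s2
  proof -
    note fr2 = s2[THEN conjunct1]
    define P where "P s' \<longleftrightarrow> frame {50, 75} {} {} s2 s' \<and> (\<exists>C. imem s' 50 = mem_vec C \<and> chain_inv ?u B S t s C (imem s' 75 0))" for s'
    show ?thesis
    proof (rule runs_While[where P = P and \<phi> = \<phi>])
      show "P s2" using chain_inv_init[OF inv opt t] s2 rows(1) by (auto simp: P_def p'_def frameD[OF fr2])
      have "card {z. z < q \<and> imem s 53 z \<noteq> 0 \<and> imem s 53 z \<le> imem s 53 (imem s2 75 0)} \<le> card {..<q}"
        by (rule card_mono) auto
      then show "\<phi> s2 + 1 + tcost (TNot (eq_test (val 75) (val 70))) \<le> 40 * q + 20"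
        by (simp add: \<phi>_def)
    next
      fix s3 assume P: "P s3" and b: "tval G n \<I> s3 (TNot (eq_test (val 75) (val 70)))"
      have fr3: "frame {50, 75} {} {} s2 s3" using P by (simp add: P_def)
      define y where "y = imem s3 75 0"
      obtain C where C: "imem s3 50 = mem_vec C" and ch: "chain_inv ?u B S t s C y"
        using P by (auto simp: P_def y_def)
      have r: "imem s3 55 = imem s 55" "imem s3 56 = imem s 56" "imem s3 57 = imem s 57" "imem s3 70 0 = S"
        using rows by (simp_all add: frameD[OF fr3] frameD[OF fr2])
      have yS: "y \<noteq> S" using b r by (auto simp: y_def)
      have y: "y < q" "imem s 53 y \<noteq> 0" using ch by (simp_all add: chain_inv_def)
      note step = chain_inv_step[OF ch yS L]
      let ?A = "\<lambda>y. {z. z < q \<and> imem s 53 z \<noteq> 0 \<and> imem s 53 z \<le> imem s 53 y}"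
      have V: "imem s 53 (imem s 55 y) < imem s 53 y" using L[OF y yS] by blast
      have "?A (imem s 55 y) \<subseteq> ?A y" using V by auto
      moreover have "y \<in> ?A y" "y \<notin> ?A (imem s 55 y)" using V y by simp_all
      ultimately have "?A (imem s 55 y) \<subset> ?A y" by blast
      then have "card (?A (imem s 55 y)) < card (?A y)" by (rule psubset_card_mono[rotated]) simp
      then have dec: "40 * card (?A (imem s 55 y)) + 28 \<le> 40 * card (?A y)" by simp
      let ?C = "insert (imem s 56 y) (C - {imem s 57 y})"
      let ?s4 = "s3\<lparr>imem := store (store (store (imem s3) 50 (imem s 57 y) 0) 50 (imem s 56 y) 1) 75 0 (imem s 55 y)\<rparr>"
      have "imem ?s4 50 = mem_vec ?C" using C by (simp add: store_row mem_vec_upd)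
      moreover have "imem ?s4 75 0 = imem s 55 y" "frame {50, 75} {} {} s2 ?s4" using fr3 by (simp_all add: store_row)
      ultimately have "P ?s4" using step unfolding P_def by auto
      moreover have "\<phi> ?s4 + 28 \<le> \<phi> s3" using dec by (simp add: \<phi>_def store_row y_def[symmetric])
      ultimately have "runs (IStore 50 (ICell 57 (val 75)) (INum 0) ;; IStore 50 (ICell 56 (val 75)) (INum 1) ;; 75 :== ICell 55 (val 75))
          s3 15 (\<lambda>s'. P s' \<and> \<phi> s' + 15 + 1 + tcost (TNot (eq_test (val 75) (val 70))) \<le> \<phi> s3)"
        by (simp add: store_row r y_def[symmetric])
      then show "\<exists>t. runs (IStore 50 (ICell 57 (val 75)) (INum 0) ;; IStore 50 (ICell 56 (val 75)) (INum 1) ;; 75 :== ICell 55 (val 75))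
          s3 t (\<lambda>s'. P s' \<and> \<phi> s' + t + 1 + tcost (TNot (eq_test (val 75) (val 70))) \<le> \<phi> s3)" by blast
    next
      fix s3 assume P: "P s3" and b: "\<not> tval G n \<I> s3 (TNot (eq_test (val 75) (val 70)))"
      have fr3: "frame {50, 75} {} {} s2 s3" using P by (simp add: P_def)
      have "imem s3 70 0 = S" using rows by (simp add: frameD[OF fr3] frameD[OF fr2])
      then have "imem s3 75 0 = S" using b by auto
      then show "frame {50, 75} {} {} s2 s3 \<and> (\<exists>C. imem s3 50 = mem_vec C \<and> chain_inv ?u B S t s C S)"
        using P by (auto simp: P_def)
    qed
  qed
  have counts: "runs (IStore 51 (val 70) (IAdd (ICell 51 (val 70)) (INum 1)) ;;
     IStore 51 (val 60) (ISub (ICell 51 (val 60)) (INum 1))) s3 30 (\<lambda>s'. frame {50, 51, 71, 75} {} {1, 3} s s' \<and>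
    (\<exists>C. imem s' 50 = mem_vec C \<and> imem s' 51 = class_count cls C \<and>
      is_opt_base \<I> (\<lambda>e. w e + rmem s' 1 (cls e)) C \<and>
      (\<forall>c. class_count cls C c + of_bool (c = t) = class_count cls B c + of_bool (c = S))))"
    if s2: "frame {71, 75} {} {1, 3} s s2 \<and> rmem s2 1 = p'"
      and s3: "frame {50, 75} {} {} s2 s3 \<and> (\<exists>C. imem s3 50 = mem_vec C \<and> chain_inv ?u B S t s C S)" for s2 s3
  proof -
    note fr2 = s2[THEN conjunct1] and fr3 = s3[THEN conjunct1]
    obtain C where C: "imem s3 50 = mem_vec C" and ch: "chain_inv ?u B S t s C S" using s3 by blast
    have r: "imem s3 51 = class_count cls B" "imem s3 70 0 = S" "imem s3 60 0 = t" "rmem s3 1 = p'"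
      using rows s2 by (simp_all add: frameD[OF fr3] frameD[OF fr2])
    have "frame {50, 51, 71, 75} {} {1, 3} s s2" by (rule frame_mono[OF fr2]) auto
    moreover have "frame {50, 51, 71, 75} {} {1, 3} s2 s3" by (rule frame_mono[OF fr3]) auto
    ultimately have fr: "frame {50, 51, 71, 75} {} {1, 3} s s3" by (rule frame_trans)
    have cnt: "\<And>c. class_count cls C c + of_bool (c = t) = class_count cls B c + of_bool (c = S)"
      and op: "is_opt_base \<I> ?u C" using ch by (simp_all add: chain_inv_def)
    \<comment> \<open>The truncated decrement is exact: \<open>cnt\<close> at \<open>t\<close>
      forces a positive count in \<open>B\<close>, since \<open>S \<noteq> t\<close>.\<close>
    have new: "(class_count cls B)(S := Suc (class_count cls B S), t := class_count cls B t - Suc 0) = class_count cls C"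
    proof
      fix c show "((class_count cls B)(S := Suc (class_count cls B S), t := class_count cls B t - Suc 0)) c = class_count cls C c"
        using cnt[of c] S by (cases "c = t"; cases "c = S") auto
    qed
    have "\<exists>D. imem s3 50 = mem_vec D \<and> class_count cls C = class_count cls D \<and>
      is_opt_base \<I> (\<lambda>e. w e + rmem s3 1 (cls e)) D \<and>
      (\<forall>c. class_count cls D c + of_bool (c = t) = class_count cls B c + of_bool (c = S))"
      using C op cnt unfolding r(4) by blast
    then show ?thesis using fr S by (simp add: store_row r(1-3) new)
  qed
  let ?W = "While (TNot (eq_test (val 75) (val 70)))
       (IStore 50 (ICell 57 (val 75)) (INum 0) ;; IStore 50 (ICell 56 (val 75)) (INum 1) ;; 75 :== ICell 55 (val 75))"
  let ?K = "IStore 51 (val 70) (IAdd (ICell 51 (val 70)) (INum 1)) ;;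
     IStore 51 (val 60) (ISub (ICell 51 (val 60)) (INum 1)) :: 'g com"
  define Q where "Q = (\<lambda>s'. frame {50, 51, 71, 75} {} {1, 3} s s' \<and>
    (\<exists>C. imem s' 50 = mem_vec C \<and> imem s' 51 = class_count cls C \<and>
      is_opt_base \<I> (\<lambda>e. w e + rmem s' 1 (cls e)) C \<and>
      (\<forall>c. class_count cls C c + of_bool (c = t) = class_count cls B c + of_bool (c = S))))"
  have tail: "runs (75 :== val 60 ;; ?W ;; ?K) s1 (40 * q + 60) Q"
    if s1: "frame {71} {} {1, 3} s s1 \<and> rmem s1 1 = p'" for s1
  proof -
    note fr1 = s1[THEN conjunct1]
    let ?s2 = "s1\<lparr>imem := store (imem s1) 75 0 t\<rparr>"
    have "frame {71, 75} {} {1, 3} s s1" by (rule frame_mono[OF fr1]) auto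
    then have s2: "frame {71, 75} {} {1, 3} s ?s2 \<and> imem ?s2 75 0 = t" "frame {71, 75} {} {1, 3} s ?s2 \<and> rmem ?s2 1 = p'"
      using s1 by (simp_all add: store_row)
    have "runs (?W ;; ?K) ?s2 (56 + 40 * q) Q"
      unfolding Q_def by (rule runs_Seq[OF walk[OF s2(1)] counts[OF s2(2)]]) simp_all
    moreover have "imem s1 60 0 = t" using rows by (simp add: frameD[OF fr1])
    ultimately show ?thesis by simp
  qed
  have "runs (for_loop 71 11 (Cond (ILe (INum 1) (ICell 53 (val 71))) (RStore 1 (val 71) (RCell 2 (val 71)))
       (RStore 1 (val 71) (RAdd (RCell 1 (val 71)) (RCell 3 (INum 0))))) ;; 75 :== val 60 ;; ?W ;; ?K) ?s (T - 9) Q"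
    by (rule runs_Seq[OF pots tail]) (use T in simp_all)
  moreover have "9 \<le> T" using T by simp
  ultimately show ?thesis unfolding augment_path_def Q_def[symmetric] using rows(5)[unfolded One_nat_def] rows(4) by simp
qed

section \<open>Repairs until the target counts are met\<close>

definition solve_frame :: "nat set" where
  "solve_frame = search_frame \<union> {50, 51, 70, 75, 76, 77}"

lemma class_count_eq_0: "B \<subseteq> {..<n} \<Longrightarrow> q \<le> c \<Longrightarrow> class_count cls B c = 0"
proof -
  assume "B \<subseteq> {..<n}" "q \<le> c"
  then have "{e \<in> B. cls e = c} = {}" using cls by fastforce
  then show ?thesis by (simp only: class_count_def card.empty)
qed

lemma opt_base_cong:
  assumes "\<And>e. e < n \<Longrightarrow> u e = u' e"
  shows "is_opt_base \<I> u B \<longleftrightarrow> is_opt_base \<I> u' B"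
proof -
  have "sum u D = sum u' D" if "is_base \<I> D" for D
    by (rule sum.cong) (use base_subset[OF that] assms in auto)
  then show ?thesis by (auto simp: is_opt_base_def)
qed

lemma runs_find_deficit:
  assumes q: "imem s 11 0 = q" and T: "40 * (q + 1) \<le> T"
  shows "runs find_deficit s T (\<lambda>s'. frame {70, 71, 77} {} {} s s' \<and>
    (imem s' 77 0 = 0 \<longrightarrow> (\<forall>c<q. imem s 42 c \<le> imem s 51 c)) \<and>
    (imem s' 77 0 \<noteq> 0 \<longrightarrow> imem s' 70 0 < q \<and> imem s 51 (imem s' 70 0) < imem s 42 (imem s' 70 0)))"
proof -
  let ?P = "\<lambda>i s'. frame {70, 71, 77} {} {} s s' \<and>
    (imem s' 77 0 = 0 \<longrightarrow> (\<forall>c<i. imem s 42 c \<le> imem s 51 c)) \<and>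
    (imem s' 77 0 \<noteq> 0 \<longrightarrow> imem s' 70 0 < q \<and> imem s 51 (imem s' 70 0) < imem s 42 (imem s' 70 0))"
  have "runs (for_loop 71 11 (Cond (less_test (ICell 51 (val 71)) (ICell 42 (val 71))) (70 :== val 71 ;; 77 :== INum 1) Skip))
      (s\<lparr>imem := store (imem s) 77 0 0\<rparr>) (T - 3) (?P q)"
  proof (rule runs_for[where m = q and t = 20 and P = ?P])
    fix i s1 assume i: "i < q" "imem s1 71 0 = i" and P: "?P i s1"
    have fr: "frame {70, 71, 77} {} {} s s1" using P by blast
    have r: "imem s1 51 = imem s 51" "imem s1 42 = imem s 42" by (simp_all add: frameD[OF fr])
    show "runs (Cond (less_test (ICell 51 (val 71)) (ICell 42 (val 71))) (70 :== val 71 ;; 77 :== INum 1) Skip)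
        s1 20 (\<lambda>s'. ?P (Suc i) s' \<and> imem s' 71 0 = i)"
      using P i by (auto simp: r store_row less_Suc_eq)
  qed (use q T in \<open>auto simp: store_row frame_def\<close>)
  then show ?thesis unfolding find_deficit_def using T by simp
qed

lemma runs_solve_init:
  assumes static: "static s" and rows: "imem s 3 = mem_vec A" "A \<subseteq> {..<n}" "imem s 30 = class_count cls A" "rmem s 4 0 = 0"
    and zero: "\<forall>e\<ge>n. imem s 50 e = 0" "\<forall>c\<ge>q. imem s 51 c = 0" and T: "40 * (n + 1) + 40 * (q + 1) \<le> T"
  shows "runs solve_init s T (\<lambda>s'. frame {29, 50, 51, 71, 76} {} {1} s s' \<and> imem s' 50 = mem_vec A \<and>
    imem s' 51 = class_count cls A \<and> imem s' 76 0 = 0 \<and> (\<forall>c<q. rmem s' 1 c = 0))"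
proof -
  have st: "imem s 0 0 = n" "imem s 11 0 = q" using static by (simp_all add: static_def)
  have c1: "runs (for_loop 29 0 (IStore 50 (val 29) (ICell 3 (val 29)))) s (20 * (n + 1))
      (\<lambda>s'. frame {29, 50} {} {} s s' \<and> imem s' 50 = mem_vec A)"
  proof (rule runs_for[where m = n and t = 6 and
        P = "\<lambda>i s'. frame {29, 50} {} {} s s' \<and> (\<forall>e. e < i \<or> n \<le> e \<longrightarrow> imem s' 50 e = mem_vec A e)"])
    fix s' assume P: "frame {29, 50} {} {} s s' \<and> (\<forall>e. e < n \<or> n \<le> e \<longrightarrow> imem s' 50 e = mem_vec A e)"
    then have "imem s' 50 e = mem_vec A e" for e using linorder_not_le by blast
    then show "frame {29, 50} {} {} s s' \<and> imem s' 50 = mem_vec A" using P by auto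
  next
    show "frame {29, 50} {} {} s s \<and> (\<forall>e. e < 0 \<or> n \<le> e \<longrightarrow> imem s 50 e = mem_vec A e)"
      using zero rows(2) by (auto simp: mem_vec_def)
  qed (use st rows in \<open>auto simp: store_row frame_def\<close>)
  have c2: "runs (for_loop 71 11 (IStore 51 (val 71) (ICell 30 (val 71)) ;; RStore 1 (val 71) (RCell 4 (INum 0)))) s1
      (30 * (q + 1)) (\<lambda>s'. frame {51, 71} {} {1} s1 s' \<and> imem s' 51 = class_count cls A \<and> (\<forall>c<q. rmem s' 1 c = 0))"
    if s1: "frame {29, 50} {} {} s s1 \<and> imem s1 50 = mem_vec A" for s1
  proof (rule runs_for[where m = q and t = 12 and P = "\<lambda>i s'. frame {51, 71} {} {1} s1 s' \<and>
      (\<forall>c. c < i \<or> q \<le> c \<longrightarrow> imem s' 51 c = class_count cls A c) \<and> (\<forall>c<i. rmem s' 1 c = 0)"])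
    note fr1 = s1[THEN conjunct1]
    have r: "imem s1 51 = imem s 51" "imem s1 30 = class_count cls A" "rmem s1 4 0 = 0" "imem s1 11 0 = q"
      using rows st by (simp_all add: frameD[OF fr1])
    show "frame {51, 71} {} {1} s1 s1 \<and> (\<forall>c. c < 0 \<or> q \<le> c \<longrightarrow> imem s1 51 c = class_count cls A c) \<and> (\<forall>c<0. rmem s1 1 c = 0)"
      using zero class_count_eq_0[OF rows(2)] by (simp add: r)
    fix s' assume P: "frame {51, 71} {} {1} s1 s' \<and>
      (\<forall>c. c < q \<or> q \<le> c \<longrightarrow> imem s' 51 c = class_count cls A c) \<and> (\<forall>c<q. rmem s' 1 c = 0)"
    then have "imem s' 51 c = class_count cls A c" for c using linorder_not_le by blast
    then show "frame {51, 71} {} {1} s1 s' \<and> imem s' 51 = class_count cls A \<and> (\<forall>c<q. rmem s' 1 c = 0)" using P by auto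
  next
    note fr1 = s1[THEN conjunct1]
    have r: "imem s1 11 0 = q" using st by (simp add: frameD[OF fr1])
    show "imem s' 11 0 = q" if "frame {51, 71} {} {1} s1 s' \<and>
      (\<forall>c. c < i \<or> q \<le> c \<longrightarrow> imem s' 51 c = class_count cls A c) \<and> (\<forall>c<i. rmem s' 1 c = 0)" for i s'
      using that r by (simp add: frame_def)
  next
    note fr1 = s1[THEN conjunct1]
    fix i s2 assume i: "i < q" "imem s2 71 0 = i" and P: "frame {51, 71} {} {1} s1 s2 \<and>
      (\<forall>c. c < i \<or> q \<le> c \<longrightarrow> imem s2 51 c = class_count cls A c) \<and> (\<forall>c<i. rmem s2 1 c = 0)"
    note fr2 = P[THEN conjunct1]
    have r: "imem s2 30 = class_count cls A" "rmem s2 4 0 = 0"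
      using rows by (simp_all add: frameD[OF fr2] frameD[OF fr1])
    show "runs (IStore 51 (val 71) (ICell 30 (val 71)) ;; RStore 1 (val 71) (RCell 4 (INum 0))) s2 12
        (\<lambda>s'. (frame {51, 71} {} {1} s1 s' \<and> (\<forall>c. c < Suc i \<or> q \<le> c \<longrightarrow> imem s' 51 c = class_count cls A c) \<and>
           (\<forall>c<Suc i. rmem s' 1 c = 0)) \<and> imem s' 71 0 = i)"
      using P i by (auto simp: store_row r less_Suc_eq)
  qed (auto simp: store_row frame_def)
  have c3: "runs (for_loop 71 11 (IStore 51 (val 71) (ICell 30 (val 71)) ;; RStore 1 (val 71) (RCell 4 (INum 0))) ;;
      76 :== INum 0) s1 (30 * (q + 1) + 5) (\<lambda>s'. frame {29, 50, 51, 71, 76} {} {1} s s' \<and> imem s' 50 = mem_vec A \<and>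
    imem s' 51 = class_count cls A \<and> imem s' 76 0 = 0 \<and> (\<forall>c<q. rmem s' 1 c = 0))"
    if s1: "frame {29, 50} {} {} s s1 \<and> imem s1 50 = mem_vec A" for s1
  proof (rule runs_Seq[OF c2[OF s1], where Td = 5])
    fix s2 assume s2: "frame {51, 71} {} {1} s1 s2 \<and> imem s2 51 = class_count cls A \<and> (\<forall>c<q. rmem s2 1 c = 0)"
    note fr1 = s1[THEN conjunct1] and fr2 = s2[THEN conjunct1]
    have "frame {29, 50, 51, 71, 76} {} {1} s s1" by (rule frame_mono[OF fr1]) auto
    moreover have "frame {29, 50, 51, 71, 76} {} {1} s1 s2" by (rule frame_mono[OF fr2]) auto
    ultimately have "frame {29, 50, 51, 71, 76} {} {1} s s2" by (rule frame_trans)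
    then show "runs (76 :== INum 0) s2 5 (\<lambda>s'. frame {29, 50, 51, 71, 76} {} {1} s s' \<and> imem s' 50 = mem_vec A \<and>
      imem s' 51 = class_count cls A \<and> imem s' 76 0 = 0 \<and> (\<forall>c<q. rmem s' 1 c = 0))"
      using s1 s2 by (simp add: store_row frameD[OF fr2])
  qed simp
  show ?thesis unfolding solve_init_def by (rule runs_Seq[OF c1 c3]) (use T in simp_all)
qed

lemma runs_solve:
  assumes static: "static s" and A: "is_opt_base \<I> w A"
    and rows: "imem s 3 = mem_vec A" "imem s 30 = class_count cls A" "rmem s 4 0 = 0" "imem s 42 = tgt"
    and zero: "\<forall>e\<ge>n. imem s 50 e = 0" "\<forall>c\<ge>q. imem s 51 c = 0" "\<forall>e\<ge>n. imem s 52 e = 0"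
    and tgt: "(\<Sum>c<q. tgt c) = card A"
    and T: "((\<Sum>c<q. tgt c - class_count cls A c) + 1) * (190 * (q * n) + 800 * (q + 1) * (q + 1) + 60 * (n + 1)) +
      60 * (n + 1) + 50 * (q + 1) \<le> T"
  shows "runs solve s T (\<lambda>s'. frame solve_frame {} {1, 2, 3} s s' \<and>
    (\<forall>e\<ge>n. imem s' 50 e = 0) \<and> (\<forall>c\<ge>q. imem s' 51 c = 0) \<and> (\<forall>e\<ge>n. imem s' 52 e = 0) \<and>
    (imem s' 76 0 = 1 \<and> (\<exists>B. imem s' 50 = mem_vec B \<and> is_base \<I> B \<and> (\<forall>c<q. class_count cls B c = tgt c) \<and>
       (\<forall>B'. is_base \<I> B' \<longrightarrow> (\<forall>c<q. class_count cls B' c = tgt c) \<longrightarrow> sum w B \<le> sum w B')) \<or>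
     imem s' 76 0 = 2 \<and> (\<forall>B'. is_base \<I> B' \<longrightarrow> (\<exists>c<q. class_count cls B' c \<noteq> tgt c))))"
proof -
  have bA: "is_base \<I> A" using A by (simp add: is_opt_base_def)
  let ?W = "190 * (q * n) + 800 * (q + 1) * (q + 1) + 60 * (n + 1)"
  \<comment> \<open>The total deficit. A repair lowers it by exactly one, because the class that
    loses an element had surplus.\<close>
  define \<mu> where "\<mu> s' = (\<Sum>c<q. tgt c - imem s' 51 c)" for s' :: "'g state"
  define \<phi> where "\<phi> s' = (if imem s' 76 0 = 0 then (\<mu> s' + 1) * ?W else 0)" for s' :: "'g state"
  define R where "R s' \<longleftrightarrow> (imem s' 76 0 = 1 \<and> (\<exists>B. imem s' 50 = mem_vec B \<and> is_base \<I> B \<and> (\<forall>c<q. class_count cls B c = tgt c) \<and>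
       (\<forall>B'. is_base \<I> B' \<longrightarrow> (\<forall>c<q. class_count cls B' c = tgt c) \<longrightarrow> sum w B \<le> sum w B')) \<or>
     imem s' 76 0 = 2 \<and> (\<forall>B'. is_base \<I> B' \<longrightarrow> (\<exists>c<q. class_count cls B' c \<noteq> tgt c)))" for s' :: "'g state"
  define P where "P s' \<longleftrightarrow> frame solve_frame {} {1, 2, 3} s s' \<and> (\<forall>e\<ge>n. imem s' 52 e = 0) \<and>
     (\<exists>B. imem s' 50 = mem_vec B \<and> imem s' 51 = class_count cls B \<and> is_opt_base \<I> (\<lambda>e. w e + rmem s' 1 (cls e)) B) \<and>
     (imem s' 76 0 = 0 \<or> R s')" for s'
  have loop: "runs (While (ILe (val 76) (INum 0)) solve_step) s1
      (((\<Sum>c<q. tgt c - class_count cls A c) + 1) * ?W + 10) (\<lambda>s'. P s' \<and> R s')"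
    if s1: "frame {29, 50, 51, 71, 76} {} {1} s s1 \<and> imem s1 50 = mem_vec A \<and>
    imem s1 51 = class_count cls A \<and> imem s1 76 0 = 0 \<and> (\<forall>c<q. rmem s1 1 c = 0)" for s1
  proof (rule runs_While_exec[where P = P and \<phi> = \<phi>])
    note fr1 = s1[THEN conjunct1]
    have "frame solve_frame {} {1, 2, 3} s s1"
      by (rule frame_mono[OF fr1]) (auto simp: solve_frame_def search_frame_def)
    moreover have "is_opt_base \<I> (\<lambda>e. w e + rmem s1 1 (cls e)) A"
      using A s1 cls by (subst opt_base_cong[where u' = w]) auto
    moreover have "\<forall>e\<ge>n. imem s1 52 e = 0" using zero by (simp add: frameD[OF fr1])
    ultimately show "P s1" using s1 by (auto simp: P_def)
    show "\<phi> s1 + 1 + tcost (ILe (val 76) (INum 0)) \<le> ((\<Sum>c<q. tgt c - class_count cls A c) + 1) * ?W + 10"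
      using s1 by (simp add: \<phi>_def \<mu>_def)
  next
    fix s2 assume P: "P s2" and b: "tval G n \<I> s2 (ILe (val 76) (INum 0))"
    have z: "imem s2 76 0 = 0" using b by simp
    have fr: "frame solve_frame {} {1, 2, 3} s s2" and m: "\<forall>e\<ge>n. imem s2 52 e = 0" using P by (simp_all add: P_def)
    define p where "p = rmem s2 1"
    obtain B where B: "imem s2 50 = mem_vec B" "imem s2 51 = class_count cls B" "is_opt_base \<I> (\<lambda>e. w e + p (cls e)) B"
      using P by (auto simp: P_def p_def)
    have bB: "is_base \<I> B" using B by (simp add: is_opt_base_def)
    have static2: "static s2" by (rule static_frame[OF static fr]) (auto simp: solve_frame_def search_frame_def)
    have t2: "imem s2 42 = tgt" using rows by (simp add: frameD[OF fr] solve_frame_def search_frame_def)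
    have q2: "imem s2 11 0 = q" using static2 by (simp add: static_def)
    obtain t1 s3 where e1: "exec G n \<I> find_deficit s2 t1 s3" "t1 \<le> 40 * (q + 1)" and fd:
      "frame {70, 71, 77} {} {} s2 s3 \<and>
      (imem s3 77 0 = 0 \<longrightarrow> (\<forall>c<q. imem s2 42 c \<le> imem s2 51 c)) \<and>
      (imem s3 77 0 \<noteq> 0 \<longrightarrow> imem s3 70 0 < q \<and> imem s2 51 (imem s3 70 0) < imem s2 42 (imem s3 70 0))"
      by (rule runsE[OF runs_find_deficit[OF q2 order_refl]])
    note fr3 = fd[THEN conjunct1]
    have "frame solve_frame {} {1, 2, 3} s2 s3"
      by (rule frame_mono[OF fr3]) (auto simp: solve_frame_def search_frame_def)
    with fr have fr': "frame solve_frame {} {1, 2, 3} s s3" by (rule frame_trans)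
    have r3: "imem s3 50 = mem_vec B" "imem s3 51 = class_count cls B" "rmem s3 1 = p" "imem s3 42 = tgt"
      "\<forall>e\<ge>n. imem s3 52 e = 0" "imem s3 76 0 = 0"
      using B t2 m z by (simp_all add: frameD[OF fr3] p_def)
    have static3: "static s3" by (rule static_frame[OF static fr']) (auto simp: solve_frame_def search_frame_def)
    have \<phi>2: "\<phi> s2 = ((\<Sum>c<q. tgt c - class_count cls B c) + 1) * ?W" by (simp add: \<phi>_def \<mu>_def z B)
    show "\<exists>t s'. exec G n \<I> solve_step s2 t s' \<and> P s' \<and> \<phi> s' + t + 1 + tcost (ILe (val 76) (INum 0)) \<le> \<phi> s2"
    proof (cases "imem s3 77 0 = 0")
      case True
      let ?s4 = "s3\<lparr>imem := store (imem s3) 76 0 1\<rparr>"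
      have e2: "exec G n \<I> solve_step s2 (t1 + (5 + 3)) ?s4" unfolding solve_step_def
        by (rule exec.Seq[OF e1(1)]) (use True in \<open>simp add: exec_Cond exec_IStore\<close>)
      have ge: "\<And>c. c < q \<Longrightarrow> tgt c \<le> class_count cls B c" using fd True t2 B by simp
      have "(\<Sum>c<q. class_count cls B c) = card B"
        by (rule sum_class_count) (use base_finite[OF bB] base_subset[OF bB] cls in auto)
      then have sums: "(\<Sum>c<q. tgt c) = (\<Sum>c<q. class_count cls B c)" using tgt base_card[OF bA bB] by simp
      \<comment> \<open>No class is deficient and both count vectors sum to the size of a base, so
        there is no surplus either.\<close>
      have eq: "class_count cls B c = tgt c" if "c < q" for c
        using sum_mono_inv[OF sums, of c] ge that by simp
      have "sum w B \<le> sum w B'" if B': "is_base \<I> B'" "\<forall>c<q. class_count cls B' c = tgt c" for B'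
        by (rule opt_base_potential[where w = w and p = p and cls = cls and Q = "{..<q}"])
          (use B(3) eq B' cls in \<open>auto simp: class_count_def\<close>)
      then have "R ?s4" using eq bB r3 by (auto simp: R_def store_row)
      moreover have "frame solve_frame {} {1, 2, 3} s ?s4" using fr' by (simp add: solve_frame_def)
      ultimately have "P ?s4" using r3 B(3) by (auto simp: P_def store_row)
      moreover have "\<phi> ?s4 + (t1 + (5 + 3)) + 1 + tcost (ILe (val 76) (INum 0)) \<le> \<phi> s2"
        using e1(2) unfolding \<phi>2 by (simp add: \<phi>_def store_row algebra_simps)
      ultimately show ?thesis using e2 by blast
    next
      case False
      define S where "S = imem s3 70 0"
      have S: "S < q" "class_count cls B S < tgt S" using fd False t2 B by (simp_all add: S_def)
      obtain t4 s4 where e4: "exec G n \<I> search_path s3 t4 s4" "t4 \<le> 190 * (q * n) + 500 * (q + 1) * (q + 1) + 60 * (n + 1)"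
        and sp: "frame search_frame {} {2, 3} s3 s4 \<and> imem s4 52 = mem_vec B \<and>
    (imem s4 73 0 = 1 \<and> imem s4 60 0 < q \<and> tgt (imem s4 60 0) < class_count cls B (imem s4 60 0) \<and>
       imem s4 72 0 \<noteq> 0 \<and> imem s4 53 (imem s4 60 0) = imem s4 72 0 \<and>
       path_inv B p S {(imem s4 60 0, z) |z. True} (imem s4 72 0) s4 \<or>
     imem s4 73 0 = 2 \<and> (\<forall>B'. is_base \<I> B' \<longrightarrow> (\<exists>c<q. class_count cls B' c \<noteq> tgt c)))"
        by (rule runsE[OF runs_search_path[OF bB B(3) S static3 r3(1) S_def[symmetric] r3(3,4,2,5) order_refl]])
      note fr4 = sp[THEN conjunct1]
      have "frame solve_frame {} {1, 2, 3} s3 s4" by (rule frame_mono[OF fr4]) (auto simp: solve_frame_def)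
      with fr' have fr'': "frame solve_frame {} {1, 2, 3} s s4" by (rule frame_trans)
      have static4: "static s4" by (rule static_frame[OF static fr'']) (auto simp: solve_frame_def search_frame_def)
      have r4: "imem s4 50 = mem_vec B" "imem s4 51 = class_count cls B" "rmem s4 1 = p" "imem s4 70 0 = S" "imem s4 76 0 = 0"
        using r3 by (simp_all add: frameD[OF fr4] search_frame_def S_def)
      have m4: "\<forall>e\<ge>n. imem s4 52 e = 0" using sp base_subset[OF bB] by (auto simp: mem_vec_def)
      show ?thesis
      proof (cases "imem s4 73 0 = 2")
        case True
        let ?s5 = "s4\<lparr>imem := store (imem s4) 76 0 2\<rparr>"
        have e5: "exec G n \<I> solve_step s2 (t1 + (5 + (t4 + (5 + 3)))) ?s5" unfolding solve_step_def
        proof (rule exec.Seq[OF e1(1)])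
          have "exec G n \<I> (search_path ;; Cond (ILe (INum 2) (val 73)) (76 :== INum 2) augment_path) s3 (t4 + (5 + 3)) ?s5"
            by (rule exec.Seq[OF e4(1)]) (use True in \<open>simp add: exec_Cond exec_IStore\<close>)
          then show "exec G n \<I> (Cond (ILe (val 77) (INum 0)) (76 :== INum 1)
            (search_path ;; Cond (ILe (INum 2) (val 73)) (76 :== INum 2) augment_path)) s3 (5 + (t4 + (5 + 3))) ?s5"
            using False by (simp add: exec_Cond ac_simps)
        qed
        have "R ?s5" using sp True by (simp add: R_def store_row)
        moreover have "frame solve_frame {} {1, 2, 3} s ?s5" using fr'' by (simp add: solve_frame_def)
        ultimately have "P ?s5" using r4 B(3) m4 by (auto simp: P_def store_row)
        moreover have "\<phi> ?s5 + (t1 + (5 + (t4 + (5 + 3)))) + 1 + tcost (ILe (val 76) (INum 0)) \<le> \<phi> s2"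
          using e1(2) e4(2) unfolding \<phi>2 by (simp add: \<phi>_def store_row algebra_simps)
        ultimately show ?thesis using e5 by blast
      next
        case ok: False
        define t where "t = imem s4 60 0"
        have s73: "imem s4 73 0 = 1" and t: "t < q" "tgt t < class_count cls B t" "imem s4 53 t = imem s4 72 0" "imem s4 72 0 \<noteq> 0"
          and pinv: "path_inv B p S {(t, z) |z. True} (imem s4 72 0) s4"
          using sp ok by (auto simp: t_def)
        have St: "S \<noteq> t" using S t by auto
        obtain t5 s5 where e5: "exec G n \<I> augment_path s4 t5 s5" "t5 \<le> 100 * (q + 1) + 50"
          and ap: "frame {50, 51, 71, 75} {} {1, 3} s4 s5 \<and>
          (\<exists>C. imem s5 50 = mem_vec C \<and> imem s5 51 = class_count cls C \<and>
            is_opt_base \<I> (\<lambda>e. w e + rmem s5 1 (cls e)) C \<and>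
            (\<forall>c. class_count cls C c + of_bool (c = t) = class_count cls B c + of_bool (c = S)))"
          by (rule runsE[OF runs_augment_path[OF pinv B(3) t(1,3,4) S(1) St static4 r4(1,2,4) t_def[symmetric] r4(3) order_refl]])
        note fr5 = ap[THEN conjunct1]
        have "frame solve_frame {} {1, 2, 3} s4 s5"
          by (rule frame_mono[OF fr5]) (auto simp: solve_frame_def search_frame_def)
        with fr'' have fr5': "frame solve_frame {} {1, 2, 3} s s5" by (rule frame_trans)
        obtain C where C: "imem s5 50 = mem_vec C" "imem s5 51 = class_count cls C" "is_opt_base \<I> (\<lambda>e. w e + rmem s5 1 (cls e)) C"
          and cnt: "\<And>c. class_count cls C c + of_bool (c = t) = class_count cls B c + of_bool (c = S)" using ap by blast
        have z5: "imem s5 76 0 = 0" "\<forall>e\<ge>n. imem s5 52 e = 0" using r4 m4 by (simp_all add: frameD[OF fr5])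
        have P5: "P s5" using fr5' C z5 by (auto simp: P_def)
        have ex: "exec G n \<I> solve_step s2 (t1 + (5 + (t4 + (5 + t5)))) s5" unfolding solve_step_def
        proof (rule exec.Seq[OF e1(1)])
          have "exec G n \<I> (search_path ;; Cond (ILe (INum 2) (val 73)) (76 :== INum 2) augment_path) s3 (t4 + (5 + t5)) s5"
            by (rule exec.Seq[OF e4(1)]) (use s73 e5 in \<open>simp add: exec_Cond\<close>)
          then show "exec G n \<I> (Cond (ILe (val 77) (INum 0)) (76 :== INum 1)
            (search_path ;; Cond (ILe (INum 2) (val 73)) (76 :== INum 2) augment_path)) s3 (5 + (t4 + (5 + t5))) s5"
            using False by (simp add: exec_Cond ac_simps)
        qed
        have "(\<Sum>c<q. tgt c - class_count cls B c) = (\<Sum>c<q. (tgt c - class_count cls C c) + of_bool (c = S))"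
        proof (rule sum.cong)
          fix c show "tgt c - class_count cls B c = (tgt c - class_count cls C c) + of_bool (c = S)"
            using cnt[of c] S t by (cases "c = S"; cases "c = t") auto
        qed simp
        also have "\<dots> = (\<Sum>c<q. tgt c - class_count cls C c) + 1"
          using S by (simp add: sum.distrib of_bool_def)
        finally have "\<phi> s2 = \<phi> s5 + ?W" unfolding \<phi>2 by (simp add: \<phi>_def \<mu>_def z5 C algebra_simps)
        moreover have "t1 + (5 + (t4 + (5 + t5))) + 1 + tcost (ILe (val 76) (INum 0)) \<le> ?W"
          using e1(2) e4(2) e5(2) by (simp add: algebra_simps)
        ultimately show ?thesis using ex P5 by (intro exI[of _ "t1 + (5 + (t4 + (5 + t5)))"] exI[of _ s5]) simp
      qed
    qed
  next
    fix s2 assume "P s2" "\<not> tval G n \<I> s2 (ILe (val 76) (INum 0))"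
    then show "P s2 \<and> R s2" by (auto simp: P_def)
  qed
  have "runs solve s T (\<lambda>s'. P s' \<and> R s')" unfolding solve_def
    by (rule runs_Seq[OF runs_solve_init[OF static rows(1) base_subset[OF bA] rows(2,3) zero(1,2) order_refl] loop])
      (use T in simp_all)
  then show ?thesis
  proof (rule runs_mono)
    fix s' assume PR: "P s' \<and> R s'"
    then obtain B where B: "imem s' 50 = mem_vec B" "imem s' 51 = class_count cls B" "is_opt_base \<I> (\<lambda>e. w e + rmem s' 1 (cls e)) B"
      by (auto simp: P_def)
    have "B \<subseteq> {..<n}" using B base_subset by (auto simp: is_opt_base_def)
    then show "frame solve_frame {} {1, 2, 3} s s' \<and>
    (\<forall>e\<ge>n. imem s' 50 e = 0) \<and> (\<forall>c\<ge>q. imem s' 51 c = 0) \<and> (\<forall>e\<ge>n. imem s' 52 e = 0) \<and>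
    (imem s' 76 0 = 1 \<and> (\<exists>B. imem s' 50 = mem_vec B \<and> is_base \<I> B \<and> (\<forall>c<q. class_count cls B c = tgt c) \<and>
       (\<forall>B'. is_base \<I> B' \<longrightarrow> (\<forall>c<q. class_count cls B' c = tgt c) \<longrightarrow> sum w B \<le> sum w B')) \<or>
     imem s' 76 0 = 2 \<and> (\<forall>B'. is_base \<I> B' \<longrightarrow> (\<exists>c<q. class_count cls B' c \<noteq> tgt c)))"
      unfolding R_def[symmetric] using PR B class_count_eq_0 by (auto simp: P_def)
  qed simp
qed

end

section \<open>Enumerating compositions\<close>

definition comps :: "nat \<Rightarrow> nat \<Rightarrow> (nat \<Rightarrow> nat) set" where
  "comps q K = {v. (\<forall>i\<ge>q. v i = 0) \<and> (\<Sum>i<q. v i) = K}"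

definition colex :: "(nat \<Rightarrow> nat) \<Rightarrow> (nat \<Rightarrow> nat) \<Rightarrow> bool" where
  "colex u v \<longleftrightarrow> (\<exists>i. u i < v i \<and> (\<forall>j>i. u j = v j))"

text \<open>The compositions still to be processed when the enumeration stands at \<open>v\<close>;
  the time potentials of the enumeration loops are sums over this set.\<close>

definition comps_from :: "nat \<Rightarrow> nat \<Rightarrow> (nat \<Rightarrow> nat) \<Rightarrow> (nat \<Rightarrow> nat) set" where
  "comps_from q K v = {u \<in> comps q K. u = v \<or> colex v u}"

lemma comps_support: "v \<in> comps q K \<Longrightarrow> v i \<noteq> 0 \<Longrightarrow> i < q"
  by (rule ccontr) (auto simp: comps_def)

lemma comps_card: "q \<ge> 1 \<Longrightarrow> finite (comps q K) \<and> card (comps q K) = (K + q - 1) choose K"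
proof -
  assume q: "q \<ge> 1"
  let ?L = "{l::nat list. length l = q \<and> sum_list l = K}"
  have "bij_betw (\<lambda>v. map v [0..<q]) (comps q K) ?L"
  proof (rule bij_betwI[where g = "\<lambda>l i. if i < q then l ! i else 0"])
    show "(\<lambda>v. map v [0..<q]) \<in> comps q K \<rightarrow> ?L"
      by (auto simp: comps_def interv_sum_list_conv_sum_set_nat atLeast0LessThan)
    show "(\<lambda>l i. if i < q then l ! i else 0) \<in> ?L \<rightarrow> comps q K"
      by (auto simp: comps_def sum_list_sum_nth atLeast0LessThan)
    show "(\<lambda>i. if i < q then map v [0..<q] ! i else 0) = v" if "v \<in> comps q K" for v
      using that by (auto simp: comps_def fun_eq_iff)
    show "map (\<lambda>i. if i < q then l ! i else 0) [0..<q] = l" if "l \<in> ?L" for l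
      using that by (auto intro: nth_equalityI)
  qed
  moreover have c: "card ?L = (K + q - 1) choose K" by (rule card_length_sum_list)
  moreover have "(K + q - 1) choose K > 0" using q by simp
  ultimately show ?thesis
    using bij_betw_same_card[of "\<lambda>v. map v [0..<q]" "comps q K" ?L] by (metis card.infinite less_irrefl)
qed

lemma colex_irrefl: "\<not> colex v v"
  by (simp add: colex_def)

lemma colex_trans: assumes "colex u v" "colex v x" shows "colex u x"
proof -
  obtain i j where "u i < v i" "\<forall>k>i. u k = v k" "v j < x j" "\<forall>k>j. v k = x k"
    using assms by (auto simp: colex_def)
  then show ?thesis unfolding colex_def
    by (intro exI[of _ "max i j"]) (cases "i = j"; cases "i < j"; force simp: max_def)
qed

text \<open>Having all units at index 0 is colex-least: any other composition is larger at its
  highest nonzero index, which is positive.\<close>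

lemma comps_from_first:
  assumes "q \<ge> 1" "v = (\<lambda>i. if i = 0 then K else 0)"
  shows "comps_from q K v = comps q K" "v \<in> comps q K"
proof -
  have "u = v \<or> colex v u" if u: "u \<in> comps q K" for u
  proof (cases "\<exists>i. 0 < i \<and> u i \<noteq> 0")
    case True
    let ?I = "{i. 0 < i \<and> u i \<noteq> 0}"
    have fin: "finite ?I" by (rule finite_subset[of _ "{..<q}"]) (use comps_support[OF u] in auto)
    define m where "m = Max ?I"
    have "m \<in> ?I" unfolding m_def using True by (intro Max_in fin) auto
    moreover have "u j = 0" if "m < j" for j using Max_ge[OF fin, of j] that by (force simp: m_def)
    ultimately have "colex v u" unfolding colex_def using assms(2) by (intro exI[of _ m]) auto
    then show ?thesis ..
  next
    case False
    then have z: "u i = 0" if "0 < i" for i using False that by blast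
    have "(\<Sum>i<q. u i) = (\<Sum>i<q. if i = 0 then u 0 else 0)" by (rule sum.cong) (use z in auto)
    also have "\<dots> = u 0" using assms(1) by simp
    finally have "u 0 = K" using u by (simp add: comps_def)
    then show ?thesis using z assms(2) by auto
  qed
  then show "comps_from q K v = comps q K" by (auto simp: comps_from_def)
  show "v \<in> comps q K" using assms by (simp add: comps_def)
qed

text \<open>Above \<open>i\<close> the two vectors agree and at \<open>i\<close> the vector
  \<open>u\<close> has more, so equality of the totals forces \<open>v\<close> to have a unit below
  \<open>i\<close>.\<close>

lemma comp_cut:
  assumes u: "u \<in> comps q K" and v: "v \<in> comps q K" and i: "v i < u i" "\<forall>j>i. v j = u j"
    and h: "\<forall>j<h. v j = 0"
  shows "h < i"
proof (rule ccontr)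
  assume "\<not> h < i"
  have iq: "i < q" by (rule comps_support[OF u]) (use i in simp)
  have split: "(\<Sum>j<q. x j) = (\<Sum>j<i. x j) + x i + (\<Sum>j\<in>{i<..<q}. x j)" for x :: "nat \<Rightarrow> nat"
  proof -
    have d: "{..<q} = {..<i} \<union> insert i {i<..<q}" using iq by auto
    show ?thesis unfolding d by (subst sum.union_disjoint) auto
  qed
  have "(\<Sum>j<i. v j) = 0" using h \<open>\<not> h < i\<close> by simp
  moreover have "(\<Sum>j\<in>{i<..<q}. v j) = (\<Sum>j\<in>{i<..<q}. u j)" by (rule sum.cong) (use i in auto)
  ultimately show False using split[of u] split[of v] u v i by (simp add: comps_def)
qed

lemma comps_from_last:
  assumes v: "v \<in> comps q K" and h: "\<forall>j<h. v j = 0" "q \<le> Suc h"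
  shows "comps_from q K v = {v}"
proof -
  have "\<not> colex v u" if u: "u \<in> comps q K" for u
  proof
    assume "colex v u"
    then obtain i where i: "v i < u i" "\<forall>j>i. v j = u j" by (auto simp: colex_def)
    then have "h < i" by (rule comp_cut[OF u v _ _ h(1)])
    moreover have "i < q" by (rule comps_support[OF u]) (use i in simp)
    ultimately show False using h by simp
  qed
  then show ?thesis using v by (auto simp: comps_from_def)
qed

text \<open>Intended for \<open>h\<close> the lowest nonzero index: one of its units moves up to
  \<open>Suc h\<close>, the others fall back to index 0. The order of the updates makes this correct
  for \<open>h = 0\<close> as well.\<close>

definition next_comp :: "(nat \<Rightarrow> nat) \<Rightarrow> nat \<Rightarrow> nat \<Rightarrow> nat" where
  "next_comp v h = (v(h := 0, 0 := v h - 1))(Suc h := Suc (v (Suc h)))"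

text \<open>By \<open>comp_cut\<close> a later composition exceeds \<open>v\<close> at an index
  above \<open>h\<close>. The least such change adds one unit at \<open>Suc h\<close> and leaves
  \<open>v h - 1\<close> units at or below \<open>h\<close>; placing them at index 0 is colex-least,
  so nothing lies in between.\<close>

lemma comps_from_next:
  assumes v: "v \<in> comps q K" and h: "\<forall>j<h. v j = 0" "v h \<noteq> 0" "Suc h < q"
  shows "next_comp v h \<in> comps q K" "comps_from q K (next_comp v h) = comps_from q K v - {v}"
proof -
  let ?v = "next_comp v h"
  have split: "(\<Sum>j<q. x j) = (\<Sum>j\<le>h. x j) + x (Suc h) + (\<Sum>j\<in>{Suc h<..<q}. x j)" for x :: "nat \<Rightarrow> nat"
  proof -
    have d: "{..<q} = {..h} \<union> insert (Suc h) {Suc h<..<q}" using h by auto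
    show ?thesis unfolding d by (subst sum.union_disjoint) auto
  qed
  have low: "?v j = (if j = 0 then v h - 1 else 0)" if "j \<le> h" for j
    using that h by (auto simp: next_comp_def)
  have up: "?v (Suc h) = Suc (v (Suc h))" "?v j = v j" if "Suc h < j" for j
    using that by (auto simp: next_comp_def)
  have "(\<Sum>j\<le>h. v j) = (\<Sum>j\<le>h. if j = h then v h else 0)" by (rule sum.cong) (use h in auto)
  then have sv: "(\<Sum>j\<le>h. v j) = v h" by simp
  have "(\<Sum>j\<le>h. ?v j) = (\<Sum>j\<le>h. if j = 0 then v h - 1 else 0)" by (rule sum.cong) (use low in auto)
  then have snv: "(\<Sum>j\<le>h. ?v j) = v h - 1" by simp
  have top: "(\<Sum>j\<in>{Suc h<..<q}. ?v j) = (\<Sum>j\<in>{Suc h<..<q}. v j)" by (rule sum.cong) (auto simp: next_comp_def)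
  have "(\<Sum>j<q. ?v j) = (\<Sum>j<q. v j)"
    unfolding split sv snv top using h(2) by (simp add: next_comp_def)
  then show nv: "?v \<in> comps q K" using v h by (auto simp: comps_def next_comp_def)
  have lt: "colex v ?v" unfolding colex_def by (intro exI[of _ "Suc h"]) (auto simp: next_comp_def)
  have between: "u = ?v \<or> colex ?v u" if u: "u \<in> comps q K" and "colex v u" for u
  proof -
    obtain i where i: "v i < u i" "\<forall>j>i. v j = u j" using \<open>colex v u\<close> by (auto simp: colex_def)
    have hi: "h < i" by (rule comp_cut[OF u v i h(1)])
    show ?thesis
    proof (cases "i = Suc h \<and> u (Suc h) = Suc (v (Suc h))")
      case False
      have "?v i < u i" using False i hi by (auto simp: next_comp_def)
      moreover have "\<forall>j>i. ?v j = u j" using i hi by (auto simp: next_comp_def)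
      ultimately have "colex ?v u" by (auto simp: colex_def)
      then show ?thesis ..
    next
      case True
      have above: "u j = ?v j" if "h < j" for j
        using True i that by (cases "j = Suc h") (auto simp: next_comp_def)
      have "(\<Sum>j\<in>{Suc h<..<q}. u j) = (\<Sum>j\<in>{Suc h<..<q}. ?v j)" by (rule sum.cong) (use above in auto)
      moreover have "(\<Sum>j<q. u j) = (\<Sum>j<q. ?v j)" using u nv by (simp add: comps_def)
      ultimately have su: "(\<Sum>j\<le>h. u j) = v h - 1"
        using above[of "Suc h"] unfolding split snv by simp
      show ?thesis
      proof (cases "\<exists>j. 0 < j \<and> j \<le> h \<and> u j \<noteq> 0")
        case True
        let ?I = "{j. 0 < j \<and> j \<le> h \<and> u j \<noteq> 0}"
        have fin: "finite ?I" by simp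
        define m where "m = Max ?I"
        have m: "m \<in> ?I" unfolding m_def using True by (intro Max_in fin) auto
        have "u j = ?v j" if "m < j" for j
        proof (cases "j \<le> h")
          case True
          have "u j = 0"
          proof (rule ccontr)
            assume "u j \<noteq> 0"
            then have "j \<in> ?I" using that True by simp
            then have "j \<le> m" unfolding m_def by (rule Max_ge[OF fin])
            then show False using that by simp
          qed
          then show ?thesis using low[OF True] that by auto
        qed (use above in auto)
        moreover have "?v m < u m" using low[of m] m by auto
        ultimately have "colex ?v u" unfolding colex_def by (intro exI[of _ m]) auto
        then show ?thesis ..
      next
        case False
        then have z: "u j = 0" if "0 < j" "j \<le> h" for j using False that by blast
        have "(\<Sum>j\<le>h. u j) = (\<Sum>j\<le>h. if j = 0 then u 0 else 0)" by (rule sum.cong) (use z in auto)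
        then have "u 0 = v h - 1" using su by simp
        then have "u j = ?v j" for j using z[of j] low[of j] above[of j] by (cases "j \<le> h") auto
        then show ?thesis by auto
      qed
    qed
  qed
  have "?v \<noteq> v" using lt colex_irrefl by metis
  have "(u \<in> comps_from q K ?v) = (u \<in> comps_from q K v - {v})" for u
    unfolding comps_from_def mem_Collect_eq Diff_iff singleton_iff
    using between[of u] lt colex_trans[OF lt, of u] colex_irrefl[of v] nv by metis
  then show "comps_from q K ?v = comps_from q K v - {v}" by blast
qed

section \<open>Programs that step through the compositions\<close>

definition comp_init :: "nat \<Rightarrow> 'g com" where
  "comp_init a = (for_loop 36 11 (IStore a (val 36) (INum 0)) ;; IStore a (INum 0) (val 35))"

definition comp_next :: "nat \<Rightarrow> nat \<Rightarrow> 'g com" where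
  "comp_next a b = (37 :== INum 0 ;; While (ILe (ICell a (val 37)) (INum 0)) (incr 37) ;;
     Cond (less_test (IAdd (val 37) (INum 1)) (val 11))
       (38 :== ICell a (val 37) ;; IStore a (val 37) (INum 0) ;; IStore a (INum 0) (ISub (val 38) (INum 1)) ;;
        IStore a (IAdd (val 37) (INum 1)) (IAdd (ICell a (IAdd (val 37) (INum 1))) (INum 1)))
       (b :== INum 1))"

context ram
begin

lemma runs_comp_init:
  assumes q: "imem s 11 0 = q" "q \<ge> 1" and K: "imem s 35 0 = K" and zero: "\<forall>c\<ge>q. imem s a c = 0"
    and a: "a \<notin> {11, 35, 36}" and T: "30 * (q + 1) \<le> T"
  shows "runs (comp_init a) s T (\<lambda>s'. frame {a, 36} {} {} s s' \<and> imem s' a = (\<lambda>i. if i = 0 then K else 0))"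
  unfolding comp_init_def
proof (rule runs_Seq[where Tc = "20 * (q + 1)" and Td = 5 and R = "\<lambda>s'. frame {a, 36} {} {} s s' \<and> imem s' a = (\<lambda>_. 0)"])
  show "runs (for_loop 36 11 (IStore a (val 36) (INum 0))) s (20 * (q + 1))
      (\<lambda>s'. frame {a, 36} {} {} s s' \<and> imem s' a = (\<lambda>_. 0))"
  proof (rule runs_for[where m = q and t = 5 and
      P = "\<lambda>i s'. frame {a, 36} {} {} s s' \<and> (\<forall>c. c < i \<or> q \<le> c \<longrightarrow> imem s' a c = 0)"])
    fix s' assume P: "frame {a, 36} {} {} s s' \<and> (\<forall>c. c < q \<or> q \<le> c \<longrightarrow> imem s' a c = 0)"
    then have "imem s' a c = 0" for c using linorder_not_le by blast
    then show "frame {a, 36} {} {} s s' \<and> imem s' a = (\<lambda>_. 0)" using P by auto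
  qed (use q zero a in \<open>auto simp: store_row frame_def\<close>)
next
  fix s' assume s': "frame {a, 36} {} {} s s' \<and> imem s' a = (\<lambda>_. 0)"
  note fr = s'[THEN conjunct1]
  have "imem s' 35 0 = K" using K a by (simp add: frameD[OF fr])
  then show "runs (IStore a (INum 0) (val 35)) s' 5
      (\<lambda>s'. frame {a, 36} {} {} s s' \<and> imem s' a = (\<lambda>i. if i = 0 then K else 0))"
    using s' by (auto simp: store_row)
qed (use T in simp)

lemma runs_comp_next:
  assumes q: "imem s 11 0 = q" and v: "imem s a = v" "v \<in> comps q K" "K \<ge> 1"
    and ab: "a \<notin> {11, 37, 38}" "b \<notin> {11, 37, 38, a}" "imem s b 0 = 0" and T: "30 * (q + 1) + 40 \<le> T"
  shows "runs (comp_next a b) s T (\<lambda>s'. frame {a, b, 37, 38} {} {} s s' \<and>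
     (imem s' b 0 \<noteq> 0 \<and> imem s' a = v \<and> comps_from q K v = {v} \<or>
      imem s' b 0 = 0 \<and> imem s' a \<in> comps q K \<and> comps_from q K (imem s' a) = comps_from q K v - {v}))"
proof -
  have "\<exists>h. v h \<noteq> 0"
  proof (rule ccontr)
    assume "\<not> ?thesis"
    then have "(\<Sum>i<q. v i) = 0" by simp
    then show False using v(2,3) by (simp add: comps_def)
  qed
  define h where "h = (LEAST h. v h \<noteq> 0)"
  have h: "v h \<noteq> 0" unfolding h_def using \<open>\<exists>h. v h \<noteq> 0\<close> by (rule LeastI_ex)
  have below: "\<forall>j<h. v j = 0" unfolding h_def using not_less_Least by blast
  have hq: "h < q" using comps_support[OF v(2) h] .
  let ?s = "s\<lparr>imem := store (imem s) 37 0 0\<rparr>"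
  have W: "runs (While (ILe (ICell a (val 37)) (INum 0)) (incr 37)) ?s (20 * h + 10)
      (\<lambda>s'. frame {37} {} {} s s' \<and> imem s' 37 0 = h)"
  proof (rule runs_While[where P = "\<lambda>s'. frame {37} {} {} s s' \<and> imem s' 37 0 \<le> h" and \<phi> = "\<lambda>s'. 20 * (h - imem s' 37 0)"])
    fix s1 assume P: "frame {37} {} {} s s1 \<and> imem s1 37 0 \<le> h" and b: "tval G n \<I> s1 (ILe (ICell a (val 37)) (INum 0))"
    have "imem s1 a = v" using v ab P by (simp add: frame_def)
    then have "imem s1 37 0 \<noteq> h" using b h by auto
    then have "imem s1 37 0 < h" using P by simp
    then have "runs (incr 37) s1 6 (\<lambda>s'. (frame {37} {} {} s s' \<and> imem s' 37 0 \<le> h) \<and>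
        20 * (h - imem s' 37 0) + 6 + 1 + tcost (ILe (ICell a (val 37)) (INum 0)) \<le> 20 * (h - imem s1 37 0))"
      using P by (auto simp: store_row)
    then show "\<exists>t. runs (incr 37) s1 t (\<lambda>s'. (frame {37} {} {} s s' \<and> imem s' 37 0 \<le> h) \<and>
        20 * (h - imem s' 37 0) + t + 1 + tcost (ILe (ICell a (val 37)) (INum 0)) \<le> 20 * (h - imem s1 37 0))" by blast
  next
    fix s1 assume P: "frame {37} {} {} s s1 \<and> imem s1 37 0 \<le> h" and b: "\<not> tval G n \<I> s1 (ILe (ICell a (val 37)) (INum 0))"
    have "imem s1 a = v" using v ab P by (simp add: frame_def)
    then have "\<not> imem s1 37 0 < h" using b below by auto
    then show "frame {37} {} {} s s1 \<and> imem s1 37 0 = h" using P by simp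
  qed (simp_all add: store_row)
  let ?C = "Cond (less_test (IAdd (val 37) (INum 1)) (val 11))
       (38 :== ICell a (val 37) ;; IStore a (val 37) (INum 0) ;; IStore a (INum 0) (ISub (val 38) (INum 1)) ;;
        IStore a (IAdd (val 37) (INum 1)) (IAdd (ICell a (IAdd (val 37) (INum 1))) (INum 1)))
       (b :== INum 1) :: 'g com"
  have C: "runs ?C s1 60 (\<lambda>s'. frame {a, b, 37, 38} {} {} s s' \<and>
     (imem s' b 0 \<noteq> 0 \<and> imem s' a = v \<and> comps_from q K v = {v} \<or>
      imem s' b 0 = 0 \<and> imem s' a \<in> comps q K \<and> comps_from q K (imem s' a) = comps_from q K v - {v}))"
    if s1: "frame {37} {} {} s s1 \<and> imem s1 37 0 = h" for s1
  proof -
    note fr = s1[THEN conjunct1]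
    have r: "imem s1 a = v" "imem s1 11 0 = q" "imem s1 b 0 = 0" "imem s1 37 0 = h"
      using v q ab s1 by (simp_all add: frameD[OF fr])
    have fr': "frame {a, b, 37, 38} {} {} s s1" by (rule frame_mono[OF fr]) auto
    show ?thesis
    proof (cases "Suc h < q")
      case True
      let ?s2 = "s1\<lparr>imem := store (store (store (store (imem s1) 38 0 (v h)) a h 0) a 0 (v h - 1)) a (Suc h) (Suc (v (Suc h)))\<rparr>"
      have "imem ?s2 a = next_comp v h" using ab r by (simp add: store_row next_comp_def)
      moreover have "frame {a, b, 37, 38} {} {} s ?s2" using fr' by simp
      moreover have "imem ?s2 b 0 = 0" using ab r by (simp add: store_row)
      ultimately show ?thesis using True ab comps_from_next[OF v(2) below h True]
        by (auto simp: store_row r)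
    next
      case False
      then show ?thesis using ab fr' comps_from_last[OF v(2) below] by (auto simp: store_row r)
    qed
  qed
  have "runs (While (ILe (ICell a (val 37)) (INum 0)) (incr 37) ;; ?C) ?s (T - 3)
     (\<lambda>s'. frame {a, b, 37, 38} {} {} s s' \<and>
     (imem s' b 0 \<noteq> 0 \<and> imem s' a = v \<and> comps_from q K v = {v} \<or>
      imem s' b 0 = 0 \<and> imem s' a \<in> comps q K \<and> comps_from q K (imem s' a) = comps_from q K v - {v}))"
    by (rule runs_Seq[OF W C]) (use T hq in simp_all)
  then show ?thesis unfolding comp_next_def using T by simp
qed

end

section \<open>Counting the admissible pairs\<close>

text \<open>A canonical choice of all but one of the units, from which the label condition recovers
  the remaining unit.\<close>

definition drop_one :: "(nat \<Rightarrow> nat) \<Rightarrow> nat \<Rightarrow> nat" where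
  "drop_one v = (let m = LEAST i. v i \<noteq> 0 in v(m := v m - 1))"

lemma comps_nonzero: assumes "v \<in> comps q K" "K \<ge> 1" shows "\<exists>i. v i \<noteq> 0"
proof (rule ccontr)
  assume "\<not> ?thesis"
  then have "(\<Sum>i<q. v i) = 0" by simp
  then show False using assms by (simp add: comps_def)
qed

lemma drop_one_comps:
  assumes v: "v \<in> comps q K" and K: "K \<ge> 1"
  obtains m where "m < q" "v = (drop_one v)(m := Suc (drop_one v m))" "drop_one v \<in> comps q (K - 1)"
proof -
  define m where "m = (LEAST i. v i \<noteq> 0)"
  have m: "v m \<noteq> 0" unfolding m_def by (rule LeastI_ex[OF comps_nonzero[OF v K]])
  have mq: "m < q" by (rule comps_support[OF v m])
  have d: "drop_one v = v(m := v m - 1)" by (simp add: drop_one_def m_def Let_def)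
  have "(\<Sum>i<q. v i) = v m + (\<Sum>i\<in>{..<q} - {m}. v i)" using mq by (subst sum.remove[of _ m]) auto
  moreover have "(\<Sum>i<q. drop_one v i) = (v m - 1) + (\<Sum>i\<in>{..<q} - {m}. drop_one v i)"
    using mq by (subst sum.remove[of _ m]) (auto simp: d)
  moreover have "(\<Sum>i\<in>{..<q} - {m}. drop_one v i) = (\<Sum>i\<in>{..<q} - {m}. v i)"
    by (rule sum.cong) (auto simp: d)
  ultimately have "(\<Sum>i<q. drop_one v i) = K - 1" using m v by (simp add: comps_def)
  then have "drop_one v \<in> comps q (K - 1)" using v by (auto simp: comps_def d)
  moreover have "v = (drop_one v)(m := Suc (drop_one v m))" using m by (auto simp: d)
  ultimately show ?thesis using mq that by blast
qed

text \<open>Deleting index 1 and closing the gap embeds these vectors into the compositions over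
  \<open>q - 1\<close> classes. Index 0 cannot play this role because the padding class may occur in
  both members of a pair.\<close>

lemma card_comps_hole:
  assumes q: "q \<ge> 2"
  shows "card {v \<in> comps q K. v 1 = 0} \<le> (K + q - 2) choose K"
proof -
  let ?f = "\<lambda>v::nat \<Rightarrow> nat. \<lambda>i. if i = 0 then v 0 else v (Suc i)"
  have q1: "q - 1 \<ge> 1" using q by simp
  have "card {v \<in> comps q K. v 1 = 0} \<le> card (comps (q - 1) K)"
  proof (rule card_inj_on_le[where f = ?f])
    show "inj_on ?f {v \<in> comps q K. v 1 = 0}"
    proof (rule inj_onI)
      fix u v assume u: "u \<in> {v \<in> comps q K. v 1 = 0}" and v: "v \<in> {v \<in> comps q K. v 1 = 0}" and e: "?f u = ?f v"
      show "u = v"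
      proof
        fix i
        have "?f u (i - 1) = ?f v (i - 1)" using e by metis
        moreover have "?f u 0 = ?f v 0" using e by metis
        ultimately show "u i = v i" using u v by (cases "i \<le> 1") (auto simp: le_Suc_eq split: if_splits)
      qed
    qed
    show "?f ` {v \<in> comps q K. v 1 = 0} \<subseteq> comps (q - 1) K"
    proof (rule image_subsetI)
      fix v assume v: "v \<in> {v \<in> comps q K. v 1 = 0}"
      obtain r where r: "q = Suc (Suc r)" using q by (metis add_2_eq_Suc le_Suc_ex)
      have "(\<Sum>i<q. v i) = v 0 + v 1 + (\<Sum>i<r. v (Suc (Suc i)))"
        unfolding r by (simp add: sum.lessThan_Suc_shift del: sum.lessThan_Suc)
      moreover have "(\<Sum>i<q - 1. ?f v i) = v 0 + (\<Sum>i<r. v (Suc (Suc i)))"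
        unfolding r by (simp add: sum.lessThan_Suc_shift del: sum.lessThan_Suc)
      ultimately show "?f v \<in> comps (q - 1) K" using v q by (auto simp: comps_def)
    qed
  qed (use comps_card[OF q1] in simp)
  then show ?thesis using comps_card[OF q1, of K] q by (simp add: numeral_2_eq_2)
qed

text \<open>For \<open>K \<le> q - 1\<close> dropping a unit of \<open>S\<close> is injective, which
  leaves the fraction \<open>K / (K + q - 1)\<close> of all pairs. For larger \<open>K\<close> the
  single class 1 is missing from \<open>R\<close> or from \<open>S\<close>, which leaves at most
  \<open>2 (q - 1) / (K + q - 1)\<close>. The factor 4 arises in the second case, from the union of
  two sets and \<open>q \<le> 2 (q - 1)\<close>.\<close>

lemma pair_filter_bound:
  assumes q: "q \<ge> 2" and K: "K \<ge> 1" and V: "V \<subseteq> comps q K \<times> comps q K"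
    and det: "\<And>R S S'. (R, S) \<in> V \<Longrightarrow> (R, S') \<in> V \<Longrightarrow> drop_one S = drop_one S' \<Longrightarrow> S = S'"
    and disj: "\<And>R S. (R, S) \<in> V \<Longrightarrow> R 1 = 0 \<or> S 1 = 0"
  shows "card V * K * q \<le> 4 * ((K + q - 1) choose K)\<^sup>2 * (min K (q - 1))\<^sup>2"
proof -
  let ?b = "(K + q - 1) choose K"
  have q1: "q \<ge> 1" using q by simp
  note C = comps_card[OF q1]
  show ?thesis
  proof (cases "K \<le> q - 1")
    case True
    have "card V \<le> card (comps q K \<times> comps q (K - 1))"
    proof (rule card_inj_on_le[where f = "\<lambda>(R, S). (R, drop_one S)"])
      show "inj_on (\<lambda>(R, S). (R, drop_one S)) V" using det by (auto simp: inj_on_def)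
      have "drop_one S \<in> comps q (K - 1)" if "S \<in> comps q K" for S
        using drop_one_comps[OF that K] by blast
      then show "(\<lambda>(R, S). (R, drop_one S)) ` V \<subseteq> comps q K \<times> comps q (K - 1)"
        using V by auto
    qed (use C in simp)
    also have "\<dots> = ?b * ((K - 1 + q - 1) choose (K - 1))" using C by (simp add: card_cartesian_product)
    finally have 1: "card V \<le> ?b * ((K - 1 + q - 1) choose (K - 1))" .
    have "K * ?b = (K + q - 1) * ((K - 1 + q - 1) choose (K - 1))"
      using binomial_absorption[of "K - 1" "K + q - 1"] K q by simp
    then have h1: "card V * (K + q - 1) \<le> ?b * (K * ?b)"
      using mult_le_mono1[OF 1, of "K + q - 1"] by (simp add: ac_simps)
    have "card V * q \<le> card V * (K + q - 1)" using K by (intro mult_le_mono) auto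
    then have "K * (card V * q) \<le> K * (?b * (K * ?b))" using h1 by (intro mult_le_mono2) (rule order_trans)
    then have "card V * K * q \<le> ?b\<^sup>2 * K\<^sup>2" by (simp only: power2_eq_square ac_simps)
    also have "\<dots> \<le> 4 * ?b\<^sup>2 * K\<^sup>2" by simp
    finally show ?thesis using True by (simp add: min_def)
  next
    case False
    let ?Z = "{v \<in> comps q K. v 1 = 0}"
    let ?b' = "(K + q - 2) choose K"
    have "V \<subseteq> ?Z \<times> comps q K \<union> comps q K \<times> ?Z"
    proof (rule subrelI)
      fix R S assume RS: "(R, S) \<in> V"
      then show "(R, S) \<in> ?Z \<times> comps q K \<union> comps q K \<times> ?Z" using V disj[OF RS] by blast
    qed
    then have "card V \<le> card (?Z \<times> comps q K \<union> comps q K \<times> ?Z)" using C by (intro card_mono) auto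
    also have "\<dots> \<le> card (?Z \<times> comps q K) + card (comps q K \<times> ?Z)" by (rule card_Un_le)
    also have "\<dots> = 2 * (?b * card ?Z)" using C by (simp add: card_cartesian_product)
    also have "\<dots> \<le> 2 * (?b * ?b')" using card_comps_hole[OF q] by simp
    finally have 1: "card V \<le> 2 * (?b * ?b')" .
    have absorb: "(K + q - 1) * ?b' = (q - 1) * ?b"
    proof -
      have "Suc (K + q - 2) = K + q - 1" "Suc (K + q - 2) - K = q - 1" using q by auto
      then show ?thesis using binomial_absorb_comp[of "K + q - 1" K] q by (simp add: numeral_2_eq_2)
    qed
    have "card V * (K + q - 1) \<le> 2 * (?b * ?b') * (K + q - 1)" by (rule mult_le_mono1[OF 1])
    also have "\<dots> = 2 * (?b * ((K + q - 1) * ?b'))" by (simp only: ac_simps)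
    finally have h1: "card V * (K + q - 1) \<le> 2 * (?b * ((q - 1) * ?b))" unfolding absorb .
    have "card V * K \<le> card V * (K + q - 1)" using q by (intro mult_le_mono) auto
    also note h1
    finally have 2: "card V * K \<le> 2 * ?b\<^sup>2 * (q - 1)" by (simp only: power2_eq_square ac_simps)
    have "card V * K * q \<le> 2 * ?b\<^sup>2 * (q - 1) * (2 * (q - 1))"
      by (rule mult_le_mono[OF 2]) (use q in auto)
    then show ?thesis using False by (simp add: power2_eq_square min_def ac_simps)
  qed
qed

text \<open>The binomial is at least \<open>((a + b) / a) ^ a\<close>, and the base of this power is
  at least 2 for \<open>a \<le> b\<close>; the other case follows by symmetry. This is what makes
  \<open>min K (q - 1)\<close> logarithmic.\<close>

lemma two_power_le_binomial: "2 ^ min a b \<le> ((a + b) choose a :: nat)"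
proof -
  have *: "2 ^ a \<le> ((a + b) choose a :: nat)" if "a \<le> b" for a b
  proof (cases "a = 0")
    case False
    have "(2::real) ^ a \<le> (real (a + b) / real a) ^ a"
      using that False by (intro power_mono) (auto simp: field_simps)
    also have "\<dots> \<le> real ((a + b) choose a)" by (rule binomial_ge_n_over_k_pow_k) simp
    finally show ?thesis by (metis of_nat_le_iff of_nat_numeral of_nat_power)
  qed simp
  show ?thesis
  proof (cases "a \<le> b")
    case True
    then show ?thesis using * by simp
  next
    case False
    then have "2 ^ b \<le> ((b + a) choose b :: nat)" using * by simp
    also have "\<dots> = (a + b) choose a" using binomial_symmetric[of a "a + b"] by (simp add: add.commute)
    finally show ?thesis using False by simp
  qed
qed

section \<open>The complete program\<close>

text \<open>Powers of class labels are formed by repeated multiplication. The exponents sum to at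
  most \<open>card A + K\<close>, so for \<open>K \<le> n\<close> this remains linear in
  \<open>n\<close> and \<open>q\<close>.\<close>

definition check_pair :: "'g com" where
  "check_pair = (44 :== INum 1 ;; GStore 5 (INum 0) (GCell 4 (INum 0)) ;;
     for_loop 36 11
       (Cond (TAnd (TNot (TAnd (ILe (INum 1) (val 36)) (TAnd (ILe (INum 1) (ICell 40 (val 36))) (ILe (INum 1) (ICell 41 (val 36))))))
            (ILe (ICell 40 (val 36)) (IAdd (ICell 30 (val 36)) (ICell 41 (val 36)))))
          Skip (44 :== INum 0) ;;
        IStore 42 (val 36) (ISub (IAdd (ICell 30 (val 36)) (ICell 41 (val 36))) (ICell 40 (val 36))) ;;
        45 :== INum 0 ;;
        While (less_test (val 45) (ICell 42 (val 36)))
          (GStore 5 (INum 0) (GMult (GCell 5 (INum 0)) (GCell 2 (val 36))) ;; incr 45)))"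

definition record_base :: "'g com" where
  "record_base = (RStore 6 (INum 0) (RCell 4 (INum 0)) ;;
     for_loop 29 0 (Cond (ILe (INum 1) (ICell 50 (val 29)))
       (RStore 6 (INum 0) (RAdd (RCell 6 (INum 0)) (RCell 0 (val 29)))) Skip) ;;
     Cond (TAnd (ILe (INum 1) (val 1)) (RLe (RCell 5 (INum 0)) (RCell 6 (INum 0)))) Skip
       (1 :== INum 1 ;; RStore 5 (INum 0) (RCell 6 (INum 0)) ;;
        for_loop 29 0 (IStore 2 (val 29) (ICell 50 (val 29)))))"

definition try_pair :: "'g com" where
  "try_pair = (check_pair ;; Cond (TAnd (ILe (INum 1) (val 44)) (GEq (GCell 5 (INum 0)) (GCell 1 (INum 0))))
     (solve ;; Cond (ILe (val 76) (INum 1)) record_base Skip) Skip)"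

definition enumerate_pairs :: "'g com" where
  "enumerate_pairs = (comp_init 40 ;; 39 :== INum 0 ;; While (ILe (val 39) (INum 0))
     (comp_init 41 ;; 43 :== INum 0 ;; While (ILe (val 43) (INum 0)) (try_pair ;; comp_next 41 43) ;;
      comp_next 40 39))"

text \<open>The empty ground set is treated apart: there the empty set is the only base, and
  \<open>K\<close> would be 0, whereas \<open>comp_next\<close> has to find a nonzero entry.\<close>

definition main_program :: "nat \<Rightarrow> 'g com" where
  "main_program k = Cond (ILe (val 0) (INum 0))
     (Cond (GEq (GCell 1 (INum 0)) (GCell 4 (INum 0))) (1 :== INum 1) Skip)
     (classify ;; merge_sort ;; greedy_base ;; class_blocks ;; 35 :== min_exp (INum k) (val 0) ;; enumerate_pairs)"

locale labeled_matroid = class_matroid G n \<I> w cls q cl st + comm_group G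
  for G :: "'g monoid" (structure) and n \<I> w cls q cl st +
  fixes l rep :: "nat \<Rightarrow> 'g" and g :: 'g and A :: "nat set" and K :: nat
  assumes classes: "label_classes l n q cls rep" and label: "l \<in> {..<n} \<rightarrow> carrier G"
    and g: "g \<in> carrier G" and A: "is_opt_base \<I> w A" and K: "K \<ge> 1" "K \<le> n"
begin

lemma base_A: "is_base \<I> A"
  using A by (simp add: is_opt_base_def)

lemma q: "q \<ge> 1" "q \<le> n"
proof -
  have "0 < n" using K by simp
  then show "q \<ge> 1" using cls[of 0] by simp
  show "q \<le> n" using classes card_image_le[of "{..<n}" l] by (simp add: label_classes_def)
qed

section \<open>Labels of count vectors, valid pairs and the bases they describe\<close>

lemma rep_closed: "c < q \<Longrightarrow> rep c \<in> carrier G"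
proof -
  assume "c < q"
  then have "rep c \<in> l ` {..<n}" using classes unfolding label_classes_def by blast
  then show ?thesis using label by auto
qed

lemma rep_inj: "c < q \<Longrightarrow> d < q \<Longrightarrow> rep c = rep d \<Longrightarrow> c = d"
  using classes by (auto simp: label_classes_def inj_on_def)

definition power_label :: "(nat \<Rightarrow> nat) \<Rightarrow> 'g" where
  "power_label v = (\<Otimes>c\<in>{..<q}. rep c [^] v c)"

lemma power_label_closed: "power_label v \<in> carrier G"
  unfolding power_label_def by (rule finprod_closed) (auto simp: rep_closed)

lemma power_label_add: "power_label (\<lambda>c. u c + v c) = power_label u \<otimes> power_label v"
proof -
  have "(\<Otimes>c\<in>{..<q}. rep c [^] (u c + v c)) = (\<Otimes>c\<in>{..<q}. rep c [^] u c \<otimes> rep c [^] v c)"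
    by (rule finprod_cong') (auto simp: rep_closed nat_pow_mult)
  also have "\<dots> = power_label u \<otimes> power_label v"
    unfolding power_label_def by (rule finprod_multf) (auto simp: rep_closed)
  finally show ?thesis by (simp add: power_label_def)
qed

lemma power_label_cong: "(\<And>c. c < q \<Longrightarrow> u c = v c) \<Longrightarrow> power_label u = power_label v"
  unfolding power_label_def by (rule finprod_cong') (auto simp: rep_closed)

lemma power_label_unit: "m < q \<Longrightarrow> power_label (\<lambda>c. if c = m then 1 else 0) = rep m"
proof -
  assume m: "m < q"
  have "power_label (\<lambda>c. if c = m then 1 else 0) = (\<Otimes>c\<in>{..<q}. if m = c then rep c else \<one>)"
    unfolding power_label_def by (rule finprod_cong') (auto simp: rep_closed)
  also have "\<dots> = rep m" by (rule finprod_singleton) (use m rep_closed in auto)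
  finally show ?thesis .
qed

lemma base_label: assumes "is_base \<I> B" shows "finprod G l B = power_label (class_count cls B)"
proof -
  have gen: "finprod G l X = power_label (class_count cls X)" if "finite X" "X \<subseteq> {..<n}" for X
    using that
  proof (induction X)
    case empty
    have "power_label (class_count cls {}) = (\<Otimes>c\<in>{..<q}. \<one>)"
      unfolding power_label_def by (rule finprod_cong') (auto simp: class_count_def)
    then show ?case by simp
  next
    case (insert e X)
    have e: "e < n" using insert by simp
    have "power_label (class_count cls (insert e X)) =
        power_label (\<lambda>c. (if c = cls e then 1 else 0) + class_count cls X c)"
      by (rule power_label_cong) (use class_count_insert[OF insert(1,2), of cls] in auto)
    also have "\<dots> = rep (cls e) \<otimes> power_label (class_count cls X)"
      unfolding power_label_add power_label_unit[OF cls[OF e]] ..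
    also have "rep (cls e) = l e" using classes e by (simp add: label_classes_def)
    finally show ?case using insert label e by (subst finprod_insert) auto
  qed
  show ?thesis by (rule gen) (use base_finite[OF assms] base_subset[OF assms] in auto)
qed

text \<open>The truncated subtraction is exact for \<open>valid\<close> pairs, which require enough
  elements in every class.\<close>

definition target :: "(nat \<Rightarrow> nat) \<times> (nat \<Rightarrow> nat) \<Rightarrow> nat \<Rightarrow> nat" where
  "target x c = class_count cls A c + snd x c - fst x c"

definition valid :: "(nat \<Rightarrow> nat) \<times> (nat \<Rightarrow> nat) \<Rightarrow> bool" where
  "valid x \<longleftrightarrow> (\<forall>c<q. (c = 0 \<or> fst x c = 0 \<or> snd x c = 0) \<and> fst x c \<le> class_count cls A c + snd x c) \<and>
     power_label (target x) = g"

definition pairs :: "((nat \<Rightarrow> nat) \<times> (nat \<Rightarrow> nat)) set" where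
  "pairs = comps q K \<times> comps q K"

definition candidates :: "((nat \<Rightarrow> nat) \<times> (nat \<Rightarrow> nat)) set \<Rightarrow> nat set set" where
  "candidates D = {B. is_base \<I> B \<and> (\<exists>x\<in>D. valid x \<and> (\<forall>c<q. class_count cls B c = target x c))}"

lemma candidates_Un: "candidates (D \<union> D') = candidates D \<union> candidates D'"
  by (auto simp: candidates_def)

lemma candidate_label: "B \<in> candidates D \<Longrightarrow> is_g_base G \<I> l g B"
proof -
  assume "B \<in> candidates D"
  then obtain x where x: "is_base \<I> B" "valid x" "\<And>c. c < q \<Longrightarrow> class_count cls B c = target x c"
    by (auto simp: candidates_def)
  have "power_label (class_count cls B) = g" using x(2) power_label_cong[OF x(3)] by (simp add: valid_def)
  then show ?thesis using x(1) base_label by (simp add: is_g_base_def)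
qed

lemma sum_class_count_base: "is_base \<I> B \<Longrightarrow> (\<Sum>c<q. class_count cls B c) = card B"
  by (rule sum_class_count) (use base_finite base_subset cls in auto)

text \<open>Equal differences of class counts are represented by pairs sharing only elements of class 0,
  which is used for padding.\<close>

lemma close_g_base_candidate:
  assumes B: "is_g_base G \<I> l g B" and close: "card (A - B) \<le> K"
  shows "B \<in> candidates pairs"
proof -
  have bB: "is_base \<I> B" using B by (simp add: is_g_base_def)
  let ?a = "class_count cls A" and ?b = "class_count cls B"
  let ?R = "\<lambda>c. if c = 0 then K - (\<Sum>d\<in>{1..<q}. ?a d - ?b d) else if c < q then ?a c - ?b c else 0"
  let ?S = "\<lambda>c. if c = 0 then K - (\<Sum>d\<in>{1..<q}. ?b d - ?a d) else if c < q then ?b c - ?a c else 0"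
  have fin: "finite A" "finite B" using base_finite base_A bB by blast+
  have diff: "class_count cls X c - class_count cls Y c \<le> class_count cls (X - Y) c"
    if "finite X" "finite Y" for X Y c
  proof -
    have "card ({e\<in>X. cls e = c} - {e\<in>Y. cls e = c}) = card {e \<in> X - Y. cls e = c}"
      by (rule arg_cong[where f = card]) auto
    then show ?thesis using diff_card_le_card_Diff[of "{e\<in>Y. cls e = c}" "{e\<in>X. cls e = c}"] that
      by (simp add: class_count_def)
  qed
  have bound: "(\<Sum>d\<in>{1..<q}. class_count cls X d - class_count cls Y d) \<le> card (X - Y)"
    if "finite X" "finite Y" "X \<subseteq> {..<n}" for X Y
  proof -
    have "(\<Sum>d\<in>{1..<q}. class_count cls X d - class_count cls Y d) \<le> (\<Sum>d\<in>{1..<q}. class_count cls (X - Y) d)"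
      by (rule sum_mono) (rule diff[OF that(1,2)])
    also have "\<dots> \<le> (\<Sum>d<q. class_count cls (X - Y) d)" by (rule sum_mono2) auto
    also have "\<dots> = card (X - Y)" by (rule sum_class_count) (use that cls in auto)
    finally show ?thesis .
  qed
  have "card (B - A) = card (A - B)"
    using base_card[OF base_A bB] fin by (simp add: card_Diff_subset_Int Int_commute)
  then have le: "(\<Sum>d\<in>{1..<q}. ?a d - ?b d) \<le> K" "(\<Sum>d\<in>{1..<q}. ?b d - ?a d) \<le> K"
    using bound[OF fin base_subset[OF base_A]] bound[OF fin(2,1) base_subset[OF bB]] close by auto
  have split: "(\<Sum>c<q. v c) = v 0 + (\<Sum>c\<in>{1..<q}. v c)" for v :: "nat \<Rightarrow> nat"
    using q(1) by (simp add: sum.atLeast_Suc_lessThan flip: atLeast0LessThan)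
  have padded: "(\<lambda>c. if c = 0 then K - (\<Sum>d\<in>{1..<q}. h d) else if c < q then h c else 0) \<in> comps q K"
    if le: "(\<Sum>d\<in>{1..<q}. h d) \<le> K" for h :: "nat \<Rightarrow> nat"
  proof -
    let ?h = "\<lambda>c. if c = 0 then K - (\<Sum>d\<in>{1..<q}. h d) else if c < q then h c else 0"
    have "(\<Sum>c\<in>{1..<q}. ?h c) = (\<Sum>d\<in>{1..<q}. h d)" by (rule sum.cong) auto
    then have "(\<Sum>c<q. ?h c) = K" unfolding split[of ?h] using le by simp
    then show ?thesis using q(1) unfolding comps_def by auto
  qed
  have R: "?R \<in> comps q K" and S: "?S \<in> comps q K" by (rule padded[OF le(1)], rule padded[OF le(2)])
  have tot: "?a 0 + (\<Sum>c\<in>{1..<q}. ?a c) = ?b 0 + (\<Sum>c\<in>{1..<q}. ?b c)"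
    unfolding split[symmetric] sum_class_count_base[OF base_A] sum_class_count_base[OF bB] by (rule base_card[OF base_A bB])
  have "(\<Sum>c\<in>{1..<q}. ?a c) + (\<Sum>c\<in>{1..<q}. ?b c - ?a c) = (\<Sum>c\<in>{1..<q}. ?b c) + (\<Sum>c\<in>{1..<q}. ?a c - ?b c)"
    unfolding sum.distrib[symmetric] by (rule sum.cong) auto
  \<comment> \<open>Both bases have the same size, so balance in all other classes forces balance in
    the padding class.\<close>
  then have zero: "?a 0 + ?S 0 = ?b 0 + ?R 0" using tot le by simp
  have t: "?R c \<le> ?a c + ?S c \<and> ?b c = target (?R, ?S) c" if "c < q" for c
  proof (cases "c = 0")
    case True
    then show ?thesis using zero by (simp add: target_def)
  next
    case False
    then show ?thesis using that by (auto simp: target_def)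
  qed
  have "power_label (target (?R, ?S)) = g"
    using B base_label[OF bB] power_label_cong[of ?b "target (?R, ?S)"] t by (simp add: is_g_base_def)
  then have "valid (?R, ?S)" using t by (auto simp: valid_def)
  then show ?thesis using bB t R S unfolding candidates_def pairs_def by blast
qed

text \<open>In the factorisation of \<open>g \<otimes> power_label R\<close> only the label of the
  unit dropped from \<open>S\<close> is not yet fixed. Cancellation determines this label, and
  injectivity of \<open>rep\<close> determines its class.\<close>

lemma valid_determined:
  assumes S: "S \<in> comps q K" "S' \<in> comps q K" and v: "valid (R, S)" "valid (R, S')" and d: "drop_one S = drop_one S'"
  shows "S = S'"
proof -
  obtain m where m: "m < q" "S = (drop_one S)(m := Suc (drop_one S m))" using drop_one_comps[OF S(1) K(1)] by metis
  obtain m' where m': "m' < q" "S' = (drop_one S')(m' := Suc (drop_one S' m'))" using drop_one_comps[OF S(2) K(1)] by metis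
  let ?a = "class_count cls A"
  have eq: "g \<otimes> power_label R = (power_label ?a \<otimes> power_label (drop_one U)) \<otimes> rep i"
    if i: "i < q" "U = (drop_one U)(i := Suc (drop_one U i))" and v: "valid (R, U)" for U i
  proof -
    have "g \<otimes> power_label R = power_label (\<lambda>c. target (R, U) c + R c)"
      using v by (simp add: power_label_add valid_def)
    also have "\<dots> = power_label (\<lambda>c. ?a c + drop_one U c + (if c = i then 1 else 0))"
    proof (rule power_label_cong)
      fix c assume "c < q"
      then have "R c \<le> ?a c + U c" using v by (simp add: valid_def)
      moreover have "U c = drop_one U c + (if c = i then 1 else 0)" using fun_cong[OF i(2), of c] by auto
      ultimately show "target (R, U) c + R c = ?a c + drop_one U c + (if c = i then 1 else 0)"
        by (simp add: target_def)
    qed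
    also have "\<dots> = (power_label ?a \<otimes> power_label (drop_one U)) \<otimes> rep i"
      unfolding power_label_add power_label_unit[OF i(1)] ..
    finally show ?thesis .
  qed
  have "(power_label ?a \<otimes> power_label (drop_one S)) \<otimes> rep m = (power_label ?a \<otimes> power_label (drop_one S)) \<otimes> rep m'"
    using eq[OF m v(1)] eq[OF m' v(2)] d by simp
  then have "rep m = rep m'" using rep_closed m(1) m'(1) power_label_closed by simp
  then have "m = m'" using rep_inj m(1) m'(1) by blast
  then show ?thesis using m(2) m'(2) d by metis
qed

lemma card_valid:
  assumes "q \<ge> 2"
  shows "card {x \<in> pairs. valid x} * K * q \<le> 4 * ((K + q - 1) choose K)\<^sup>2 * (min K (q - 1))\<^sup>2"
proof (rule pair_filter_bound[OF assms K(1)])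
  show "{x \<in> pairs. valid x} \<subseteq> comps q K \<times> comps q K" by (auto simp: pairs_def)
  show "S = S'" if "(R, S) \<in> {x \<in> pairs. valid x}" "(R, S') \<in> {x \<in> pairs. valid x}" "drop_one S = drop_one S'" for R S S'
    using valid_determined[of S S' R] that by (simp add: pairs_def)
  show "R 1 = 0 \<or> S 1 = 0" if "(R, S) \<in> {x \<in> pairs. valid x}" for R S
  proof -
    have "valid (R, S)" using that by simp
    note this[unfolded valid_def, THEN conjunct1, THEN spec, of 1]
    then show ?thesis using assms by simp
  qed
qed

text \<open>The deficit is bounded by the number of added units. That it vanishes for
  \<open>q = 1\<close> has to be recorded separately: there the binomial is 1 and
  \<open>min K (q - 1)\<close> is 0, so a factor \<open>K\<close> could not be paid for.\<close>

lemma target_sums: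
  assumes x: "x \<in> pairs" "valid x"
  shows "(\<Sum>c<q. target x c) = card A" "(\<Sum>c<q. target x c - class_count cls A c) \<le> (if q = 1 then 0 else K)"
proof -
  have s: "(\<Sum>c<q. fst x c) = K" "(\<Sum>c<q. snd x c) = K" using x by (auto simp: pairs_def comps_def)
  have "(\<Sum>c<q. target x c) + (\<Sum>c<q. fst x c) = (\<Sum>c<q. class_count cls A c) + (\<Sum>c<q. snd x c)"
    unfolding sum.distrib[symmetric] by (rule sum.cong) (use x(2) in \<open>auto simp: target_def valid_def\<close>)
  then show "(\<Sum>c<q. target x c) = card A" using s sum_class_count_base[OF base_A] by simp
  show "(\<Sum>c<q. target x c - class_count cls A c) \<le> (if q = 1 then 0 else K)"
  proof (cases "q = 1")
    case True
    then have "fst x 0 = snd x 0" using s by simp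
    then show ?thesis using True by (simp add: target_def)
  next
    case False
    have "(\<Sum>c<q. target x c - class_count cls A c) \<le> (\<Sum>c<q. snd x c)" by (rule sum_mono) (simp add: target_def)
    then show ?thesis using False s by simp
  qed
qed

end

section \<open>The program for one instance\<close>

context labeled_matroid
begin

text \<open>The invariant between two pairs. The cells from \<open>n\<close> or \<open>q\<close> on
  must be zero because the working arrays are compared as whole functions with
  \<open>mem_vec\<close> and \<open>class_count\<close>.\<close>

definition ready :: "'g state \<Rightarrow> bool" where
  "ready s \<longleftrightarrow> static s \<and> imem s 3 = mem_vec A \<and> imem s 30 = class_count cls A \<and> rmem s 4 0 = 0 \<and>
     gmem s 2 = rep \<and> gmem s 4 0 = \<one> \<and> gmem s 1 0 = g \<and> imem s 35 0 = K \<and>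
     (\<forall>e\<ge>n. imem s 50 e = 0) \<and> (\<forall>c\<ge>q. imem s 51 c = 0) \<and> (\<forall>e\<ge>n. imem s 52 e = 0)"

definition work_frame :: "nat set" where
  "work_frame = solve_frame \<union> {1, 2, 36, 37, 38, 39, 40, 41, 42, 43, 44, 45}"

lemma ready_frame:
  assumes "ready s" "frame X Y Z s s'" "X \<subseteq> work_frame" "Y \<subseteq> {5}" "Z \<subseteq> {1, 2, 3, 5, 6}"
    "X \<inter> {50, 51, 52} = {} \<or> (\<forall>e\<ge>n. imem s' 50 e = 0) \<and> (\<forall>c\<ge>q. imem s' 51 c = 0) \<and> (\<forall>e\<ge>n. imem s' 52 e = 0)"
  shows "ready s'"
proof -
  have fr: "frame work_frame {5} {1, 2, 3, 5, 6} s s'" by (rule frame_mono[OF assms(2-5)])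
  have st: "static s" using assms(1) by (simp add: ready_def)
  have "static s'" by (rule static_frame[OF st fr]) (auto simp: work_frame_def solve_frame_def search_frame_def)
  moreover have "imem s' 3 = imem s 3" "imem s' 30 = imem s 30" "imem s' 35 = imem s 35" "rmem s' 4 = rmem s 4"
      "gmem s' 2 = gmem s 2" "gmem s' 4 = gmem s 4" "gmem s' 1 = gmem s 1"
    by (simp_all add: frameD[OF fr] work_frame_def solve_frame_def search_frame_def)
  moreover have "(\<forall>e\<ge>n. imem s' 50 e = 0) \<and> (\<forall>c\<ge>q. imem s' 51 c = 0) \<and> (\<forall>e\<ge>n. imem s' 52 e = 0)"
    using assms(6)
  proof
    assume d: "X \<inter> {50, 51, 52} = {}"
    have "imem s' 50 = imem s 50" "imem s' 51 = imem s 51" "imem s' 52 = imem s 52"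
      using d by (intro frame_imem[OF assms(2)]; blast)+
    then show ?thesis using assms(1) by (simp add: ready_def)
  qed
  ultimately show ?thesis using assms(1) by (simp add: ready_def)
qed

lemma card_A: "card A \<le> n"
  using card_mono[OF _ base_subset[OF base_A]] by simp

lemma runs_check_pair:
  assumes ready: "ready s" and rows: "imem s 40 = fst x" "imem s 41 = snd x" and x: "x \<in> pairs"
    and T: "60 * (n + 1) + 120 * (q + 1) \<le> T"
  shows "runs check_pair s T (\<lambda>s'. frame {36, 42, 44, 45} {5} {} s s' \<and>
    (imem s' 44 0 \<noteq> 0 \<and> gmem s' 5 0 = g \<longleftrightarrow> valid x) \<and> (\<forall>c<q. imem s' 42 c = target x c))"
proof -
  let ?a = "class_count cls A"
  let ?ok = "\<lambda>c. (c = 0 \<or> fst x c = 0 \<or> snd x c = 0) \<and> fst x c \<le> ?a c + snd x c"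
  let ?P = "\<lambda>i s'. frame {36, 42, 44, 45} {5} {} s s' \<and> (imem s' 44 0 \<noteq> 0 \<longleftrightarrow> (\<forall>c<i. ?ok c)) \<and>
     (\<forall>c<i. imem s' 42 c = target x c) \<and> gmem s' 5 0 = (\<Otimes>c\<in>{..<i}. rep c [^] target x c)"
  let ?s = "s\<lparr>imem := store (imem s) 44 0 1, gmem := store (gmem s) 5 0 \<one>\<rparr>"
  let ?W = "While (less_test (val 45) (ICell 42 (val 36)))
          (GStore 5 (INum 0) (GMult (GCell 5 (INum 0)) (GCell 2 (val 36))) ;; incr 45)"
  let ?b = "Cond (TAnd (TNot (TAnd (ILe (INum 1) (val 36)) (TAnd (ILe (INum 1) (ICell 40 (val 36))) (ILe (INum 1) (ICell 41 (val 36))))))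
            (ILe (ICell 40 (val 36)) (IAdd (ICell 30 (val 36)) (ICell 41 (val 36)))))
          Skip (44 :== INum 0) ;;
        IStore 42 (val 36) (ISub (IAdd (ICell 30 (val 36)) (ICell 41 (val 36))) (ICell 40 (val 36))) ;;
        45 :== INum 0 ;; ?W"
  have rd: "imem s 11 0 = q" "imem s 30 = ?a" "gmem s 2 = rep" "gmem s 4 0 = \<one>"
    using ready by (simp_all add: ready_def static_def)
  have "runs (for_loop 36 11 ?b) ?s (T - 7) (?P q)"
  proof (rule runs_for_sum[where m = q and t = "\<lambda>i. 25 * (?a i + snd x i) + 100" and P = ?P])
    show "(\<Sum>i<q. 25 * (?a i + snd x i) + 100) + (q + 1) * 13 \<le> T - 7"
    proof -
      have "(\<Sum>i<q. 25 * (?a i + snd x i) + 100) = 25 * ((\<Sum>i<q. ?a i) + (\<Sum>i<q. snd x i)) + 100 * q"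
        by (simp add: sum.distrib sum_distrib_left[symmetric])
      also have "\<dots> = 25 * (card A + K) + 100 * q"
        using x sum_class_count_base[OF base_A] by (auto simp: pairs_def comps_def)
      finally show ?thesis using card_A K T by simp
    qed
  next
    fix i s1 assume i: "i < q" "imem s1 36 0 = i" and P: "?P i s1"
    have fr: "frame {36, 42, 44, 45} {5} {} s s1" using P by blast
    have r: "imem s1 40 = fst x" "imem s1 41 = snd x" "imem s1 30 = ?a" "gmem s1 2 = rep"
      using rows rd by (simp_all add: frameD[OF fr])
    define X where "X = (\<Otimes>c\<in>{..<i}. rep c [^] target x c)"
    have Xc: "X \<in> carrier G" unfolding X_def by (rule finprod_closed) (use i rep_closed in auto)
    have ri: "rep i \<in> carrier G" using rep_closed i by simp
    have t: "target x i = ?a i + snd x i - fst x i" by (simp add: target_def)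
    \<comment> \<open>The state in which the multiplication loop starts, described for both outcomes
      of the admissibility test.\<close>
    define s2 where "s2 = (if ?ok i then s1\<lparr>imem := store (store (imem s1) 42 i (target x i)) 45 0 0\<rparr>
      else s1\<lparr>imem := store (store (store (imem s1) 44 0 0) 42 i (target x i)) 45 0 0\<rparr>)"
    have s2: "frame {36, 42, 44, 45} {5} {} s s2" "imem s2 44 0 \<noteq> 0 \<longleftrightarrow> (\<forall>c<Suc i. ?ok c)"
      "\<forall>c<Suc i. imem s2 42 c = target x c" "gmem s2 5 0 = X" "imem s2 36 0 = i" "gmem s2 2 = rep"
      using P i r by (auto simp: s2_def store_row less_Suc_eq X_def)
    have W: "runs ?W s2 (25 * target x i + 10) (\<lambda>s'. ?P (Suc i) s' \<and> imem s' 36 0 = i)"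
    proof (rule runs_While[where \<phi> = "\<lambda>s'. 25 * (target x i - imem s' 45 0)" and
        P = "\<lambda>s'. frame {45} {5} {} s2 s' \<and> imem s' 45 0 \<le> target x i \<and> gmem s' 5 0 = X \<otimes> rep i [^] imem s' 45 0"])
      show "frame {45} {5} {} s2 s2 \<and> imem s2 45 0 \<le> target x i \<and> gmem s2 5 0 = X \<otimes> rep i [^] imem s2 45 0"
        using s2(4) Xc by (simp add: s2_def store_row)
    next
      fix s3 assume P3: "frame {45} {5} {} s2 s3 \<and> imem s3 45 0 \<le> target x i \<and> gmem s3 5 0 = X \<otimes> rep i [^] imem s3 45 0"
        and b: "tval G n \<I> s3 (less_test (val 45) (ICell 42 (val 36)))"
      note fr3 = P3[THEN conjunct1]
      have r3: "imem s3 36 0 = i" "imem s3 42 i = target x i" "gmem s3 2 = rep"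
        using s2 by (simp_all add: frameD[OF fr3])
      have lt: "imem s3 45 0 < target x i" using b r3 by simp
      have "runs (GStore 5 (INum 0) (GMult (GCell 5 (INum 0)) (GCell 2 (val 36))) ;; incr 45) s3 15
         (\<lambda>s'. (frame {45} {5} {} s2 s' \<and> imem s' 45 0 \<le> target x i \<and> gmem s' 5 0 = X \<otimes> rep i [^] imem s' 45 0) \<and>
           25 * (target x i - imem s' 45 0) + 15 + 1 + tcost (less_test (val 45) (ICell 42 (val 36))) \<le>
           25 * (target x i - imem s3 45 0))"
        using P3 lt Xc ri by (simp add: r3 store_row m_assoc)
      then show "\<exists>t. runs (GStore 5 (INum 0) (GMult (GCell 5 (INum 0)) (GCell 2 (val 36))) ;; incr 45) s3 t
         (\<lambda>s'. (frame {45} {5} {} s2 s' \<and> imem s' 45 0 \<le> target x i \<and> gmem s' 5 0 = X \<otimes> rep i [^] imem s' 45 0) \<and>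
           25 * (target x i - imem s' 45 0) + t + 1 + tcost (less_test (val 45) (ICell 42 (val 36))) \<le>
           25 * (target x i - imem s3 45 0))" by blast
    next
      fix s3 assume P3: "frame {45} {5} {} s2 s3 \<and> imem s3 45 0 \<le> target x i \<and> gmem s3 5 0 = X \<otimes> rep i [^] imem s3 45 0"
        and b: "\<not> tval G n \<I> s3 (less_test (val 45) (ICell 42 (val 36)))"
      note fr3 = P3[THEN conjunct1]
      have r3: "imem s3 36 0 = i" "imem s3 42 = imem s2 42" "imem s3 44 = imem s2 44"
        using s2 by (simp_all add: frameD[OF fr3])
      have j: "imem s3 45 0 = target x i" using b P3 r3 s2(3) by simp
      have "frame {36, 42, 44, 45} {5} {} s2 s3" by (rule frame_mono[OF fr3]) auto
      with s2(1) have f: "frame {36, 42, 44, 45} {5} {} s s3" by (rule frame_trans)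
      have "(\<Otimes>c\<in>{..<Suc i}. rep c [^] target x c) = rep i [^] target x i \<otimes> X"
        unfolding lessThan_Suc X_def by (rule finprod_insert) (use i rep_closed in auto)
      then have "gmem s3 5 0 = (\<Otimes>c\<in>{..<Suc i}. rep c [^] target x c)"
        using P3 j Xc ri by (simp add: m_comm)
      then show "?P (Suc i) s3 \<and> imem s3 36 0 = i" using f r3 s2(2,3) by simp
    qed (use s2 in \<open>simp add: s2_def store_row\<close>)
    have e: "Suc 0 \<le> y \<longleftrightarrow> y \<noteq> 0" for y :: nat by auto
    have "25 * target x i \<le> 25 * (?a i + snd x i)" by (simp add: t)
    then have W': "runs ?W s2 (25 * (?a i + snd x i) + 15) (\<lambda>s'. ?P (Suc i) s' \<and> imem s' 36 0 = i)"
      by (intro runs_mono[OF W]) auto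
    define Q where "Q = (\<lambda>s'. ?P (Suc i) s' \<and> imem s' 36 0 = i)"
    have ok: "?ok i \<longleftrightarrow> \<not> (Suc 0 \<le> i \<and> Suc 0 \<le> fst x i \<and> Suc 0 \<le> snd x i) \<and> fst x i \<le> ?a i + snd x i"
      using e by auto
    have W'': "runs ?W s2 (t - m) Q" if "m \<le> 60" "t = 25 * (?a i + snd x i) + 100" for t m
      unfolding Q_def by (rule runs_mono[OF W']) (use that in auto)
    have "runs ?b s1 t0 Q" if t0: "t0 = 25 * (?a i + snd x i) + 100" for t0
    proof -
      have big: "100 \<le> t0" using t0 by simp
      show ?thesis
      proof (cases "?ok i")
        case True
        then have s2e: "s2 = s1\<lparr>imem := store (store (imem s1) 42 i (target x i)) 45 0 0\<rparr>" by (simp add: s2_def)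
        show ?thesis
          using True[unfolded ok] W''[OF _ t0, unfolded s2e] i big by (auto simp: r store_row t)
      next
        case False
        then have s2e: "s2 = s1\<lparr>imem := store (store (store (imem s1) 44 0 0) 42 i (target x i)) 45 0 0\<rparr>"
          unfolding s2_def by (rule if_not_P)
        show ?thesis
          using False[unfolded ok] W''[OF _ t0, unfolded s2e] i big by (auto simp: r store_row t)
      qed
    qed
    then show "runs ?b s1 (25 * (?a i + snd x i) + 100) (\<lambda>s'. ?P (Suc i) s' \<and> imem s' 36 0 = i)"
      unfolding Q_def by blast
  qed (use rd in \<open>auto simp: store_row frame_def\<close>)
  moreover have "7 \<le> T" using T by simp
  ultimately have "runs check_pair s T (?P q)" unfolding check_pair_def by (simp add: rd)
  then show ?thesis
    by (rule runs_mono) (auto simp: valid_def power_label_def)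
qed

lemma runs_record_base:
  assumes ready: "ready s" and B: "imem s 50 = mem_vec B" "B \<subseteq> {..<n}" and T: "80 * (n + 1) + 50 \<le> T"
  shows "runs record_base s T (\<lambda>s'. frame {1, 2, 29} {} {5, 6} s s' \<and>
    (if imem s 1 0 \<noteq> 0 \<and> rmem s 5 0 \<le> sum w B then imem s' 1 0 = imem s 1 0 \<and> imem s' 2 = imem s 2 \<and> rmem s' 5 0 = rmem s 5 0
     else imem s' 1 0 = 1 \<and> (\<forall>e<n. imem s' 2 e = mem_vec B e) \<and> rmem s' 5 0 = sum w B))"
proof -
  have rd: "imem s 0 0 = n" "rmem s 0 = w" "rmem s 4 0 = 0" using ready by (simp_all add: ready_def static_def)
  have e: "Suc 0 \<le> y \<longleftrightarrow> y \<noteq> 0" for y :: nat by auto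
  let ?s = "s\<lparr>rmem := store (rmem s) 6 0 0\<rparr>"
  let ?P = "\<lambda>i s'. frame {29} {} {6} s s' \<and> rmem s' 6 0 = (\<Sum>e<i. if e \<in> B then w e else 0)"
  have W: "runs (for_loop 29 0 (Cond (ILe (INum 1) (ICell 50 (val 29)))
       (RStore 6 (INum 0) (RAdd (RCell 6 (INum 0)) (RCell 0 (val 29)))) Skip)) ?s (40 * (n + 1))
       (\<lambda>s'. frame {29} {} {6} s s' \<and> rmem s' 6 0 = sum w B)"
  proof (rule runs_for[where m = n and t = 25 and P = ?P])
    fix i s1 assume i: "i < n" "imem s1 29 0 = i" and P: "?P i s1"
    note fr = P[THEN conjunct1]
    have r: "imem s1 50 = mem_vec B" "rmem s1 0 = w" using B rd by (simp_all add: frameD[OF fr])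
    show "runs (Cond (ILe (INum 1) (ICell 50 (val 29)))
       (RStore 6 (INum 0) (RAdd (RCell 6 (INum 0)) (RCell 0 (val 29)))) Skip) s1 25 (\<lambda>s'. ?P (Suc i) s' \<and> imem s' 29 0 = i)"
      using P i by (simp add: r store_row e)
  next
    fix s1 assume P: "?P n s1"
    have "(\<Sum>e<n. if e \<in> B then w e else 0) = sum w B"
      using B(2) by (simp add: sum.If_cases Int_absorb1)
    then show "frame {29} {} {6} s s1 \<and> rmem s1 6 0 = sum w B" using P by simp
  qed (use rd in \<open>auto simp: store_row frame_def\<close>)
  let ?C = "Cond (TAnd (ILe (INum 1) (val 1)) (RLe (RCell 5 (INum 0)) (RCell 6 (INum 0)))) Skip
       (1 :== INum 1 ;; RStore 5 (INum 0) (RCell 6 (INum 0)) ;;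
        for_loop 29 0 (IStore 2 (val 29) (ICell 50 (val 29))))"
  define Q where "Q s' \<longleftrightarrow> frame {1, 2, 29} {} {5, 6} s s' \<and>
    (if imem s 1 0 \<noteq> 0 \<and> rmem s 5 0 \<le> sum w B then imem s' 1 0 = imem s 1 0 \<and> imem s' 2 = imem s 2 \<and> rmem s' 5 0 = rmem s 5 0
     else imem s' 1 0 = 1 \<and> (\<forall>e<n. imem s' 2 e = mem_vec B e) \<and> rmem s' 5 0 = sum w B)" for s'
  have C: "runs ?C s1 (20 * (n + 1) + 30) Q" if s1: "frame {29} {} {6} s s1 \<and> rmem s1 6 0 = sum w B" for s1
  proof -
    note fr = s1[THEN conjunct1]
    have r: "imem s1 1 = imem s 1" "imem s1 2 = imem s 2" "rmem s1 5 = rmem s 5" "imem s1 50 = mem_vec B" "imem s1 0 0 = n"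
      using B rd by (simp_all add: frameD[OF fr])
    have fr': "frame {1, 2, 29} {} {5, 6} s s1" by (rule frame_mono[OF fr]) auto
    show ?thesis
    proof (cases "imem s 1 0 \<noteq> 0 \<and> rmem s 5 0 \<le> sum w B")
      case True
      then have "Q s1" using fr' r by (simp add: Q_def)
      then show ?thesis using True s1 r(1)[unfolded One_nat_def] r(3) by (simp add: e)
    next
      case False
      let ?s2 = "s1\<lparr>imem := store (imem s1) 1 0 1, rmem := store (rmem s1) 5 0 (sum w B)\<rparr>"
      have "runs (for_loop 29 0 (IStore 2 (val 29) (ICell 50 (val 29)))) ?s2 (20 * (n + 1)) Q"
      proof (rule runs_for[where m = n and t = 6 and P = "\<lambda>i s'. frame {2, 29} {} {} ?s2 s' \<and> (\<forall>e<i. imem s' 2 e = mem_vec B e)"])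
        fix s3 assume s3: "frame {2, 29} {} {} ?s2 s3 \<and> (\<forall>e<n. imem s3 2 e = mem_vec B e)"
        note fr3 = s3[THEN conjunct1]
        have "frame {1, 2, 29} {} {5, 6} ?s2 s3" by (rule frame_mono[OF fr3]) auto
        moreover have "frame {1, 2, 29} {} {5, 6} s ?s2" using fr' by simp
        ultimately have "frame {1, 2, 29} {} {5, 6} s s3" using frame_trans by blast
        moreover have "imem s3 1 0 = 1" "rmem s3 5 0 = sum w B" by (simp_all add: frameD[OF fr3] store_row)
        ultimately show "Q s3" using False s3 by (auto simp: Q_def)
      qed (use r in \<open>auto simp: store_row frame_def less_Suc_eq\<close>)
      moreover have "\<not> (Suc 0 \<le> imem s1 (Suc 0) 0 \<and> rmem s1 5 0 \<le> rmem s1 6 0)"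
        using False s1 r(1)[unfolded One_nat_def] r(3) by (simp add: e)
      ultimately have "runs (1 :== INum 1 ;; RStore 5 (INum 0) (RCell 6 (INum 0)) ;;
        for_loop 29 0 (IStore 2 (val 29) (ICell 50 (val 29)))) s1 (20 * (n + 1) + 7) Q"
        using s1 by simp
      then show ?thesis using \<open>\<not> (Suc 0 \<le> imem s1 (Suc 0) 0 \<and> rmem s1 5 0 \<le> rmem s1 6 0)\<close>
        by (simp only: runs_Cond tval.simps ival.simps rval.simps) (auto elim: runs_mono)
    qed
  qed
  have "runs record_base s T Q" unfolding record_base_def
    using runs_Seq[OF W C, of "T - 4"] T rd by simp
  then show ?thesis unfolding Q_def .
qed

text \<open>Only the first \<open>n\<close> cells of array 2 are constrained, which are the ones
  that \<open>answer\<close> reads.\<close>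

definition best :: "((nat \<Rightarrow> nat) \<times> (nat \<Rightarrow> nat)) set \<Rightarrow> 'g state \<Rightarrow> bool" where
  "best D s \<longleftrightarrow> (imem s 1 0 = 0 \<and> candidates D = {} \<or> imem s 1 0 \<noteq> 0 \<and> (\<exists>B\<in>candidates D.
     (\<forall>e<n. imem s 2 e = mem_vec B e) \<and> rmem s 5 0 = sum w B \<and> (\<forall>B'\<in>candidates D. sum w B \<le> sum w B')))"

lemma best_cong:
  assumes "imem s' 1 0 = imem s 1 0" "imem s' 2 = imem s 2" "rmem s' 5 0 = rmem s 5 0" "candidates D' = candidates D"
  shows "best D' s' \<longleftrightarrow> best D s"
  using assms by (simp add: best_def)

lemma best_insert:
  assumes D: "best D s" and B: "B \<in> candidates {x}" "\<And>B'. B' \<in> candidates {x} \<Longrightarrow> sum w B \<le> sum w B'"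
    and s': "if imem s 1 0 \<noteq> 0 \<and> rmem s 5 0 \<le> sum w B then imem s' 1 0 = imem s 1 0 \<and> imem s' 2 = imem s 2 \<and> rmem s' 5 0 = rmem s 5 0
     else imem s' 1 0 = 1 \<and> (\<forall>e<n. imem s' 2 e = mem_vec B e) \<and> rmem s' 5 0 = sum w B"
  shows "best (insert x D) s'"
proof -
  have U: "candidates (insert x D) = candidates {x} \<union> candidates D"
    using candidates_Un[of "{x}" D] by simp
  show ?thesis
  proof (cases "imem s 1 0 \<noteq> 0 \<and> rmem s 5 0 \<le> sum w B")
    case True
    then obtain C where C: "C \<in> candidates D" "\<forall>e<n. imem s 2 e = mem_vec C e" "rmem s 5 0 = sum w C"
      "\<forall>B'\<in>candidates D. sum w C \<le> sum w B'" using D by (auto simp: best_def)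
    have "sum w C \<le> sum w B'" if "B' \<in> candidates {x}" for B' using B(2)[OF that] True C(3) by simp
    then show ?thesis unfolding best_def U using True s' C by (intro disjI2 conjI bexI[of _ C]) auto
  next
    case False
    then have s: "imem s' 1 0 = 1" "\<forall>e<n. imem s' 2 e = mem_vec B e" "rmem s' 5 0 = sum w B" using s' by auto
    have "sum w B \<le> sum w B'" if "B' \<in> candidates D" for B'
      using False D that by (fastforce simp: best_def)
    then show ?thesis unfolding best_def U using s B by (intro disjI2 conjI bexI[of _ B]) auto
  qed
qed

text \<open>The bound of \<open>runs_solve\<close> with the total deficit replaced by its estimate
  from \<open>target_sums\<close>.\<close>

definition solve_time :: nat where
  "solve_time = ((if q = 1 then 0 else K) + 1) * (190 * (q * n) + 800 * (q + 1) * (q + 1) + 60 * (n + 1)) +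
      60 * (n + 1) + 50 * (q + 1)"

text \<open>Every pair pays the linear part, but only valid pairs pay for \<open>solve\<close>; this
  split is what lets the count of valid pairs improve the running time.\<close>

definition pair_time :: "(nat \<Rightarrow> nat) \<times> (nat \<Rightarrow> nat) \<Rightarrow> nat" where
  "pair_time x = 140 * (n + 1) + 120 * (q + 1) + 100 + (if valid x then solve_time else 0)"

lemma runs_try_pair:
  assumes ready: "ready s" and rows: "imem s 40 = fst x" "imem s 41 = snd x" and x: "x \<in> pairs" and best: "best D s"
  shows "runs try_pair s (pair_time x) (\<lambda>s'. ready s' \<and> frame (work_frame - {35, 37, 38, 39, 40, 41, 43}) {5} {1, 2, 3, 5, 6} s s' \<and>
    best (insert x D) s')"
proof -
  let ?F = "work_frame - {35, 37, 38, 39, 40, 41, 43}"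
  let ?Q = "\<lambda>s'. ready s' \<and> frame ?F {5} {1, 2, 3, 5, 6} s s' \<and> best (insert x D) s'"
  have e: "Suc 0 \<le> y \<longleftrightarrow> y \<noteq> 0" for y :: nat by auto
  have U: "candidates (insert x D) = candidates {x} \<union> candidates D"
    using candidates_Un[of "{x}" D] by simp
  have sub: "\<And>X. X \<subseteq> ?F \<Longrightarrow> X \<subseteq> work_frame" by blast
  have rest: "runs (Cond (TAnd (ILe (INum 1) (val 44)) (GEq (GCell 5 (INum 0)) (GCell 1 (INum 0))))
     (solve ;; Cond (ILe (val 76) (INum 1)) record_base Skip) Skip) s1
     (80 * (n + 1) + 80 + (if valid x then solve_time else 0)) ?Q"
    if s1: "frame {36, 42, 44, 45} {5} {} s s1 \<and>
      (imem s1 44 0 \<noteq> 0 \<and> gmem s1 5 0 = g \<longleftrightarrow> valid x) \<and> (\<forall>c<q. imem s1 42 c = target x c)" for s1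
  proof -
    note fr1 = s1[THEN conjunct1]
    have ready1: "ready s1"
      by (rule ready_frame[OF ready fr1]) (auto simp: work_frame_def)
    have F1: "frame ?F {5} {1, 2, 3, 5, 6} s s1" by (rule frame_mono[OF fr1]) (auto simp: work_frame_def)
    have best1: "best D s1" using best by (subst best_cong[where s = s]) (simp_all add: frameD[OF fr1])
    have g1: "gmem s1 1 0 = g" using ready1 by (simp add: ready_def)
    show ?thesis
    proof (cases "valid x")
      case False
      then have "candidates {x} = {}" by (simp add: candidates_def)
      then have "best (insert x D) s1" using best1 U by (subst best_cong[where s = s1 and D = D]) simp_all
      then show ?thesis using False s1 ready1 F1 g1[unfolded One_nat_def] by (auto simp: e)
    next
      case True
      have tsum: "(\<Sum>c<q. imem s1 42 c) = card A"
        using target_sums(1)[OF x True] s1 by simp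
      have tdiff: "(\<Sum>c<q. imem s1 42 c - class_count cls A c) \<le> (if q = 1 then 0 else K)"
        using target_sums(2)[OF x True] s1 by simp
      have cand: "B \<in> candidates {x} \<longleftrightarrow> is_base \<I> B \<and> (\<forall>c<q. class_count cls B c = imem s1 42 c)" for B
        using True s1 by (auto simp: candidates_def)
      have rd: "static s1" "imem s1 3 = mem_vec A" "imem s1 30 = class_count cls A" "rmem s1 4 0 = 0"
        "\<forall>e\<ge>n. imem s1 50 e = 0" "\<forall>c\<ge>q. imem s1 51 c = 0" "\<forall>e\<ge>n. imem s1 52 e = 0"
        using ready1 by (simp_all add: ready_def)
      have T: "((\<Sum>c<q. imem s1 42 c - class_count cls A c) + 1) * (190 * (q * n) + 800 * (q + 1) * (q + 1) + 60 * (n + 1)) +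
          60 * (n + 1) + 50 * (q + 1) \<le> solve_time"
        unfolding solve_time_def by (intro add_mono mult_le_mono tdiff order_refl)
      note S = runs_solve[OF rd(1) A rd(2-4) refl rd(5-7) tsum T]
      have R: "runs (Cond (ILe (val 76) (INum 1)) record_base Skip) s2 (80 * (n + 1) + 60) ?Q"
        if s2: "frame solve_frame {} {1, 2, 3} s1 s2 \<and>
    (\<forall>e\<ge>n. imem s2 50 e = 0) \<and> (\<forall>c\<ge>q. imem s2 51 c = 0) \<and> (\<forall>e\<ge>n. imem s2 52 e = 0) \<and>
    (imem s2 76 0 = 1 \<and> (\<exists>B. imem s2 50 = mem_vec B \<and> is_base \<I> B \<and> (\<forall>c<q. class_count cls B c = imem s1 42 c) \<and>
       (\<forall>B'. is_base \<I> B' \<longrightarrow> (\<forall>c<q. class_count cls B' c = imem s1 42 c) \<longrightarrow> sum w B \<le> sum w B')) \<or>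
     imem s2 76 0 = 2 \<and> (\<forall>B'. is_base \<I> B' \<longrightarrow> (\<exists>c<q. class_count cls B' c \<noteq> imem s1 42 c)))" for s2
      proof -
        note fr2 = s2[THEN conjunct1]
        have ready2: "ready s2" by (rule ready_frame[OF ready1 fr2]) (use s2 in \<open>auto simp: work_frame_def\<close>)
        have "frame ?F {5} {1, 2, 3, 5, 6} s1 s2"
          by (rule frame_mono[OF fr2]) (auto simp: work_frame_def solve_frame_def search_frame_def)
        with F1 have F2: "frame ?F {5} {1, 2, 3, 5, 6} s s2" by (rule frame_trans)
        have best2: "best D s2" using best1
          by (subst best_cong[where s = s1]) (simp_all add: frameD[OF fr2] solve_frame_def search_frame_def)
        show ?thesis
        proof (cases "imem s2 76 0 = 2")
          case True
          then have "candidates {x} = {}" using s2 cand by auto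
          then have "best (insert x D) s2" using best2 U by (subst best_cong[where s = s2 and D = D]) simp_all
          then show ?thesis using True ready2 F2 by simp
        next
          case False
          then obtain B where B: "imem s2 50 = mem_vec B" "B \<in> candidates {x}"
            "\<And>B'. B' \<in> candidates {x} \<Longrightarrow> sum w B \<le> sum w B'" and o: "imem s2 76 0 = 1"
            using s2 unfolding cand by blast
          have Bn: "B \<subseteq> {..<n}" using B(2) base_subset unfolding cand by blast
          have "runs record_base s2 (80 * (n + 1) + 50) ?Q"
          proof (rule runs_mono[OF runs_record_base[OF ready2 B(1) Bn order_refl] order_refl])
            fix s3 assume s3: "frame {1, 2, 29} {} {5, 6} s2 s3 \<and>
    (if imem s2 1 0 \<noteq> 0 \<and> rmem s2 5 0 \<le> sum w B then imem s3 1 0 = imem s2 1 0 \<and> imem s3 2 = imem s2 2 \<and> rmem s3 5 0 = rmem s2 5 0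
     else imem s3 1 0 = 1 \<and> (\<forall>e<n. imem s3 2 e = mem_vec B e) \<and> rmem s3 5 0 = sum w B)"
            note fr3 = s3[THEN conjunct1]
            have "ready s3" by (rule ready_frame[OF ready2 fr3]) (auto simp: work_frame_def solve_frame_def search_frame_def)
            moreover have "frame ?F {5} {1, 2, 3, 5, 6} s2 s3"
              by (rule frame_mono[OF fr3]) (auto simp: work_frame_def solve_frame_def search_frame_def)
            with F2 have "frame ?F {5} {1, 2, 3, 5, 6} s s3" by (rule frame_trans)
            moreover have "best (insert x D) s3" by (rule best_insert[OF best2 B(2,3) s3[THEN conjunct2]])
            ultimately show "?Q s3" by blast
          qed
          from runs_mono[OF this, of "80 * (n + 1) + 55"] show ?thesis using o by simp
        qed
      qed
      have "runs (solve ;; Cond (ILe (val 76) (INum 1)) record_base Skip) s1 (solve_time + (80 * (n + 1) + 60)) ?Q"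
        by (rule runs_Seq[OF S R]) simp_all
      then have "runs (solve ;; Cond (ILe (val 76) (INum 1)) record_base Skip) s1
          (80 * (n + 1) + 80 + solve_time - (1 + tcost (TAnd (ILe (INum 1) (val 44)) (GEq (GCell 5 (INum 0)) (GCell 1 (INum 0))) :: 'g test))) ?Q"
        by (rule runs_mono) auto
      moreover have "tval G n \<I> s1 (TAnd (ILe (INum 1) (val 44)) (GEq (GCell 5 (INum 0)) (GCell 1 (INum 0))))"
        using s1 True g1 by (simp add: e)
      moreover have "1 + tcost (TAnd (ILe (INum 1) (val 44)) (GEq (GCell 5 (INum 0)) (GCell 1 (INum 0))) :: 'g test) \<le>
          80 * (n + 1) + 80 + solve_time" by simp
      ultimately show ?thesis unfolding runs_Cond using True by presburger
    qed
  qed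
  show ?thesis unfolding try_pair_def
    by (rule runs_Seq[OF runs_check_pair[OF ready rows x order_refl] rest]) (auto simp: pair_time_def)
qed

definition step_time :: nat where "step_time = 30 * (q + 1) + 50"

lemma runs_inner:
  assumes ready: "ready s" and R: "imem s 40 = R" "R \<in> comps q K" and S: "\<forall>c\<ge>q. imem s 41 c = 0" and best: "best D s"
  shows "runs (comp_init 41 ;; 43 :== INum 0 ;; While (ILe (val 43) (INum 0)) (try_pair ;; comp_next 41 43)) s
    ((\<Sum>S\<in>comps q K. pair_time (R, S) + step_time) + 30 * (q + 1) + 20)
    (\<lambda>s'. ready s' \<and> frame (work_frame - {35, 39, 40}) {5} {1, 2, 3, 5, 6} s s' \<and> best (D \<union> {R} \<times> comps q K) s' \<and>
      imem s' 41 \<in> comps q K)"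
proof -
  let ?F = "work_frame - {35, 39, 40}"
  have st: "imem s 11 0 = q" "imem s 35 0 = K" using ready by (simp_all add: ready_def static_def)
  have fin: "finite (comps q K)" using comps_card[OF q(1)] by blast
  define v0 where "v0 = (\<lambda>i::nat. if i = 0 then K else 0)"
  note v0 = comps_from_first[OF q(1) v0_def]
  note init = runs_comp_init[OF st(1) q(1) st(2) S _ order_refl, folded v0_def]
  define T where "T = (\<Sum>S\<in>comps q K. pair_time (R, S) + step_time)"
  define \<phi> where "\<phi> s' = (if imem s' 43 0 = 0 then (\<Sum>S\<in>comps_from q K (imem s' 41). pair_time (R, S) + step_time) else 0)" for s' :: "'g state"
  define P where "P s' \<longleftrightarrow> ready s' \<and> frame ?F {5} {1, 2, 3, 5, 6} s s' \<and> imem s' 41 \<in> comps q K \<and>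
     (if imem s' 43 0 = 0 then best (D \<union> {R} \<times> (comps q K - comps_from q K (imem s' 41))) s' else best (D \<union> {R} \<times> comps q K) s')" for s'
  have loop: "runs (43 :== INum 0 ;; While (ILe (val 43) (INum 0)) (try_pair ;; comp_next 41 43)) s1 (T + 20)
      (\<lambda>s'. P s' \<and> imem s' 43 0 \<noteq> 0)"
    if s1: "frame {41, 36} {} {} s s1 \<and> imem s1 41 = v0" for s1
  proof -
    note fr1 = s1[THEN conjunct1]
    let ?s = "s1\<lparr>imem := store (imem s1) 43 0 0\<rparr>"
    have fr: "frame {36, 41, 43} {} {} s ?s"
      using frame_mono[OF fr1, of "{36, 41, 43}" "{}" "{}"] by simp
    have "ready ?s" by (rule ready_frame[OF ready fr]) (auto simp: work_frame_def)
    moreover have "frame ?F {5} {1, 2, 3, 5, 6} s ?s" by (rule frame_mono[OF fr]) (auto simp: work_frame_def)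
    moreover have "best D ?s" using best by (subst best_cong[where s = s]) (simp_all add: store_row frameD[OF fr1])
    ultimately have P0: "P ?s" using s1 v0 by (simp add: P_def store_row)
    have "runs (While (ILe (val 43) (INum 0)) (try_pair ;; comp_next 41 43)) ?s (T + 10) (\<lambda>s'. P s' \<and> imem s' 43 0 \<noteq> 0)"
    proof (rule runs_While_exec[where P = P and \<phi> = \<phi>])
      show "\<phi> ?s + 1 + tcost (ILe (val 43) (INum 0)) \<le> T + 10" using s1 v0 by (simp add: \<phi>_def store_row T_def)
    next
      fix s2 assume P: "P s2" and b: "tval G n \<I> s2 (ILe (val 43) (INum 0))"
      define S where "S = imem s2 41"
      have z: "imem s2 43 0 = 0" using b by simp
      have ready2: "ready s2" and fr2: "frame ?F {5} {1, 2, 3, 5, 6} s s2" and SC: "S \<in> comps q K"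
        and best2: "best (D \<union> {R} \<times> (comps q K - comps_from q K S)) s2"
        using P z by (simp_all add: P_def S_def)
      have r2: "imem s2 40 = fst (R, S)" "imem s2 41 = snd (R, S)"
        using R by (simp_all add: S_def frameD[OF fr2] work_frame_def)
      have x: "(R, S) \<in> pairs" using R SC by (simp add: pairs_def)
      obtain t3 s3 where e3: "exec G n \<I> try_pair s2 t3 s3" "t3 \<le> pair_time (R, S)"
        and tp: "ready s3 \<and> frame (work_frame - {35, 37, 38, 39, 40, 41, 43}) {5} {1, 2, 3, 5, 6} s2 s3 \<and>
          best (insert (R, S) (D \<union> {R} \<times> (comps q K - comps_from q K S))) s3"
        by (rule runsE[OF runs_try_pair[OF ready2 r2 x best2]])
      note ready3 = tp[THEN conjunct1] and fr3 = tp[THEN conjunct2, THEN conjunct1] and best3 = tp[THEN conjunct2, THEN conjunct2]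
      have r3: "imem s3 11 0 = q" "imem s3 41 = S" "imem s3 43 0 = 0"
        using ready3 z by (simp_all add: ready_def static_def S_def frameD[OF fr3])
      obtain t4 s4 where e4: "exec G n \<I> (comp_next 41 43) s3 t4 s4" "t4 \<le> 30 * (q + 1) + 40"
        and cn: "frame {41, 43, 37, 38} {} {} s3 s4 \<and>
          (imem s4 43 0 \<noteq> 0 \<and> imem s4 41 = S \<and> comps_from q K S = {S} \<or>
           imem s4 43 0 = 0 \<and> imem s4 41 \<in> comps q K \<and> comps_from q K (imem s4 41) = comps_from q K S - {S})"
        by (rule runsE[OF runs_comp_next[OF r3(1,2) SC K(1) _ _ r3(3) order_refl]]) simp_all
      note fr4 = cn[THEN conjunct1]
      have ready4: "ready s4" by (rule ready_frame[OF ready3 fr4]) (auto simp: work_frame_def)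
      have "frame ?F {5} {1, 2, 3, 5, 6} s2 s3" by (rule frame_mono[OF fr3]) auto
      moreover have "frame ?F {5} {1, 2, 3, 5, 6} s3 s4" by (rule frame_mono[OF fr4]) (auto simp: work_frame_def)
      ultimately have fr4': "frame ?F {5} {1, 2, 3, 5, 6} s s4" using fr2 frame_trans by blast
      have self: "S \<in> comps_from q K S" using SC by (simp add: comps_from_def)
      have sub: "comps_from q K S \<subseteq> comps q K" by (auto simp: comps_from_def)
      have sum: "(\<Sum>S'\<in>comps_from q K S. pair_time (R, S') + step_time) =
          pair_time (R, S) + step_time + (\<Sum>S'\<in>comps_from q K S - {S}. pair_time (R, S') + step_time)"
        by (rule sum.remove[OF finite_subset[OF sub fin] self])
      have ins: "insert (R, S) (D \<union> {R} \<times> (comps q K - comps_from q K S)) = D \<union> {R} \<times> (comps q K - (comps_from q K S - {S}))"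
        using SC by auto
      have best4: "best (D \<union> {R} \<times> (comps q K - (comps_from q K S - {S}))) s4"
        using best3 unfolding ins by (subst best_cong[where s = s3]) (simp_all add: frameD[OF fr4])
      have "exec G n \<I> (try_pair ;; comp_next 41 43) s2 (t3 + t4) s4" using e3(1) e4(1) by (rule exec.Seq)
      moreover have "P s4 \<and> \<phi> s4 + pair_time (R, S) + step_time \<le> \<phi> s2"
      proof (cases "imem s4 43 0 = 0")
        case True
        then have c: "imem s4 41 \<in> comps q K" "comps_from q K (imem s4 41) = comps_from q K S - {S}" using cn by auto
        show ?thesis using ready4 fr4' best4 True z c sum by (simp add: P_def \<phi>_def S_def[symmetric])
      next
        case False
        then have c: "imem s4 41 = S" "comps_from q K S = {S}" using cn by auto
        have "best (D \<union> {R} \<times> comps q K) s4" using best4 unfolding c by simp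
        then show ?thesis using ready4 fr4' False z c SC sum by (simp add: P_def \<phi>_def S_def[symmetric])
      qed
      ultimately show "\<exists>t s'. exec G n \<I> (try_pair ;; comp_next 41 43) s2 t s' \<and> P s' \<and>
          \<phi> s' + t + 1 + tcost (ILe (val 43) (INum 0)) \<le> \<phi> s2"
        using e3(2) e4(2) by (intro exI[of _ "t3 + t4"] exI[of _ s4]) (auto simp: step_time_def)
    next
      fix s2 assume "P s2" "\<not> tval G n \<I> s2 (ILe (val 43) (INum 0))"
      then show "P s2 \<and> imem s2 43 0 \<noteq> 0" by simp
    qed (rule P0)
    then have "runs (While (ILe (val 43) (INum 0)) (try_pair ;; comp_next 41 43)) ?s (T + 20 - 3) (\<lambda>s'. P s' \<and> imem s' 43 0 \<noteq> 0)"
      by (rule runs_mono) auto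
    then show ?thesis by simp
  qed
  have "runs (comp_init 41 ;; 43 :== INum 0 ;; While (ILe (val 43) (INum 0)) (try_pair ;; comp_next 41 43)) s
    (T + 30 * (q + 1) + 20) (\<lambda>s'. P s' \<and> imem s' 43 0 \<noteq> 0)"
    by (rule runs_Seq[OF init loop]) simp_all
  then show ?thesis unfolding T_def by (rule runs_mono) (auto simp: P_def)
qed

lemma runs_enumerate_pairs:
  assumes ready: "ready s" and z: "\<forall>c\<ge>q. imem s 40 c = 0" "\<forall>c\<ge>q. imem s 41 c = 0" and best: "imem s 1 0 = 0"
    and T: "(\<Sum>x\<in>pairs. pair_time x + step_time) + (card (comps q K) + 1) * (60 * (q + 1) + 100) \<le> T"
  shows "runs enumerate_pairs s T (best pairs)"
proof -
  let ?F = "work_frame - {35}"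
  let ?in = "comp_init 41 ;; 43 :== INum 0 ;; While (ILe (val 43) (INum 0)) (try_pair ;; comp_next 41 43) :: 'g com"
  let ?body = "comp_init 41 ;; 43 :== INum 0 ;; While (ILe (val 43) (INum 0)) (try_pair ;; comp_next 41 43) ;;
      comp_next 40 39 :: 'g com"
  have st: "imem s 11 0 = q" "imem s 35 0 = K" using ready by (simp_all add: ready_def static_def)
  have fin: "finite (comps q K)" using comps_card[OF q(1)] by blast
  define v0 where "v0 = (\<lambda>i::nat. if i = 0 then K else 0)"
  note v0 = comps_from_first[OF q(1) v0_def]
  note init = runs_comp_init[OF st(1) q(1) st(2) z(1) _ order_refl, folded v0_def]
  define t where "t R = (\<Sum>S\<in>comps q K. pair_time (R, S) + step_time) + (60 * (q + 1) + 90)" for R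
  define \<phi> where "\<phi> s' = (if imem s' 39 0 = 0 then (\<Sum>R\<in>comps_from q K (imem s' 40). t R) else 0)" for s' :: "'g state"
  define P where "P s' \<longleftrightarrow> ready s' \<and> imem s' 40 \<in> comps q K \<and> (\<forall>c\<ge>q. imem s' 41 c = 0) \<and>
     (if imem s' 39 0 = 0 then best ((comps q K - comps_from q K (imem s' 40)) \<times> comps q K) s' else best pairs s')" for s'
  have tsum: "(\<Sum>R\<in>comps q K. t R) = (\<Sum>x\<in>pairs. pair_time x + step_time) + card (comps q K) * (60 * (q + 1) + 90)"
    unfolding t_def pairs_def by (simp only: sum.distrib[of _ "\<lambda>_. 60 * (q + 1) + 90"] sum.cartesian_product sum_constant)
      (simp add: case_prod_unfold)
  have loop: "runs (39 :== INum 0 ;; While (ILe (val 39) (INum 0)) ?body) s1 ((\<Sum>R\<in>comps q K. t R) + 20) (best pairs)"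
    if s1: "frame {40, 36} {} {} s s1 \<and> imem s1 40 = v0" for s1
  proof -
    note fr1 = s1[THEN conjunct1]
    let ?s = "s1\<lparr>imem := store (imem s1) 39 0 0\<rparr>"
    have fr: "frame {36, 39, 40} {} {} s ?s"
      using frame_mono[OF fr1, of "{36, 39, 40}" "{}" "{}"] by simp
    have "ready ?s" by (rule ready_frame[OF ready fr]) (auto simp: work_frame_def)
    moreover have "best {} ?s" using best by (simp add: best_def candidates_def store_row frameD[OF fr1])
    moreover have "\<forall>c\<ge>q. imem ?s 41 c = 0" using z(2) by (simp add: store_row frameD[OF fr1])
    ultimately have P0: "P ?s" using s1 v0 by (simp add: P_def store_row)
    have "runs (While (ILe (val 39) (INum 0)) ?body) ?s ((\<Sum>R\<in>comps q K. t R) + 10) (best pairs)"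
    proof (rule runs_While_exec[where P = P and \<phi> = \<phi>])
      show "\<phi> ?s + 1 + tcost (ILe (val 39) (INum 0)) \<le> (\<Sum>R\<in>comps q K. t R) + 10" using s1 v0 by (simp add: \<phi>_def store_row)
    next
      fix s2 assume P: "P s2" and b: "tval G n \<I> s2 (ILe (val 39) (INum 0))"
      define R where "R = imem s2 40"
      have z2: "imem s2 39 0 = 0" using b by simp
      have ready2: "ready s2" and RC: "R \<in> comps q K" and m2: "\<forall>c\<ge>q. imem s2 41 c = 0"
        and best2: "best ((comps q K - comps_from q K R) \<times> comps q K) s2"
        using P z2 by (simp_all add: P_def R_def)
      obtain t3 s3 where e3: "exec G n \<I> ?in s2 t3 s3" "t3 \<le> (\<Sum>S\<in>comps q K. pair_time (R, S) + step_time) + 30 * (q + 1) + 20"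
        and tp: "ready s3 \<and> frame (work_frame - {35, 39, 40}) {5} {1, 2, 3, 5, 6} s2 s3 \<and>
          best ((comps q K - comps_from q K R) \<times> comps q K \<union> {R} \<times> comps q K) s3 \<and> imem s3 41 \<in> comps q K"
        by (rule runsE[OF runs_inner[OF ready2 R_def[symmetric] RC m2 best2]])
      have ready3: "ready s3" and fr3: "frame (work_frame - {35, 39, 40}) {5} {1, 2, 3, 5, 6} s2 s3"
        and best3: "best ((comps q K - comps_from q K R) \<times> comps q K \<union> {R} \<times> comps q K) s3"
        and m3: "imem s3 41 \<in> comps q K" using tp by - (elim conjE, assumption)+
      have r3: "imem s3 11 0 = q" "imem s3 40 = R" "imem s3 39 0 = 0"
        using ready3 z2 by (simp_all add: ready_def static_def R_def frameD[OF fr3])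
      obtain t4 s4 where e4: "exec G n \<I> (comp_next 40 39) s3 t4 s4" "t4 \<le> 30 * (q + 1) + 40"
        and cn: "frame {40, 39, 37, 38} {} {} s3 s4 \<and>
          (imem s4 39 0 \<noteq> 0 \<and> imem s4 40 = R \<and> comps_from q K R = {R} \<or>
           imem s4 39 0 = 0 \<and> imem s4 40 \<in> comps q K \<and> comps_from q K (imem s4 40) = comps_from q K R - {R})"
        by (rule runsE[OF runs_comp_next[OF r3(1,2) RC K(1) _ _ r3(3) order_refl]]) simp_all
      note fr4 = cn[THEN conjunct1]
      have ready4: "ready s4" by (rule ready_frame[OF ready3 fr4]) (auto simp: work_frame_def)
      have m4: "\<forall>c\<ge>q. imem s4 41 c = 0" using m3 by (simp add: frameD[OF fr4] comps_def)
      have self: "R \<in> comps_from q K R" using RC by (simp add: comps_from_def)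
      have sub: "comps_from q K R \<subseteq> comps q K" by (auto simp: comps_from_def)
      have sum: "(\<Sum>R'\<in>comps_from q K R. t R') = t R + (\<Sum>R'\<in>comps_from q K R - {R}. t R')"
        by (rule sum.remove[OF finite_subset[OF sub fin] self])
      have ins: "(comps q K - comps_from q K R) \<times> comps q K \<union> {R} \<times> comps q K = (comps q K - (comps_from q K R - {R})) \<times> comps q K"
        using RC by auto
      have best4: "best ((comps q K - (comps_from q K R - {R})) \<times> comps q K) s4"
        using best3 unfolding ins by (subst best_cong[where s = s3]) (simp_all add: frameD[OF fr4])
      \<comment> \<open>In \<open>?body\<close> the statements of \<open>?in\<close> are nested to
        the right, so the execution of \<open>?in\<close> is taken apart and re-assembled with the
        final \<open>comp_next\<close>.\<close>
      let ?W = "While (ILe (val 43) (INum 0)) (try_pair ;; comp_next 41 43) :: 'g com"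
      obtain u1 u2 x1 where u: "exec G n \<I> (comp_init 41) s2 u1 x1" "exec G n \<I> (43 :== INum 0 ;; ?W) x1 u2 s3" "t3 = u1 + u2"
        using e3(1) unfolding exec_Seq[of "comp_init 41"] by blast
      obtain u3 u4 x2 where u': "exec G n \<I> (43 :== INum 0) x1 u3 x2" "exec G n \<I> ?W x2 u4 s3" "u2 = u3 + u4"
        using u(2) unfolding exec_Seq[of "43 :== INum 0"] by blast
      define t5 where "t5 = u1 + (u3 + (u4 + t4))"
      have e5: "exec G n \<I> ?body s2 t5 s4" "t5 \<le> t3 + t4"
        unfolding t5_def by (intro exec.Seq[OF u(1)] exec.Seq[OF u'(1)] exec.Seq[OF u'(2)] e4(1)) (simp add: u(3) u'(3))
      have "P s4 \<and> \<phi> s4 + t R \<le> \<phi> s2"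
      proof (cases "imem s4 39 0 = 0")
        case True
        then have c: "imem s4 40 \<in> comps q K" "comps_from q K (imem s4 40) = comps_from q K R - {R}" using cn by auto
        show ?thesis using ready4 best4 m4 True z2 c sum by (simp add: P_def \<phi>_def R_def[symmetric])
      next
        case False
        then have c: "imem s4 40 = R" "comps_from q K R = {R}" using cn by auto
        have "best pairs s4" using best4 unfolding c pairs_def by simp
        then show ?thesis using ready4 m4 False z2 c RC sum by (simp add: P_def \<phi>_def R_def[symmetric])
      qed
      moreover have "t5 + 1 + tcost (ILe (val 39) (INum 0)) \<le> t R"
        using e3(2) e4(2) e5(2) by (simp add: t_def)
      ultimately show "\<exists>t s'. exec G n \<I> ?body s2 t s' \<and> P s' \<and> \<phi> s' + t + 1 + tcost (ILe (val 39) (INum 0)) \<le> \<phi> s2"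
        using e5(1) by (intro exI[of _ t5] exI[of _ s4]) auto
    next
      fix s2 assume "P s2" "\<not> tval G n \<I> s2 (ILe (val 39) (INum 0))"
      then show "best pairs s2" by (simp add: P_def)
    qed (rule P0)
    then have "runs (While (ILe (val 39) (INum 0)) ?body) ?s ((\<Sum>R\<in>comps q K. t R) + 20 - 3) (best pairs)"
      by (rule runs_mono) auto
    then show ?thesis by simp
  qed
  show ?thesis unfolding enumerate_pairs_def
    by (rule runs_Seq[OF init loop]) (use T tsum in \<open>simp_all add: algebra_simps\<close>)
qed

end

section \<open>The main theorem\<close>

context labeled_matroid
begin

text \<open>The linear part over all pairs is within \<open>b\<^sup>2 * n\<close> up to a constant
  because \<open>q \<le> n\<close>. A valid pair costs \<open>O(K q n)\<close> for
  \<open>q \<ge> 2\<close>, and the factor \<open>K q\<close> is exactly what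
  \<open>card_valid\<close> absorbs.\<close>

lemma pair_times_le:
  defines "b \<equiv> (K + q - 1) choose K" and "m \<equiv> min K (q - 1)"
  shows "(\<Sum>x\<in>pairs. pair_time x + step_time) + (card (comps q K) + 1) * (60 * (q + 1) + 100)
    \<le> 40000 * (b\<^sup>2 * n) * (m\<^sup>2 + 1)"
proof -
  note C = comps_card[OF q(1), of K]
  have fin: "finite pairs" using C by (simp add: pairs_def)
  have cp: "card pairs = b\<^sup>2" using C by (simp add: pairs_def card_cartesian_product b_def power2_eq_square)
  have b1: "1 \<le> b" using K q by (simp add: b_def Suc_le_eq)
  let ?F = "card {x \<in> pairs. valid x}"
  let ?w = "140 * (n + 1) + 120 * (q + 1) + 100 + step_time"
  have "(\<Sum>x\<in>pairs. pair_time x + step_time) = (\<Sum>x\<in>pairs. ?w) + (\<Sum>x\<in>pairs. if valid x then solve_time else 0)"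
    unfolding sum.distrib[symmetric] by (rule sum.cong) (auto simp: pair_time_def)
  also have "\<dots> = b\<^sup>2 * ?w + ?F * solve_time"
    using fin by (simp add: cp sum.If_cases Collect_conj_eq Int_commute)
  finally have sum: "(\<Sum>x\<in>pairs. pair_time x + step_time) = b\<^sup>2 * ?w + ?F * solve_time" .
  have n1: "1 \<le> n" using K by simp
  have "?w \<le> 760 * n" using q n1 by (simp add: step_time_def)
  then have 1: "b\<^sup>2 * ?w \<le> 760 * (b\<^sup>2 * n)" using mult_le_mono2[of ?w "760 * n" "b\<^sup>2"] by (simp add: ac_simps)
  have "(b + 1) * (60 * (q + 1) + 100) \<le> (2 * b) * (220 * n)"
    using b1 q n1 by (intro mult_le_mono) auto
  also have "\<dots> \<le> 440 * (b\<^sup>2 * n)" using b1 by (simp add: power2_eq_square)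
  finally have 2: "(card (comps q K) + 1) * (60 * (q + 1) + 100) \<le> 440 * (b\<^sup>2 * n)" using C by (simp add: b_def)
  define M where "M = (if q = 1 then 0 else K)"
  have st: "solve_time \<le> 4000 * ((M + 1) * (q * n))"
  proof -
    have qn: "1 \<le> q * n" "q \<le> q * n" "n \<le> q * n" "q * q \<le> q * n"
      using q n1 by simp_all
    have scaled: "60 * (n + 1) \<le> 120 * X" if "1 \<le> X" "n \<le> X" for X using that by simp
    have scaled': "50 * (q + 1) \<le> 100 * X" if "1 \<le> X" "q \<le> X" for X using that by simp
    have "(q + 1) * (q + 1) \<le> (2 * q) * (2 * q)" using q by (intro mult_le_mono) auto
    also have "\<dots> = 4 * (q * q)" by simp
    also have "\<dots> \<le> 4 * (q * n)" using qn by simp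
    finally have "800 * ((q + 1) * (q + 1)) \<le> 3200 * (q * n)" by simp
    then have "800 * (q + 1) * (q + 1) \<le> 3200 * (q * n)" by (simp only: mult.assoc)
    moreover have "60 * (n + 1) \<le> 120 * (q * n)" by (rule scaled[OF qn(1,3)])
    ultimately have "190 * (q * n) + 800 * (q + 1) * (q + 1) + 60 * (n + 1) \<le> 3510 * (q * n)" by linarith
    then have "(M + 1) * (190 * (q * n) + 800 * (q + 1) * (q + 1) + 60 * (n + 1)) \<le> (M + 1) * (3510 * (q * n))"
      by (rule mult_le_mono2)
    moreover have "60 * (n + 1) + 50 * (q + 1) \<le> 220 * (q * n)"
      using add_mono[OF scaled[OF qn(1,3)] scaled'[OF qn(1,2)]] by (simp only: add_mult_distrib[symmetric]) simp
    moreover have "220 * (q * n) \<le> (M + 1) * (220 * (q * n))" by simp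
    ultimately have "solve_time \<le> (M + 1) * (3510 * (q * n)) + (M + 1) * (220 * (q * n))"
      unfolding solve_time_def M_def[symmetric] by linarith
    also have "\<dots> \<le> 4000 * ((M + 1) * (q * n))" by (simp add: algebra_simps)
    finally show ?thesis .
  qed
  have 3: "?F * solve_time \<le> 32000 * (b\<^sup>2 * n) * (m\<^sup>2 + 1)"
  proof (cases "q = 1")
    case True
    have "?F \<le> b\<^sup>2" using card_mono[OF fin, of "{x \<in> pairs. valid x}"] cp by auto
    then have "?F * solve_time \<le> b\<^sup>2 * (4000 * ((M + 1) * (q * n)))" using st by (rule mult_le_mono)
    also have "\<dots> \<le> 32000 * (b\<^sup>2 * n) * (m\<^sup>2 + 1)" using True by (simp add: M_def)
    finally show ?thesis .
  next
    case False
    then have q2: "q \<ge> 2" using q by simp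
    have "M + 1 \<le> 2 * K" using False K by (simp add: M_def)
    then have "4000 * ((M + 1) * (q * n)) \<le> 8000 * (K * q * n)"
      using mult_le_mono1[of "M + 1" "2 * K" "4000 * (q * n)"] by (simp add: algebra_simps)
    with st have "solve_time \<le> 8000 * (K * q * n)" by (rule order_trans)
    then have "?F * solve_time \<le> ?F * (8000 * (K * q * n))" by (rule mult_le_mono2)
    also have "\<dots> = 8000 * (?F * K * q) * n" by (simp only: ac_simps)
    also have "\<dots> \<le> 8000 * (4 * b\<^sup>2 * m\<^sup>2) * n"
      using mult_le_mono1[OF mult_le_mono2[OF card_valid[OF q2, folded b_def m_def]]] .
    also have "\<dots> \<le> 32000 * (b\<^sup>2 * n) * (m\<^sup>2 + 1)" by (simp add: algebra_simps)
    finally show ?thesis .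
  qed
  have "1200 * (b\<^sup>2 * n) \<le> 1200 * (b\<^sup>2 * n) * (m\<^sup>2 + 1)" by simp
  then have "b\<^sup>2 * ?w + ?F * solve_time + (card (comps q K) + 1) * (60 * (q + 1) + 100)
      \<le> 1200 * (b\<^sup>2 * n) * (m\<^sup>2 + 1) + 32000 * (b\<^sup>2 * n) * (m\<^sup>2 + 1)"
    using 1 2 3 by linarith
  also have "\<dots> \<le> 40000 * (b\<^sup>2 * n) * (m\<^sup>2 + 1)" by (simp add: algebra_simps)
  finally show ?thesis unfolding sum .
qed

text \<open>Closeness places some optimum \<open>g\<close>-base among the candidates, and every
  candidate is a \<open>g\<close>-base; hence a best candidate is optimum, and absence of candidates
  means that no \<open>g\<close>-base exists.\<close>

lemma best_pairs_answer:
  assumes best: "best pairs s"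
    and close: "\<exists>B. is_g_base G \<I> l g B \<Longrightarrow> \<exists>B. is_opt_g_base G \<I> l w g B \<and> card (A - B) \<le> K"
  shows "correct_answer (is_opt_g_base G \<I> l w g) (answer n s)"
proof (cases "imem s 1 0 = 0")
  case True
  then have none: "candidates pairs = {}" using best by (simp add: best_def)
  have "\<not> is_opt_g_base G \<I> l w g B" for B
  proof
    assume "is_opt_g_base G \<I> l w g B"
    then obtain C where "is_opt_g_base G \<I> l w g C" "card (A - C) \<le> K"
      using close by (auto simp: is_opt_g_base_def)
    then show False using close_g_base_candidate none by (auto simp: is_opt_g_base_def)
  qed
  then show ?thesis using True by (simp add: correct_answer_def answer_def)
next
  case False
  then obtain B where B: "B \<in> candidates pairs" "\<forall>e<n. imem s 2 e = mem_vec B e"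
    "\<forall>B'\<in>candidates pairs. sum w B \<le> sum w B'" using best by (auto simp: best_def)
  have gB: "is_g_base G \<I> l g B" by (rule candidate_label[OF B(1)])
  obtain C where C: "is_opt_g_base G \<I> l w g C" "card (A - C) \<le> K" using close gB by blast
  have "C \<in> candidates pairs" using C close_g_base_candidate by (auto simp: is_opt_g_base_def)
  then have "sum w B \<le> sum w C" using B(3) by blast
  then have opt: "is_opt_g_base G \<I> l w g B" using C(1) gB by (auto simp: is_opt_g_base_def)
  have "B \<subseteq> {..<n}" using gB base_subset by (simp add: is_g_base_def)
  moreover have "imem s 2 e \<noteq> 0 \<longleftrightarrow> e \<in> B" if "e < n" for e using B(2) that by simp
  ultimately have "stored_set n s 2 = B" by (auto simp: stored_set_def)
  then show ?thesis using False opt by (simp add: correct_answer_def answer_def)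
qed

end

text \<open>The arrays hold default values outside the ground set, so the labeling and the weights
  that the program sees agree with the given ones only on \<open>E\<close>.\<close>

lemma is_opt_g_base_cong:
  assumes "matroid E \<I>" "\<And>e. e \<in> E \<Longrightarrow> l e = l' e" "\<And>e. e \<in> E \<Longrightarrow> w e = w' e"
    "l \<in> E \<rightarrow> carrier G" "comm_monoid G"
  shows "is_g_base G \<I> l g = is_g_base G \<I> l' g" "is_opt_g_base G \<I> l w g = is_opt_g_base G \<I> l' w' g"
    "is_opt_base \<I> w = is_opt_base \<I> w'"
proof -
  interpret finite_matroid E \<I> by unfold_locales (rule assms(1))
  interpret comm_monoid G by (rule assms(5))
  have f: "finprod G l B = finprod G l' B" if "is_base \<I> B" for B
    by (rule finprod_cong') (use base_subset[OF that] assms(2,4) in \<open>auto simp: Pi_iff\<close>)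
  have s: "sum w B = sum w' B" if "is_base \<I> B" for B
    by (rule sum.cong) (use base_subset[OF that] assms(3) in auto)
  show g: "is_g_base G \<I> l g = is_g_base G \<I> l' g" by (auto simp: fun_eq_iff is_g_base_def f)
  have s': "sum w B = sum w' B" if "is_g_base G \<I> l' g B" for B using s that by (simp add: is_g_base_def)
  show "is_opt_g_base G \<I> l w g = is_opt_g_base G \<I> l' w' g"
    unfolding fun_eq_iff is_opt_g_base_def g using s' by metis
  show "is_opt_base \<I> w = is_opt_base \<I> w'" unfolding fun_eq_iff is_opt_base_def using s by metis
qed

lemma run_main_program:
  fixes G :: "'g monoid" and l :: "nat \<Rightarrow> 'g"
  assumes G: "comm_group G" "finite (carrier G)" and M: "matroid {..<n} \<I>" and l: "l \<in> {..<n} \<rightarrow> carrier G"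
    and g: "g \<in> carrier G" and k: "k \<ge> 1" and n: "n \<ge> 1" and L: "n \<le> 2 ^ L"
    and close: "\<And>A. \<exists>B. is_g_base G \<I> l g B \<Longrightarrow> is_opt_base \<I> w A \<Longrightarrow>
      \<exists>B. is_opt_g_base G \<I> l w g B \<and> card (A - B) \<le> k"
  obtains t s K q where "exec G n \<I> (main_program k) (init_state G n l w g) t s"
    "correct_answer (is_opt_g_base G \<I> l w g) (answer n s)" "1 \<le> K" "K \<le> k" "1 \<le> q" "q \<le> card (carrier G)"
    "t \<le> 50000 * (((K + q - 1) choose K)\<^sup>2 * n) * ((min K (q - 1))\<^sup>2 + L + 2)"
proof -
  interpret ram G n \<I> .
  interpret finite_matroid "{..<n}" \<I> by unfold_locales (rule M)
  interpret comm_group G by (rule G(1))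
  define s0 where "s0 = init_state G n l w g"
  define l' w' where "l' = gmem s0 0" and "w' = rmem s0 0"
  have l': "l e = l' e" and w': "w e = w' e" if "e \<in> {..<n}" for e
    using that by (simp_all add: l'_def w'_def s0_def init_state_def)
  have cong: "is_g_base G \<I> l h = is_g_base G \<I> l' h" "is_opt_g_base G \<I> l w h = is_opt_g_base G \<I> l' w' h"
      "is_opt_base \<I> w = is_opt_base \<I> w'" for h
    by (rule is_opt_g_base_cong[OF M _ _ l comm_monoid_axioms], erule l', erule w')+
  have s0: "imem s0 0 0 = n" "imem s0 11 0 = 0" "\<And>a. a \<noteq> 0 \<Longrightarrow> imem s0 a = (\<lambda>_. 0)"
      "gmem s0 1 0 = g" "gmem s0 4 0 = \<one>\<^bsub>G\<^esub>" "rmem s0 4 0 = 0"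
    by (auto simp: s0_def init_state_def)
  \<comment> \<open>Two bases differ in at most \<open>n\<close> elements, so truncation at
    \<open>n\<close> preserves closeness. It also keeps the treatment of an invalid pair linear in
    \<open>n\<close>.\<close>
  define K where "K = min k n"
  have K: "1 \<le> K" "K \<le> n" "K \<le> k" using k n by (simp_all add: K_def)
  obtain t1 s1 where e1: "exec G n \<I> classify s0 t1 s1" "t1 \<le> (n + 1) * (22 * card (l' ` {..<n}) + 100)"
    and c1: "frame {10, 11, 12, 13} {2} {} s0 s1 \<and> label_classes l' n (imem s1 11 0) (imem s1 10) (gmem s1 2)"
    by (rule runsE[OF runs_classify[OF s0(1,2) l'_def[symmetric] refl order_refl]])
  note fr1 = c1[THEN conjunct1]
  define q cls rep where "q = imem s1 11 0" and "cls = imem s1 10" and "rep = gmem s1 2"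
  have classes: "label_classes l' n q cls rep" using c1 by (simp add: q_def cls_def rep_def)
  have qc: "q = card (l' ` {..<n})" and clsq: "\<And>e. e < n \<Longrightarrow> cls e < q"
    using classes unfolding label_classes_def by blast+
  have lc: "l' ` {..<n} \<subseteq> carrier G" using l l' by force
  have q: "1 \<le> q" "q \<le> n" "q \<le> card (carrier G)"
    using clsq[of 0] n card_image_le[of "{..<n}" l'] card_mono[OF G(2) lc] by (simp_all add: qc)
  note bounds = K(1,3) q(1,3)
  have r1: "imem s1 0 0 = n" "rmem s1 0 = w'" using s0 by (simp_all add: frameD[OF fr1] w'_def)
  obtain t2 s2 where e2: "exec G n \<I> merge_sort s1 t2 s2" "t2 \<le> 300 * (n + 1) * (L + 1)"
    and c2: "frame {20..29} {} {} s1 s2 \<and> imem s2 20 ` {..<n} = {..<n} \<and> sorted_on w' (imem s2 20) 0 n"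
    by (rule runsE[OF runs_merge_sort[OF r1 L order_refl]])
  note fr2 = c2[THEN conjunct1]
  define f where "f = imem s2 20"
  have f: "f ` {..<n} = {..<n}" "sorted_on w' f 0 n" using c2 by (simp_all add: f_def)
  have r2: "imem s2 0 0 = n" "imem s2 10 = cls" "imem s2 3 = (\<lambda>_. 0)" "imem s2 30 = (\<lambda>_. 0)"
    using s0 by (simp_all add: frameD[OF fr2] frameD[OF fr1] cls_def)
  define A where "A = greedy \<I> f n"
  obtain t3 s3 where e3: "exec G n \<I> greedy_base s2 t3 s3" "t3 \<le> 50 * (n + 1)"
    and c3: "frame {3, 29, 30} {} {} s2 s3 \<and> imem s3 3 = mem_vec A \<and> imem s3 30 = class_count cls A"
    unfolding A_def by (rule runsE[OF runs_greedy_base[OF r2(1) f_def[symmetric] f(1) r2(2-4) order_refl]])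
  note fr3 = c3[THEN conjunct1]
  have A: "is_opt_base \<I> w' A" unfolding A_def
    by (rule greedy_opt_base[OF f(1)]) (use f(2) in \<open>auto simp: sorted_on_def\<close>)
  have r3: "imem s3 0 0 = n" "imem s3 20 = f" "imem s3 10 = cls" "imem s3 11 0 = q" "imem s3 32 0 = 0" "imem s3 33 0 = 0"
    using r2 s0 by (simp_all add: frameD[OF fr3] frameD[OF fr2] frameD[OF fr1] f_def cls_def q_def)
  obtain t4 s4 where e4: "exec G n \<I> class_blocks s3 t4 s4" "t4 \<le> 70 * (q + 1) * (n + 1)"
    and c4: "frame {29, 31, 32, 33, 34} {} {} s3 s4 \<and>
    (\<forall>c<q. sorted_block w' (imem s4 31) (imem s4 32 c) (imem s4 32 (Suc c)) {e. e < n \<and> cls e = c})"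
    by (rule runsE[OF runs_class_blocks[OF r3(1,2) f r3(3-6) order_refl]])
  note fr4 = c4[THEN conjunct1]
  define cl st where "cl = imem s4 31" and "st = imem s4 32"
  let ?s5 = "s4\<lparr>imem := store (imem s4) 35 0 K\<rparr>"
  have r4: "imem s4 0 0 = n" "imem s4 11 0 = q" "imem s4 10 = cls" "imem s4 3 = mem_vec A" "imem s4 30 = class_count cls A"
      "rmem s4 0 = w'" "rmem s4 4 0 = 0" "gmem s4 2 = rep" "gmem s4 4 0 = \<one>\<^bsub>G\<^esub>" "gmem s4 1 0 = g"
      "imem s4 50 = (\<lambda>_. 0)" "imem s4 51 = (\<lambda>_. 0)" "imem s4 52 = (\<lambda>_. 0)" "imem s4 40 = (\<lambda>_. 0)" "imem s4 41 = (\<lambda>_. 0)"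
      "imem s4 1 = (\<lambda>_. 0)"
    using s0 c3 by (simp_all add: frameD[OF fr4] frameD[OF fr3] frameD[OF fr2] frameD[OF fr1] q_def cls_def rep_def w'_def)
  interpret labeled_matroid G n \<I> w' cls q cl st l' rep g A K
  proof unfold_locales
    show "sorted_block w' cl (st c) (st (Suc c)) {e. e < n \<and> cls e = c}" if "c < q" for c
      using c4 that by (simp add: cl_def st_def)
    show "l' \<in> {..<n} \<rightarrow> carrier G" using lc by auto
  qed (use clsq classes g A K in auto)
  have "ready ?s5" using r4 unfolding ready_def static_def by (simp add: store_row cl_def st_def)
  note ready = this
  obtain t6 s6 where e6: "exec G n \<I> enumerate_pairs ?s5 t6 s6"
    "t6 \<le> (\<Sum>x\<in>pairs. pair_time x + step_time) + (card (comps q K) + 1) * (60 * (q + 1) + 100)" and best6: "best pairs s6"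
    by (rule runsE[OF runs_enumerate_pairs[OF ready _ _ _ order_refl]]) (use r4 in \<open>simp_all add: store_row\<close>)
  have e5: "exec G n \<I> (35 :== min_exp (INum k) (val 0)) s4 (2 + (4 + 2)) ?s5"
    using r4 by (simp add: exec_IStore K_def)
  have "exec G n \<I> (classify ;; merge_sort ;; greedy_base ;; class_blocks ;; 35 :== min_exp (INum k) (val 0) ;; enumerate_pairs)
      s0 (t1 + (t2 + (t3 + (t4 + ((2 + (4 + 2)) + t6))))) s6"
    by (intro exec.Seq[OF e1(1)] exec.Seq[OF e2(1)] exec.Seq[OF e3(1)] exec.Seq[OF e4(1)] exec.Seq[OF e5] e6(1))
  then have run: "exec G n \<I> (main_program k) s0 (1 + 4 + (t1 + (t2 + (t3 + (t4 + ((2 + (4 + 2)) + t6)))))) s6"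
    unfolding main_program_def exec_Cond using s0(1) n
    by (intro exI[of _ "t1 + (t2 + (t3 + (t4 + ((2 + (4 + 2)) + t6))))"]) simp
  have "\<exists>B. is_opt_g_base G \<I> l' w' g B \<and> card (A - B) \<le> K" if ex: "\<exists>B. is_g_base G \<I> l' g B"
  proof -
    obtain B where B: "is_opt_g_base G \<I> l' w' g B" "card (A - B) \<le> k"
      using close[of A] ex A unfolding cong by blast
    moreover have "card (A - B) \<le> n"
      using card_mono[OF _ base_subset[OF base_A]] card_mono[OF base_finite[OF base_A], of "A - B"] by force
    ultimately show ?thesis by (auto simp: K_def)
  qed
  then have ans: "correct_answer (is_opt_g_base G \<I> l w g) (answer n s6)"
    unfolding cong by (rule best_pairs_answer[OF best6])
  define b m where "b = ((K + q - 1) choose K)" and "m = min K (q - 1)"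
  have t6: "t6 \<le> 40000 * (b\<^sup>2 * n) * (m\<^sup>2 + 1)" using e6(2) pair_times_le by (simp add: b_def m_def)
  obtain p where p: "q = Suc p" using q(1) by (cases q) simp_all
  \<comment> \<open>Aims at \<open>q \<le> b\<close>, which absorbs the \<open>O(q n)\<close> of the
    preprocessing into \<open>b\<^sup>2 * n\<close>.\<close>
  have "q = (1 + p) choose p" by (simp add: p)
  also have "\<dots> \<le> (K + p) choose p" by (rule binomial_right_mono) (use K(1) in linarith)
  also have "\<dots> = (K + p) choose K" using binomial_symmetric[of K "K + p"] by simp
  finally have qb: "q \<le> b" by (simp add: b_def p)
  have b1: "b \<le> b\<^sup>2" using qb q by (simp add: power2_eq_square)
  have qn: "q * n \<le> b\<^sup>2 * n" using qb b1 by (intro mult_le_mono) auto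
  have nb: "n \<le> b\<^sup>2 * n" "1 \<le> b\<^sup>2 * n" using b1 qb q n by simp_all
  have scaled: "300 * (n + 1) \<le> 600 * X" if "n \<le> X" for X using n that by simp
  have "t1 \<le> 2 * n * (122 * q)"
    using e1(2) unfolding qc[symmetric] by (rule order_trans) (use n q in \<open>intro mult_le_mono; simp\<close>)
  moreover have "t4 \<le> 140 * q * (2 * n)"
    using e4(2) by (rule order_trans) (rule mult_le_mono; use n q in simp)
  moreover have "t2 \<le> 600 * (b\<^sup>2 * n) * (L + 1)"
    using e2(2) by (rule order_trans) (rule mult_le_mono[OF scaled[OF nb(1)] order_refl])
  ultimately have "t1 + t2 + t3 + t4 \<le> 244 * (q * n) + 600 * (b\<^sup>2 * n) * (L + 1) + 100 * n + 280 * (q * n)"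
    using e3(2) n by (simp add: ac_simps)
  also have "\<dots> \<le> 700 * (b\<^sup>2 * n) + 600 * (b\<^sup>2 * n) * (L + 1)" using qn nb by linarith
  finally have "1 + 4 + (t1 + (t2 + (t3 + (t4 + ((2 + (4 + 2)) + t6))))) \<le>
      720 * (b\<^sup>2 * n) + 600 * (b\<^sup>2 * n) * (L + 1) + 40000 * (b\<^sup>2 * n) * (m\<^sup>2 + 1)"
    using t6 nb by linarith
  also have "\<dots> \<le> 50000 * (b\<^sup>2 * n) * (m\<^sup>2 + L + 2)" by (simp add: algebra_simps)
  finally show ?thesis using that[OF run[unfolded s0_def] ans bounds] unfolding b_def m_def by blast
qed

section \<open>Degenerate closeness and the passage to soft-O bounds\<close>

lemma strongly_k_close_group_imp: "strongly_k_close_group G k \<Longrightarrow> k_close_group G k"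
  unfolding strongly_k_close_group_def k_close_group_def
proof (intro allI impI)
  fix E :: "nat set" and \<I> l
  assume "\<forall>(E::nat set) \<I> l. loopless_matroid E \<I> \<longrightarrow> l \<in> E \<rightarrow> carrier G \<longrightarrow> strongly_k_close_labeling G \<I> l k"
    and "loopless_matroid E \<I>" "l \<in> E \<rightarrow> carrier G"
  then have s: "strongly_k_close_labeling G \<I> l k" by blast
  show "k_close_labeling G \<I> l k" unfolding k_close_labeling_def
  proof (intro ballI impI allI)
    fix g A assume g: "g \<in> carrier G" "\<exists>B. is_g_base G \<I> l g B" and A: "is_base \<I> A"
    have "is_opt_base \<I> (\<lambda>_. 0) A" using A by (simp add: is_opt_base_def)
    then obtain B where "is_opt_g_base G \<I> l (\<lambda>_. 0) g B" "card (A - B) \<le> k"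
      using s g unfolding strongly_k_close_labeling_def by blast
    then show "\<exists>B. is_g_base G \<I> l g B \<and> card (A - B) \<le> k" by (auto simp: is_opt_g_base_def)
  qed
qed

text \<open>Two parallel elements with different labels show that only the trivial group is 0-close.\<close>

lemma zero_close_group_trivial:
  assumes "comm_group G" "finite (carrier G)" "k_close_group G 0"
  shows "card (carrier G) = 1"
proof -
  interpret comm_group G by (rule assms(1))
  let ?E = "{0, 1::nat}" and ?I = "{{}, {0}, {1::nat}}"
  have "S \<in> ?I" if "T \<in> ?I" "S \<subseteq> T" for S T :: "nat set"
    using that by (metis insertCI insertE singletonD subset_empty subset_singletonD)
  moreover have "\<exists>e\<in>T - S. insert e S \<in> ?I" if "S \<in> ?I" "T \<in> ?I" "card S < card T" for S T :: "nat set"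
  proof -
    have "card T \<le> 1" using that(2) by (elim insertE) simp_all
    then have "S = {}" using that(1,3) by (elim insertE) simp_all
    moreover have "T = {0} \<or> T = {1}" using that(2,3) by (elim insertE) simp_all
    ultimately show ?thesis by (elim disjE) simp_all
  qed
  ultimately have "matroid ?E ?I" unfolding matroid_def by (intro conjI ballI allI impI) (simp, simp, simp, metis+)
  then have M: "loopless_matroid ?E ?I" unfolding loopless_matroid_def by simp
  have "h = \<one>\<^bsub>G\<^esub>" if h: "h \<in> carrier G" for h
  proof -
    let ?l = "\<lambda>i::nat. if i = 0 then \<one>\<^bsub>G\<^esub> else h"
    have "k_close_labeling G ?I ?l 0" using assms(3) M h unfolding k_close_group_def by auto
    moreover have "is_base ?I {0}" "is_base ?I {1}" by (auto simp: is_base_def)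
    moreover have "is_g_base G ?I ?l h {1}" using h by (auto simp: is_g_base_def is_base_def)
    ultimately obtain B where B: "is_g_base G ?I ?l h B" "card ({0} - B) \<le> 0"
      using h unfolding k_close_labeling_def by blast
    then have "0 \<in> B" by (auto simp: card_eq_0_iff)
    moreover have "B \<in> ?I" using B by (simp add: is_g_base_def is_base_def)
    ultimately have "B = {0}" by auto
    then show ?thesis using B(1) by (simp add: is_g_base_def)
  qed
  then have "carrier G = {\<one>\<^bsub>G\<^esub>}" by auto
  then show ?thesis by simp
qed

text \<open>The factor 2 comes from the crude estimate \<open>ln 2 \<ge> 1 / 2\<close>.\<close>

lemma le_ln_of_two_power_le:
  assumes "2 ^ m \<le> (b::nat)"
  shows "real m \<le> 2 * ln (real b)"
proof -
  have "(2::real) ^ m \<le> real b" using of_nat_mono[OF assms, where 'a = real] by simp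
  then have "ln ((2::real) ^ m) \<le> ln (real b)" by (rule ln_mono) simp
  then have "real m * ln 2 \<le> ln (real b)" by (simp add: ln_realpow)
  moreover have ln2_half: "1 / 2 \<le> ln (2::real)" using ln_add_one_self_le_self2[of "- (1 / 2)"] by (simp add: ln_div)
  moreover have "real m * (1 / 2) \<le> real m * ln 2" using ln2_half by (intro mult_left_mono) auto
  ultimately show ?thesis by simp
qed

text \<open>Supplies the number of merge rounds; the upper bound on \<open>2 ^ L\<close> is what
  keeps it logarithmic in \<open>n\<close>.\<close>

lemma ex_log_bound: "n \<ge> 1 \<Longrightarrow> \<exists>L. n \<le> 2 ^ L \<and> 2 ^ L \<le> 2 * (n::nat)"
proof -
  assume n: "n \<ge> 1"
  define L where "L = (LEAST L. n \<le> 2 ^ L)"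
  have "n \<le> 2 ^ n" by (simp add: less_imp_le)
  then have 1: "n \<le> 2 ^ L" unfolding L_def by (rule LeastI)
  have "2 ^ L \<le> 2 * n"
  proof (cases L)
    case (Suc j)
    then have "\<not> n \<le> 2 ^ j" using not_less_Least[of j "\<lambda>L. n \<le> 2 ^ L"] by (simp add: L_def)
    then show ?thesis using Suc by simp
  qed (use n in simp)
  with 1 show ?thesis by blast
qed

text \<open>Looplessness makes every singleton independent. This is where
  \<open>r powr (5/6) \<ge> 1\<close> comes from.\<close>

lemma matroid_rank_pos:
  assumes "loopless_matroid {..<n} (\<I> :: nat set set)" "n \<ge> 1"
  shows "matroid_rank \<I> \<ge> 1"
proof -
  have "finite \<I>" using assms unfolding loopless_matroid_def matroid_def
    by (meson finite_Pow_iff finite_subset)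
  moreover have "{0::nat} \<in> \<I>" using assms by (simp add: loopless_matroid_def)
  ultimately have "card {0::nat} \<le> matroid_rank \<I>" unfolding matroid_rank_def by (intro Max_ge finite_imageI imageI)
  then show ?thesis by simp
qed

text \<open>The binomial is monotone in both parameters, so \<open>K\<close> and \<open>q\<close>
  may be replaced by \<open>k\<close> and \<open>Q\<close>. With \<open>y = 1 + ln f\<close> one has
  \<open>m \<le> 2 * y\<close> and \<open>L \<le> 4 * y\<close>, hence
  \<open>m\<^sup>2 + L + 2 \<le> 10 * y\<^sup>2\<close>; this is the origin of the exponent 2, and
  10 times 50000 lies below the constant 1000000.\<close>

lemma soft_bound:
  assumes K: "1 \<le> K" "K \<le> k" and q: "1 \<le> q" "q \<le> Q" and n: "1 \<le> n" and r: "1 \<le> r" and L: "2 ^ L \<le> 2 * n"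
    and t: "t \<le> 50000 * (((K + q - 1) choose K)\<^sup>2 * n) * ((min K (q - 1))\<^sup>2 + L + 2)"
  shows "real t \<le> soft_O_bound 1000000 2 (run_time Q k n r)"
proof -
  define b m f y where "b = (K + q - 1) choose K" and "m = min K (q - 1)"
    and "f = run_time Q k n r" and "y = 1 + ln (max 1 f)"
  have "b \<le> ((k + Q - 1) choose k)"
  proof -
    have "b \<le> ((K + Q - 1) choose K)" unfolding b_def by (rule binomial_right_mono) (use q in simp)
    also have "\<dots> = (K + (Q - 1)) choose (Q - 1)" using binomial_symmetric[of K "K + (Q - 1)"] q by simp
    also have "\<dots> \<le> (k + (Q - 1)) choose (Q - 1)" by (rule binomial_right_mono) (use K in simp)
    also have "\<dots> = (k + Q - 1) choose k" using binomial_symmetric[of k "k + (Q - 1)"] q by simp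
    finally show ?thesis .
  qed
  then have "real b ^ 2 * real n * 1 \<le> f" unfolding f_def run_time_def
    using r by (intro mult_mono power_mono ge_one_powr_ge_zero) auto
  moreover have b1: "1 \<le> b" using K q by (simp add: b_def Suc_le_eq)
  ultimately have bf: "real b ^ 2 * real n \<le> f" by simp
  have "1 * 1 \<le> real b * real b" "1 * 1 \<le> real b * real n" using b1 n by (intro mult_mono; simp)+
  then have "1 * real n \<le> real b ^ 2 * real n" "real b * 1 \<le> real b * (real b * real n)"
    using mult_right_mono[of 1 "real b * real b" "real n"] mult_left_mono[of 1 "real b * real n" "real b"]
    by (simp_all add: power2_eq_square)
  then have nf: "real n \<le> f" "real b \<le> f" using bf by (simp_all add: power2_eq_square mult.assoc)
  have f1: "1 \<le> f" using nf(1) n by simp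
  then have mx: "max 1 f = f" by simp
  have y1: "1 \<le> y" using f1 by (simp add: y_def)
  have "2 ^ m \<le> b" using two_power_le_binomial[of K "q - 1"] q by (simp add: m_def b_def)
  then have "real m \<le> 2 * ln (real b)" by (rule le_ln_of_two_power_le)
  also have "\<dots> \<le> 2 * y"
  proof -
    have "ln (real b) \<le> ln f" using nf(2) b1 by (intro ln_mono) auto
    then show ?thesis using f1 by (simp add: y_def)
  qed
  finally have "(real m)\<^sup>2 \<le> (2 * y)\<^sup>2" by (intro power_mono) auto
  moreover have "real L \<le> 4 * y"
  proof -
    have "real L \<le> 2 * ln (real (2 * n))" by (rule le_ln_of_two_power_le[OF L])
    also have "\<dots> = 2 * ln 2 + 2 * ln (real n)" using n by (simp add: ln_mult)
    also have "\<dots> \<le> 2 + 2 * ln f" using nf(1) n ln_2_less_1 f1 by (intro add_mono) auto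
    also have "\<dots> \<le> 4 * y" using f1 by (simp add: y_def)
    finally show ?thesis .
  qed
  moreover have yy: "y \<le> y\<^sup>2" "1 \<le> y\<^sup>2" using y1 mult_mono[of 1 y 1 y] by (simp_all add: power2_eq_square)
  ultimately have s: "(real m)\<^sup>2 + real L + 2 \<le> 10 * y\<^sup>2" by (simp add: power_mult_distrib)
  have "real t \<le> real (50000 * (b\<^sup>2 * n) * (m\<^sup>2 + L + 2))"
    using t unfolding b_def m_def by (rule of_nat_mono)
  also have "\<dots> = 50000 * (real b ^ 2 * real n) * ((real m)\<^sup>2 + real L + 2)"
    by (simp only: of_nat_mult of_nat_add of_nat_power of_nat_numeral)
  also have "\<dots> \<le> 50000 * f * (10 * y\<^sup>2)" using bf s f1 by (intro mult_mono) auto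
  also have "\<dots> \<le> 1000000 * f * y\<^sup>2" using f1 by (simp add: mult_nonneg_nonneg)
  finally show ?thesis unfolding soft_O_bound_def f_def[symmetric] by (simp add: mx y_def[unfolded mx])
qed

text \<open>The neutral element of \<open>G\<close> is read from the group array 4, which is never
  written, so the program mentions no group constant at all.\<close>

lemma set_main_program: "set_com (main_program k) = {}"
  by (simp add: main_program_def classify_def merge_sort_def merge_round_def merge_block_def merge_step_def weight_at_def
      greedy_base_def class_blocks_def enumerate_pairs_def comp_init_def comp_next_def try_pair_def check_pair_def
      record_base_def solve_def solve_init_def solve_step_def find_deficit_def search_path_def search_init_def
      select_class_def visit_class_def scan_pair_def scan_elem_def put_back_def relax_def augment_path_def
      for_loop_def min_exp_def)

lemma main_program_solves:
  fixes G :: "'g monoid"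
  assumes G: "comm_group G" "finite (carrier G)" and M: "loopless_matroid {..<n} \<I>" and l: "l \<in> {..<n} \<rightarrow> carrier G"
    and g: "g \<in> carrier G" and k: "k \<ge> 1"
    and close: "\<And>A. \<exists>B. is_g_base G \<I> l g B \<Longrightarrow> is_opt_base \<I> w A \<Longrightarrow>
      \<exists>B. is_opt_g_base G \<I> l w g B \<and> card (A - B) \<le> k"
  shows "\<exists>t s. exec G n \<I> (main_program k) (init_state G n l w g) t s \<and>
    real t \<le> soft_O_bound 1000000 2 (run_time (card (carrier G)) k n (matroid_rank \<I>)) \<and>
    correct_answer (is_opt_g_base G \<I> l w g) (answer n s)"
proof (cases "n = 0")
  case False
  have m: "matroid {..<n} \<I>" using M by (simp add: loopless_matroid_def)
  have n: "n \<ge> 1" using False by simp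
  obtain L where L: "n \<le> 2 ^ L" "2 ^ L \<le> 2 * n" using ex_log_bound[OF n] by blast
  obtain t s K q where r: "exec G n \<I> (main_program k) (init_state G n l w g) t s"
    "correct_answer (is_opt_g_base G \<I> l w g) (answer n s)" "1 \<le> K" "K \<le> k" "1 \<le> q" "q \<le> card (carrier G)"
    "t \<le> 50000 * (((K + q - 1) choose K)\<^sup>2 * n) * ((min K (q - 1))\<^sup>2 + L + 2)"
    by (rule run_main_program[OF G m l g k n L(1) close])
  show ?thesis using r(1,2) soft_bound[OF r(3-6) n matroid_rank_pos[OF M n] L(2) r(7)] by blast
next
  case True
  interpret comm_group G by (rule G(1))
  interpret ram G n \<I> .
  let ?s = "init_state G n l w g"
  have I: "\<I> = {{}}" using M True by (auto simp: loopless_matroid_def matroid_def)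
  have base: "is_base \<I> B \<longleftrightarrow> B = {}" for B by (auto simp: I is_base_def)
  have gb: "is_g_base G \<I> l g B \<longleftrightarrow> B = {} \<and> g = \<one>\<^bsub>G\<^esub>" for B
    unfolding is_g_base_def base by (metis finprod_empty)
  then have ob: "is_opt_g_base G \<I> l w g B \<longleftrightarrow> B = {} \<and> g = \<one>\<^bsub>G\<^esub>" for B
    unfolding is_opt_g_base_def by (metis order_refl)
  have "runs (main_program k) ?s 50 (\<lambda>s'. correct_answer (is_opt_g_base G \<I> l w g) (answer n s'))"
  proof -
    have "imem ?s 0 0 = 0" "imem ?s 1 0 = 0" "gmem ?s 1 0 = g" "gmem ?s 4 0 = \<one>\<^bsub>G\<^esub>"
      using True by (simp_all add: init_state_def)
    moreover have "answer n s = (if imem s 1 0 \<noteq> 0 then Some {} else None)" for s :: "'g state"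
      using True by (simp add: answer_def stored_set_def)
    moreover have "is_opt_g_base G \<I> l w \<one>\<^bsub>G\<^esub> {}" if "g = \<one>\<^bsub>G\<^esub>" using ob that by simp
    ultimately show ?thesis
      by (cases "g = \<one>\<^bsub>G\<^esub>") (simp_all add: main_program_def correct_answer_def ob store_row)
  qed
  then obtain t s where ts: "exec G n \<I> (main_program k) ?s t s" "t \<le> 50"
    "correct_answer (is_opt_g_base G \<I> l w g) (answer n s)" by (rule runsE)
  \<comment> \<open>For \<open>n = 0\<close> the value of \<open>run_time\<close> is 0 and the bound
    is the bare constant 1000000.\<close>
  moreover have "real t \<le> soft_O_bound 1000000 2 (run_time (card (carrier G)) k n (matroid_rank \<I>))"
    using ts(2) True by (simp add: soft_O_bound_def run_time_def)
  ultimately show ?thesis by blast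
qed

theorem theorem1:
  "\<exists>(C::real) (d::nat). \<forall>(G::'g monoid) (k::nat). comm_group G \<longrightarrow> finite (carrier G) \<longrightarrow>
     (k_close_group G k \<longrightarrow>
        (\<exists>c. solves_matroid_base G c (\<lambda>n r. soft_O_bound C d (run_time (card (carrier G)) k n r)))) \<and>
     (strongly_k_close_group G k \<longrightarrow>
        (\<exists>c. solves_opt_matroid_base G c (\<lambda>n r. soft_O_bound C d (run_time (card (carrier G)) k n r))))"
proof (intro exI allI impI)
  fix G :: "'g monoid" and k :: nat
  assume G: "comm_group G" "finite (carrier G)"
  let ?T = "\<lambda>n r. soft_O_bound 1000000 2 (run_time (card (carrier G)) k n r)"
  \<comment> \<open>The enumeration requires a positive number of exchanges. A 0-close group is
    trivial, and for it the binomial in \<open>run_time\<close> is 1 for \<open>k = 0\<close> and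
    \<open>k = 1\<close> alike.\<close>
  let ?k = "max 1 k"
  have rt: "run_time (card (carrier G)) ?k = run_time (card (carrier G)) k" if "k_close_group G k"
  proof (cases "k = 0")
    case True
    then show ?thesis using zero_close_group_trivial[OF G] that by (simp add: run_time_def fun_eq_iff)
  qed (simp add: max_def)
  \<comment> \<open>Lets one program serve both problems: the unweighted one is the weighted one
    with all weights zero.\<close>
  have unweighted: "is_opt_base \<I> (\<lambda>_. 0) = is_base \<I>" "is_opt_g_base G \<I> l (\<lambda>_. 0) g = is_g_base G \<I> l g"
    for \<I> :: "nat set set" and l g
    by (auto simp: fun_eq_iff is_opt_base_def is_opt_g_base_def)
  show "(k_close_group G k \<longrightarrow> (\<exists>c. solves_matroid_base G c ?T)) \<and>
     (strongly_k_close_group G k \<longrightarrow> (\<exists>c. solves_opt_matroid_base G c ?T))"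
  proof (intro conjI impI exI)
    assume close: "k_close_group G k"
    show "solves_matroid_base G (main_program ?k) ?T" unfolding solves_matroid_base_def
    proof (intro conjI allI impI)
      fix n :: nat and \<I> l g
      assume inst: "loopless_matroid {..<n} \<I>" "l \<in> {..<n} \<rightarrow> carrier G" "g \<in> carrier G"
      have lab: "k_close_labeling G \<I> l k" using close inst unfolding k_close_group_def by blast
      have "\<exists>B. is_opt_g_base G \<I> l (\<lambda>_. 0) g B \<and> card (A - B) \<le> ?k"
        if "\<exists>B. is_g_base G \<I> l g B" "is_opt_base \<I> (\<lambda>_. 0) A" for A
        using lab inst(3) that unfolding unweighted k_close_labeling_def by (meson le_max_iff_disj)
      from main_program_solves[OF G inst _ this] show "\<exists>t s. exec G n \<I> (main_program ?k) (init_state G n l (\<lambda>_. 0) g) t s \<and>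
          real t \<le> ?T n (matroid_rank \<I>) \<and> correct_answer (is_g_base G \<I> l g) (answer n s)"
        unfolding unweighted rt[OF close] by simp
    qed (simp add: set_main_program)
  next
    assume close: "strongly_k_close_group G k"
    show "solves_opt_matroid_base G (main_program ?k) ?T" unfolding solves_opt_matroid_base_def
    proof (intro conjI allI impI)
      fix n :: nat and \<I> l w g
      assume inst: "loopless_matroid {..<n} \<I>" "l \<in> {..<n} \<rightarrow> carrier G" "g \<in> carrier G"
      have lab: "strongly_k_close_labeling G \<I> l k" using close inst unfolding strongly_k_close_group_def by blast
      have "\<exists>B. is_opt_g_base G \<I> l w g B \<and> card (A - B) \<le> ?k"
        if "\<exists>B. is_g_base G \<I> l g B" "is_opt_base \<I> w A" for A
        using lab inst(3) that unfolding strongly_k_close_labeling_def by (meson le_max_iff_disj)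
      from main_program_solves[OF G inst _ this] show "\<exists>t s. exec G n \<I> (main_program ?k) (init_state G n l w g) t s \<and>
          real t \<le> ?T n (matroid_rank \<I>) \<and> correct_answer (is_opt_g_base G \<I> l w g) (answer n s)"
        unfolding rt[OF strongly_k_close_group_imp[OF close]] by simp
    qed (simp add: set_main_program)
  qed
qed

end
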